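(* Let $\mathcal{C}$ be an exact Mal'tsev category, and let $\mathcal{F}$ be the class of regular epimorphisms in the category $\mathsf{Gpd}(\mathcal{C})$ of internal groupoids in $\mathcal{C}$. The relative monotone-light factorization system $(\mathcal{E}',\mathcal{M}^* )$ for $\mathcal{F}$ corresponding to the connected component reflection $\pi_0\dashv D\colon\mathcal{C}\to\mathsf{Gpd}(\mathcal{C})$ is exactly the comprehensive factorization system restricted to regular epimorphisms: $\mathcal{E}'$ is the class of final functors and $\mathcal{M}^*$ is the class of regular epimorphic discrete fibrations.
   Context: "Exact" means Barr-exact (in particular, with finite limits). For an internal groupoid $\mathbb{X}$ with domain and codomain morphisms $d,c\colon X_1\to X_0$, $\pi_0(\mathbb{X})$ is the codomain of the coequalizer of $(d,c)$; $D$ sends an object to the corresponding discrete internal groupoid; $\pi_0$ is left adjoint to $D$, with unit $\eta\colon 1\to D\pi_0$. An internal functor $F=(f_0,f_1)\colon\mathbb{X}\to\mathbb{Y}$ is a discrete fibration if the square $c f_1=f_0 c$ is a pullback. Final functors are the morphisms of $\mathsf{Gpd}(\mathcal{C})$ in the class (left) orthogonal to the internal discrete fibrations: $e$ is final if for every commutative square $ge=mf$ with $m$ a discrete fibration there is a unique $\delta$ with $\delta e=f$ and $m\delta=g$. Final functors and discrete fibrations form the comprehensive factorization system on $\mathsf{Gpd}(\mathcal{C})$. For an object $\mathbb{B}$ of $\mathsf{Gpd}(\mathcal{C})$, $\mathcal{F}(\mathbb{B})$ is the full subcategory of the slice category over $\mathbb{B}$ whose objects are in $\mathcal{F}$. $\mathcal{E}$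 is the class of morphisms of $\mathsf{Gpd}(\mathcal{C})$ sent to isomorphisms by $\pi_0$. $\mathcal{M}$ is the class of those $m\colon\mathbb{A}\to\mathbb{B}$ in $\mathcal{F}$ for which the naturality square $\eta_{\mathbb{B}}\, m = D\pi_0(m)\,\eta_{\mathbb{A}}$ is a pullback. A morphism $p\colon\mathbb{E}\to\mathbb{B}$ is a monadic extension if the pullback functor $p^*\colon\mathcal{F}(\mathbb{B})\to\mathcal{F}(\mathbb{E})$ is monadic. $\mathcal{M}^*$ is the class of those $f\colon \mathbb{A}\to\mathbb{B}$ in $\mathcal{F}$ for which there is a monadic extension $p$ with codomain $\mathbb{B}$ such that the pullback of $f$ along $p$ is in $\mathcal{M}$. $\mathcal{E}'$ is the class of morphisms of $\mathsf{Gpd}(\mathcal{C})$ all of whose pullbacks along arrows in $\mathcal{F}$ are in $\mathcal{E}$. A factorization system for $\mathcal{F}$ is a pair $(\mathcal{E}_0,\mathcal{M}_0)$ of classes of arrows such that: (1) both contain identities and are closed under composition with isomorphisms; (2) for any commutative square $ge=mf$ with $e\in\mathcal{E}_0$, $m\in\mathcal{M}_0$ there is a unique $\delta$ with $\delta e=f$ and $m\delta=g$; (3) $\mathcal{M}_0\subseteq\mathcal{F}$; (4) every $f\in\mathcal{F}$ is a composite $f=me$ with $m\in\mathcal{M}_0$, $e\in\mathcal{E}_0$. The pair $(\mathcal{E}',\mathcal{M}^* )$ is called a relative monotone-light factorization system for $\mathcal{F}$ when it is a factorization system for $\mathcal{F}$. *)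

theory Defs
  imports Main
begin

section \<open>Categories, limits and exactness\<close>

record ('o, 'a) cat =
  Obj :: "'o set"
  Arr :: "'a set"
  Dom :: "'a \<Rightarrow> 'o"
  Cod :: "'a \<Rightarrow> 'o"
  Idn :: "'o \<Rightarrow> 'a"
  Comp :: "'a \<Rightarrow> 'a \<Rightarrow> 'a"  (infixl "\<cdot>\<index>" 70)

definition Hom :: "('o, 'a) cat \<Rightarrow> 'o \<Rightarrow> 'o \<Rightarrow> 'a set" where
  "Hom C a b = {f \<in> Arr C. Dom C f = a \<and> Cod C f = b}"

locale category =
  fixes C :: "('o, 'a) cat" (structure)
  assumes Dom_Obj: "f \<in> Arr C \<Longrightarrow> Dom C f \<in> Obj C"
    and Cod_Obj: "f \<in> Arr C \<Longrightarrow> Cod C f \<in> Obj C"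
    and Idn_Hom: "a \<in> Obj C \<Longrightarrow> Idn C a \<in> Hom C a a"
    and Comp_Hom: "\<lbrakk>f \<in> Hom C a b; g \<in> Hom C b c\<rbrakk> \<Longrightarrow> g \<cdot> f \<in> Hom C a c"
    and Comp_Idn: "f \<in> Hom C a b \<Longrightarrow> f \<cdot> Idn C a = f"
    and Idn_Comp: "f \<in> Hom C a b \<Longrightarrow> Idn C b \<cdot> f = f"
    and Comp_assoc: "\<lbrakk>f \<in> Hom C a b; g \<in> Hom C b c; h \<in> Hom C c d\<rbrakk>
      \<Longrightarrow> (h \<cdot> g) \<cdot> f = h \<cdot> (g \<cdot> f)"

definition is_iso :: "('o, 'a) cat \<Rightarrow> 'a \<Rightarrow> bool" where
  "is_iso C f \<longleftrightarrow> f \<in> Arr C \<and>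
     (\<exists>g \<in> Hom C (Cod C f) (Dom C f).
        g \<cdot>\<^bsub>C\<^esub> f = Idn C (Dom C f) \<and> f \<cdot>\<^bsub>C\<^esub> g = Idn C (Cod C f))"

definition is_terminal :: "('o, 'a) cat \<Rightarrow> 'o \<Rightarrow> bool" where
  "is_terminal C t \<longleftrightarrow> t \<in> Obj C \<and> (\<forall>a \<in> Obj C. \<exists>!f. f \<in> Hom C a t)"

text \<open>The square \<open>f \<cdot> p = g \<cdot> q\<close> is a pullback; \<open>p\<close> is the pullback of \<open>g\<close> along \<open>f\<close>
  and \<open>q\<close> is the pullback of \<open>f\<close> along \<open>g\<close>.\<close>

definition is_pullback :: "('o, 'a) cat \<Rightarrow> 'a \<Rightarrow> 'a \<Rightarrow> 'a \<Rightarrow> 'a \<Rightarrow> bool" where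
  "is_pullback C f g p q \<longleftrightarrow>
     f \<in> Arr C \<and> g \<in> Arr C \<and> Cod C f = Cod C g \<and>
     p \<in> Arr C \<and> q \<in> Arr C \<and> Dom C p = Dom C q \<and> Cod C p = Dom C f \<and> Cod C q = Dom C g \<and>
     f \<cdot>\<^bsub>C\<^esub> p = g \<cdot>\<^bsub>C\<^esub> q \<and>
     (\<forall>t. \<forall>u \<in> Hom C t (Dom C f). \<forall>v \<in> Hom C t (Dom C g).
        f \<cdot>\<^bsub>C\<^esub> u = g \<cdot>\<^bsub>C\<^esub> v \<longrightarrow>
        (\<exists>!w. w \<in> Hom C t (Dom C p) \<and> p \<cdot>\<^bsub>C\<^esub> w = u \<and> q \<cdot>\<^bsub>C\<^esub> w = v))"

definition is_coequalizer :: "('o, 'a) cat \<Rightarrow> 'a \<Rightarrow> 'a \<Rightarrow> 'a \<Rightarrow> bool" where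
  "is_coequalizer C u v q \<longleftrightarrow>
     u \<in> Arr C \<and> v \<in> Arr C \<and> Dom C u = Dom C v \<and> Cod C u = Cod C v \<and>
     q \<in> Arr C \<and> Dom C q = Cod C u \<and> q \<cdot>\<^bsub>C\<^esub> u = q \<cdot>\<^bsub>C\<^esub> v \<and>
     (\<forall>z. \<forall>h \<in> Hom C (Cod C u) z. h \<cdot>\<^bsub>C\<^esub> u = h \<cdot>\<^bsub>C\<^esub> v \<longrightarrow>
        (\<exists>!k. k \<in> Hom C (Cod C q) z \<and> k \<cdot>\<^bsub>C\<^esub> q = h))"

definition regular_epis :: "('o, 'a) cat \<Rightarrow> 'a set" where
  "regular_epis C = {q. \<exists>u v. is_coequalizer C u v q}"

text \<open>Finite limits, in the usual form of a terminal object and pullbacks.\<close>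

definition has_finite_limits :: "('o, 'a) cat \<Rightarrow> bool" where
  "has_finite_limits C \<longleftrightarrow> (\<exists>t. is_terminal C t) \<and>
     (\<forall>f \<in> Arr C. \<forall>g \<in> Arr C. Cod C f = Cod C g \<longrightarrow> (\<exists>p q. is_pullback C f g p q))"

definition regular_category :: "('o, 'a) cat \<Rightarrow> bool" where
  "regular_category C \<longleftrightarrow> category C \<and> has_finite_limits C \<and>
     (\<forall>f p q. is_pullback C f f p q \<longrightarrow> (\<exists>e. is_coequalizer C p q e)) \<and>
     (\<forall>f g p q. is_pullback C f g p q \<and> f \<in> regular_epis C \<longrightarrow> q \<in> regular_epis C)"

text \<open>An internal relation on \<open>x\<close> is a jointly monic pair of arrows \<open>r \<rightrightarrows> x\<close>.\<close>

definition is_relation :: "('o, 'a) cat \<Rightarrow> 'a \<Rightarrow> 'a \<Rightarrow> bool" where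
  "is_relation C r1 r2 \<longleftrightarrow>
     r1 \<in> Arr C \<and> r2 \<in> Arr C \<and> Dom C r1 = Dom C r2 \<and> Cod C r1 = Cod C r2 \<and>
     (\<forall>t. \<forall>u \<in> Hom C t (Dom C r1). \<forall>v \<in> Hom C t (Dom C r1).
        r1 \<cdot>\<^bsub>C\<^esub> u = r1 \<cdot>\<^bsub>C\<^esub> v \<and> r2 \<cdot>\<^bsub>C\<^esub> u = r2 \<cdot>\<^bsub>C\<^esub> v \<longrightarrow> u = v)"

definition is_reflexive_relation :: "('o, 'a) cat \<Rightarrow> 'a \<Rightarrow> 'a \<Rightarrow> bool" where
  "is_reflexive_relation C r1 r2 \<longleftrightarrow> is_relation C r1 r2 \<and>
     (\<exists>s \<in> Hom C (Cod C r1) (Dom C r1).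
        r1 \<cdot>\<^bsub>C\<^esub> s = Idn C (Cod C r1) \<and> r2 \<cdot>\<^bsub>C\<^esub> s = Idn C (Cod C r1))"

definition is_symmetric_relation :: "('o, 'a) cat \<Rightarrow> 'a \<Rightarrow> 'a \<Rightarrow> bool" where
  "is_symmetric_relation C r1 r2 \<longleftrightarrow> is_relation C r1 r2 \<and>
     (\<exists>s \<in> Hom C (Dom C r1) (Dom C r1). r1 \<cdot>\<^bsub>C\<^esub> s = r2 \<and> r2 \<cdot>\<^bsub>C\<^esub> s = r1)"

definition is_transitive_relation :: "('o, 'a) cat \<Rightarrow> 'a \<Rightarrow> 'a \<Rightarrow> bool" where
  "is_transitive_relation C r1 r2 \<longleftrightarrow> is_relation C r1 r2 \<and>
     (\<forall>p1 p2. is_pullback C r2 r1 p1 p2 \<longrightarrow>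
        (\<exists>t \<in> Hom C (Dom C p1) (Dom C r1).
           r1 \<cdot>\<^bsub>C\<^esub> t = r1 \<cdot>\<^bsub>C\<^esub> p1 \<and> r2 \<cdot>\<^bsub>C\<^esub> t = r2 \<cdot>\<^bsub>C\<^esub> p2))"

definition is_equivalence_relation :: "('o, 'a) cat \<Rightarrow> 'a \<Rightarrow> 'a \<Rightarrow> bool" where
  "is_equivalence_relation C r1 r2 \<longleftrightarrow>
     is_reflexive_relation C r1 r2 \<and> is_symmetric_relation C r1 r2 \<and> is_transitive_relation C r1 r2"

definition exact_category :: "('o, 'a) cat \<Rightarrow> bool" where
  "exact_category C \<longleftrightarrow> regular_category C \<and>
     (\<forall>r1 r2. is_equivalence_relation C r1 r2 \<longrightarrow> (\<exists>f. is_pullback C f f r1 r2))"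

definition maltsev_category :: "('o, 'a) cat \<Rightarrow> bool" where
  "maltsev_category C \<longleftrightarrow> category C \<and> has_finite_limits C \<and>
     (\<forall>r1 r2. is_reflexive_relation C r1 r2 \<longrightarrow> is_equivalence_relation C r1 r2)"


section \<open>Functors and monadicity\<close>

record ('o, 'a, 'p, 'b) cfunctor =
  FObj :: "'o \<Rightarrow> 'p"
  FArr :: "'a \<Rightarrow> 'b"

definition id_functor :: "('o, 'a, 'o, 'a) cfunctor" where
  "id_functor = \<lparr>FObj = (\<lambda>x. x), FArr = (\<lambda>f. f)\<rparr>"

definition comp_functor ::
  "('p, 'b, 'q, 'c) cfunctor \<Rightarrow> ('o, 'a, 'p, 'b) cfunctor \<Rightarrow> ('o, 'a, 'q, 'c) cfunctor" where
  "comp_functor G F = \<lparr>FObj = FObj G \<circ> FObj F, FArr = FArr G \<circ> FArr F\<rparr>"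

definition is_functor ::
  "('o, 'a) cat \<Rightarrow> ('p, 'b) cat \<Rightarrow> ('o, 'a, 'p, 'b) cfunctor \<Rightarrow> bool" where
  "is_functor A B F \<longleftrightarrow>
     (\<forall>x \<in> Obj A. FObj F x \<in> Obj B) \<and>
     (\<forall>f \<in> Arr A. FArr F f \<in> Hom B (FObj F (Dom A f)) (FObj F (Cod A f))) \<and>
     (\<forall>x \<in> Obj A. FArr F (Idn A x) = Idn B (FObj F x)) \<and>
     (\<forall>f \<in> Arr A. \<forall>g \<in> Arr A. Dom A g = Cod A f \<longrightarrow>
        FArr F (g \<cdot>\<^bsub>A\<^esub> f) = FArr F g \<cdot>\<^bsub>B\<^esub> FArr F f)"

definition is_nat_trans ::
  "('o, 'a) cat \<Rightarrow> ('p, 'b) cat \<Rightarrow> ('o, 'a, 'p, 'b) cfunctor \<Rightarrow> ('o, 'a, 'p, 'b) cfunctor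
     \<Rightarrow> ('o \<Rightarrow> 'b) \<Rightarrow> bool" where
  "is_nat_trans A B F G \<tau> \<longleftrightarrow>
     (\<forall>x \<in> Obj A. \<tau> x \<in> Hom B (FObj F x) (FObj G x)) \<and>
     (\<forall>f \<in> Arr A. \<tau> (Cod A f) \<cdot>\<^bsub>B\<^esub> FArr F f = FArr G f \<cdot>\<^bsub>B\<^esub> \<tau> (Dom A f))"

definition is_nat_iso ::
  "('o, 'a) cat \<Rightarrow> ('p, 'b) cat \<Rightarrow> ('o, 'a, 'p, 'b) cfunctor \<Rightarrow> ('o, 'a, 'p, 'b) cfunctor
     \<Rightarrow> ('o \<Rightarrow> 'b) \<Rightarrow> bool" where
  "is_nat_iso A B F G \<tau> \<longleftrightarrow> is_nat_trans A B F G \<tau> \<and> (\<forall>x \<in> Obj A. is_iso B (\<tau> x))"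

definition is_equivalence_functor ::
  "('o, 'a) cat \<Rightarrow> ('p, 'b) cat \<Rightarrow> ('o, 'a, 'p, 'b) cfunctor \<Rightarrow> bool" where
  "is_equivalence_functor A B F \<longleftrightarrow> is_functor A B F \<and>
     (\<exists>G \<alpha> \<beta>. is_functor B A G \<and>
        is_nat_iso A A id_functor (comp_functor G F) \<alpha> \<and>
        is_nat_iso B B (comp_functor F G) id_functor \<beta>)"

definition is_adjunction ::
  "('p, 'b) cat \<Rightarrow> ('o, 'a) cat \<Rightarrow> ('p, 'b, 'o, 'a) cfunctor \<Rightarrow> ('o, 'a, 'p, 'b) cfunctor
     \<Rightarrow> ('p \<Rightarrow> 'b) \<Rightarrow> ('o \<Rightarrow> 'a) \<Rightarrow> bool" where
  "is_adjunction X A L U \<eta> \<epsilon> \<longleftrightarrow>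
     is_functor X A L \<and> is_functor A X U \<and>
     is_nat_trans X X id_functor (comp_functor U L) \<eta> \<and>
     is_nat_trans A A (comp_functor L U) id_functor \<epsilon> \<and>
     (\<forall>x \<in> Obj X. \<epsilon> (FObj L x) \<cdot>\<^bsub>A\<^esub> FArr L (\<eta> x) = Idn A (FObj L x)) \<and>
     (\<forall>a \<in> Obj A. FArr U (\<epsilon> a) \<cdot>\<^bsub>X\<^esub> \<eta> (FObj U a) = Idn X (FObj U a))"

text \<open>The Eilenberg--Moore category of a monad \<open>(T, \<eta>, \<mu>)\<close> on \<open>X\<close>: an algebra is a pair
  (object, structure map), and an arrow is a triple (source algebra, underlying arrow, target
  algebra).\<close>

definition EM_algebras ::
  "('p, 'b) cat \<Rightarrow> ('p, 'b, 'p, 'b) cfunctor \<Rightarrow> ('p \<Rightarrow> 'b) \<Rightarrow> ('p \<Rightarrow> 'b) \<Rightarrow> ('p \<times> 'b) set" where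
  "EM_algebras X T \<eta> \<mu> = {(x, h). x \<in> Obj X \<and> h \<in> Hom X (FObj T x) x \<and>
     h \<cdot>\<^bsub>X\<^esub> \<eta> x = Idn X x \<and> h \<cdot>\<^bsub>X\<^esub> \<mu> x = h \<cdot>\<^bsub>X\<^esub> FArr T h}"

definition EM_category ::
  "('p, 'b) cat \<Rightarrow> ('p, 'b, 'p, 'b) cfunctor \<Rightarrow> ('p \<Rightarrow> 'b) \<Rightarrow> ('p \<Rightarrow> 'b)
     \<Rightarrow> ('p \<times> 'b, ('p \<times> 'b) \<times> 'b \<times> ('p \<times> 'b)) cat" where
  "EM_category X T \<eta> \<mu> =
     \<lparr>Obj = EM_algebras X T \<eta> \<mu>,
      Arr = {((x, h), f, (y, k)).
               (x, h) \<in> EM_algebras X T \<eta> \<mu> \<and> (y, k) \<in> EM_algebras X T \<eta> \<mu> \<and>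
               f \<in> Hom X x y \<and> f \<cdot>\<^bsub>X\<^esub> h = k \<cdot>\<^bsub>X\<^esub> FArr T f},
      Dom = (\<lambda>(s, f, t). s),
      Cod = (\<lambda>(s, f, t). t),
      Idn = (\<lambda>(x, h). ((x, h), Idn X x, (x, h))),
      Comp = (\<lambda>(s', g, t') (s, f, t). (s, g \<cdot>\<^bsub>X\<^esub> f, t'))\<rparr>"

definition comparison_functor ::
  "('o, 'a) cat \<Rightarrow> ('o, 'a, 'p, 'b) cfunctor \<Rightarrow> ('o \<Rightarrow> 'a)
     \<Rightarrow> ('o, 'a, 'p \<times> 'b, ('p \<times> 'b) \<times> 'b \<times> ('p \<times> 'b)) cfunctor" where
  "comparison_functor A U \<epsilon> =
     \<lparr>FObj = (\<lambda>a. (FObj U a, FArr U (\<epsilon> a))),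
      FArr = (\<lambda>f. ((FObj U (Dom A f), FArr U (\<epsilon> (Dom A f))), FArr U f,
                   (FObj U (Cod A f), FArr U (\<epsilon> (Cod A f)))))\<rparr>"

text \<open>A functor \<open>U\<close> is monadic if it has a left adjoint and the comparison functor to the algebras
  of the induced monad is an equivalence of categories.\<close>

definition is_monadic ::
  "('o, 'a) cat \<Rightarrow> ('p, 'b) cat \<Rightarrow> ('o, 'a, 'p, 'b) cfunctor \<Rightarrow> bool" where
  "is_monadic A X U \<longleftrightarrow>
     (\<exists>L \<eta> \<epsilon>. is_adjunction X A L U \<eta> \<epsilon> \<and>
        is_equivalence_functor A
          (EM_category X (comp_functor U L) \<eta> (\<lambda>x. FArr U (\<epsilon> (FObj L x))))
          (comparison_functor A U \<epsilon>))"


section \<open>Relative monotone-light factorization\<close>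

text \<open>The full subcategory of the slice over \<open>b\<close> on the arrows in \<open>F\<close>. An arrow from \<open>f\<close> to \<open>g\<close>
  is a triple \<open>(f, h, g)\<close> with \<open>g \<cdot> h = f\<close>.\<close>

definition slice_in :: "('o, 'a) cat \<Rightarrow> 'a set \<Rightarrow> 'o \<Rightarrow> ('a, 'a \<times> 'a \<times> 'a) cat" where
  "slice_in G F b =
     \<lparr>Obj = {f \<in> Arr G. f \<in> F \<and> Cod G f = b},
      Arr = {(f, h, g). f \<in> Arr G \<and> f \<in> F \<and> Cod G f = b \<and> g \<in> Arr G \<and> g \<in> F \<and> Cod G g = b \<and>
               h \<in> Hom G (Dom G f) (Dom G g) \<and> g \<cdot>\<^bsub>G\<^esub> h = f},
      Dom = (\<lambda>(f, h, g). f),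
      Cod = (\<lambda>(f, h, g). g),
      Idn = (\<lambda>f. (f, Idn G (Dom G f), f)),
      Comp = (\<lambda>(f', h', g') (f, h, g). (f, h' \<cdot>\<^bsub>G\<^esub> h, g'))\<rparr>"

definition some_pullback :: "('o, 'a) cat \<Rightarrow> 'a \<Rightarrow> 'a \<Rightarrow> 'a \<times> 'a" where
  "some_pullback G f p = (SOME (s, t). is_pullback G f p s t)"

definition pullback_functor ::
  "('o, 'a) cat \<Rightarrow> 'a \<Rightarrow> ('a, 'a \<times> 'a \<times> 'a, 'a, 'a \<times> 'a \<times> 'a) cfunctor" where
  "pullback_functor G p =
     \<lparr>FObj = (\<lambda>f. snd (some_pullback G f p)),
      FArr = (\<lambda>(f, h, g).
        (snd (some_pullback G f p),
         THE k. k \<in> Hom G (Dom G (snd (some_pullback G f p))) (Dom G (snd (some_pullback G g p))) \<and>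
                fst (some_pullback G g p) \<cdot>\<^bsub>G\<^esub> k = h \<cdot>\<^bsub>G\<^esub> fst (some_pullback G f p) \<and>
                snd (some_pullback G g p) \<cdot>\<^bsub>G\<^esub> k = snd (some_pullback G f p),
         snd (some_pullback G g p)))\<rparr>"

definition monadic_extension :: "('o, 'a) cat \<Rightarrow> 'a set \<Rightarrow> 'a \<Rightarrow> bool" where
  "monadic_extension G F p \<longleftrightarrow> p \<in> Arr G \<and>
     is_monadic (slice_in G F (Cod G p)) (slice_in G F (Dom G p)) (pullback_functor G p)"

text \<open>Below \<open>I\<close> is a functor from \<open>G\<close> to \<open>X\<close>, left adjoint to \<open>H\<close>, with unit \<open>\<eta>\<close>.\<close>

definition class_E :: "('p, 'b) cat \<Rightarrow> ('o, 'a) cat \<Rightarrow> ('p, 'b, 'o, 'a) cfunctor \<Rightarrow> 'b set" where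
  "class_E G X I = {f \<in> Arr G. is_iso X (FArr I f)}"

definition class_M :: "('p, 'b) cat \<Rightarrow> 'b set \<Rightarrow> ('p, 'b, 'o, 'a) cfunctor
    \<Rightarrow> ('o, 'a, 'p, 'b) cfunctor \<Rightarrow> ('p \<Rightarrow> 'b) \<Rightarrow> 'b set" where
  "class_M G F I H \<eta> = {m \<in> Arr G. m \<in> F \<and>
     is_pullback G (\<eta> (Cod G m)) (FArr H (FArr I m)) m (\<eta> (Dom G m))}"

definition class_E' ::
  "('p, 'b) cat \<Rightarrow> ('o, 'a) cat \<Rightarrow> 'b set \<Rightarrow> ('p, 'b, 'o, 'a) cfunctor \<Rightarrow> 'b set" where
  "class_E' G X F I = {e \<in> Arr G. \<forall>f \<in> F. \<forall>s t. is_pullback G e f s t \<longrightarrow> t \<in> class_E G X I}"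

definition class_M_star :: "('p, 'b) cat \<Rightarrow> 'b set \<Rightarrow> ('p, 'b, 'o, 'a) cfunctor
    \<Rightarrow> ('o, 'a, 'p, 'b) cfunctor \<Rightarrow> ('p \<Rightarrow> 'b) \<Rightarrow> 'b set" where
  "class_M_star G F I H \<eta> = {f \<in> Arr G. f \<in> F \<and>
     (\<exists>p s t. monadic_extension G F p \<and> is_pullback G f p s t \<and> t \<in> class_M G F I H \<eta>)}"

definition orthogonal :: "('o, 'a) cat \<Rightarrow> 'a \<Rightarrow> 'a \<Rightarrow> bool" where
  "orthogonal G e m \<longleftrightarrow>
     (\<forall>f \<in> Hom G (Dom G e) (Dom G m). \<forall>g \<in> Hom G (Cod G e) (Cod G m).
        g \<cdot>\<^bsub>G\<^esub> e = m \<cdot>\<^bsub>G\<^esub> f \<longrightarrow>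
        (\<exists>!\<delta>. \<delta> \<in> Hom G (Cod G e) (Dom G m) \<and> \<delta> \<cdot>\<^bsub>G\<^esub> e = f \<and> m \<cdot>\<^bsub>G\<^esub> \<delta> = g))"

definition closed_under_isos :: "('o, 'a) cat \<Rightarrow> 'a set \<Rightarrow> bool" where
  "closed_under_isos G S \<longleftrightarrow>
     (\<forall>f \<in> S. \<forall>i. is_iso G i \<longrightarrow>
        (Dom G i = Cod G f \<longrightarrow> i \<cdot>\<^bsub>G\<^esub> f \<in> S) \<and> (Cod G i = Dom G f \<longrightarrow> f \<cdot>\<^bsub>G\<^esub> i \<in> S))"

definition factorization_system_for ::
  "('o, 'a) cat \<Rightarrow> 'a set \<Rightarrow> 'a set \<Rightarrow> 'a set \<Rightarrow> bool" where
  "factorization_system_for G F E0 M0 \<longleftrightarrow>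
     E0 \<subseteq> Arr G \<and> M0 \<subseteq> Arr G \<and>
     (\<forall>x \<in> Obj G. Idn G x \<in> E0 \<and> Idn G x \<in> M0) \<and>
     closed_under_isos G E0 \<and> closed_under_isos G M0 \<and>
     (\<forall>e \<in> E0. \<forall>m \<in> M0. orthogonal G e m) \<and>
     M0 \<subseteq> F \<and>
     (\<forall>f \<in> F. \<exists>e \<in> E0. \<exists>m \<in> M0. Cod G e = Dom G m \<and> f = m \<cdot>\<^bsub>G\<^esub> e)"

definition relative_monotone_light_system :: "('p, 'b) cat \<Rightarrow> ('o, 'a) cat \<Rightarrow> 'b set
    \<Rightarrow> ('p, 'b, 'o, 'a) cfunctor \<Rightarrow> ('o, 'a, 'p, 'b) cfunctor \<Rightarrow> ('p \<Rightarrow> 'b) \<Rightarrow> bool" where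
  "relative_monotone_light_system G X F I H \<eta> \<longleftrightarrow>
     factorization_system_for G F (class_E' G X F I) (class_M_star G F I H \<eta>)"


section \<open>Internal groupoids\<close>

text \<open>An internal groupoid carries its object \<open>G2\<close> of composable pairs, a pullback of
  \<open>gdom\<close> and \<open>gcod\<close> with projections \<open>gpr1\<close> and \<open>gpr2\<close>: a generalized element is a pair \<open>(u, v)\<close>
  with \<open>gdom \<cdot> u = gcod \<cdot> v\<close>, and \<open>gmult\<close> sends it to the composite ``\<open>u\<close> after \<open>v\<close>''.
  Different choices of \<open>G2\<close> yield canonically isomorphic groupoids.\<close>

record ('o, 'a) igpd =
  G0 :: 'o
  G1 :: 'o
  G2 :: 'o
  gdom :: 'a
  gcod :: 'a
  gunit :: 'a
  gpr1 :: 'a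
  gpr2 :: 'a
  gmult :: 'a

definition gpair :: "('o, 'a) cat \<Rightarrow> ('o, 'a) igpd \<Rightarrow> 'a \<Rightarrow> 'a \<Rightarrow> 'a" where
  "gpair C X u v =
     (THE w. w \<in> Hom C (Dom C u) (G2 X) \<and> gpr1 X \<cdot>\<^bsub>C\<^esub> w = u \<and> gpr2 X \<cdot>\<^bsub>C\<^esub> w = v)"

definition gcomp :: "('o, 'a) cat \<Rightarrow> ('o, 'a) igpd \<Rightarrow> 'a \<Rightarrow> 'a \<Rightarrow> 'a" where
  "gcomp C X u v = gmult X \<cdot>\<^bsub>C\<^esub> gpair C X u v"

text \<open>Associativity is expressed through generalized elements, i.e. for all composable triples
  \<open>t \<rightarrow> G1\<close>.\<close>

definition internal_category :: "('o, 'a) cat \<Rightarrow> ('o, 'a) igpd \<Rightarrow> bool" where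
  "internal_category C X \<longleftrightarrow>
     G0 X \<in> Obj C \<and> G1 X \<in> Obj C \<and> G2 X \<in> Obj C \<and>
     gdom X \<in> Hom C (G1 X) (G0 X) \<and> gcod X \<in> Hom C (G1 X) (G0 X) \<and>
     gunit X \<in> Hom C (G0 X) (G1 X) \<and>
     gpr1 X \<in> Hom C (G2 X) (G1 X) \<and> gpr2 X \<in> Hom C (G2 X) (G1 X) \<and>
     gmult X \<in> Hom C (G2 X) (G1 X) \<and>
     is_pullback C (gdom X) (gcod X) (gpr1 X) (gpr2 X) \<and>
     gdom X \<cdot>\<^bsub>C\<^esub> gunit X = Idn C (G0 X) \<and> gcod X \<cdot>\<^bsub>C\<^esub> gunit X = Idn C (G0 X) \<and>
     gdom X \<cdot>\<^bsub>C\<^esub> gmult X = gdom X \<cdot>\<^bsub>C\<^esub> gpr2 X \<and> gcod X \<cdot>\<^bsub>C\<^esub> gmult X = gcod X \<cdot>\<^bsub>C\<^esub> gpr1 X \<and>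
     gcomp C X (Idn C (G1 X)) (gunit X \<cdot>\<^bsub>C\<^esub> gdom X) = Idn C (G1 X) \<and>
     gcomp C X (gunit X \<cdot>\<^bsub>C\<^esub> gcod X) (Idn C (G1 X)) = Idn C (G1 X) \<and>
     (\<forall>t. \<forall>u \<in> Hom C t (G1 X). \<forall>v \<in> Hom C t (G1 X). \<forall>w \<in> Hom C t (G1 X).
        gdom X \<cdot>\<^bsub>C\<^esub> u = gcod X \<cdot>\<^bsub>C\<^esub> v \<and> gdom X \<cdot>\<^bsub>C\<^esub> v = gcod X \<cdot>\<^bsub>C\<^esub> w \<longrightarrow>
        gcomp C X (gcomp C X u v) w = gcomp C X u (gcomp C X v w))"

definition internal_groupoid :: "('o, 'a) cat \<Rightarrow> ('o, 'a) igpd \<Rightarrow> bool" where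
  "internal_groupoid C X \<longleftrightarrow> internal_category C X \<and>
     (\<exists>i \<in> Hom C (G1 X) (G1 X).
        gdom X \<cdot>\<^bsub>C\<^esub> i = gcod X \<and> gcod X \<cdot>\<^bsub>C\<^esub> i = gdom X \<and>
        gcomp C X (Idn C (G1 X)) i = gunit X \<cdot>\<^bsub>C\<^esub> gcod X \<and>
        gcomp C X i (Idn C (G1 X)) = gunit X \<cdot>\<^bsub>C\<^esub> gdom X)"

record ('o, 'a) ifunctor =
  Src :: "('o, 'a) igpd"
  Tgt :: "('o, 'a) igpd"
  f0 :: 'a
  f1 :: 'a

definition internal_functor :: "('o, 'a) cat \<Rightarrow> ('o, 'a) ifunctor \<Rightarrow> bool" where
  "internal_functor C F \<longleftrightarrow>
     internal_groupoid C (Src F) \<and> internal_groupoid C (Tgt F) \<and>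
     f0 F \<in> Hom C (G0 (Src F)) (G0 (Tgt F)) \<and> f1 F \<in> Hom C (G1 (Src F)) (G1 (Tgt F)) \<and>
     gdom (Tgt F) \<cdot>\<^bsub>C\<^esub> f1 F = f0 F \<cdot>\<^bsub>C\<^esub> gdom (Src F) \<and>
     gcod (Tgt F) \<cdot>\<^bsub>C\<^esub> f1 F = f0 F \<cdot>\<^bsub>C\<^esub> gcod (Src F) \<and>
     f1 F \<cdot>\<^bsub>C\<^esub> gunit (Src F) = gunit (Tgt F) \<cdot>\<^bsub>C\<^esub> f0 F \<and>
     f1 F \<cdot>\<^bsub>C\<^esub> gmult (Src F) =
       gcomp C (Tgt F) (f1 F \<cdot>\<^bsub>C\<^esub> gpr1 (Src F)) (f1 F \<cdot>\<^bsub>C\<^esub> gpr2 (Src F))"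

definition Gpd :: "('o, 'a) cat \<Rightarrow> (('o, 'a) igpd, ('o, 'a) ifunctor) cat" where
  "Gpd C =
     \<lparr>Obj = {X. internal_groupoid C X},
      Arr = {F. internal_functor C F},
      Dom = Src,
      Cod = Tgt,
      Idn = (\<lambda>X. \<lparr>Src = X, Tgt = X, f0 = Idn C (G0 X), f1 = Idn C (G1 X)\<rparr>),
      Comp = (\<lambda>G F. \<lparr>Src = Src F, Tgt = Tgt G, f0 = f0 G \<cdot>\<^bsub>C\<^esub> f0 F, f1 = f1 G \<cdot>\<^bsub>C\<^esub> f1 F\<rparr>)\<rparr>"

definition discrete_fibrations :: "('o, 'a) cat \<Rightarrow> ('o, 'a) ifunctor set" where
  "discrete_fibrations C =
     {F \<in> Arr (Gpd C). is_pullback C (gcod (Tgt F)) (f0 F) (f1 F) (gcod (Src F))}"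

definition final_functors :: "('o, 'a) cat \<Rightarrow> ('o, 'a) ifunctor set" where
  "final_functors C = {E \<in> Arr (Gpd C). \<forall>M \<in> discrete_fibrations C. orthogonal (Gpd C) E M}"

definition discrete_groupoid :: "('o, 'a) cat \<Rightarrow> 'o \<Rightarrow> ('o, 'a) igpd" where
  "discrete_groupoid C x =
     \<lparr>G0 = x, G1 = x, G2 = x, gdom = Idn C x, gcod = Idn C x, gunit = Idn C x,
      gpr1 = Idn C x, gpr2 = Idn C x, gmult = Idn C x\<rparr>"

definition discrete_functor ::
  "('o, 'a) cat \<Rightarrow> ('o, 'a, ('o, 'a) igpd, ('o, 'a) ifunctor) cfunctor" where
  "discrete_functor C =
     \<lparr>FObj = discrete_groupoid C,
      FArr = (\<lambda>f. \<lparr>Src = discrete_groupoid C (Dom C f), Tgt = discrete_groupoid C (Cod C f),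
                   f0 = f, f1 = f\<rparr>)\<rparr>"

text \<open>In an exact category the coequalizer of \<open>gdom\<close> and \<open>gcod\<close> exists; one is chosen.\<close>

definition components :: "('o, 'a) cat \<Rightarrow> ('o, 'a) igpd \<Rightarrow> 'a" where
  "components C X = (SOME q. is_coequalizer C (gdom X) (gcod X) q)"

definition pi0 :: "('o, 'a) cat \<Rightarrow> (('o, 'a) igpd, ('o, 'a) ifunctor, 'o, 'a) cfunctor" where
  "pi0 C =
     \<lparr>FObj = (\<lambda>X. Cod C (components C X)),
      FArr = (\<lambda>F. THE k.
        k \<in> Hom C (Cod C (components C (Src F))) (Cod C (components C (Tgt F))) \<and>
        k \<cdot>\<^bsub>C\<^esub> components C (Src F) = components C (Tgt F) \<cdot>\<^bsub>C\<^esub> f0 F)\<rparr>"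

definition pi0_unit :: "('o, 'a) cat \<Rightarrow> ('o, 'a) igpd \<Rightarrow> ('o, 'a) ifunctor" where
  "pi0_unit C X =
     \<lparr>Src = X, Tgt = discrete_groupoid C (FObj (pi0 C) X),
      f0 = components C X, f1 = components C X \<cdot>\<^bsub>C\<^esub> gdom X\<rparr>"

end

theory Submission
  imports Defs
begin

text \<open>The proof works with generalized elements \<open>t \<rightarrow> X\<close> and with existence up to covers, that is, after
composition with a regular epimorphism. In this internal language, groupoids in \<open>C\<close> can be treated
nearly as ordinary groupoids. Two consequences of the hypotheses carry the argument: a reflexive
relation has an effective quotient (\<open>effective_quotient\<close>), and a regular epimorphism of groupoids lifts
an arrow along any lift of its domain (\<open>regular_pushout\<close>, \<open>regular_functor_lift\<close>). From these one gets
that regular epimorphisms of groupoids are levelwise (\<open>Gpd_regular_epi_iff\<close>), and that pulling back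
along each of them is monadic (\<open>Gpd_effective_descent\<close>, \<open>regular_epi_monadic_extension\<close>): the structure
map of an algebra is a reflexive relation, whose quotient is the descended object.

Final functors are identified with the locally full and essentially surjective ones. These are
orthogonal to discrete fibrations by transporting along chosen arrows (\<open>full_ess_surj_orthogonal\<close>),
and every functor factors through one of them followed by a discrete fibration, whose fibre
over \<open>y\<close> consists of the connected components of the comma groupoid at \<open>y\<close>
(\<open>comprehensive_factorization\<close>).

Both classes of the monotone-light system are computed by testing on one cover of \<open>B\<close>, its
decalage \<open>W\<close>, the sum of the slices \<open>B/y\<close>: this is an equivalence relation, its components are the
objects of \<open>B\<close>, and \<open>W\<close> is at once a regular epimorphism and a discrete fibration. That the pullback of
\<open>E\<close> along \<open>W\<close> be bijective on components spells out as fullness and essential surjectivity of \<open>E\<close>, and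
conversely these two properties yield bijectivity on components after pullback along any regular
epimorphism (\<open>class_E'_eq_final\<close>). A discrete fibration over an equivalence relation has no
monodromy, so that it is pulled back from its components; hence a regular epimorphic discrete
fibration becomes trivial on the decalage and belongs to \<open>M*\<close>. Conversely, trivial coverings are
discrete fibrations, and since monadic functors reflect isomorphisms, so is whatever becomes one
after pullback along a monadic extension (\<open>M_star_eq\<close>).

It remains to restrict the comprehensive factorization system to regular epimorphisms: if \<open>M P\<close> is a
regular epimorphism, then so is \<open>M\<close>.\<close>

section \<open>Generalized elements and covers\<close>

lemma Hom_iff [simp]: "f \<in> Hom C a b \<longleftrightarrow> f \<in> Arr C \<and> Dom C f = a \<and> Cod C f = b"
  by (simp add: Hom_def)

definition monic :: "('o, 'a) cat \<Rightarrow> 'a \<Rightarrow> bool" where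
  "monic C m \<longleftrightarrow> (\<forall>a b. a \<in> Arr C \<longrightarrow> b \<in> Arr C \<longrightarrow> Dom C a = Dom C b \<longrightarrow> Cod C a = Dom C m \<longrightarrow>
     Cod C b = Dom C m \<longrightarrow> m \<cdot>\<^bsub>C\<^esub> a = m \<cdot>\<^bsub>C\<^esub> b \<longrightarrow> a = b)"

definition jointly_monic :: "('o, 'a) cat \<Rightarrow> 'a \<Rightarrow> 'a \<Rightarrow> bool" where
  "jointly_monic C m n \<longleftrightarrow> (\<forall>a b. a \<in> Arr C \<longrightarrow> b \<in> Arr C \<longrightarrow> Dom C a = Dom C b \<longrightarrow>
     Cod C a = Dom C m \<longrightarrow> Cod C b = Dom C m \<longrightarrow>
     m \<cdot>\<^bsub>C\<^esub> a = m \<cdot>\<^bsub>C\<^esub> b \<longrightarrow> n \<cdot>\<^bsub>C\<^esub> a = n \<cdot>\<^bsub>C\<^esub> b \<longrightarrow> a = b)"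

definition pbpair :: "('o, 'a) cat \<Rightarrow> 'a \<Rightarrow> 'a \<Rightarrow> 'a \<Rightarrow> 'a \<Rightarrow> 'a" where
  "pbpair C p q u v = (THE w. w \<in> Hom C (Dom C u) (Dom C p) \<and> p \<cdot>\<^bsub>C\<^esub> w = u \<and> q \<cdot>\<^bsub>C\<^esub> w = v)"

text \<open>Relations are handled through an arbitrary span \<open>r1\<close>, \<open>r2\<close> that need not be jointly monic: \<open>x\<close> and
\<open>y\<close> are related when, after passing to a cover, the pair lifts to the apex, which says that it
belongs to the image of the span. So a span can stand for its image.\<close>

definition related :: "('o, 'a) cat \<Rightarrow> 'a \<Rightarrow> 'a \<Rightarrow> 'a \<Rightarrow> 'a \<Rightarrow> bool" where
  "related C r1 r2 x y \<longleftrightarrow> (\<exists>e w. e \<in> regular_epis C \<and> Cod C e = Dom C x \<and>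
     w \<in> Hom C (Dom C e) (Dom C r1) \<and> r1 \<cdot>\<^bsub>C\<^esub> w = x \<cdot>\<^bsub>C\<^esub> e \<and> r2 \<cdot>\<^bsub>C\<^esub> w = y \<cdot>\<^bsub>C\<^esub> e)"

lemma is_pullback_D:
  assumes "is_pullback C f g p q"
  shows "f \<in> Arr C" "g \<in> Arr C" "Cod C g = Cod C f" "p \<in> Arr C" "q \<in> Arr C" "Dom C q = Dom C p"
    "Cod C p = Dom C f" "Cod C q = Dom C g" "f \<cdot>\<^bsub>C\<^esub> p = g \<cdot>\<^bsub>C\<^esub> q"
  using assms unfolding is_pullback_def by auto

lemma is_pullback_unique:
  assumes "is_pullback C f g p q" "u \<in> Arr C" "v \<in> Arr C" "Dom C v = Dom C u"
    "Cod C u = Dom C f" "Cod C v = Dom C g" "f \<cdot>\<^bsub>C\<^esub> u = g \<cdot>\<^bsub>C\<^esub> v"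
  shows "\<exists>!w. w \<in> Hom C (Dom C u) (Dom C p) \<and> p \<cdot>\<^bsub>C\<^esub> w = u \<and> q \<cdot>\<^bsub>C\<^esub> w = v"
  using assms unfolding is_pullback_def by (metis Hom_iff)

lemma pbpair:
  assumes "is_pullback C f g p q" "u \<in> Arr C" "v \<in> Arr C" "Dom C v = Dom C u"
    "Cod C u = Dom C f" "Cod C v = Dom C g" "f \<cdot>\<^bsub>C\<^esub> u = g \<cdot>\<^bsub>C\<^esub> v"
  shows "pbpair C p q u v \<in> Arr C" "Dom C (pbpair C p q u v) = Dom C u"
    "Cod C (pbpair C p q u v) = Dom C p"
    "p \<cdot>\<^bsub>C\<^esub> pbpair C p q u v = u" "q \<cdot>\<^bsub>C\<^esub> pbpair C p q u v = v"
  using theI'[OF is_pullback_unique[OF assms]] unfolding pbpair_def by auto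

lemma pullback_lift:
  assumes "is_pullback C f g p q" "u \<in> Arr C" "v \<in> Arr C" "Dom C v = Dom C u"
    "Cod C u = Dom C f" "Cod C v = Dom C g" "f \<cdot>\<^bsub>C\<^esub> u = g \<cdot>\<^bsub>C\<^esub> v"
  shows "\<exists>w. w \<in> Arr C \<and> Dom C w = Dom C u \<and> Cod C w = Dom C p \<and> p \<cdot>\<^bsub>C\<^esub> w = u \<and> q \<cdot>\<^bsub>C\<^esub> w = v"
  using pbpair[OF assms] by blast

lemma coequalizer_lift:
  assumes "is_coequalizer C u v q" "h \<in> Arr C" "Dom C h = Cod C u" "h \<cdot>\<^bsub>C\<^esub> u = h \<cdot>\<^bsub>C\<^esub> v"
  shows "\<exists>k. k \<in> Arr C \<and> Dom C k = Cod C q \<and> Cod C k = Cod C h \<and> k \<cdot>\<^bsub>C\<^esub> q = h"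
  using assms unfolding is_coequalizer_def by (metis Hom_iff)

lemma regular_epi_arr [simp]: "q \<in> regular_epis C \<Longrightarrow> q \<in> Arr C"
  unfolding regular_epis_def is_coequalizer_def by auto

context category
begin

abbreviation arr where "arr f \<equiv> f \<in> Arr C"
abbreviation dom where "dom \<equiv> Dom C"
abbreviation cod where "cod \<equiv> Cod C"
abbreviation covers where "covers \<equiv> regular_epis C"
abbreviation gpd_comp (infixl "\<bullet>" 70) where "G \<bullet> F \<equiv> G \<cdot>\<^bsub>Gpd C\<^esub> F"

lemma comp_arr [simp]:
  assumes "arr f" "arr g" "dom g = cod f"
  shows "arr (g \<cdot> f)" "dom (g \<cdot> f) = dom f" "cod (g \<cdot> f) = cod g"
  using Comp_Hom[of f "dom f" "cod f" g "cod g"] assms by auto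

lemma comp_assoc [simp]:
  assumes "arr f" "arr g" "arr h" "dom g = cod f" "dom h = cod g"
  shows "(h \<cdot> g) \<cdot> f = h \<cdot> (g \<cdot> f)"
  using Comp_assoc[of f "dom f" "cod f" g "cod g" h "cod h"] assms by auto

lemma idn_arr [simp]:
  assumes "a \<in> Obj C"
  shows "arr (Idn C a)" "dom (Idn C a) = a" "cod (Idn C a) = a"
  using Idn_Hom[OF assms] by auto

lemma comp_idn [simp]: "arr f \<Longrightarrow> dom f = a \<Longrightarrow> f \<cdot> Idn C a = f"
  using Comp_Idn[of f a "cod f"] by auto

lemma idn_comp [simp]: "arr f \<Longrightarrow> cod f = a \<Longrightarrow> Idn C a \<cdot> f = f"
  using Idn_Comp[of f "dom f" a] by auto

declare Dom_Obj [simp] Cod_Obj [simp]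

lemma comp_ext:
  assumes "p \<cdot> u = w" "arr p" "arr u" "dom p = cod u" "arr e" "cod e = dom u"
  shows "p \<cdot> (u \<cdot> e) = w \<cdot> e"
  using assms by (metis comp_assoc)

lemma comp_ext2:
  assumes "p \<cdot> u = q \<cdot> v" "arr p" "arr u" "dom p = cod u"
    "arr q" "arr v" "dom q = cod v" "arr e" "cod e = dom u" "dom v = dom u"
  shows "p \<cdot> (u \<cdot> e) = q \<cdot> (v \<cdot> e)"
  using assms by (metis comp_assoc)

lemma is_pullbackI:
  assumes "arr f" "arr g" "cod f = cod g" "arr p" "arr q" "dom p = dom q"
    "cod p = dom f" "cod q = dom g" "f \<cdot> p = g \<cdot> q"
    and ex: "\<And>u v. \<lbrakk>arr u; arr v; dom u = dom v; cod u = dom f; cod v = dom g;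
       f \<cdot> u = g \<cdot> v\<rbrakk>
       \<Longrightarrow> \<exists>w. arr w \<and> dom w = dom v \<and> cod w = dom q \<and> p \<cdot> w = u \<and> q \<cdot> w = v"
    and jm: "jointly_monic C p q"
  shows "is_pullback C f g p q"
  unfolding is_pullback_def
proof (intro conjI allI ballI impI)
  fix t u v assume "u \<in> Hom C t (dom f)" "v \<in> Hom C t (dom g)" "f \<cdot> u = g \<cdot> v"
  then have *: "arr u" "arr v" "dom u = dom v" "cod u = dom f" "cod v = dom g"
    "f \<cdot> u = g \<cdot> v" and t: "t = dom v" by auto
  from ex[OF *] obtain w where w: "arr w" "dom w = dom v" "cod w = dom q"
    "p \<cdot> w = u" "q \<cdot> w = v" by blast
  show "\<exists>!w. w \<in> Hom C t (dom p) \<and> p \<cdot> w = u \<and> q \<cdot> w = v"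
  proof (rule ex1I[of _ w])
    show "w \<in> Hom C t (dom p) \<and> p \<cdot> w = u \<and> q \<cdot> w = v" using w t assms by simp
  next
    fix w' assume "w' \<in> Hom C t (dom p) \<and> p \<cdot> w' = u \<and> q \<cdot> w' = v"
    then show "w' = w" using w t assms jm unfolding jointly_monic_def by simp
  qed
qed (use assms in auto)

lemma pullback_jointly_monic:
  assumes "is_pullback C f g p q" shows "jointly_monic C p q"
  unfolding jointly_monic_def
proof (intro allI impI)
  note D = is_pullback_D[OF assms]
  fix a b assume *: "arr a" "arr b" "dom a = dom b" "cod a = dom p" "cod b = dom p"
    "p \<cdot> a = p \<cdot> b" "q \<cdot> a = q \<cdot> b"
  have "f \<cdot> (p \<cdot> a) = g \<cdot> (q \<cdot> a)" by (rule comp_ext2[OF D(9)]) (use D * in auto)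
  then have "\<exists>!w. w \<in> Hom C (dom (p \<cdot> a)) (dom p) \<and> p \<cdot> w = p \<cdot> a \<and> q \<cdot> w = q \<cdot> a"
    using is_pullback_unique[OF assms, of "p \<cdot> a" "q \<cdot> a"] D * by simp
  then show "a = b" using * D by auto
qed

lemma jointly_monicD:
  assumes "jointly_monic C m n" "arr a" "arr b" "dom a = dom b"
     "cod a = dom m" "cod b = dom m"
     "m \<cdot> a = m \<cdot> b" "n \<cdot> a = n \<cdot> b"
  shows "a = b"
  using assms unfolding jointly_monic_def by blast

lemmas pullback_eqI = jointly_monicD[OF pullback_jointly_monic]

lemma monicD:
  assumes "monic C m" "arr a" "arr b" "dom a = dom b"
     "cod a = dom m" "cod b = dom m" "m \<cdot> a = m \<cdot> b"
  shows "a = b"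
  using assms unfolding monic_def by blast

lemma pbpair_comp:
  assumes pb: "is_pullback C f g p q" and "arr u" "arr v" "dom v = dom u"
    "cod u = dom f" "cod v = dom g" "f \<cdot> u = g \<cdot> v" "arr e" "cod e = dom u"
  shows "pbpair C p q u v \<cdot> e = pbpair C p q (u \<cdot> e) (v \<cdot> e)"
proof (rule pullback_eqI[OF pb])
  note D = is_pullback_D[OF pb]
  note P = pbpair[OF assms(1-7)]
  have e: "f \<cdot> (u \<cdot> e) = g \<cdot> (v \<cdot> e)" by (rule comp_ext2[OF assms(7)]) (use assms D in auto)
  note P' = pbpair[OF pb, of "u \<cdot> e" "v \<cdot> e"]
  show "arr (pbpair C p q u v \<cdot> e)" using P assms by simp
  show "arr (pbpair C p q (u \<cdot> e) (v \<cdot> e))" using P' e assms D by simp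
  show "dom (pbpair C p q u v \<cdot> e) = dom (pbpair C p q (u \<cdot> e) (v \<cdot> e))" using P P' e assms D by simp
  show "cod (pbpair C p q u v \<cdot> e) = dom p"  using P P' e assms D by simp
  show "cod (pbpair C p q (u \<cdot> e) (v \<cdot> e)) = dom p"  using P P' e assms D by simp
  show "p \<cdot> (pbpair C p q u v \<cdot> e) = p \<cdot> pbpair C p q (u \<cdot> e) (v \<cdot> e)"
    using comp_ext[OF P(4)] P P' e assms D by simp
  show "q \<cdot> (pbpair C p q u v \<cdot> e) = q \<cdot> pbpair C p q (u \<cdot> e) (v \<cdot> e)"
    using comp_ext[OF P(5)] P P' e assms D by simp
qed

lemma pullback_sym:
  assumes "is_pullback C f g p q" shows "is_pullback C g f q p"
proof (rule is_pullbackI)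
  note D = is_pullback_D[OF assms]
  show "jointly_monic C q p"
    using pullback_jointly_monic[OF assms] D unfolding jointly_monic_def by metis
  fix u v assume "arr u" "arr v" "dom u = dom v" "cod u = dom g" "cod v = dom f"
    "g \<cdot> u = f \<cdot> v"
  then show "\<exists>w. arr w \<and> dom w = dom v \<and> cod w = dom p \<and> q \<cdot> w = u \<and> p \<cdot> w = v"
    using pullback_lift[OF assms, of v u] by auto
qed (use is_pullback_D[OF assms] in auto)

lemma regular_epiI: "is_coequalizer C u v q \<Longrightarrow> q \<in> covers"
  unfolding regular_epis_def by blast

lemma regular_epi_epi:
  assumes q: "q \<in> covers" and "arr a" "arr b" "dom a = cod q" "dom b = cod q"
    "a \<cdot> q = b \<cdot> q"
  shows "a = b"
proof -
  obtain u v where c: "is_coequalizer C u v q" using q unfolding regular_epis_def by blast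
  then have D: "arr u" "arr v" "dom u = dom v" "cod u = cod v" "arr q"
    "dom q = cod u" "q \<cdot> u = q \<cdot> v" unfolding is_coequalizer_def by auto
  have "cod a = cod b" using assms D by (metis comp_arr(3))
  moreover have "(a \<cdot> q) \<cdot> u = (a \<cdot> q) \<cdot> v" using D assms by simp
  moreover have "a \<cdot> q \<in> Hom C (cod u) (cod a)" using D assms(2-5) by simp
  ultimately have "\<exists>!k. k \<in> Hom C (cod q) (cod a) \<and> k \<cdot> q = a \<cdot> q"
    using c unfolding is_coequalizer_def by blast
  then show ?thesis using assms \<open>cod a = cod b\<close> by auto
qed

lemma regular_epi_coequalizer_of_kernel_pair:
  assumes q: "q \<in> covers" and pb: "is_pullback C q q a b"
  shows "is_coequalizer C a b q"
proof -
  note D = is_pullback_D[OF pb]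
  obtain u v where c: "is_coequalizer C u v q" using q unfolding regular_epis_def by blast
  then have E: "arr u" "arr v" "dom u = dom v" "cod u = cod v" "arr q"
    "dom q = cod u" "q \<cdot> u = q \<cdot> v" unfolding is_coequalizer_def by auto
  obtain w where w: "arr w" "dom w = dom u" "cod w = dom a" "a \<cdot> w = u" "b \<cdot> w = v"
    using pullback_lift[OF pb E(1,2)] D E by metis
  show ?thesis unfolding is_coequalizer_def
  proof (intro conjI allI ballI impI)
    fix z h assume h: "h \<in> Hom C (cod a) z" and eq: "h \<cdot> a = h \<cdot> b"
    have "h \<cdot> (a \<cdot> w) = h \<cdot> (b \<cdot> w)"
      by (rule comp_ext2[OF eq]) (use w h D in auto)
    then have "h \<cdot> u = h \<cdot> v" using w by simp
    moreover have "h \<in> Hom C (cod u) z" using h D E by simp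
    ultimately show "\<exists>!k. k \<in> Hom C (cod q) z \<and> k \<cdot> q = h"
      using c unfolding is_coequalizer_def by blast
  qed (use D in auto)
qed

lemma idn_regular_epi: assumes "a \<in> Obj C" shows "Idn C a \<in> covers"
proof (rule regular_epiI)
  show "is_coequalizer C (Idn C a) (Idn C a) (Idn C a)"
    unfolding is_coequalizer_def using assms by (auto intro!: ex1I)
qed

lemma is_isoI:
  assumes "arr f" "arr g" "dom g = cod f" "cod g = dom f"
    "g \<cdot> f = Idn C (dom f)" "f \<cdot> g = Idn C (cod f)"
  shows "is_iso C f"
  using assms unfolding is_iso_def by auto

lemma is_isoE:
  assumes "is_iso C f"
  obtains g where "arr f" "arr g" "dom g = cod f" "cod g = dom f"
    "g \<cdot> f = Idn C (dom f)" "f \<cdot> g = Idn C (cod f)"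
  using assms unfolding is_iso_def by auto

lemma iso_regular_epi: assumes "is_iso C f" shows "f \<in> covers"
proof -
  obtain g where g: "arr f" "arr g" "dom g = cod f" "cod g = dom f"
    "g \<cdot> f = Idn C (dom f)" "f \<cdot> g = Idn C (cod f)" using assms by (rule is_isoE)
  have "is_coequalizer C (Idn C (dom f)) (Idn C (dom f)) f" unfolding is_coequalizer_def
  proof (intro conjI allI ballI impI)
    fix z h assume h: "h \<in> Hom C (cod (Idn C (dom f))) z"
    show "\<exists>!k. k \<in> Hom C (cod f) z \<and> k \<cdot> f = h"
    proof (rule ex1I[of _ "h \<cdot> g"])
      show "h \<cdot> g \<in> Hom C (cod f) z \<and> h \<cdot> g \<cdot> f = h" using g h by simp
      fix k assume k: "k \<in> Hom C (cod f) z \<and> k \<cdot> f = h"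
      then have "h \<cdot> g = (k \<cdot> f) \<cdot> g" by simp
      also have "\<dots> = k \<cdot> (f \<cdot> g)" using g k by (intro comp_assoc) auto
      also have "\<dots> = k" using g k by simp
      finally show "k = h \<cdot> g" by simp
    qed
  qed (use g in auto)
  then show ?thesis by (rule regular_epiI)
qed

lemma iso_comp_regular_epi:
  assumes e: "e \<in> covers" and i: "is_iso C m" and dm: "dom m = cod e"
  shows "m \<cdot> e \<in> covers"
proof -
  obtain u v where c: "is_coequalizer C u v e" using e unfolding regular_epis_def by blast
  then have E: "arr u" "arr v" "dom u = dom v" "cod u = cod v"
    "arr e" "dom e = cod u" "e \<cdot> u = e \<cdot> v" unfolding is_coequalizer_def by auto
  obtain n where n: "arr m" "arr n" "dom n = cod m" "cod n = dom m"
    "n \<cdot> m = Idn C (dom m)" "m \<cdot> n = Idn C (cod m)" using i by (rule is_isoE)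
  have "is_coequalizer C u v (m \<cdot> e)" unfolding is_coequalizer_def
  proof (intro conjI allI ballI impI)
    fix z h assume h: "h \<in> Hom C (cod u) z" and eq: "h \<cdot> u = h \<cdot> v"
    have ex: "\<exists>!k. k \<in> Hom C (cod e) z \<and> k \<cdot> e = h"
      using c h eq unfolding is_coequalizer_def by blast
    then obtain k where k: "k \<in> Hom C (cod e) z" "k \<cdot> e = h" by blast
    show "\<exists>!k. k \<in> Hom C (cod (m \<cdot> e)) z \<and> k \<cdot> (m \<cdot> e) = h"
    proof (rule ex1I[of _ "k \<cdot> n"])
      have "n \<cdot> (m \<cdot> e) = e" using comp_ext[OF n(5), of e] n dm E by simp
      then show "k \<cdot> n \<in> Hom C (cod (m \<cdot> e)) z \<and> k \<cdot> n \<cdot> (m \<cdot> e) = h"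
        using k n dm E by simp
      fix k' assume k': "k' \<in> Hom C (cod (m \<cdot> e)) z \<and> k' \<cdot> (m \<cdot> e) = h"
      then have "(k' \<cdot> m) \<cdot> e = h" "k' \<cdot> m \<in> Hom C (cod e) z" using n dm E by auto
      then have "k' \<cdot> m = k" using ex k by blast
      then show "k' = k \<cdot> n" using k' n dm E by auto
    qed
  qed (use E n dm in auto)
  then show ?thesis by (rule regular_epiI)
qed

lemma monic_split_iso:
  assumes m: "monic C m" "arr m" and s: "arr s" "dom s = cod m" "cod s = dom m"
    "m \<cdot> s = Idn C (cod m)"
  shows "is_iso C m"
proof (rule is_isoI[OF m(2) s(1-3) _ s(4)])
  show "s \<cdot> m = Idn C (dom m)"
    by (rule monicD[OF m(1)]) (use m s comp_ext[OF s(4)] in simp_all)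
qed

end

locale regular_cat =
  fixes C :: "('o, 'a) cat" (structure)
  assumes regular: "regular_category C"
begin

sublocale category C using regular unfolding regular_category_def by simp

lemma finite_limits: "has_finite_limits C" using regular unfolding regular_category_def by simp

lemma pullback_exists:
  assumes "arr f" "arr g" "cod f = cod g"
  obtains p q where "is_pullback C f g p q"
  using finite_limits assms unfolding has_finite_limits_def by blast

lemma regular_epi_stable: "is_pullback C f g p q \<Longrightarrow> f \<in> covers \<Longrightarrow> q \<in> covers"
  using regular unfolding regular_category_def by blast

lemma product_exists:
  assumes "a \<in> Obj C" "b \<in> Obj C"
  obtains p q where "arr p" "arr q" "dom p = dom q" "cod p = a" "cod q = b"
    "jointly_monic C p q"
    "\<And>u v. \<lbrakk>arr u; arr v; dom u = dom v; cod u = a; cod v = b\<rbrakk>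
       \<Longrightarrow> \<exists>w. arr w \<and> dom w = dom u \<and> cod w = dom p \<and> p \<cdot> w = u \<and> q \<cdot> w = v"
proof -
  obtain t where t: "t \<in> Obj C" "\<And>a. a \<in> Obj C \<Longrightarrow> \<exists>!f. f \<in> Hom C a t"
    using finite_limits unfolding has_finite_limits_def is_terminal_def by blast
  obtain f g where f: "f \<in> Hom C a t" and g: "g \<in> Hom C b t" using t assms by blast
  obtain p q where pb: "is_pullback C f g p q" using f g by (auto intro: pullback_exists)
  note D = is_pullback_D[OF pb]
  show ?thesis
  proof (rule that[of p q])
    fix u v assume uv: "arr u" "arr v" "dom u = dom v" "cod u = a" "cod v = b"
    have "f \<cdot> u \<in> Hom C (dom u) t" "g \<cdot> v \<in> Hom C (dom u) t" using uv f g by auto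
    moreover have "dom u \<in> Obj C" using uv by simp
    ultimately have "f \<cdot> u = g \<cdot> v" using t(2) by blast
    then show "\<exists>w. arr w \<and> dom w = dom u \<and> cod w = dom p \<and> p \<cdot> w = u \<and> q \<cdot> w = v"
      using pullback_lift[OF pb, of u v] uv f g by auto
  qed (use D f g pullback_jointly_monic[OF pb] in auto)
qed

text \<open>Regular epimorphisms are locally surjective: pulled back along a generalized element, they become
the cover on which that element lifts. All existence arguments below are of this form, followed by
a descent step through uniqueness.\<close>

lemma cover_lift:
  assumes "q \<in> covers" "arr u" "cod u = cod q"
  obtains e a where "e \<in> covers" "arr e" "cod e = dom u" "arr a" "dom a = dom e"
    "cod a = dom q" "q \<cdot> a = u \<cdot> e"
proof -
  obtain p r where pb: "is_pullback C q u p r" using assms pullback_exists regular_epi_arr by metis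
  note D = is_pullback_D[OF pb]
  show ?thesis by (rule that[of r p]) (use regular_epi_stable[OF pb] D assms in auto)
qed

lemma kernel_pair_exists:
  assumes "arr q" obtains a b where "is_pullback C q q a b"
  using assms pullback_exists by blast

text \<open>Descent: an arrow defined on a cover descends as soon as it identifies whatever the cover
identifies. This is how arrows out of a quotient are defined from their effect on generalized
elements.\<close>

lemma glue:
  assumes q: "q \<in> covers" and h: "arr h" "dom h = dom q"
    and w: "\<And>a b. \<lbrakk>arr a; arr b; dom a = dom b; cod a = dom q; cod b = dom q;
       q \<cdot> a = q \<cdot> b\<rbrakk> \<Longrightarrow> h \<cdot> a = h \<cdot> b"
  obtains k where "arr k" "dom k = cod q" "cod k = cod h" "k \<cdot> q = h"
proof -
  obtain a b where pb: "is_pullback C q q a b" using q kernel_pair_exists regular_epi_arr by metis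
  note D = is_pullback_D[OF pb]
  have "h \<cdot> a = h \<cdot> b" by (rule w) (use D in auto)
  then show ?thesis
    using coequalizer_lift[OF regular_epi_coequalizer_of_kernel_pair[OF q pb], of h] that D h by auto
qed

lemma image_exists:
  assumes f: "arr f"
  obtains e m where "e \<in> covers" "dom e = dom f" "arr m" "dom m = cod e"
    "cod m = cod f" "m \<cdot> e = f" "monic C m"
proof -
  obtain p q where pb: "is_pullback C f f p q" using f kernel_pair_exists by blast
  note D = is_pullback_D[OF pb]
  obtain e where ce: "is_coequalizer C p q e"
    using regular pb unfolding regular_category_def by blast
  then have e: "e \<in> covers" by (rule regular_epiI)
  have de: "dom e = dom f" "e \<cdot> p = e \<cdot> q" using ce D unfolding is_coequalizer_def by auto
  obtain m where m: "arr m" "dom m = cod e" "cod m = cod f" "m \<cdot> e = f"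
    using coequalizer_lift[OF ce, of f] D f by auto
  have "monic C m" unfolding monic_def
  proof (intro allI impI)
    fix a b assume ab: "arr a" "arr b" "dom a = dom b" "cod a = dom m"
      "cod b = dom m" "m \<cdot> a = m \<cdot> b"
    obtain e1 x where x: "e1 \<in> covers" "arr e1" "cod e1 = dom a" "arr x"
      "dom x = dom e1" "cod x = dom e" "e \<cdot> x = a \<cdot> e1"
      using cover_lift[OF e, of a] ab m by auto
    obtain e2 y where y: "e2 \<in> covers" "arr e2" "cod e2 = dom e1" "arr y"
      "dom y = dom e2" "cod y = dom e" "e \<cdot> y = (b \<cdot> e1) \<cdot> e2"
      using cover_lift[OF e, of "b \<cdot> e1"] ab m x by auto
    have "f \<cdot> (x \<cdot> e2) = m \<cdot> (e \<cdot> (x \<cdot> e2))" using comp_ext[OF m(4), of "x \<cdot> e2"] m x y e de by simp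
    also have "\<dots> = m \<cdot> (a \<cdot> (e1 \<cdot> e2))" using comp_ext[OF x(7), of e2] m x y e de ab by simp
    also have "\<dots> = m \<cdot> (b \<cdot> (e1 \<cdot> e2))" by (rule comp_ext2[OF ab(6)]) (use m x y ab in auto)
    also have "\<dots> = m \<cdot> (e \<cdot> y)" using m x y e de ab by simp
    also have "\<dots> = f \<cdot> y"  using comp_ext[OF m(4), of y] m x y e de by simp
    finally have fe: "f \<cdot> (x \<cdot> e2) = f \<cdot> y" .
    obtain w where w: "arr w" "dom w = dom y" "cod w = dom p" "p \<cdot> w = x \<cdot> e2" "q \<cdot> w = y"
      using pullback_lift[OF pb, of "x \<cdot> e2" y] fe x y e de by auto
    have "e \<cdot> (p \<cdot> w) = e \<cdot> (q \<cdot> w)" by (rule comp_ext2[OF de(2)]) (use w D e de in auto)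
    then have "(a \<cdot> e1) \<cdot> e2 = (b \<cdot> e1) \<cdot> e2" using w x y ab m comp_ext[OF x(7), of e2] e by simp
    then have "a \<cdot> e1 = b \<cdot> e1" using regular_epi_epi[OF y(1), of "a \<cdot> e1" "b \<cdot> e1"] x y ab by simp
    then show "a = b" using regular_epi_epi[OF x(1)] x ab by simp
  qed
  then show ?thesis using that e de m by blast
qed

lemma regular_epi_cancel:
  assumes r: "f \<cdot> g \<in> covers" and f: "arr f" and g: "arr g" "dom f = cod g"
  shows "f \<in> covers"
proof -
  obtain e m where m: "e \<in> covers" "dom e = dom f" "arr m" "dom m = cod e"
    "cod m = cod f" "m \<cdot> e = f" "monic C m" using image_exists[OF f] by blast
  have fg: "f \<cdot> g = m \<cdot> (e \<cdot> g)" using comp_ext[OF m(6), of g] m g by simp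
  obtain k where k: "arr k" "dom k = cod f" "cod k = cod e" "k \<cdot> (f \<cdot> g) = e \<cdot> g"
  proof (rule glue[OF r, of "e \<cdot> g"])
    fix a b assume ab: "arr a" "arr b" "dom a = dom b" "cod a = dom (f \<cdot> g)"
      "cod b = dom (f \<cdot> g)" "f \<cdot> g \<cdot> a = f \<cdot> g \<cdot> b"
    then have "m \<cdot> (e \<cdot> g \<cdot> a) = m \<cdot> (e \<cdot> g \<cdot> b)" using fg m g f by simp
    then show "e \<cdot> g \<cdot> a = e \<cdot> g \<cdot> b" using monicD[OF m(7), of "e \<cdot> g \<cdot> a" "e \<cdot> g \<cdot> b"] m g f ab by simp
  qed (use m f g in auto)
  have "m \<cdot> k = Idn C (cod m)"
  proof (rule regular_epi_epi[OF r])
    show "m \<cdot> k \<cdot> (f \<cdot> g) = Idn C (cod m) \<cdot> (f \<cdot> g)" using k m f g fg by simp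
  qed (use k m f g in auto)
  then have i: "is_iso C m" using monic_split_iso[OF m(7,3), of k] k m by simp
  show ?thesis using iso_comp_regular_epi[OF m(1) i m(4)] m(6) by simp
qed

lemma regular_epi_comp:
  assumes f: "f \<in> covers" and g: "g \<in> covers" "dom g = cod f"
  shows "g \<cdot> f \<in> covers"
proof -
  have fg: "arr f" "arr g" using f g by auto
  then have gf: "arr (g \<cdot> f)" using g by simp
  obtain e m where m: "e \<in> covers" "dom e = dom (g \<cdot> f)" "arr m" "dom m = cod e"
    "cod m = cod (g \<cdot> f)" "m \<cdot> e = g \<cdot> f" "monic C m" using image_exists[OF gf] by blast
  have ea: "arr e" using m by simp
  obtain k where k: "arr k" "dom k = cod f" "cod k = cod e" "k \<cdot> f = e"
  proof (rule glue[OF f, of e])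
    fix a b assume ab: "arr a" "arr b" "dom a = dom b" "cod a = dom f"
      "cod b = dom f" "f \<cdot> a = f \<cdot> b"
    then have "m \<cdot> (e \<cdot> a) = m \<cdot> (e \<cdot> b)" using comp_ext[OF m(6), of a] comp_ext[OF m(6), of b] m g fg ea by simp
    then show "e \<cdot> a = e \<cdot> b" using monicD[OF m(7), of "e \<cdot> a" "e \<cdot> b"] m g fg ab ea by simp
  qed (use m fg g in auto)
  have mk: "m \<cdot> k = g"
    by (rule regular_epi_epi[OF f]) (use m k fg g in auto)
  obtain l where l: "arr l" "dom l = cod g" "cod l = cod e" "l \<cdot> g = k"
  proof (rule glue[OF g(1), of k])
    fix a b assume ab: "arr a" "arr b" "dom a = dom b" "cod a = dom g"
      "cod b = dom g" "g \<cdot> a = g \<cdot> b"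
    then have "m \<cdot> (k \<cdot> a) = m \<cdot> (k \<cdot> b)" using comp_ext[OF mk] m g fg ea k by simp
    then show "k \<cdot> a = k \<cdot> b" using monicD[OF m(7), of "k \<cdot> a" "k \<cdot> b"] m g fg ab ea k by simp
  qed (use m fg g k in auto)
  have "m \<cdot> l = Idn C (cod m)"
    by (rule regular_epi_epi[OF g(1)]) (use m k l fg g mk in auto)
  then have "is_iso C m" using monic_split_iso[OF m(7,3), of l] l m g fg by simp
  then show ?thesis using iso_comp_regular_epi[OF m(1) _ m(4)] m(6) by simp
qed

end

section \<open>Relations in an exact Mal'tsev category\<close>

context regular_cat
begin

lemma relatedI:
  assumes "e \<in> covers" "cod e = dom x" "arr w" "dom w = dom e" "cod w = dom r1"
    "r1 \<cdot> w = x \<cdot> e" "r2 \<cdot> w = y \<cdot> e"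
  shows "related C r1 r2 x y"
  unfolding related_def using assms by auto

lemma relatedE:
  assumes "related C r1 r2 x y"
  obtains e w where "e \<in> covers" "arr e" "cod e = dom x" "arr w" "dom w = dom e"
    "cod w = dom r1" "r1 \<cdot> w = x \<cdot> e" "r2 \<cdot> w = y \<cdot> e"
  using assms unfolding related_def by auto

lemma related_global:
  assumes "arr w" "dom w = dom x" "cod w = dom r1" "r1 \<cdot> w = x" "r2 \<cdot> w = y"
    "arr x" "arr y" "dom y = dom x"
  shows "related C r1 r2 x y"
  by (rule relatedI[of "Idn C (dom x)" _ w]) (use assms in \<open>auto simp: idn_regular_epi\<close>)

lemma related_local:
  assumes e: "e \<in> covers" "cod e = dom x" and r: "related C r1 r2 (x \<cdot> e) (y \<cdot> e)"
    and t: "arr x" "arr y" "dom y = dom x"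
  shows "related C r1 r2 x y"
proof -
  have ea: "arr e" using e by simp
  obtain e' w where w: "e' \<in> covers" "arr e'" "cod e' = dom (x \<cdot> e)" "arr w"
    "dom w = dom e'" "cod w = dom r1" "r1 \<cdot> w = (x \<cdot> e) \<cdot> e'" "r2 \<cdot> w = (y \<cdot> e) \<cdot> e'"
    using r by (rule relatedE)
  show ?thesis
    by (rule relatedI[of "e \<cdot> e'" _ w]) (use w e t ea regular_epi_comp in auto)
qed

lemma related_eq:
  assumes r: "related C r1 r2 x y" and h: "h \<cdot> r1 = h \<cdot> r2"
    and t: "arr x" "arr y" "dom y = dom x" "cod x = cod r1" "cod y = cod r1"
     "arr r1" "arr r2" "dom r2 = dom r1" "cod r2 = cod r1" "arr h" "dom h = cod r1"
  shows "h \<cdot> x = h \<cdot> y"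
proof -
  obtain e w where w: "e \<in> covers" "arr e" "cod e = dom x" "arr w" "dom w = dom e"
    "cod w = dom r1" "r1 \<cdot> w = x \<cdot> e" "r2 \<cdot> w = y \<cdot> e" using r by (rule relatedE)
  have "h \<cdot> (r1 \<cdot> w) = h \<cdot> (r2 \<cdot> w)" by (rule comp_ext2[OF h]) (use t w in auto)
  then have "(h \<cdot> x) \<cdot> e = (h \<cdot> y) \<cdot> e" using w t by simp
  then show ?thesis by (rule regular_epi_epi[OF w(1), rotated 4]) (use w t in auto)
qed

text \<open>The regular epi-mono factorization of the induced arrow into the product; it turns a span into an
honest internal relation, to which the exactness and Mal'tsev axioms apply.\<close>

lemma joint_image_exists:
  assumes r: "arr r1" "arr r2" "dom r2 = dom r1"
  obtains e m1 m2 where "e \<in> covers" "arr e" "dom e = dom r1" "arr m1" "arr m2"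
    "dom m1 = cod e" "dom m2 = cod e" "cod m1 = cod r1" "cod m2 = cod r2"
    "m1 \<cdot> e = r1" "m2 \<cdot> e = r2" "jointly_monic C m1 m2"
proof -
  obtain p q where pq: "arr p" "arr q" "dom p = dom q" "cod p = cod r1" "cod q = cod r2"
    "jointly_monic C p q" and
    ex: "\<And>u v. \<lbrakk>arr u; arr v; dom u = dom v; cod u = cod r1;
       cod v = cod r2\<rbrakk>
       \<Longrightarrow> \<exists>w. arr w \<and> dom w = dom u \<and> cod w = dom p \<and> p \<cdot> w = u \<and> q \<cdot> w = v"
    using product_exists[of "cod r1" "cod r2"] Cod_Obj r(1,2) by metis
  obtain w where w: "arr w" "dom w = dom r1" "cod w = dom p" "p \<cdot> w = r1" "q \<cdot> w = r2"
    using ex[OF r(1,2)] r by auto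
  obtain e m where m: "e \<in> covers" "dom e = dom w" "arr m" "dom m = cod e"
    "cod m = cod w" "m \<cdot> e = w" "monic C m" using image_exists[OF w(1)] by blast
  have e: "arr e" using m by simp
  show ?thesis
  proof (rule that[of e "p \<cdot> m" "q \<cdot> m"])
    show "jointly_monic C (p \<cdot> m) (q \<cdot> m)" unfolding jointly_monic_def
    proof (intro allI impI)
      fix a b assume ab: "arr a" "arr b" "dom a = dom b" "cod a = dom (p \<cdot> m)"
       "cod b = dom (p \<cdot> m)" "p \<cdot> m \<cdot> a = p \<cdot> m \<cdot> b" "q \<cdot> m \<cdot> a = q \<cdot> m \<cdot> b"
      have "m \<cdot> a = m \<cdot> b" by (rule jointly_monicD[OF pq(6)]) (use ab m pq w in auto)
      then show "a = b" by (rule monicD[OF m(7), rotated 5]) (use ab m pq w in auto)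
    qed
  qed (use e m pq w in auto)
qed

text \<open>On a jointly monic pair no cover is needed: the local lifts agree on overlaps because they are
unique, and so they glue.\<close>

lemma related_joint_image:
  assumes r: "arr r1" "arr r2" "dom r2 = dom r1"
    and e: "e \<in> covers" "dom e = dom r1" "arr m1" "arr m2"
    "dom m1 = cod e" "dom m2 = cod e"  "m1 \<cdot> e = r1" "m2 \<cdot> e = r2" "jointly_monic C m1 m2"
    and t: "arr x" "arr y" "dom y = dom x" "cod x = cod r1" "cod y = cod r2"
  shows "related C r1 r2 x y \<longleftrightarrow>
    (\<exists>i. arr i \<and> dom i = dom x \<and> cod i = cod e \<and> m1 \<cdot> i = x \<and> m2 \<cdot> i = y)"
proof
  have ea: "arr e" using e by simp
  have cd: "cod r1 = cod m1" "cod r2 = cod m2" using e ea comp_arr(3) by metis+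
  {
    assume "related C r1 r2 x y"
    then obtain e1 w where w: "e1 \<in> covers" "arr e1" "cod e1 = dom x" "arr w"
      "dom w = dom e1" "cod w = dom r1" "r1 \<cdot> w = x \<cdot> e1" "r2 \<cdot> w = y \<cdot> e1" by (rule relatedE)
    define j where "j = e \<cdot> w"
    have j: "arr j" "dom j = dom e1" "cod j = cod e" "m1 \<cdot> j = x \<cdot> e1" "m2 \<cdot> j = y \<cdot> e1"
      using w e ea r comp_ext[OF e(7), of w] comp_ext[OF e(8), of w] unfolding j_def by auto
    obtain i where i: "arr i" "dom i = cod e1" "cod i = cod j" "i \<cdot> e1 = j"
    proof (rule glue[OF w(1), of j])
      fix a b assume ab: "arr a" "arr b" "dom a = dom b" "cod a = dom e1"
        "cod b = dom e1" "e1 \<cdot> a = e1 \<cdot> b"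
      have "m1 \<cdot> (j \<cdot> a) = m1 \<cdot> (j \<cdot> b)"
        using comp_ext[OF j(4), of a] comp_ext[OF j(4), of b] ab j e ea t w by simp
      moreover have "m2 \<cdot> (j \<cdot> a) = m2 \<cdot> (j \<cdot> b)"
        using comp_ext[OF j(5), of a] comp_ext[OF j(5), of b] ab j e ea t w by simp
      ultimately show "j \<cdot> a = j \<cdot> b"
        using jointly_monicD[OF e(9), of "j \<cdot> a" "j \<cdot> b"] ab j e by simp
    qed (use j in auto)
    have "m1 \<cdot> i = x" by (rule regular_epi_epi[OF w(1)]) (use i j e t w in auto)
    moreover have "m2 \<cdot> i = y" by (rule regular_epi_epi[OF w(1)]) (use i j e t w in auto)
    ultimately show "\<exists>i. arr i \<and> dom i = dom x \<and> cod i = cod e \<and> m1 \<cdot> i = x \<and> m2 \<cdot> i = y"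
      using i j w by auto
  next
    assume "\<exists>i. arr i \<and> dom i = dom x \<and> cod i = cod e \<and> m1 \<cdot> i = x \<and> m2 \<cdot> i = y"
    then obtain i where i: "arr i" "dom i = dom x" "cod i = cod e" "m1 \<cdot> i = x" "m2 \<cdot> i = y"
      by blast
    obtain e1 w where w: "e1 \<in> covers" "arr e1" "cod e1 = dom i" "arr w"
      "dom w = dom e1" "cod w = dom e" "e \<cdot> w = i \<cdot> e1" using cover_lift[OF e(1) i(1)] i by metis
    show "related C r1 r2 x y"
    proof (rule relatedI[of e1 _ w])
      have "m1 \<cdot> (e \<cdot> w) = x \<cdot> e1" using comp_ext[OF i(4), of e1] i w e by simp
      then show "r1 \<cdot> w = x \<cdot> e1" using comp_ext[OF e(7), of w] w e ea by simp
      have "m2 \<cdot> (e \<cdot> w) = y \<cdot> e1" using comp_ext[OF i(5), of e1] i w e by simp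
      then show "r2 \<cdot> w = y \<cdot> e1" using comp_ext[OF e(8), of w] w e ea by simp
    qed (use w e i in auto)
  }
qed

end

locale exact_maltsev =
  fixes C :: "('o, 'a) cat" (structure)
  assumes exact: "exact_category C" and maltsev: "maltsev_category C"
begin

sublocale regular_cat C using exact unfolding exact_category_def by unfold_locales simp

text \<open>The image of a span that is locally reflexive is a reflexive relation, hence an equivalence
relation by the Mal'tsev axiom, hence a kernel pair by exactness. So the coequalizer of the span
identifies exactly the related pairs. Every quotient below is formed in this way, and only
reflexivity ever has to be verified.\<close>

lemma effective_quotient:
  assumes r: "arr r1" "arr r2" "dom r2 = dom r1" "cod r1 = X" "cod r2 = X"
    and refl: "\<And>x. arr x \<Longrightarrow> cod x = X \<Longrightarrow> related C r1 r2 x x"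
  obtains q where "is_coequalizer C r1 r2 q"
    "\<And>x y. \<lbrakk>arr x; arr y; dom x = dom y; cod x = X; cod y = X\<rbrakk>
       \<Longrightarrow> q \<cdot> x = q \<cdot> y \<longleftrightarrow> related C r1 r2 x y"
proof -
  obtain e m1 m2 where e: "e \<in> covers" "arr e" "dom e = dom r1" "arr m1" "arr m2"
    "dom m1 = cod e" "dom m2 = cod e" "cod m1 = cod r1" "cod m2 = cod r2"
    "m1 \<cdot> e = r1" "m2 \<cdot> e = r2" "jointly_monic C m1 m2" using joint_image_exists[OF r(1-3)] by metis
  have X: "X \<in> Obj C" using r by auto
  have rel: "is_relation C m1 m2"
    using e r unfolding is_relation_def jointly_monic_def by auto
  have im: "related C r1 r2 x y \<longleftrightarrow>
    (\<exists>i. arr i \<and> dom i = dom x \<and> cod i = cod e \<and> m1 \<cdot> i = x \<and> m2 \<cdot> i = y)"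
    if "arr x" "arr y" "dom x = dom y" "cod x = X" "cod y = X" for x y
    by (rule related_joint_image[OF r(1-3) e(1,3-7,10-12)]) (use that r in auto)
  have "\<exists>i. arr i \<and> dom i = X \<and> cod i = cod e \<and> m1 \<cdot> i = Idn C X \<and> m2 \<cdot> i = Idn C X"
    using im[of "Idn C X" "Idn C X"] refl[of "Idn C X"] X by auto
  then have "is_reflexive_relation C m1 m2"
    unfolding is_reflexive_relation_def using rel e r by auto
  then have "is_equivalence_relation C m1 m2" using maltsev unfolding maltsev_category_def by blast
  then obtain f where f: "is_pullback C f f m1 m2" using exact unfolding exact_category_def by blast
  note D = is_pullback_D[OF f]
  obtain q n where q: "q \<in> covers" "dom q = dom f" "arr n" "dom n = cod q"
    "cod n = cod f" "n \<cdot> q = f" "monic C n" using image_exists[OF D(1)] by metis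
  have qa: "arr q" using q by simp
  have dq: "dom q = X" using q D e r by simp
  have qiff: "q \<cdot> x = q \<cdot> y \<longleftrightarrow> related C r1 r2 x y"
    if t: "arr x" "arr y" "dom x = dom y" "cod x = X" "cod y = X" for x y
  proof
    assume "q \<cdot> x = q \<cdot> y"
    then have "f \<cdot> x = f \<cdot> y"
      using comp_ext[OF q(6), of x] comp_ext[OF q(6), of y] t q qa dq by simp
    then have "\<exists>w. arr w \<and> dom w = dom x \<and> cod w = dom m1 \<and> m1 \<cdot> w = x \<and> m2 \<cdot> w = y"
      by (intro pullback_lift[OF f]) (use t D e r in auto)
    then show "related C r1 r2 x y" using im[OF t] e by simp
  next
    assume "related C r1 r2 x y"
    then obtain i where i: "arr i" "dom i = dom x" "cod i = cod e" "m1 \<cdot> i = x" "m2 \<cdot> i = y"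
      using im[OF t] by auto
    have "f \<cdot> (m1 \<cdot> i) = f \<cdot> (m2 \<cdot> i)" by (rule comp_ext2[OF D(9)]) (use i D e in auto)
    then have "n \<cdot> (q \<cdot> x) = n \<cdot> (q \<cdot> y)"
      using i comp_ext[OF q(6), of x] comp_ext[OF q(6), of y] t q qa dq by simp
    then show "q \<cdot> x = q \<cdot> y" by (rule monicD[OF q(7), rotated 5]) (use t q qa dq in auto)
  qed
  have "is_coequalizer C r1 r2 q" unfolding is_coequalizer_def
  proof (intro conjI allI ballI impI)
    have "related C r1 r2 r1 r2"
      by (rule related_global[of "Idn C (dom r1)"]) (use r in auto)
    then show "q \<cdot> r1 = q \<cdot> r2" using qiff[of r1 r2] r by simp
    fix z h assume h: "h \<in> Hom C (cod r1) z" and eq: "h \<cdot> r1 = h \<cdot> r2"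
    obtain k where k: "arr k" "dom k = cod q" "cod k = cod h" "k \<cdot> q = h"
    proof (rule glue[OF q(1), of h])
      fix a b assume ab: "arr a" "arr b" "dom a = dom b" "cod a = dom q"
        "cod b = dom q" "q \<cdot> a = q \<cdot> b"
      then have "related C r1 r2 a b" using qiff[of a b] dq by simp
      then show "h \<cdot> a = h \<cdot> b" by (rule related_eq[OF _ eq]) (use ab h r dq in auto)
    qed (use h r dq in auto)
    show "\<exists>!k. k \<in> Hom C (cod q) z \<and> k \<cdot> q = h"
    proof (rule ex1I[of _ k])
      fix k' assume k': "k' \<in> Hom C (cod q) z \<and> k' \<cdot> q = h"
      show "k' = k" by (rule regular_epi_epi[OF q(1)]) (use k k' in auto)
    qed (use k h in auto)
  qed (use r dq qa in auto)
  then show ?thesis using that qiff by blast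
qed

text \<open>Relations in a Mal'tsev category are difunctional, by the classical argument: on the object \<open>I\<close> of
the relation, the relation ``the first component of \<open>i\<close> is related to the second component of \<open>k\<close>''
is reflexive, and its transitivity is difunctionality of the original relation.\<close>

lemma related_difunctional:
  assumes r: "arr r1" "arr r2" "dom r2 = dom r1"
    and xs: "arr x" "arr x'" "dom x = t" "dom x' = t" "cod x = cod r1" "cod x' = cod r1"
    and ys: "arr y" "arr y'" "dom y = t" "dom y' = t" "cod y = cod r2" "cod y' = cod r2"
    and R: "related C r1 r2 x y" "related C r1 r2 x' y" "related C r1 r2 x' y'"
  shows "related C r1 r2 x y'"
proof -
  obtain e m1 m2 where e: "e \<in> covers" "arr e" "dom e = dom r1" "arr m1" "arr m2"
    "dom m1 = cod e" "dom m2 = cod e" "cod m1 = cod r1" "cod m2 = cod r2"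
    "m1 \<cdot> e = r1" "m2 \<cdot> e = r2" "jointly_monic C m1 m2" using joint_image_exists[OF r(1-3)] by metis
  define I where "I = cod e"
  have I: "I \<in> Obj C" "dom m1 = I" "dom m2 = I" using e unfolding I_def by auto
  have im: "related C r1 r2 x y \<longleftrightarrow>
    (\<exists>i. arr i \<and> dom i = t \<and> cod i = I \<and> m1 \<cdot> i = x \<and> m2 \<cdot> i = y)"
    if "arr x" "arr y" "dom x = t" "dom y = t" "cod x = cod r1" "cod y = cod r2" for x y t
    using related_joint_image[OF r(1-3) e(1,3-7,10-12), of x y] that unfolding I_def by simp
  \<comment> \<open>the relation S on the object I of the relation: (x, y) S (x', y') if x is related to y'\<close>
  obtain a1 b1 where pb1: "is_pullback C m1 m1 a1 b1" using e kernel_pair_exists by metis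
  note D1 = is_pullback_D[OF pb1]
  obtain a2 b2 where pb2: "is_pullback C (m2 \<cdot> b1) m2 a2 b2"
    using pullback_exists[of "m2 \<cdot> b1" m2] D1 e by auto
  note D2 = is_pullback_D[OF pb2]
  define s1 s2 where "s1 = a1 \<cdot> a2" and "s2 = b2"
  have s: "arr s1" "arr s2" "dom s1 = dom a2" "dom s2 = dom a2" "cod s1 = I" "cod s2 = I"
    using D1 D2 e I unfolding s1_def s2_def by auto
  have S_intro: "\<exists>l. arr l \<and> dom l = t \<and> cod l = dom a2 \<and> s1 \<cdot> l = i \<and> s2 \<cdot> l = k"
    if i: "arr i" "dom i = t" "cod i = I" and j: "arr j" "dom j = t" "cod j = I"
      and k: "arr k" "dom k = t" "cod k = I" and eq: "m1 \<cdot> i = m1 \<cdot> j" "m2 \<cdot> j = m2 \<cdot> k" for i j k t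
  proof -
    obtain v where v: "arr v" "dom v = t" "cod v = dom a1" "a1 \<cdot> v = i" "b1 \<cdot> v = j"
      using pullback_lift[OF pb1 i(1) j(1)] i j I eq by auto
    have "(m2 \<cdot> b1) \<cdot> v = m2 \<cdot> k" using v eq D1 e by simp
    then have "\<exists>w. arr w \<and> dom w = dom v \<and> cod w = dom a2 \<and> a2 \<cdot> w = v \<and> b2 \<cdot> w = k"
      by (intro pullback_lift[OF pb2]) (use v k D1 D2 e I in auto)
    then obtain w where w: "arr w" "dom w = dom v" "cod w = dom a2" "a2 \<cdot> w = v" "b2 \<cdot> w = k"
      by blast
    then show ?thesis using v D1 D2 e I by (intro exI[of _ w]) (simp add: s1_def s2_def)
  qed
  have S_elim: "\<exists>j. arr j \<and> dom j = dom l \<and> cod j = I \<and> m1 \<cdot> (s1 \<cdot> l) = m1 \<cdot> j \<and> m2 \<cdot> j = m2 \<cdot> (s2 \<cdot> l)"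
    if l: "arr l" "cod l = dom a2" for l
  proof (rule exI[of _ "b1 \<cdot> (a2 \<cdot> l)"], intro conjI)
    have "m1 \<cdot> (a1 \<cdot> (a2 \<cdot> l)) = m1 \<cdot> (b1 \<cdot> (a2 \<cdot> l))"
      by (rule comp_ext2[OF D1(9)]) (use l D1 D2 e in auto)
    then show "m1 \<cdot> (s1 \<cdot> l) = m1 \<cdot> (b1 \<cdot> (a2 \<cdot> l))" using l D1 D2 e by (simp add: s1_def)
    have "(m2 \<cdot> b1) \<cdot> (a2 \<cdot> l) = m2 \<cdot> (b2 \<cdot> l)"
      by (rule comp_ext2[OF D2(9)]) (use l D1 D2 e in auto)
    then show "m2 \<cdot> (b1 \<cdot> (a2 \<cdot> l)) = m2 \<cdot> (s2 \<cdot> l)" using l D1 D2 e by (simp add: s2_def)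
  qed (use l D1 D2 e I in auto)
  have "is_relation C s1 s2" unfolding is_relation_def
  proof (intro conjI allI ballI impI)
    fix t u v assume u: "u \<in> Hom C t (dom s1)" and v: "v \<in> Hom C t (dom s1)"
      and eq: "s1 \<cdot> u = s1 \<cdot> v \<and> s2 \<cdot> u = s2 \<cdot> v"
    have "m1 \<cdot> (b1 \<cdot> (a2 \<cdot> u)) = m1 \<cdot> (s1 \<cdot> u)" if "arr u" "cod u = dom a2" for u
    proof -
      have "m1 \<cdot> (a1 \<cdot> (a2 \<cdot> u)) = m1 \<cdot> (b1 \<cdot> (a2 \<cdot> u))"
        by (rule comp_ext2[OF D1(9)]) (use that D1 D2 e in auto)
      then show ?thesis using that D1 D2 e by (simp add: s1_def)
    qed
    then have 1: "m1 \<cdot> (b1 \<cdot> (a2 \<cdot> u)) = m1 \<cdot> (b1 \<cdot> (a2 \<cdot> v))" using u v eq s by simp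
    have "m2 \<cdot> (b1 \<cdot> (a2 \<cdot> u)) = m2 \<cdot> (s2 \<cdot> u)" if "arr u" "cod u = dom a2" for u
    proof -
      have "(m2 \<cdot> b1) \<cdot> (a2 \<cdot> u) = m2 \<cdot> (b2 \<cdot> u)"
        by (rule comp_ext2[OF D2(9)]) (use that D1 D2 e in auto)
      then show ?thesis using that D1 D2 e by (simp add: s2_def)
    qed
    then have 2: "m2 \<cdot> (b1 \<cdot> (a2 \<cdot> u)) = m2 \<cdot> (b1 \<cdot> (a2 \<cdot> v))" using u v eq s by simp
    have 3: "b1 \<cdot> (a2 \<cdot> u) = b1 \<cdot> (a2 \<cdot> v)"
      by (rule jointly_monicD[OF e(12) _ _ _ _ _ 1 2]) (use u v s D1 D2 e in auto)
    have 4: "a2 \<cdot> u = a2 \<cdot> v"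
      by (rule pullback_eqI[OF pb1 _ _ _ _ _ _ 3]) (use u v eq s D1 D2 e in \<open>auto simp: s1_def\<close>)
    show "u = v"
      by (rule pullback_eqI[OF pb2 _ _ _ _ _ 4]) (use u v eq s D1 D2 e in \<open>auto simp: s2_def\<close>)
  qed (use s in auto)
  moreover have "\<exists>w \<in> Hom C (cod s1) (dom s1). s1 \<cdot> w = Idn C (cod s1) \<and> s2 \<cdot> w = Idn C (cod s1)"
    using S_intro[of "Idn C I" I "Idn C I" "Idn C I"] s I by auto
  ultimately have "is_reflexive_relation C s1 s2" unfolding is_reflexive_relation_def by blast
  then have "is_equivalence_relation C s1 s2" using maltsev unfolding maltsev_category_def by blast
  then have tr: "is_transitive_relation C s1 s2" unfolding is_equivalence_relation_def by simp
  obtain i1 where i1: "arr i1" "dom i1 = t" "cod i1 = I" "m1 \<cdot> i1 = x" "m2 \<cdot> i1 = y"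
    using im[of x y t] xs ys R by auto
  obtain i2 where i2: "arr i2" "dom i2 = t" "cod i2 = I" "m1 \<cdot> i2 = x'" "m2 \<cdot> i2 = y"
    using im[of x' y t] xs ys R by auto
  obtain i3 where i3: "arr i3" "dom i3 = t" "cod i3 = I" "m1 \<cdot> i3 = x'" "m2 \<cdot> i3 = y'"
    using im[of x' y' t] xs ys R by auto
  obtain l1 where l1: "arr l1" "dom l1 = t" "cod l1 = dom a2" "s1 \<cdot> l1 = i1" "s2 \<cdot> l1 = i2"
    using S_intro[OF i1(1-3) i1(1-3) i2(1-3)] i1 i2 by auto
  obtain l2 where l2: "arr l2" "dom l2 = t" "cod l2 = dom a2" "s1 \<cdot> l2 = i2" "s2 \<cdot> l2 = i3"
    using S_intro[OF i2(1-3) i3(1-3) i3(1-3)] i2 i3 by auto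
  obtain p1 p2 where pb: "is_pullback C s2 s1 p1 p2" using pullback_exists[of s2 s1] s by auto
  note D = is_pullback_D[OF pb]
  obtain c where c: "arr c" "dom c = dom p1" "cod c = dom s1" "s1 \<cdot> c = s1 \<cdot> p1" "s2 \<cdot> c = s2 \<cdot> p2"
    using tr pb unfolding is_transitive_relation_def by (metis Hom_iff)
  have "\<exists>w. arr w \<and> dom w = dom l1 \<and> cod w = dom p1 \<and> p1 \<cdot> w = l1 \<and> p2 \<cdot> w = l2"
    by (rule pullback_lift[OF pb]) (use l1 l2 s in auto)
  then obtain w where w: "arr w" "dom w = t" "cod w = dom p1" "p1 \<cdot> w = l1" "p2 \<cdot> w = l2"
    using l1 by auto
  have cw: "arr (c \<cdot> w)" "dom (c \<cdot> w) = t" "cod (c \<cdot> w) = dom a2" using c w s by auto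
  have "s1 \<cdot> (c \<cdot> w) = s1 \<cdot> (p1 \<cdot> w)" by (rule comp_ext2[OF c(4)]) (use c w s D in auto)
  then have 1: "s1 \<cdot> (c \<cdot> w) = i1" using w l1 by simp
  have "s2 \<cdot> (c \<cdot> w) = s2 \<cdot> (p2 \<cdot> w)" by (rule comp_ext2[OF c(5)]) (use c w s D in auto)
  then have 2: "s2 \<cdot> (c \<cdot> w) = i3" using w l2 by simp
  have "\<exists>j. arr j \<and> dom j = t \<and> cod j = I \<and> m1 \<cdot> j = x \<and> m2 \<cdot> j = y'"
    using S_elim[OF cw(1,3)] cw 1 2 i1 i3 by metis
  then show ?thesis using im[of x y' t] xs ys by auto
qed

text \<open>A morphism of split epimorphisms with regular epimorphic components is a regular pushout. For a
lift \<open>y\<close> of \<open>b\<close> along \<open>q1\<close> the point \<open>d \<cdot> y\<close> agrees with \<open>x\<close> only after \<open>q0\<close>; difunctionality of the span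
\<open>d\<close>, \<open>q1\<close>, applied to \<open>x\<close>, \<open>d \<cdot> y\<close> and their common image under the section, corrects this. It is the
source of all liftings of arrows along functors that are regular epimorphisms at both levels.\<close>

lemma regular_pushout:
  assumes d: "arr d" "dom d = X1" "cod d = X0" and s: "arr s" "dom s = X0" "cod s = X1"
    and ds: "d \<cdot> s = Idn C X0"
    and q1: "q1 \<in> covers" "dom q1 = X1" and q0: "arr q0" "dom q0 = X0"
    and d': "arr d'" "dom d' = cod q1" "cod d' = cod q0"
    and s': "arr s'" "dom s' = cod q0" "cod s' = cod q1"
    and eq: "d' \<cdot> q1 = q0 \<cdot> d" "q1 \<cdot> s = s' \<cdot> q0"
    and b: "arr b" "dom b = t" "cod b = cod q1"
    and x: "arr x" "dom x = t" "cod x = X0" and bx: "d' \<cdot> b = q0 \<cdot> x"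
  obtains e u where "e \<in> covers" "arr e" "cod e = t" "arr u" "dom u = dom e" "cod u = X1"
    "d \<cdot> u = x \<cdot> e" "q1 \<cdot> u = b \<cdot> e"
proof -
  have q1a: "arr q1" using q1 by simp
  obtain e y where y: "e \<in> covers" "arr e" "cod e = dom b" "arr y" "dom y = dom e"
    "cod y = dom q1" "q1 \<cdot> y = b \<cdot> e" using cover_lift[OF q1(1) b(1,3)] by metis
  have f: "q0 \<cdot> (d \<cdot> y) = q0 \<cdot> (x \<cdot> e)"
  proof -
    have "q0 \<cdot> (d \<cdot> y) = d' \<cdot> (q1 \<cdot> y)"
      by (rule comp_ext2[OF eq(1), symmetric]) (use d q1 q1a q0 d' y in auto)
    also have "\<dots> = (d' \<cdot> b) \<cdot> e" using d' y b by simp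
    also have "\<dots> = q0 \<cdot> (x \<cdot> e)" using bx x q0 y b by simp
    finally show ?thesis .
  qed
  have sx: "d \<cdot> (s \<cdot> z) = z" "q1 \<cdot> (s \<cdot> z) = s' \<cdot> (q0 \<cdot> z)" if "arr z" "cod z = X0" for z
    using comp_ext[OF ds, of z] that d s q0 apply simp
    by (rule comp_ext2[OF eq(2)]) (use that s q1 q1a q0 s' in auto)
  have xe: "arr (x \<cdot> e)" "cod (x \<cdot> e) = X0" and dy: "arr (d \<cdot> y)" "cod (d \<cdot> y) = X0"
    using x y b d q1 by auto
  have "related C d q1 (x \<cdot> e) (b \<cdot> e)"
  proof (rule related_difunctional[where x' = "d \<cdot> y" and y = "s' \<cdot> (q0 \<cdot> (x \<cdot> e))" and t = "dom e"])
    show "related C d q1 (x \<cdot> e) (s' \<cdot> (q0 \<cdot> (x \<cdot> e)))"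
      by (rule related_global[of "s \<cdot> (x \<cdot> e)"]) (use sx[OF xe] x y b s d q0 s' in auto)
    show "related C d q1 (d \<cdot> y) (s' \<cdot> (q0 \<cdot> (x \<cdot> e)))"
      by (rule related_global[of "s \<cdot> (d \<cdot> y)"]) (use sx[OF dy] dy xe x y b s d q0 q1(2) s' f in simp_all)
    show "related C d q1 (d \<cdot> y) (b \<cdot> e)"
      by (rule related_global[of y]) (use x y b s d q0 s' q1 in auto)
  qed (use d s q1a q1 q0 d' s' b x y in auto)
  then have "related C d q1 x b"
    using related_local[OF y(1), of x d q1 b] b x y by simp
  then obtain e' w where w: "e' \<in> covers" "arr e'" "cod e' = dom x" "arr w"
    "dom w = dom e'" "cod w = dom d" "d \<cdot> w = x \<cdot> e'" "q1 \<cdot> w = b \<cdot> e'" by (rule relatedE)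
  then show ?thesis using that[of e' w] x d by auto
qed

end

section \<open>Calculus in an internal groupoid\<close>

definition ginv :: "('o, 'a) cat \<Rightarrow> ('o, 'a) igpd \<Rightarrow> 'a" where
  "ginv C X = (SOME i. i \<in> Hom C (G1 X) (G1 X) \<and>
        gdom X \<cdot>\<^bsub>C\<^esub> i = gcod X \<and> gcod X \<cdot>\<^bsub>C\<^esub> i = gdom X \<and>
        gcomp C X (Idn C (G1 X)) i = gunit X \<cdot>\<^bsub>C\<^esub> gcod X \<and>
        gcomp C X i (Idn C (G1 X)) = gunit X \<cdot>\<^bsub>C\<^esub> gdom X)"

lemma Gpd_sel [simp]:
  "Dom (Gpd C) = Src" "Cod (Gpd C) = Tgt" "F \<in> Arr (Gpd C) \<longleftrightarrow> internal_functor C F"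
  "X \<in> Obj (Gpd C) \<longleftrightarrow> internal_groupoid C X"
  "Src (G \<cdot>\<^bsub>Gpd C\<^esub> F) = Src F" "Tgt (G \<cdot>\<^bsub>Gpd C\<^esub> F) = Tgt G"
  "f0 (G \<cdot>\<^bsub>Gpd C\<^esub> F) = f0 G \<cdot>\<^bsub>C\<^esub> f0 F" "f1 (G \<cdot>\<^bsub>Gpd C\<^esub> F) = f1 G \<cdot>\<^bsub>C\<^esub> f1 F"
  "Src (Idn (Gpd C) X) = X" "Tgt (Idn (Gpd C) X) = X"
  "f0 (Idn (Gpd C) X) = Idn C (G0 X)" "f1 (Idn (Gpd C) X) = Idn C (G1 X)"
  by (auto simp: Gpd_def)

lemma functor_eqI:
  fixes F G :: "('o, 'a) ifunctor"
  assumes "Src F = Src G" "Tgt F = Tgt G" "f0 F = f0 G" "f1 F = f1 G"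
  shows "F = G"
  using assms by (auto intro: ifunctor.equality)

context category
begin

lemma gpd_arr [simp]:
  assumes "internal_groupoid C X"
  shows "G0 X \<in> Obj C" "G1 X \<in> Obj C" "G2 X \<in> Obj C"
    "arr (gdom X)" "dom (gdom X) = G1 X" "cod (gdom X) = G0 X"
    "arr (gcod X)" "dom (gcod X) = G1 X" "cod (gcod X) = G0 X"
    "arr (gunit X)" "dom (gunit X) = G0 X" "cod (gunit X) = G1 X"
    "arr (gpr1 X)" "dom (gpr1 X) = G2 X" "cod (gpr1 X) = G1 X"
    "arr (gpr2 X)" "dom (gpr2 X) = G2 X" "cod (gpr2 X) = G1 X"
    "arr (gmult X)" "dom (gmult X) = G2 X" "cod (gmult X) = G1 X"
  using assms unfolding internal_groupoid_def internal_category_def by auto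

lemma gpd_pullback:
  assumes "internal_groupoid C X"
  shows "is_pullback C (gdom X) (gcod X) (gpr1 X) (gpr2 X)"
  using assms unfolding internal_groupoid_def internal_category_def by auto

lemma gpd_eqs:
  assumes "internal_groupoid C X"
  shows "gdom X \<cdot> gunit X = Idn C (G0 X)" "gcod X \<cdot> gunit X = Idn C (G0 X)"
    "gdom X \<cdot> gmult X = gdom X \<cdot> gpr2 X" "gcod X \<cdot> gmult X = gcod X \<cdot> gpr1 X"
    "gcomp C X (Idn C (G1 X)) (gunit X \<cdot> gdom X) = Idn C (G1 X)"
    "gcomp C X (gunit X \<cdot> gcod X) (Idn C (G1 X)) = Idn C (G1 X)"
  using assms unfolding internal_groupoid_def internal_category_def by auto

lemma gdom_gunit [simp]:
  assumes "internal_groupoid C X" "arr x" "cod x = G0 X"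
  shows "gdom X \<cdot> (gunit X \<cdot> x) = x" "gcod X \<cdot> (gunit X \<cdot> x) = x"
  using comp_ext[OF gpd_eqs(1)[OF assms(1)], of x] comp_ext[OF gpd_eqs(2)[OF assms(1)], of x] assms by auto

lemma gpair_eq: "internal_groupoid C X \<Longrightarrow> gpair C X u v = pbpair C (gpr1 X) (gpr2 X) u v"
  unfolding gpair_def pbpair_def by simp

lemma gpair:
  assumes X: "internal_groupoid C X" and "arr u" "arr v" "dom v = dom u"
    "cod u = G1 X" "cod v = G1 X" "gdom X \<cdot> u = gcod X \<cdot> v"
  shows "arr (gpair C X u v)" "dom (gpair C X u v) = dom u" "cod (gpair C X u v) = G2 X"
    "gpr1 X \<cdot> gpair C X u v = u" "gpr2 X \<cdot> gpair C X u v = v"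
  using pbpair[OF gpd_pullback[OF X], of u v] assms by (auto simp: gpair_eq)

lemma gcomp_arr [simp]:
  assumes X: "internal_groupoid C X" and "arr u" "arr v" "dom v = dom u"
    "cod u = G1 X" "cod v = G1 X" "gdom X \<cdot> u = gcod X \<cdot> v"
  shows "arr (gcomp C X u v)" "dom (gcomp C X u v) = dom u" "cod (gcomp C X u v) = G1 X"
    "gdom X \<cdot> gcomp C X u v = gdom X \<cdot> v" "gcod X \<cdot> gcomp C X u v = gcod X \<cdot> u"
proof -
  note P = gpair[OF assms]
  show "arr (gcomp C X u v)" "dom (gcomp C X u v) = dom u" "cod (gcomp C X u v) = G1 X"
    using P X by (auto simp: gcomp_def)
  have "gdom X \<cdot> (gmult X \<cdot> gpair C X u v) = gdom X \<cdot> (gpr2 X \<cdot> gpair C X u v)"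
    by (rule comp_ext2[OF gpd_eqs(3)[OF X]]) (use P X in auto)
  then show "gdom X \<cdot> gcomp C X u v = gdom X \<cdot> v" using P by (simp add: gcomp_def)
  have "gcod X \<cdot> (gmult X \<cdot> gpair C X u v) = gcod X \<cdot> (gpr1 X \<cdot> gpair C X u v)"
    by (rule comp_ext2[OF gpd_eqs(4)[OF X]]) (use P X in auto)
  then show "gcod X \<cdot> gcomp C X u v = gcod X \<cdot> u" using P by (simp add: gcomp_def)
qed

lemma gcomp_comp [simp]:
  assumes X: "internal_groupoid C X" and "arr u" "arr v" "dom v = dom u"
    "cod u = G1 X" "cod v = G1 X" "gdom X \<cdot> u = gcod X \<cdot> v" "arr e" "cod e = dom u"
  shows "gcomp C X u v \<cdot> e = gcomp C X (u \<cdot> e) (v \<cdot> e)"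
  using gpair[OF assms(1-7)] pbpair_comp[OF gpd_pullback[OF X], of u v e] assms
  by (simp add: gcomp_def gpair_eq)

lemma gcomp_unit_right [simp]:
  assumes X: "internal_groupoid C X" and u: "arr u" "cod u = G1 X" "gdom X \<cdot> u = x"
  shows "gcomp C X u (gunit X \<cdot> x) = u"
proof -
  have "gdom X \<cdot> Idn C (G1 X) = gcod X \<cdot> (gunit X \<cdot> gdom X)" using X by simp
  then have "gcomp C X (Idn C (G1 X)) (gunit X \<cdot> gdom X) \<cdot> u = gcomp C X u (gunit X \<cdot> (gdom X \<cdot> u))"
    using X u by simp
  then show ?thesis using gpd_eqs(5)[OF X] u X by simp
qed

lemma gcomp_unit_left [simp]:
  assumes X: "internal_groupoid C X" and u: "arr u" "cod u = G1 X" "gcod X \<cdot> u = x"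
  shows "gcomp C X (gunit X \<cdot> x) u = u"
proof -
  have "gdom X \<cdot> (gunit X \<cdot> gcod X) = gcod X \<cdot> Idn C (G1 X)" using X by simp
  then have "gcomp C X (gunit X \<cdot> gcod X) (Idn C (G1 X)) \<cdot> u = gcomp C X (gunit X \<cdot> (gcod X \<cdot> u)) u"
    using X u by simp
  then show ?thesis using gpd_eqs(6)[OF X] u X by simp
qed

lemma gcomp_assoc [simp]:
  assumes X: "internal_groupoid C X" and u: "arr u" "arr v" "arr w" "dom v = dom u"
    "dom w = dom u" "cod u = G1 X" "cod v = G1 X" "cod w = G1 X"
    "gdom X \<cdot> u = gcod X \<cdot> v" "gdom X \<cdot> v = gcod X \<cdot> w"
  shows "gcomp C X (gcomp C X u v) w = gcomp C X u (gcomp C X v w)"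
  using X u unfolding internal_groupoid_def internal_category_def by (metis Hom_iff)

lemma ginv_prop:
  assumes X: "internal_groupoid C X"
  shows "ginv C X \<in> Hom C (G1 X) (G1 X)" "gdom X \<cdot> ginv C X = gcod X" "gcod X \<cdot> ginv C X = gdom X"
    "gcomp C X (Idn C (G1 X)) (ginv C X) = gunit X \<cdot> gcod X"
    "gcomp C X (ginv C X) (Idn C (G1 X)) = gunit X \<cdot> gdom X"
proof -
  have "\<exists>i. i \<in> Hom C (G1 X) (G1 X) \<and> gdom X \<cdot> i = gcod X \<and> gcod X \<cdot> i = gdom X \<and>
        gcomp C X (Idn C (G1 X)) i = gunit X \<cdot> gcod X \<and> gcomp C X i (Idn C (G1 X)) = gunit X \<cdot> gdom X"
    using X unfolding internal_groupoid_def by blast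
  from someI_ex[OF this] show "ginv C X \<in> Hom C (G1 X) (G1 X)" "gdom X \<cdot> ginv C X = gcod X"
    "gcod X \<cdot> ginv C X = gdom X" "gcomp C X (Idn C (G1 X)) (ginv C X) = gunit X \<cdot> gcod X"
    "gcomp C X (ginv C X) (Idn C (G1 X)) = gunit X \<cdot> gdom X"
    unfolding ginv_def by auto
qed

lemma ginv_arr [simp]:
  assumes "internal_groupoid C X"
  shows "arr (ginv C X)" "dom (ginv C X) = G1 X" "cod (ginv C X) = G1 X"
  using ginv_prop(1)[OF assms] by auto

lemma ginv_dom [simp]:
  assumes X: "internal_groupoid C X" and u: "arr u" "cod u = G1 X"
  shows "gdom X \<cdot> (ginv C X \<cdot> u) = gcod X \<cdot> u" "gcod X \<cdot> (ginv C X \<cdot> u) = gdom X \<cdot> u"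
  using comp_ext[OF ginv_prop(2)[OF X], of u] comp_ext[OF ginv_prop(3)[OF X], of u] X u by auto

lemma gcomp_ginv [simp]:
  assumes X: "internal_groupoid C X" and u: "arr u" "cod u = G1 X"
  shows "gcomp C X u (ginv C X \<cdot> u) = gunit X \<cdot> (gcod X \<cdot> u)"
    "gcomp C X (ginv C X \<cdot> u) u = gunit X \<cdot> (gdom X \<cdot> u)"
proof -
  have "gcomp C X (Idn C (G1 X)) (ginv C X) \<cdot> u = gcomp C X u (ginv C X \<cdot> u)"
    using X u ginv_prop(2,3)[OF X] by simp
  then show "gcomp C X u (ginv C X \<cdot> u) = gunit X \<cdot> (gcod X \<cdot> u)"
    using X u by (simp add: ginv_prop(4)[OF X])
  have "gcomp C X (ginv C X) (Idn C (G1 X)) \<cdot> u = gcomp C X (ginv C X \<cdot> u) u"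
    using X u ginv_prop(2,3)[OF X] by simp
  then show "gcomp C X (ginv C X \<cdot> u) u = gunit X \<cdot> (gdom X \<cdot> u)"
    using X u by (simp add: ginv_prop(5)[OF X])
qed

lemma gcomp_ginv_cancel [simp]:
  assumes X: "internal_groupoid C X" and u: "arr u" "arr v" "dom v = dom u"
    "cod u = G1 X" "cod v = G1 X"
  shows "gcod X \<cdot> u = gcod X \<cdot> v \<Longrightarrow> gcomp C X u (gcomp C X (ginv C X \<cdot> u) v) = v"
    "gdom X \<cdot> u = gcod X \<cdot> v \<Longrightarrow> gcomp C X (ginv C X \<cdot> u) (gcomp C X u v) = v"
proof -
  assume "gcod X \<cdot> u = gcod X \<cdot> v"
  then show "gcomp C X u (gcomp C X (ginv C X \<cdot> u) v) = v"
    using gcomp_assoc[OF X, of u "ginv C X \<cdot> u" v] X u by simp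
next
  assume "gdom X \<cdot> u = gcod X \<cdot> v"
  then show "gcomp C X (ginv C X \<cdot> u) (gcomp C X u v) = v"
    using gcomp_assoc[OF X, of "ginv C X \<cdot> u" u v] X u by simp
qed

lemma gcomp_left_cancel:
  assumes X: "internal_groupoid C X" and "arr u" "arr v" "arr w" "dom v = dom u"
    "dom w = dom u" "cod u = G1 X" "cod v = G1 X" "cod w = G1 X"
    "gdom X \<cdot> u = gcod X \<cdot> v" "gdom X \<cdot> u = gcod X \<cdot> w" "gcomp C X u v = gcomp C X u w"
  shows "v = w"
  using gcomp_ginv_cancel(2)[OF X, of u v] gcomp_ginv_cancel(2)[OF X, of u w] assms by metis

lemma ginv_unique:
  assumes X: "internal_groupoid C X" and u: "arr u" "arr v" "dom v = dom u"
    "cod u = G1 X" "cod v = G1 X" "gdom X \<cdot> u = gcod X \<cdot> v" "gcod X \<cdot> u = gdom X \<cdot> v"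
    "gcomp C X u v = gunit X \<cdot> (gcod X \<cdot> u)"
  shows "v = ginv C X \<cdot> u"
  by (rule gcomp_left_cancel[OF X u(1,2)]) (use X u in auto)

lemma gcomp_idempotent:
  assumes X: "internal_groupoid C X" and u: "arr u" "cod u = G1 X" "gdom X \<cdot> u = gcod X \<cdot> u"
    "gcomp C X u u = u"
  shows "u = gunit X \<cdot> (gdom X \<cdot> u)"
  by (rule gcomp_left_cancel[OF X u(1,1)]) (use X u in auto)

lemma functor_gpd [simp]:
  assumes "internal_functor C F"
  shows "internal_groupoid C (Src F)" "internal_groupoid C (Tgt F)"
  using assms unfolding internal_functor_def by auto

lemma functor_arr [simp]:
  assumes "internal_functor C F"
  shows "arr (f0 F)" "dom (f0 F) = G0 (Src F)" "cod (f0 F) = G0 (Tgt F)"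
     "arr (f1 F)" "dom (f1 F) = G1 (Src F)" "cod (f1 F) = G1 (Tgt F)"
  using assms unfolding internal_functor_def by auto

lemma functor_gdom [simp]:
  assumes F: "internal_functor C F" "Tgt F = Y" and u: "arr u" "cod u = G1 (Src F)"
  shows "gdom Y \<cdot> (f1 F \<cdot> u) = f0 F \<cdot> (gdom (Src F) \<cdot> u)"
    "gcod Y \<cdot> (f1 F \<cdot> u) = f0 F \<cdot> (gcod (Src F) \<cdot> u)"
proof -
  have "gdom Y \<cdot> f1 F = f0 F \<cdot> gdom (Src F)" "gcod Y \<cdot> f1 F = f0 F \<cdot> gcod (Src F)"
    using F unfolding internal_functor_def by auto
  from comp_ext2[OF this(1)] comp_ext2[OF this(2)]
  show "gdom Y \<cdot> (f1 F \<cdot> u) = f0 F \<cdot> (gdom (Src F) \<cdot> u)"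
    "gcod Y \<cdot> (f1 F \<cdot> u) = f0 F \<cdot> (gcod (Src F) \<cdot> u)" using F u by auto
qed

lemma functor_gunit [simp]:
  assumes F: "internal_functor C F" "Src F = X" and u: "arr u" "cod u = G0 X"
  shows "f1 F \<cdot> (gunit X \<cdot> u) = gunit (Tgt F) \<cdot> (f0 F \<cdot> u)"
proof -
  have "f1 F \<cdot> gunit X = gunit (Tgt F) \<cdot> f0 F" using F unfolding internal_functor_def by auto
  then show ?thesis using comp_ext2[of "f1 F" "gunit X" "gunit (Tgt F)" "f0 F" u] F u functor_gpd[OF F(1)] by simp
qed

lemma functor_gcomp [simp]:
  assumes F: "internal_functor C F" and X: "Src F = X" and uv: "arr u" "arr v" "dom v = dom u"
    "cod u = G1 X" "cod v = G1 X" "gdom X \<cdot> u = gcod X \<cdot> v"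
  shows "f1 F \<cdot> gcomp C X u v = gcomp C (Tgt F) (f1 F \<cdot> u) (f1 F \<cdot> v)"
proof -
  have gX: "internal_groupoid C X" and gY: "internal_groupoid C (Tgt F)" using F X by auto
  note P = gpair[OF gX uv]
  have e: "f1 F \<cdot> gmult X = gcomp C (Tgt F) (f1 F \<cdot> gpr1 X) (f1 F \<cdot> gpr2 X)"
    using F X unfolding internal_functor_def by auto
  have c: "gdom X \<cdot> gpr1 X = gcod X \<cdot> gpr2 X" using is_pullback_D(9)[OF gpd_pullback[OF gX]] .
  have "f1 F \<cdot> (gmult X \<cdot> gpair C X u v) = gcomp C (Tgt F) (f1 F \<cdot> gpr1 X) (f1 F \<cdot> gpr2 X) \<cdot> gpair C X u v"
    by (rule comp_ext[OF e]) (use F gX gY X P in auto)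
  also have "\<dots> = gcomp C (Tgt F) (f1 F \<cdot> u) (f1 F \<cdot> v)" using F gX gY X P c by simp
  finally show ?thesis unfolding gcomp_def by simp
qed

lemma functor_ginv [simp]:
  assumes F: "internal_functor C F" and X: "Src F = X" and u: "arr u" "cod u = G1 X"
  shows "f1 F \<cdot> (ginv C X \<cdot> u) = ginv C (Tgt F) \<cdot> (f1 F \<cdot> u)"
proof -
  have gX: "internal_groupoid C X" and gY: "internal_groupoid C (Tgt F)" using F X by auto
  have "gcomp C (Tgt F) (f1 F \<cdot> u) (f1 F \<cdot> (ginv C X \<cdot> u)) = f1 F \<cdot> gcomp C X u (ginv C X \<cdot> u)"
    by (rule functor_gcomp[OF F X, symmetric]) (use gX u in auto)
  also have "\<dots> = gunit (Tgt F) \<cdot> (f0 F \<cdot> (gcod X \<cdot> u))" using F X gX u by simp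
  finally have e: "gcomp C (Tgt F) (f1 F \<cdot> u) (f1 F \<cdot> (ginv C X \<cdot> u)) = gunit (Tgt F) \<cdot> (f0 F \<cdot> (gcod X \<cdot> u))" .
  show ?thesis
    by (rule ginv_unique[OF gY]) (use F X gX gY u e in auto)
qed

lemma internal_functorI:
  assumes X: "internal_groupoid C X" and Y: "internal_groupoid C Y"
    and h0: "arr h0" "dom h0 = G0 X" "cod h0 = G0 Y"
    and h1: "arr h1" "dom h1 = G1 X" "cod h1 = G1 Y"
    and d: "gdom Y \<cdot> h1 = h0 \<cdot> gdom X" and c: "gcod Y \<cdot> h1 = h0 \<cdot> gcod X"
    and m: "\<And>u v. \<lbrakk>arr u; arr v; dom v = dom u; cod u = G1 X; cod v = G1 X;
       gdom X \<cdot> u = gcod X \<cdot> v\<rbrakk>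
       \<Longrightarrow> h1 \<cdot> gcomp C X u v = gcomp C Y (h1 \<cdot> u) (h1 \<cdot> v)"
  shows "internal_functor C \<lparr>Src = X, Tgt = Y, f0 = h0, f1 = h1\<rparr>"
proof -
  have pr: "gdom X \<cdot> gpr1 X = gcod X \<cdot> gpr2 X" using is_pullback_D(9)[OF gpd_pullback[OF X]] .
  have d': "gdom Y \<cdot> (h1 \<cdot> u) = h0 \<cdot> (gdom X \<cdot> u)" "gcod Y \<cdot> (h1 \<cdot> u) = h0 \<cdot> (gcod X \<cdot> u)"
    if "arr u" "cod u = G1 X" for u
    using comp_ext2[OF d, of u] comp_ext2[OF c, of u] that X Y h0 h1 by auto
  have pb: "is_pullback C (gdom X) (gcod X) (gpr1 X) (gpr2 X)" using X by (rule gpd_pullback)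
  have "gpair C X (gpr1 X) (gpr2 X) = Idn C (G2 X)"
    by (rule pullback_eqI[OF pb]) (use gpair[OF X, of "gpr1 X" "gpr2 X"] pr X in auto)
  then have "gmult X = gcomp C X (gpr1 X) (gpr2 X)" unfolding gcomp_def using X by simp
  then have m1: "h1 \<cdot> gmult X = gcomp C Y (h1 \<cdot> gpr1 X) (h1 \<cdot> gpr2 X)" using m[of "gpr1 X" "gpr2 X"] X pr by simp
  have id: "gunit X \<cdot> Idn C (G0 X) = gunit X" using X by simp
  have s: "gdom X \<cdot> gunit X = Idn C (G0 X)" "gcod X \<cdot> gunit X = Idn C (G0 X)" using gpd_eqs X by auto
  have "gcomp C X (gunit X) (gunit X) = gunit X"
    using gcomp_unit_right[OF X, of "gunit X" "Idn C (G0 X)"] s X by simp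
  then have ie: "gcomp C Y (h1 \<cdot> gunit X) (h1 \<cdot> gunit X) = h1 \<cdot> gunit X"
    using m[of "gunit X" "gunit X"] s X by simp
  have "h1 \<cdot> gunit X = gunit Y \<cdot> (gdom Y \<cdot> (h1 \<cdot> gunit X))"
    by (rule gcomp_idempotent[OF Y]) (use ie d'[of "gunit X"] s X h1 in auto)
  then have "h1 \<cdot> gunit X = gunit Y \<cdot> h0" using d' s X h0 by simp
  then show ?thesis unfolding internal_functor_def using assms m1 by simp
qed

text \<open>A composition given as an operation on generalized elements that is natural under reparametrization
is represented by an arrow on the object of composable pairs (its value at the generic pair); this
permits all later groupoids to be defined elementwise.\<close>

lemma groupoid_from_operation:
  assumes x: "x0 \<in> Obj C" "x1 \<in> Obj C" and d: "arr d" "dom d = x1" "cod d = x0"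
    and c: "arr c" "dom c = x1" "cod c = x0" and s: "arr s" "dom s = x0" "cod s = x1"
    and pb: "is_pullback C d c p1 p2" and ds: "d \<cdot> s = Idn C x0" "c \<cdot> s = Idn C x0"
    and m: "\<And>u v. \<lbrakk>arr u; arr v; dom v = dom u; cod u = x1; cod v = x1;
       d \<cdot> u = c \<cdot> v\<rbrakk>
       \<Longrightarrow> arr (m u v) \<and> dom (m u v) = dom u \<and> cod (m u v) = x1 \<and> d \<cdot> m u v = d \<cdot> v \<and> c \<cdot> m u v = c \<cdot> u"
    and nat: "\<And>u v e. \<lbrakk>arr u; arr v; dom v = dom u; cod u = x1; cod v = x1;
       d \<cdot> u = c \<cdot> v; arr e; cod e = dom u\<rbrakk>
       \<Longrightarrow> m u v \<cdot> e = m (u \<cdot> e) (v \<cdot> e)"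
    and ur: "\<And>u. arr u \<Longrightarrow> cod u = x1 \<Longrightarrow> m u (s \<cdot> (d \<cdot> u)) = u"
    and ul: "\<And>u. arr u \<Longrightarrow> cod u = x1 \<Longrightarrow> m (s \<cdot> (c \<cdot> u)) u = u"
    and as: "\<And>u v w. \<lbrakk>arr u; arr v; arr w; dom v = dom u; dom w = dom u;
       cod u = x1; cod v = x1; cod w = x1; d \<cdot> u = c \<cdot> v; d \<cdot> v = c \<cdot> w\<rbrakk>
       \<Longrightarrow> m (m u v) w = m u (m v w)"
    and i: "arr i" "dom i = x1" "cod i = x1" "d \<cdot> i = c" "c \<cdot> i = d"
    and ii: "m (Idn C x1) i = s \<cdot> c" "m i (Idn C x1) = s \<cdot> d"
  obtains X where "internal_groupoid C X" "G0 X = x0" "G1 X = x1" "gdom X = d" "gcod X = c" "gunit X = s"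
    "\<And>u v. \<lbrakk>arr u; arr v; dom v = dom u; cod u = x1; cod v = x1;
       d \<cdot> u = c \<cdot> v\<rbrakk> \<Longrightarrow> gcomp C X u v = m u v"
proof -
  define X where "X = \<lparr>G0 = x0, G1 = x1, G2 = dom p1, gdom = d, gcod = c, gunit = s,
    gpr1 = p1, gpr2 = p2, gmult = m p1 p2\<rparr>"
  have sel [simp]: "G0 X = x0" "G1 X = x1" "G2 X = dom p1" "gdom X = d" "gcod X = c" "gunit X = s"
    "gpr1 X = p1" "gpr2 X = p2" "gmult X = m p1 p2" unfolding X_def by simp_all
  note D = is_pullback_D[OF pb]
  have M: "arr (m p1 p2)" "dom (m p1 p2) = dom p1" "cod (m p1 p2) = x1"
     "d \<cdot> m p1 p2 = d \<cdot> p2" "c \<cdot> m p1 p2 = c \<cdot> p1" using m[of p1 p2] D d c by auto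
  have g: "gcomp C X u v = m u v"
    if uv: "arr u" "arr v" "dom v = dom u" "cod u = x1" "cod v = x1" "d \<cdot> u = c \<cdot> v" for u v
  proof -
    note P = pbpair[OF pb uv(1-3) _ _ uv(6), unfolded uv(4,5) d(2) c(2), OF refl refl]
    have "gcomp C X u v = m p1 p2 \<cdot> pbpair C p1 p2 u v"
      unfolding gcomp_def gpair_def pbpair_def by simp
    also have "\<dots> = m (p1 \<cdot> pbpair C p1 p2 u v) (p2 \<cdot> pbpair C p1 p2 u v)"
      by (rule nat) (use D P d c in auto)
    finally show ?thesis using P by simp
  qed
  have dds: "d \<cdot> (s \<cdot> z) = z" "c \<cdot> (s \<cdot> z) = z" if "arr z" "cod z = x0" for z
    using comp_ext[OF ds(1), of z] comp_ext[OF ds(2), of z] that d c s by auto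
  have "internal_category C X" unfolding internal_category_def
  proof (intro conjI allI ballI impI)
    show "gcomp C X (Idn C (G1 X)) (gunit X \<cdot> gdom X) = Idn C (G1 X)"
      using g[of "Idn C x1" "s \<cdot> d"] ur[of "Idn C x1"] x d c s dds by simp
    show "gcomp C X (gunit X \<cdot> gcod X) (Idn C (G1 X)) = Idn C (G1 X)"
      using g[of "s \<cdot> c" "Idn C x1"] ul[of "Idn C x1"] x d c s dds by simp
    fix t u v w
    assume "u \<in> Hom C t (G1 X)" "v \<in> Hom C t (G1 X)" "w \<in> Hom C t (G1 X)"
      and "gdom X \<cdot> u = gcod X \<cdot> v \<and> gdom X \<cdot> v = gcod X \<cdot> w"
    then have h: "arr u" "arr v" "arr w" "dom u = t" "dom v = t" "dom w = t"
      "cod u = x1" "cod v = x1" "cod w = x1" "d \<cdot> u = c \<cdot> v" "d \<cdot> v = c \<cdot> w" by auto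
    have 1: "arr (m u v) \<and> dom (m u v) = dom u \<and> cod (m u v) = x1 \<and>
       d \<cdot> m u v = d \<cdot> v \<and> c \<cdot> m u v = c \<cdot> u" by (rule m) (use h in auto)
    have 2: "arr (m v w) \<and> dom (m v w) = dom v \<and> cod (m v w) = x1 \<and>
       d \<cdot> m v w = d \<cdot> w \<and> c \<cdot> m v w = c \<cdot> v" by (rule m) (use h in auto)
    show "gcomp C X (gcomp C X u v) w = gcomp C X u (gcomp C X v w)"
      using as[of u v w] h g[of u v] g[of v w] g[of "m u v" w] g[of u "m v w"] 1 2 by simp
  qed (use x d c s D ds M pb in auto)
  moreover have "\<exists>i \<in> Hom C (G1 X) (G1 X). gdom X \<cdot> i = gcod X \<and> gcod X \<cdot> i = gdom X \<and>
        gcomp C X (Idn C (G1 X)) i = gunit X \<cdot> gcod X \<and> gcomp C X i (Idn C (G1 X)) = gunit X \<cdot> gdom X"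
    using g[of "Idn C x1" i] g[of i "Idn C x1"] i ii x d c by (intro bexI[of _ i]) auto
  ultimately have "internal_groupoid C X" unfolding internal_groupoid_def by blast
  then show ?thesis using that[of X] g by auto
qed

lemma Gpd_category: "category (Gpd C)"
proof
  fix X assume "X \<in> Obj (Gpd C)"
  then have X: "internal_groupoid C X" by simp
  have "internal_functor C \<lparr>Src = X, Tgt = X, f0 = Idn C (G0 X), f1 = Idn C (G1 X)\<rparr>"
    by (rule internal_functorI) (use X in auto)
  then show "Idn (Gpd C) X \<in> Hom (Gpd C) X X" by (simp add: Gpd_def)
next
  fix F G X Y Z assume "F \<in> Hom (Gpd C) X Y" "G \<in> Hom (Gpd C) Y Z"
  then have F: "internal_functor C F" "Src F = X" "Tgt F = Y" and
    G: "internal_functor C G" "Src G = Y" "Tgt G = Z" by auto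
  then have g: "internal_groupoid C X" "internal_groupoid C Y" "internal_groupoid C Z" by auto
  have dF: "gdom Y \<cdot> f1 F = f0 F \<cdot> gdom X" "gcod Y \<cdot> f1 F = f0 F \<cdot> gcod X"
    and dG: "gdom Z \<cdot> f1 G = f0 G \<cdot> gdom Y" "gcod Z \<cdot> f1 G = f0 G \<cdot> gcod Y"
    using F G unfolding internal_functor_def by auto
  have "internal_functor C \<lparr>Src = X, Tgt = Z, f0 = f0 G \<cdot> f0 F, f1 = f1 G \<cdot> f1 F\<rparr>"
  proof (rule internal_functorI)
    show "gdom Z \<cdot> (f1 G \<cdot> f1 F) = (f0 G \<cdot> f0 F) \<cdot> gdom X"
      using functor_gdom(1)[OF G(1,3), of "f1 F"] F G g dF by simp
    show "gcod Z \<cdot> (f1 G \<cdot> f1 F) = (f0 G \<cdot> f0 F) \<cdot> gcod X"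
      using functor_gdom(2)[OF G(1,3), of "f1 F"] F G g dF by simp
  qed (use F G g in auto)
  then show "G \<bullet> F \<in> Hom (Gpd C) X Z" using F G by (simp add: Gpd_def)
qed (auto intro!: functor_eqI)

end

section \<open>Pullbacks of internal groupoids\<close>

context category
begin

lemma pullback_iso:
  assumes pb: "is_pullback C f g p q" and i: "is_iso C i" "cod i = dom p"
  shows "is_pullback C f g (p \<cdot> i) (q \<cdot> i)"
proof (rule is_pullbackI)
  note D = is_pullback_D[OF pb]
  obtain j where j: "arr i" "arr j" "dom j = cod i" "cod j = dom i"
    "j \<cdot> i = Idn C (dom i)" "i \<cdot> j = Idn C (cod i)" using i(1) by (rule is_isoE)
  show "f \<cdot> (p \<cdot> i) = g \<cdot> (q \<cdot> i)" by (rule comp_ext2[OF D(9)]) (use D i j in auto)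
  show "arr (p \<cdot> i)" "arr (q \<cdot> i)" "dom (p \<cdot> i) = dom (q \<cdot> i)" "cod (p \<cdot> i) = dom f"
    "cod (q \<cdot> i) = dom g" "arr f" "arr g" "cod f = cod g" using D i j by auto
  show "jointly_monic C (p \<cdot> i) (q \<cdot> i)" unfolding jointly_monic_def
  proof (intro allI impI)
    fix a b assume ab: "arr a" "arr b" "dom a = dom b" "cod a = dom (p \<cdot> i)"
       "cod b = dom (p \<cdot> i)" "(p \<cdot> i) \<cdot> a = (p \<cdot> i) \<cdot> b" "(q \<cdot> i) \<cdot> a = (q \<cdot> i) \<cdot> b"
    have "i \<cdot> a = i \<cdot> b" by (rule pullback_eqI[OF pb]) (use ab D i j in auto)
    then have "j \<cdot> (i \<cdot> a) = j \<cdot> (i \<cdot> b)" by simp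
    then show "a = b" using comp_ext[OF j(5), of a] comp_ext[OF j(5), of b] ab D i j by simp
  qed
  fix u v assume uv: "arr u" "arr v" "dom u = dom v" "cod u = dom f" "cod v = dom g"
    "f \<cdot> u = g \<cdot> v"
  obtain w where w: "arr w" "dom w = dom u" "cod w = dom p" "p \<cdot> w = u" "q \<cdot> w = v"
    using pullback_lift[OF pb uv(1,2)] uv by metis
  have "i \<cdot> (j \<cdot> w) = w" using comp_ext[OF j(6), of w] j i w by simp
  then show "\<exists>w. arr w \<and> dom w = dom v \<and> cod w = dom (q \<cdot> i) \<and> (p \<cdot> i) \<cdot> w = u \<and> (q \<cdot> i) \<cdot> w = v"
    by (intro exI[of _ "j \<cdot> w"]) (use w i j D uv in simp)
qed

text \<open>Two pullbacks of the same cospan are isomorphic, so facts about one chosen pullback carry over to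
every other.\<close>

lemma pullback_compare:
  assumes pb: "is_pullback C f g p q" and pb': "is_pullback C f g p' q'"
  obtains i where "is_iso C i" "arr i" "dom i = dom p'" "cod i = dom p" "p \<cdot> i = p'" "q \<cdot> i = q'"
proof -
  note D = is_pullback_D[OF pb] and D' = is_pullback_D[OF pb']
  obtain i where i: "arr i" "dom i = dom p'" "cod i = dom p" "p \<cdot> i = p'" "q \<cdot> i = q'"
    using pullback_lift[OF pb D'(4,5)] D' by metis
  obtain j where j: "arr j" "dom j = dom p" "cod j = dom p'" "p' \<cdot> j = p" "q' \<cdot> j = q"
    using pullback_lift[OF pb' D(4,5)] D by metis
  have "is_iso C i"
  proof (rule is_isoI[OF i(1) j(1)])
    show "j \<cdot> i = Idn C (dom i)"
      by (rule pullback_eqI[OF pb']) (use i j D D' comp_ext[OF j(4), of i] comp_ext[OF j(5), of i] in auto)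
    show "i \<cdot> j = Idn C (cod i)"
      by (rule pullback_eqI[OF pb]) (use i j D D' comp_ext[OF i(4), of j] comp_ext[OF i(5), of j] in auto)
  qed (use i j in auto)
  then show ?thesis using that i by blast
qed

lemma gmult_gcomp:
  assumes X: "internal_groupoid C X" and a: "arr a" "cod a = G2 X"
  shows "gmult X \<cdot> a = gcomp C X (gpr1 X \<cdot> a) (gpr2 X \<cdot> a)"
    "gdom X \<cdot> (gpr1 X \<cdot> a) = gcod X \<cdot> (gpr2 X \<cdot> a)"
proof -
  note pb = gpd_pullback[OF X]
  show c: "gdom X \<cdot> (gpr1 X \<cdot> a) = gcod X \<cdot> (gpr2 X \<cdot> a)"
    by (rule comp_ext2[OF is_pullback_D(9)[OF pb]]) (use X a in auto)
  have "gpair C X (gpr1 X \<cdot> a) (gpr2 X \<cdot> a) = a"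
    by (rule pullback_eqI[OF pb]) (use gpair[OF X _ _ _ _ _ c] X a in auto)
  then show "gmult X \<cdot> a = gcomp C X (gpr1 X \<cdot> a) (gpr2 X \<cdot> a)" by (simp add: gcomp_def)
qed

lemma functor_gdom_arr:
  assumes F: "internal_functor C F" "Tgt F = Y" "Src F = X"
  shows "gdom Y \<cdot> f1 F = f0 F \<cdot> gdom X" "gcod Y \<cdot> f1 F = f0 F \<cdot> gcod X" "f1 F \<cdot> gunit X = gunit Y \<cdot> f0 F"
  using F unfolding internal_functor_def by auto

text \<open>Since a functor is determined by its effect on generalized objects and arrows, the mediating functor
is given by the two mediating arrows.\<close>

lemma levelwise_pullback:
  assumes F: "internal_functor C F" and G: "internal_functor C G" and P: "internal_functor C P"
    and Q: "internal_functor C Q" and t: "Tgt F = Tgt G" "Src P = Src Q" "Tgt P = Src F" "Tgt Q = Src G"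
    and pb0: "is_pullback C (f0 F) (f0 G) (f0 P) (f0 Q)" and pb1: "is_pullback C (f1 F) (f1 G) (f1 P) (f1 Q)"
  shows "is_pullback (Gpd C) F G P Q"
proof -
  interpret G: category "Gpd C" by (rule Gpd_category)
  show ?thesis
  proof (rule G.is_pullbackI)
    show "F \<bullet> P = G \<bullet> Q"
      by (rule functor_eqI) (use t is_pullback_D(9)[OF pb0] is_pullback_D(9)[OF pb1] in auto)
    show "jointly_monic (Gpd C) P Q" unfolding jointly_monic_def
    proof (intro allI impI)
      fix A B assume A: "A \<in> Arr (Gpd C)" "B \<in> Arr (Gpd C)" "Dom (Gpd C) A = Dom (Gpd C) B"
        "Cod (Gpd C) A = Dom (Gpd C) P" "Cod (Gpd C) B = Dom (Gpd C) P"
        "P \<bullet> A = P \<bullet> B" "Q \<bullet> A = Q \<bullet> B"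
      have e: "f0 P \<cdot> f0 A = f0 P \<cdot> f0 B" "f1 P \<cdot> f1 A = f1 P \<cdot> f1 B"
        "f0 Q \<cdot> f0 A = f0 Q \<cdot> f0 B" "f1 Q \<cdot> f1 A = f1 Q \<cdot> f1 B"
        using arg_cong[OF A(6), of f0] arg_cong[OF A(6), of f1]
          arg_cong[OF A(7), of f0] arg_cong[OF A(7), of f1] by auto
      show "A = B"
      proof (rule functor_eqI)
        show "f0 A = f0 B" by (rule pullback_eqI[OF pb0 _ _ _ _ _ e(1,3)]) (use A P in auto)
        show "f1 A = f1 B" by (rule pullback_eqI[OF pb1 _ _ _ _ _ e(2,4)]) (use A P in auto)
      qed (use A in auto)
    qed
    fix U V assume "U \<in> Arr (Gpd C)" "V \<in> Arr (Gpd C)" "Dom (Gpd C) U = Dom (Gpd C) V"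
      "Cod (Gpd C) U = Dom (Gpd C) F" "Cod (Gpd C) V = Dom (Gpd C) G" "F \<bullet> U = G \<bullet> V"
    then have U: "internal_functor C U" "internal_functor C V" "Src U = Src V" "Tgt U = Src F" "Tgt V = Src G"
      and e: "F \<bullet> U = G \<bullet> V" by auto
    have e: "f0 F \<cdot> f0 U = f0 G \<cdot> f0 V" "f1 F \<cdot> f1 U = f1 G \<cdot> f1 V"
      using arg_cong[OF e, of f0] arg_cong[OF e, of f1] by auto
    define X where "X = Src V"
    define Y where "Y = Src Q"
    have g: "internal_groupoid C X" "internal_groupoid C Y" using U Q by (auto simp: X_def Y_def)
    have s: "Src U = X" "Src V = X" "Src P = Y" "Src Q = Y" using t U X_def Y_def by auto
    have "\<exists>w. arr w \<and> dom w = dom (f0 U) \<and> cod w = dom (f0 P) \<and> f0 P \<cdot> w = f0 U \<and> f0 Q \<cdot> w = f0 V"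
      by (rule pullback_lift[OF pb0]) (use U e F G in auto)
    then obtain w0 where w0: "arr w0" "dom w0 = G0 X" "cod w0 = G0 Y"
      "f0 P \<cdot> w0 = f0 U" "f0 Q \<cdot> w0 = f0 V" using U P s by auto
    have "\<exists>w. arr w \<and> dom w = dom (f1 U) \<and> cod w = dom (f1 P) \<and> f1 P \<cdot> w = f1 U \<and> f1 Q \<cdot> w = f1 V"
      by (rule pullback_lift[OF pb1]) (use U e F G in auto)
    then obtain w1 where w1: "arr w1" "dom w1 = G1 X" "cod w1 = G1 Y"
      "f1 P \<cdot> w1 = f1 U" "f1 Q \<cdot> w1 = f1 V" using U P s by auto
    have w1e: "f1 P \<cdot> (w1 \<cdot> z) = f1 U \<cdot> z" "f1 Q \<cdot> (w1 \<cdot> z) = f1 V \<cdot> z" if "arr z" "cod z = G1 X" for z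
      using comp_ext[OF w1(4), of z] comp_ext[OF w1(5), of z] that w1 P Q s by auto
    have w0e: "f0 P \<cdot> (w0 \<cdot> z) = f0 U \<cdot> z" "f0 Q \<cdot> (w0 \<cdot> z) = f0 V \<cdot> z" if "arr z" "cod z = G0 X" for z
      using comp_ext[OF w0(4), of z] comp_ext[OF w0(5), of z] that w0 P Q s by auto
    have gU: "gdom (Tgt P) \<cdot> f1 U = f0 U \<cdot> gdom X" "gcod (Tgt P) \<cdot> f1 U = f0 U \<cdot> gcod X"
      "gdom (Tgt Q) \<cdot> f1 V = f0 V \<cdot> gdom X" "gcod (Tgt Q) \<cdot> f1 V = f0 V \<cdot> gcod X"
      using functor_gdom_arr[OF U(1)] functor_gdom_arr[OF U(2)] U s t by auto
    have d: "gdom Y \<cdot> w1 = w0 \<cdot> gdom X"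
    proof (rule pullback_eqI[OF pb0])
      have "f0 P \<cdot> (gdom Y \<cdot> w1) = gdom (Tgt P) \<cdot> (f1 P \<cdot> w1)"
        by (rule comp_ext2[OF functor_gdom_arr(1)[OF P refl s(3), symmetric]]) (use P w1 s g in auto)
      then show "f0 P \<cdot> (gdom Y \<cdot> w1) = f0 P \<cdot> (w0 \<cdot> gdom X)" using w0e w1 gU g by simp
      have "f0 Q \<cdot> (gdom Y \<cdot> w1) = gdom (Tgt Q) \<cdot> (f1 Q \<cdot> w1)"
        by (rule comp_ext2[OF functor_gdom_arr(1)[OF Q refl s(4), symmetric]]) (use Q w1 s g in auto)
      then show "f0 Q \<cdot> (gdom Y \<cdot> w1) = f0 Q \<cdot> (w0 \<cdot> gdom X)" using w0e w1 gU g by simp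
    qed (use P w0 w1 s g in auto)
    have c: "gcod Y \<cdot> w1 = w0 \<cdot> gcod X"
    proof (rule pullback_eqI[OF pb0])
      have "f0 P \<cdot> (gcod Y \<cdot> w1) = gcod (Tgt P) \<cdot> (f1 P \<cdot> w1)"
        by (rule comp_ext2[OF functor_gdom_arr(2)[OF P refl s(3), symmetric]]) (use P w1 s g in auto)
      then show "f0 P \<cdot> (gcod Y \<cdot> w1) = f0 P \<cdot> (w0 \<cdot> gcod X)" using w0e w1 gU g by simp
      have "f0 Q \<cdot> (gcod Y \<cdot> w1) = gcod (Tgt Q) \<cdot> (f1 Q \<cdot> w1)"
        by (rule comp_ext2[OF functor_gdom_arr(2)[OF Q refl s(4), symmetric]]) (use Q w1 s g in auto)
      then show "f0 Q \<cdot> (gcod Y \<cdot> w1) = f0 Q \<cdot> (w0 \<cdot> gcod X)" using w0e w1 gU g by simp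
    qed (use P w0 w1 s g in auto)
    have de: "gdom Y \<cdot> (w1 \<cdot> z) = w0 \<cdot> (gdom X \<cdot> z)" "gcod Y \<cdot> (w1 \<cdot> z) = w0 \<cdot> (gcod X \<cdot> z)"
      if "arr z" "cod z = G1 X" for z
      using comp_ext2[OF d, of z] comp_ext2[OF c, of z] that w0 w1 g by auto
    define W where "W = \<lparr>Src = X, Tgt = Y, f0 = w0, f1 = w1\<rparr>"
    have "internal_functor C W" unfolding W_def
    proof (rule internal_functorI[OF g w0(1-3) w1(1-3) d c])
      fix u v assume uv: "arr u" "arr v" "dom v = dom u" "cod u = G1 X" "cod v = G1 X"
        "gdom X \<cdot> u = gcod X \<cdot> v"
      have a: "arr (gcomp C X u v)" "cod (gcomp C X u v) = G1 X" "dom (gcomp C X u v) = dom u"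
        using g uv by auto
      have cc: "gdom Y \<cdot> (w1 \<cdot> u) = gcod Y \<cdot> (w1 \<cdot> v)" using de uv by simp
      have b: "arr (gcomp C Y (w1 \<cdot> u) (w1 \<cdot> v))" "cod (gcomp C Y (w1 \<cdot> u) (w1 \<cdot> v)) = G1 Y"
        "dom (gcomp C Y (w1 \<cdot> u) (w1 \<cdot> v)) = dom u" using g uv w1 cc by auto
      show "w1 \<cdot> gcomp C X u v = gcomp C Y (w1 \<cdot> u) (w1 \<cdot> v)"
      proof (rule pullback_eqI[OF pb1])
        show "f1 P \<cdot> (w1 \<cdot> gcomp C X u v) = f1 P \<cdot> gcomp C Y (w1 \<cdot> u) (w1 \<cdot> v)"
          using a uv s P U w1 cc t by (simp add: w1e)
        show "f1 Q \<cdot> (w1 \<cdot> gcomp C X u v) = f1 Q \<cdot> gcomp C Y (w1 \<cdot> u) (w1 \<cdot> v)"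
          using a uv s Q U w1 cc t by (simp add: w1e)
      qed (use a b w1 P s in auto)
    qed
    then show "\<exists>W. W \<in> Arr (Gpd C) \<and> Dom (Gpd C) W = Dom (Gpd C) V \<and> Cod (Gpd C) W = Dom (Gpd C) Q \<and>
       P \<bullet> W = U \<and> Q \<bullet> W = V"
      by (intro exI[of _ W]) (use w0 w1 U s t in \<open>auto intro!: functor_eqI simp: W_def\<close>)
  qed (use F G P Q t in auto)
qed

lemma Gpd_iso_levelwise:
  assumes "is_iso (Gpd C) F" shows "internal_functor C F" "is_iso C (f0 F)" "is_iso C (f1 F)"
proof -
  interpret G: category "Gpd C" by (rule Gpd_category)
  obtain H where "F \<in> Arr (Gpd C)" "H \<in> Arr (Gpd C)" "Dom (Gpd C) H = Cod (Gpd C) F"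
    "Cod (Gpd C) H = Dom (Gpd C) F" and e: "H \<bullet> F = Idn (Gpd C) (Dom (Gpd C) F)"
    "F \<bullet> H = Idn (Gpd C) (Cod (Gpd C) F)" using assms by (rule G.is_isoE)
  then have H: "internal_functor C F" "internal_functor C H" "Src H = Tgt F" "Tgt H = Src F" by auto
  have e: "f0 H \<cdot> f0 F = Idn C (G0 (Src F))" "f1 H \<cdot> f1 F = Idn C (G1 (Src F))"
    "f0 F \<cdot> f0 H = Idn C (G0 (Tgt F))" "f1 F \<cdot> f1 H = Idn C (G1 (Tgt F))"
    using arg_cong[OF e(1), of f0] arg_cong[OF e(1), of f1]
      arg_cong[OF e(2), of f0] arg_cong[OF e(2), of f1] by auto
  show "internal_functor C F" by (rule H)
  show "is_iso C (f0 F)" by (rule is_isoI[of _ "f0 H"]) (use H e in auto)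
  show "is_iso C (f1 F)" by (rule is_isoI[of _ "f1 H"]) (use H e in auto)
qed

end

context regular_cat
begin

text \<open>The pullback groupoid is formed on the pullbacks of objects and of arrows, with componentwise
composition.\<close>

lemma Gpd_pullback_exists:
  assumes F: "internal_functor C F" and G: "internal_functor C G" and t: "Tgt F = Tgt G"
  obtains P Q where "internal_functor C P" "internal_functor C Q" "Src P = Src Q" "Tgt P = Src F"
    "Tgt Q = Src G" "is_pullback C (f0 F) (f0 G) (f0 P) (f0 Q)" "is_pullback C (f1 F) (f1 G) (f1 P) (f1 Q)"
proof -
  define X Y B where "X = Src F" and "Y = Src G" and "B = Tgt G"
  have g: "internal_groupoid C X" "internal_groupoid C Y" "internal_groupoid C B"
    using F G unfolding X_def Y_def B_def by auto
  have s: "Src F = X" "Tgt F = B" "Src G = Y" "Tgt G = B" using t unfolding X_def Y_def B_def by auto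
  obtain p0 q0 where pb0: "is_pullback C (f0 F) (f0 G) p0 q0"
    using pullback_exists[of "f0 F" "f0 G"] F G t by auto
  obtain p1 q1 where pb1: "is_pullback C (f1 F) (f1 G) p1 q1"
    using pullback_exists[of "f1 F" "f1 G"] F G t by auto
  define x0 x1 where "x0 = dom p0" and "x1 = dom p1"
  note D0 = is_pullback_D[OF pb0] and D1 = is_pullback_D[OF pb1]
  have p: "arr p0" "dom p0 = x0" "cod p0 = G0 X" "arr q0" "dom q0 = x0" "cod q0 = G0 Y"
    "arr p1" "dom p1 = x1" "cod p1 = G1 X" "arr q1" "dom q1 = x1" "cod q1 = G1 Y"
    "x0 \<in> Obj C" "x1 \<in> Obj C"
    using D0 D1 F G s by (auto simp: x0_def x1_def)
  have sq: "f1 F \<cdot> (p1 \<cdot> z) = f1 G \<cdot> (q1 \<cdot> z)" if "arr z" "cod z = x1" for z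
    by (rule comp_ext2[OF D1(9)]) (use that p F G s in auto)
  have sq0: "f0 F \<cdot> (p0 \<cdot> z) = f0 G \<cdot> (q0 \<cdot> z)" if "arr z" "cod z = x0" for z
    by (rule comp_ext2[OF D0(9)]) (use that p F G s in auto)
  have lift0: "\<exists>w. arr w \<and> dom w = t \<and> cod w = x0 \<and> p0 \<cdot> w = u \<and> q0 \<cdot> w = v"
    if "arr u" "arr v" "dom u = t" "dom v = t" "cod u = G0 X" "cod v = G0 Y"
      "f0 F \<cdot> u = f0 G \<cdot> v" for u v t
    using pullback_lift[OF pb0 that(1,2)] that p F G s by auto
  have lift1: "\<exists>w. arr w \<and> dom w = t \<and> cod w = x1 \<and> p1 \<cdot> w = u \<and> q1 \<cdot> w = v"
    if "arr u" "arr v" "dom u = t" "dom v = t" "cod u = G1 X" "cod v = G1 Y"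
      "f1 F \<cdot> u = f1 G \<cdot> v" for u v t
    using pullback_lift[OF pb1 that(1,2)] that p F G s by auto
  have eq0: "a = b" if "p0 \<cdot> a = p0 \<cdot> b" "q0 \<cdot> a = q0 \<cdot> b" "arr a" "arr b" "dom a = dom b"
    "cod a = x0" "cod b = x0" for a b
    by (rule pullback_eqI[OF pb0]) (use that p in auto)
  have eq1: "a = b" if "p1 \<cdot> a = p1 \<cdot> b" "q1 \<cdot> a = q1 \<cdot> b" "arr a" "arr b" "dom a = dom b"
    "cod a = x1" "cod b = x1" for a b
    by (rule pullback_eqI[OF pb1]) (use that p in auto)
  obtain d where d: "arr d" "dom d = x1" "cod d = x0" "p0 \<cdot> d = gdom X \<cdot> p1" "q0 \<cdot> d = gdom Y \<cdot> q1"
  proof -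
    have "f0 F \<cdot> (gdom X \<cdot> p1) = gdom B \<cdot> (f1 F \<cdot> p1)" using F s p by simp
    also have "\<dots> = gdom B \<cdot> (f1 G \<cdot> q1)" using D1 by simp
    also have "\<dots> = f0 G \<cdot> (gdom Y \<cdot> q1)" using G s p by simp
    finally have "f0 F \<cdot> (gdom X \<cdot> p1) = f0 G \<cdot> (gdom Y \<cdot> q1)" .
    then show ?thesis using that lift0[of "gdom X \<cdot> p1" "gdom Y \<cdot> q1" x1] p g by auto
  qed
  obtain c where c: "arr c" "dom c = x1" "cod c = x0" "p0 \<cdot> c = gcod X \<cdot> p1" "q0 \<cdot> c = gcod Y \<cdot> q1"
  proof -
    have "f0 F \<cdot> (gcod X \<cdot> p1) = gcod B \<cdot> (f1 F \<cdot> p1)" using F s p by simp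
    also have "\<dots> = gcod B \<cdot> (f1 G \<cdot> q1)" using D1 by simp
    also have "\<dots> = f0 G \<cdot> (gcod Y \<cdot> q1)" using G s p by simp
    finally have "f0 F \<cdot> (gcod X \<cdot> p1) = f0 G \<cdot> (gcod Y \<cdot> q1)" .
    then show ?thesis using that lift0[of "gcod X \<cdot> p1" "gcod Y \<cdot> q1" x1] p g by auto
  qed
  obtain s' where s': "arr s'" "dom s' = x0" "cod s' = x1" "p1 \<cdot> s' = gunit X \<cdot> p0" "q1 \<cdot> s' = gunit Y \<cdot> q0"
  proof -
    have "f1 F \<cdot> (gunit X \<cdot> p0) = gunit B \<cdot> (f0 F \<cdot> p0)" using F s p by simp
    also have "\<dots> = gunit B \<cdot> (f0 G \<cdot> q0)" using D0 by simp
    also have "\<dots> = f1 G \<cdot> (gunit Y \<cdot> q0)" using G s p by simp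
    finally have "f1 F \<cdot> (gunit X \<cdot> p0) = f1 G \<cdot> (gunit Y \<cdot> q0)" .
    then show ?thesis using that lift1[of "gunit X \<cdot> p0" "gunit Y \<cdot> q0" x0] p g by auto
  qed
  obtain i where i: "arr i" "dom i = x1" "cod i = x1" "p1 \<cdot> i = ginv C X \<cdot> p1" "q1 \<cdot> i = ginv C Y \<cdot> q1"
  proof -
    have "f1 F \<cdot> (ginv C X \<cdot> p1) = ginv C B \<cdot> (f1 F \<cdot> p1)" using F s p by simp
    also have "\<dots> = ginv C B \<cdot> (f1 G \<cdot> q1)" using D1 by simp
    also have "\<dots> = f1 G \<cdot> (ginv C Y \<cdot> q1)" using G s p by simp
    finally have "f1 F \<cdot> (ginv C X \<cdot> p1) = f1 G \<cdot> (ginv C Y \<cdot> q1)" .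
    then show ?thesis using that lift1[of "ginv C X \<cdot> p1" "ginv C Y \<cdot> q1" x1] p g by auto
  qed
  have de: "p0 \<cdot> (d \<cdot> z) = gdom X \<cdot> (p1 \<cdot> z)" "q0 \<cdot> (d \<cdot> z) = gdom Y \<cdot> (q1 \<cdot> z)"
     "p0 \<cdot> (c \<cdot> z) = gcod X \<cdot> (p1 \<cdot> z)" "q0 \<cdot> (c \<cdot> z) = gcod Y \<cdot> (q1 \<cdot> z)"
     "p1 \<cdot> (i \<cdot> z) = ginv C X \<cdot> (p1 \<cdot> z)" "q1 \<cdot> (i \<cdot> z) = ginv C Y \<cdot> (q1 \<cdot> z)"
    if z: "arr z" "cod z = x1" for z
    using comp_ext[OF d(4), of z] comp_ext[OF d(5), of z] comp_ext[OF c(4), of z] comp_ext[OF c(5), of z]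
      comp_ext[OF i(4), of z] comp_ext[OF i(5), of z] z d c i p g by auto
  have se: "p1 \<cdot> (s' \<cdot> z) = gunit X \<cdot> (p0 \<cdot> z)" "q1 \<cdot> (s' \<cdot> z) = gunit Y \<cdot> (q0 \<cdot> z)"
    if z: "arr z" "cod z = x0" for z
    using comp_ext[OF s'(4), of z] comp_ext[OF s'(5), of z] z s' p g by auto
  have cmp: "gdom X \<cdot> (p1 \<cdot> u) = gcod X \<cdot> (p1 \<cdot> v)" "gdom Y \<cdot> (q1 \<cdot> u) = gcod Y \<cdot> (q1 \<cdot> v)"
    if "arr u" "arr v" "cod u = x1" "cod v = x1" "d \<cdot> u = c \<cdot> v" for u v
    using de(1,2)[of u] de(3,4)[of v] that by auto
  define m where "m u v = pbpair C p1 q1 (gcomp C X (p1 \<cdot> u) (p1 \<cdot> v)) (gcomp C Y (q1 \<cdot> u) (q1 \<cdot> v))" for u v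
  have m: "arr (m u v)" "dom (m u v) = dom u" "cod (m u v) = x1"
    "p1 \<cdot> m u v = gcomp C X (p1 \<cdot> u) (p1 \<cdot> v)" "q1 \<cdot> m u v = gcomp C Y (q1 \<cdot> u) (q1 \<cdot> v)"
    if uv: "arr u" "arr v" "dom v = dom u" "cod u = x1" "cod v = x1" "d \<cdot> u = c \<cdot> v" for u v
  proof -
    note cm = cmp[OF uv(1,2,4,5,6)]
    have "f1 F \<cdot> gcomp C X (p1 \<cdot> u) (p1 \<cdot> v) = gcomp C B (f1 F \<cdot> (p1 \<cdot> u)) (f1 F \<cdot> (p1 \<cdot> v))"
      using F s p uv cm by simp
    also have "\<dots> = gcomp C B (f1 G \<cdot> (q1 \<cdot> u)) (f1 G \<cdot> (q1 \<cdot> v))" using sq uv by simp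
    also have "\<dots> = f1 G \<cdot> gcomp C Y (q1 \<cdot> u) (q1 \<cdot> v)" using G s p uv cm by simp
    finally have e: "f1 F \<cdot> gcomp C X (p1 \<cdot> u) (p1 \<cdot> v) = f1 G \<cdot> gcomp C Y (q1 \<cdot> u) (q1 \<cdot> v)" .
    note P = pbpair[OF pb1 _ _ _ _ _ e]
    show "arr (m u v)" "dom (m u v) = dom u" "cod (m u v) = x1"
    "p1 \<cdot> m u v = gcomp C X (p1 \<cdot> u) (p1 \<cdot> v)" "q1 \<cdot> m u v = gcomp C Y (q1 \<cdot> u) (q1 \<cdot> v)"
      unfolding m_def using P g p uv cm F G s by auto
  qed
  obtain r1 r2 where pbr: "is_pullback C d c r1 r2" using pullback_exists[of d c] d c by auto
  have dc: "d \<cdot> m u v = d \<cdot> v" "c \<cdot> m u v = c \<cdot> u"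
    if uv: "arr u" "arr v" "dom v = dom u" "cod u = x1" "cod v = x1" "d \<cdot> u = c \<cdot> v" for u v
  proof -
    note M = m[OF uv] and cm = cmp[OF uv(1,2,4,5,6)]
    show "d \<cdot> m u v = d \<cdot> v" by (rule eq0) (use M uv d c p g cm in \<open>auto simp: de\<close>)
    show "c \<cdot> m u v = c \<cdot> u" by (rule eq0) (use M uv d c p g cm in \<open>auto simp: de\<close>)
  qed
  have ds: "d \<cdot> s' = Idn C x0" "c \<cdot> s' = Idn C x0"
    by (rule eq0; use d c s' p g in \<open>auto simp: de\<close>)+
  have dse: "d \<cdot> (s' \<cdot> z) = z" "c \<cdot> (s' \<cdot> z) = z" if "arr z" "cod z = x0" for z
    using comp_ext[OF ds(1), of z] comp_ext[OF ds(2), of z] that d c s' by auto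
  have di: "d \<cdot> i = c" "c \<cdot> i = d"
    by (rule eq0; use d c i p g in \<open>auto simp: de\<close>)+
  obtain Z where Z: "internal_groupoid C Z" "G0 Z = x0" "G1 Z = x1" "gdom Z = d" "gcod Z = c" "gunit Z = s'"
    and Zm: "\<And>u v. \<lbrakk>arr u; arr v; dom v = dom u; cod u = x1; cod v = x1;
       d \<cdot> u = c \<cdot> v\<rbrakk> \<Longrightarrow> gcomp C Z u v = m u v"
  proof (rule groupoid_from_operation[where m = m and i = i, OF p(13,14) d(1-3) c(1-3) s'(1-3) pbr ds])
    fix u v assume uv: "arr u" "arr v" "dom v = dom u" "cod u = x1" "cod v = x1" "d \<cdot> u = c \<cdot> v"
    show "arr (m u v) \<and> dom (m u v) = dom u \<and> cod (m u v) = x1 \<and> d \<cdot> m u v = d \<cdot> v \<and> c \<cdot> m u v = c \<cdot> u"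
      using m[OF uv] dc[OF uv] by simp
    fix e assume e: "arr e" "cod e = dom u"
    have c2: "d \<cdot> (u \<cdot> e) = c \<cdot> (v \<cdot> e)" by (rule comp_ext2[OF uv(6)]) (use uv e d c in auto)
    have ue: "arr (u \<cdot> e)" "arr (v \<cdot> e)" "dom (v \<cdot> e) = dom (u \<cdot> e)" "cod (u \<cdot> e) = x1" "cod (v \<cdot> e) = x1"
      using uv e by auto
    note M = m[OF uv] and M' = m[OF ue c2] and cm = cmp[OF uv(1,2,4,5,6)]
    show "m u v \<cdot> e = m (u \<cdot> e) (v \<cdot> e)"
      by (rule eq1) (use M M' uv e p g cm comp_ext[OF M(4), of e] comp_ext[OF M(5), of e] in auto)
  next
    fix u assume u: "arr u" "cod u = x1"
    show "m u (s' \<cdot> (d \<cdot> u)) = u"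
      by (rule eq1) (use u d c s' p g in \<open>auto simp: dse m se de\<close>)
    show "m (s' \<cdot> (c \<cdot> u)) u = u"
      by (rule eq1) (use u d c s' p g in \<open>auto simp: dse m se de\<close>)
  next
    fix u v w assume h: "arr u" "arr v" "arr w" "dom v = dom u" "dom w = dom u"
      "cod u = x1" "cod v = x1" "cod w = x1" "d \<cdot> u = c \<cdot> v" "d \<cdot> v = c \<cdot> w"
    have 1: "gdom X \<cdot> (p1 \<cdot> u) = gcod X \<cdot> (p1 \<cdot> v)" "gdom Y \<cdot> (q1 \<cdot> u) = gcod Y \<cdot> (q1 \<cdot> v)"
      "gdom X \<cdot> (p1 \<cdot> v) = gcod X \<cdot> (p1 \<cdot> w)" "gdom Y \<cdot> (q1 \<cdot> v) = gcod Y \<cdot> (q1 \<cdot> w)"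
      using cmp[of u v] cmp[of v w] h by auto
    show "m (m u v) w = m u (m v w)"
      by (rule eq1) (use h p g 1 in \<open>auto simp: dc m\<close>)
  next
    show "m (Idn C x1) i = s' \<cdot> c" "m i (Idn C x1) = s' \<cdot> d"
      by (rule eq1; use p g di d c s' i in \<open>auto simp: m se de\<close>)+
  qed (use i di in auto)
  define P Q where "P = \<lparr>Src = Z, Tgt = X, f0 = p0, f1 = p1\<rparr>" and "Q = \<lparr>Src = Z, Tgt = Y, f0 = q0, f1 = q1\<rparr>"
  have P: "internal_functor C P" unfolding P_def
    by (rule internal_functorI) (use Z g p d c in \<open>auto simp: Zm m\<close>)
  have Q: "internal_functor C Q" unfolding Q_def
    by (rule internal_functorI) (use Z g p d c in \<open>auto simp: Zm m\<close>)
  show ?thesis by (rule that[OF P Q]) (use pb0 pb1 s in \<open>auto simp: P_def Q_def\<close>)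
qed

text \<open>Any pullback of groupoids is isomorphic to the levelwise one, and isomorphisms of groupoids are
isomorphisms at both levels.\<close>

lemma Gpd_pullback_levelwise:
  assumes pb: "is_pullback (Gpd C) F G P Q"
  shows "is_pullback C (f0 F) (f0 G) (f0 P) (f0 Q)" "is_pullback C (f1 F) (f1 G) (f1 P) (f1 Q)"
proof -
  interpret G: category "Gpd C" by (rule Gpd_category)
  have D: "internal_functor C F" "internal_functor C G" "Tgt F = Tgt G"
    using is_pullback_D[OF pb] by auto
  obtain P' Q' where P': "internal_functor C P'" "internal_functor C Q'" "Src P' = Src Q'" "Tgt P' = Src F"
    "Tgt Q' = Src G" and pb0: "is_pullback C (f0 F) (f0 G) (f0 P') (f0 Q')"
    and pb1: "is_pullback C (f1 F) (f1 G) (f1 P') (f1 Q')" using Gpd_pullback_exists[OF D] by blast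
  have "is_pullback (Gpd C) F G P' Q'" by (rule levelwise_pullback[OF D(1,2) P'(1,2) D(3) P'(3-5) pb0 pb1])
  from G.pullback_compare[OF this pb]
  obtain I where I: "is_iso (Gpd C) I" "I \<in> Arr (Gpd C)" "Cod (Gpd C) I = Dom (Gpd C) P'"
    "P' \<bullet> I = P" "Q' \<bullet> I = Q" by metis
  have "f0 P = f0 P' \<cdot> f0 I" "f1 P = f1 P' \<cdot> f1 I" "f0 Q = f0 Q' \<cdot> f0 I" "f1 Q = f1 Q' \<cdot> f1 I"
    using I(4,5) by auto
  then show "is_pullback C (f0 F) (f0 G) (f0 P) (f0 Q)" "is_pullback C (f1 F) (f1 G) (f1 P) (f1 Q)"
    using pullback_iso[OF pb0, of "f0 I"] pullback_iso[OF pb1, of "f1 I"] Gpd_iso_levelwise[OF I(1)] I P' by auto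
qed

end

section \<open>Quotients and regular epimorphisms of internal groupoids\<close>

lemma (in regular_cat) regular_epi_local:
  assumes "f \<in> Arr C" "e \<in> regular_epis C" "a \<in> Arr C" "Cod C a = Dom C f" "f \<cdot> a = e"
  shows "f \<in> regular_epis C"
  by (rule regular_epi_cancel[of f a]) (use assms in auto)

lemma (in regular_cat) split_regular_epi:
  assumes "f \<in> Arr C" "s \<in> Arr C" "Cod C s = Dom C f" "f \<cdot> s = Idn C (Cod C f)"
  shows "f \<in> regular_epis C"
  by (rule regular_epi_local[OF assms(1) _ assms(2-4)]) (use assms idn_regular_epi in auto)

context exact_maltsev
begin

text \<open>A functor that is a regular epimorphism at both levels lifts, locally, an arrow together with a
prescribed lift of its domain. This is where the Mal'tsev condition enters the study of groupoids:
in a general regular category surjectivity on arrows gives no control of the domain.\<close>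

lemma regular_functor_lift:
  assumes F: "internal_functor C F" "f1 F \<in> covers" "Src F = X" "Tgt F = Y"
    and b: "arr b" "dom b = t" "cod b = G1 Y"
    and x: "arr x" "dom x = t" "cod x = G0 X" and bx: "gdom Y \<cdot> b = f0 F \<cdot> x"
  obtains e u where "e \<in> covers" "arr e" "cod e = t" "arr u" "dom u = dom e"
    "cod u = G1 X" "gdom X \<cdot> u = x \<cdot> e" "f1 F \<cdot> u = b \<cdot> e"
proof (rule regular_pushout[where d = "gdom X" and s = "gunit X" and ?q1.0 = "f1 F" and ?q0.0 = "f0 F" and
      d' = "gdom Y" and s' = "gunit Y" and b = b and x = x and t = t and ?X0.0 = "G0 X" and ?X1.0 = "G1 X"])
  have g: "internal_groupoid C X" "internal_groupoid C Y" using F by auto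
  show "gdom X \<cdot> gunit X = Idn C (G0 X)" using gpd_eqs(1) g by simp
  show "gdom Y \<cdot> f1 F = f0 F \<cdot> gdom X" "f1 F \<cdot> gunit X = gunit Y \<cdot> f0 F"
    using functor_gdom_arr[OF F(1,4,3)] by auto
qed (use F b x bx functor_gpd[OF F(1)] that in auto)

text \<open>A composable pair of the quotient lifts to a composable pair of \<open>X\<close>, by the regular pushout property;
so composition descends along the regular epimorphism on composable pairs, and likewise the axioms
hold because they hold on lifts.\<close>

lemma quotient_groupoid:
  assumes X: "internal_groupoid C X"
    and q0: "q0 \<in> covers" "dom q0 = G0 X" and q1: "q1 \<in> covers" "dom q1 = G1 X"
    and kd: "\<And>u v. \<lbrakk>arr u; arr v; dom u = dom v; cod u = G1 X; cod v = G1 X;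
       q1 \<cdot> u = q1 \<cdot> v\<rbrakk>
       \<Longrightarrow> q0 \<cdot> (gdom X \<cdot> u) = q0 \<cdot> (gdom X \<cdot> v)"
    and ku: "\<And>x y. \<lbrakk>arr x; arr y; dom x = dom y; cod x = G0 X; cod y = G0 X;
       q0 \<cdot> x = q0 \<cdot> y\<rbrakk>
       \<Longrightarrow> q1 \<cdot> (gunit X \<cdot> x) = q1 \<cdot> (gunit X \<cdot> y)"
    and ki: "\<And>u v. \<lbrakk>arr u; arr v; dom u = dom v; cod u = G1 X; cod v = G1 X;
       q1 \<cdot> u = q1 \<cdot> v\<rbrakk>
       \<Longrightarrow> q1 \<cdot> (ginv C X \<cdot> u) = q1 \<cdot> (ginv C X \<cdot> v)"
    and km: "\<And>u v u' v'. \<lbrakk>arr u; arr v; arr u'; arr v'; dom v = dom u;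
       dom u' = dom u; dom v' = dom u; cod u = G1 X; cod v = G1 X; cod u' = G1 X; cod v' = G1 X;
       gdom X \<cdot> u = gcod X \<cdot> v; gdom X \<cdot> u' = gcod X \<cdot> v'; q1 \<cdot> u = q1 \<cdot> u';
       q1 \<cdot> v = q1 \<cdot> v'\<rbrakk>
       \<Longrightarrow> q1 \<cdot> gcomp C X u v = q1 \<cdot> gcomp C X u' v'"
  obtains Y where "internal_functor C \<lparr>Src = X, Tgt = Y, f0 = q0, f1 = q1\<rparr>"
proof -
  define y0 y1 where "y0 = cod q0" and "y1 = cod q1"
  have q: "arr q0" "cod q0 = y0" "arr q1" "cod q1 = y1" "y0 \<in> Obj C" "y1 \<in> Obj C"
    using q0 q1 unfolding y0_def y1_def by auto
  note kd' = kd
  have kc: "q0 \<cdot> (gcod X \<cdot> u) = q0 \<cdot> (gcod X \<cdot> v)"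
    if "arr u" "arr v" "dom u = dom v" "cod u = G1 X" "cod v = G1 X" "q1 \<cdot> u = q1 \<cdot> v" for u v
    using kd[of "ginv C X \<cdot> u" "ginv C X \<cdot> v"] ki[OF that] that X by simp
  obtain d where d: "arr d" "dom d = y1" "cod d = y0" "d \<cdot> q1 = q0 \<cdot> gdom X"
  proof (rule glue[OF q1(1), of "q0 \<cdot> gdom X"])
    fix a b assume "arr a" "arr b" "dom a = dom b" "cod a = dom q1" "cod b = dom q1"
      "q1 \<cdot> a = q1 \<cdot> b"
    then show "(q0 \<cdot> gdom X) \<cdot> a = (q0 \<cdot> gdom X) \<cdot> b" using kd[of a b] X q q0 q1 by simp
  qed (use X q q0 q1 in auto)
  obtain c where c: "arr c" "dom c = y1" "cod c = y0" "c \<cdot> q1 = q0 \<cdot> gcod X"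
  proof (rule glue[OF q1(1), of "q0 \<cdot> gcod X"])
    fix a b assume "arr a" "arr b" "dom a = dom b" "cod a = dom q1" "cod b = dom q1"
      "q1 \<cdot> a = q1 \<cdot> b"
    then show "(q0 \<cdot> gcod X) \<cdot> a = (q0 \<cdot> gcod X) \<cdot> b" using kc[of a b] X q q0 q1 by simp
  qed (use X q q0 q1 in auto)
  obtain s where s: "arr s" "dom s = y0" "cod s = y1" "s \<cdot> q0 = q1 \<cdot> gunit X"
  proof (rule glue[OF q0(1), of "q1 \<cdot> gunit X"])
    fix a b assume "arr a" "arr b" "dom a = dom b" "cod a = dom q0" "cod b = dom q0"
      "q0 \<cdot> a = q0 \<cdot> b"
    then show "(q1 \<cdot> gunit X) \<cdot> a = (q1 \<cdot> gunit X) \<cdot> b" using ku[of a b] X q q0 q1 by simp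
  qed (use X q q0 q1 in auto)
  obtain i where i: "arr i" "dom i = y1" "cod i = y1" "i \<cdot> q1 = q1 \<cdot> ginv C X"
  proof (rule glue[OF q1(1), of "q1 \<cdot> ginv C X"])
    fix a b assume "arr a" "arr b" "dom a = dom b" "cod a = dom q1" "cod b = dom q1"
      "q1 \<cdot> a = q1 \<cdot> b"
    then show "(q1 \<cdot> ginv C X) \<cdot> a = (q1 \<cdot> ginv C X) \<cdot> b" using ki[of a b] X q q0 q1 by simp
  qed (use X q q0 q1 in auto)
  have E: "d \<cdot> (q1 \<cdot> z) = q0 \<cdot> (gdom X \<cdot> z)" "c \<cdot> (q1 \<cdot> z) = q0 \<cdot> (gcod X \<cdot> z)"
    "i \<cdot> (q1 \<cdot> z) = q1 \<cdot> (ginv C X \<cdot> z)" if "arr z" "cod z = G1 X" for z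
    using comp_ext[OF d(4), of z] comp_ext[OF c(4), of z] comp_ext[OF i(4), of z] that d c i q q1 q0 X by auto
  have E0: "s \<cdot> (q0 \<cdot> z) = q1 \<cdot> (gunit X \<cdot> z)" if "arr z" "cod z = G0 X" for z
    using comp_ext[OF s(4), of z] that s q q1 q0 X by auto
  have g0: "gdom X \<cdot> gunit X = Idn C (G0 X)" "gcod X \<cdot> gunit X = Idn C (G0 X)" using gpd_eqs X by auto
  have "d \<cdot> (s \<cdot> q0) = q0" "c \<cdot> (s \<cdot> q0) = q0"
    using E(1,2)[of "gunit X"] s(4) g0 X q q0 by simp_all
  then have ds: "d \<cdot> s = Idn C y0" "c \<cdot> s = Idn C y0"
    using regular_epi_epi[OF q0(1), of "d \<cdot> s" "Idn C y0"] regular_epi_epi[OF q0(1), of "c \<cdot> s" "Idn C y0"]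
      d c s q q0 by simp_all
  have "d \<cdot> (i \<cdot> q1) = c \<cdot> q1" "c \<cdot> (i \<cdot> q1) = d \<cdot> q1"
    using E(1,2)[of "ginv C X"] i(4) c(4) d(4) ginv_prop(2,3)[OF X] X by simp_all
  then have di: "d \<cdot> i = c" "c \<cdot> i = d"
    using regular_epi_epi[OF q1(1), of "d \<cdot> i" c] regular_epi_epi[OF q1(1), of "c \<cdot> i" d]
      d c i q by simp_all
  have lift2: "\<exists>e a. e \<in> covers \<and> arr e \<and> cod e = t \<and> arr a \<and> dom a = dom e \<and> cod a = G1 X \<and>
     gdom X \<cdot> a = x \<cdot> e \<and> q1 \<cdot> a = u \<cdot> e"
    if h: "arr u" "dom u = t" "cod u = y1" "arr x" "dom x = t" "cod x = G0 X" "d \<cdot> u = q0 \<cdot> x" for u x t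
  proof (rule regular_pushout[where d = "gdom X" and s = "gunit X" and ?q1.0 = q1 and ?q0.0 = q0 and
      d' = d and s' = s and b = u and x = x and t = t and ?X0.0 = "G0 X" and ?X1.0 = "G1 X"])
    fix e a assume "e \<in> covers" "arr e" "cod e = t" "arr a" "dom a = dom e"
      "cod a = G1 X" "gdom X \<cdot> a = x \<cdot> e" "q1 \<cdot> a = u \<cdot> e"
    then show ?thesis by blast
  qed (use X q q0 q1 d s h g0 in auto)
  obtain p1 p2 where pb: "is_pullback C d c p1 p2" using pullback_exists[of d c] d c by auto
  note D = is_pullback_D[OF pb]
  have gp: "gdom X \<cdot> gpr1 X = gcod X \<cdot> gpr2 X" using is_pullback_D(9)[OF gpd_pullback[OF X]] .
  obtain q2 where q2: "arr q2" "dom q2 = G2 X" "cod q2 = dom p1" "p1 \<cdot> q2 = q1 \<cdot> gpr1 X" "p2 \<cdot> q2 = q1 \<cdot> gpr2 X"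
  proof -
    have "d \<cdot> (q1 \<cdot> gpr1 X) = c \<cdot> (q1 \<cdot> gpr2 X)" using E(1)[of "gpr1 X"] E(2)[of "gpr2 X"] gp X by simp
    then have "\<exists>w. arr w \<and> dom w = dom (q1 \<cdot> gpr1 X) \<and> cod w = dom p1 \<and>
        p1 \<cdot> w = q1 \<cdot> gpr1 X \<and> p2 \<cdot> w = q1 \<cdot> gpr2 X"
      by (intro pullback_lift[OF pb]) (use X q q1 d c in simp_all)
    then show ?thesis using that X q q1 by auto
  qed
  have q2e: "p1 \<cdot> (q2 \<cdot> z) = q1 \<cdot> (gpr1 X \<cdot> z)" "p2 \<cdot> (q2 \<cdot> z) = q1 \<cdot> (gpr2 X \<cdot> z)" if "arr z" "cod z = G2 X" for z
  proof -
    have "p1 \<cdot> (q2 \<cdot> z) = (q1 \<cdot> gpr1 X) \<cdot> z" by (rule comp_ext[OF q2(4)]) (use that D q2 in auto)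
    moreover have "p2 \<cdot> (q2 \<cdot> z) = (q1 \<cdot> gpr2 X) \<cdot> z" by (rule comp_ext[OF q2(5)]) (use that D q2 in auto)
    ultimately show "p1 \<cdot> (q2 \<cdot> z) = q1 \<cdot> (gpr1 X \<cdot> z)" "p2 \<cdot> (q2 \<cdot> z) = q1 \<cdot> (gpr2 X \<cdot> z)"
      using that X q q1 by simp_all
  qed
  have q2r: "q2 \<in> covers"
  proof -
    obtain e1 b where b: "e1 \<in> covers" "arr e1" "cod e1 = dom p2" "arr b" "dom b = dom e1"
      "cod b = dom q1" "q1 \<cdot> b = p2 \<cdot> e1" using cover_lift[OF q1(1), of p2] D c q by auto
    have "d \<cdot> (p1 \<cdot> e1) = c \<cdot> (p2 \<cdot> e1)" by (rule comp_ext2[OF D(9)]) (use D b in auto)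
    then have "d \<cdot> (p1 \<cdot> e1) = q0 \<cdot> (gcod X \<cdot> b)" using E(2)[of b] b q1 by simp
    then obtain e2 a where a: "e2 \<in> covers" "arr e2" "cod e2 = dom e1" "arr a" "dom a = dom e2"
      "cod a = G1 X" "gdom X \<cdot> a = (gcod X \<cdot> b) \<cdot> e2" "q1 \<cdot> a = (p1 \<cdot> e1) \<cdot> e2"
      using lift2[of "p1 \<cdot> e1" "dom e1" "gcod X \<cdot> b"] D(4,6,7) b X d q1(2) by auto
    define w where "w = gpair C X a (b \<cdot> e2)"
    have w: "arr w" "dom w = dom a" "cod w = G2 X" "gpr1 X \<cdot> w = a" "gpr2 X \<cdot> w = b \<cdot> e2"
      using gpair[OF X, of a "b \<cdot> e2"] a b q1 X unfolding w_def by auto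
    have "q2 \<cdot> w = e1 \<cdot> e2"
    proof (rule pullback_eqI[OF pb])
      show "p1 \<cdot> (q2 \<cdot> w) = p1 \<cdot> (e1 \<cdot> e2)" using q2e w a b D by simp
      show "p2 \<cdot> (q2 \<cdot> w) = p2 \<cdot> (e1 \<cdot> e2)" using q2e w a b D comp_ext[OF b(7), of e2] q q1 by simp
    qed (use w q2 a b D in auto)
    then show ?thesis
      using regular_epi_local[OF q2(1) regular_epi_comp[OF a(1) b(1)] w(1)] a w q2 by simp
  qed
  obtain k where k: "arr k" "dom k = dom p1" "cod k = y1" "k \<cdot> q2 = q1 \<cdot> gmult X"
  proof (rule glue[OF q2r, of "q1 \<cdot> gmult X"])
    fix a b assume ab: "arr a" "arr b" "dom a = dom b" "cod a = dom q2" "cod b = dom q2"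
      "q2 \<cdot> a = q2 \<cdot> b"
    have "q1 \<cdot> gcomp C X (gpr1 X \<cdot> a) (gpr2 X \<cdot> a) = q1 \<cdot> gcomp C X (gpr1 X \<cdot> b) (gpr2 X \<cdot> b)"
    proof (rule km)
      show "q1 \<cdot> (gpr1 X \<cdot> a) = q1 \<cdot> (gpr1 X \<cdot> b)" using q2e(1)[of a] q2e(1)[of b] ab q2 by simp
      show "q1 \<cdot> (gpr2 X \<cdot> a) = q1 \<cdot> (gpr2 X \<cdot> b)" using q2e(2)[of a] q2e(2)[of b] ab q2 by simp
      show "gdom X \<cdot> (gpr1 X \<cdot> a) = gcod X \<cdot> (gpr2 X \<cdot> a)" "gdom X \<cdot> (gpr1 X \<cdot> b) = gcod X \<cdot> (gpr2 X \<cdot> b)"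
        using gmult_gcomp(2)[OF X] ab q2 by auto
    qed (use ab q2 X in auto)
    then show "(q1 \<cdot> gmult X) \<cdot> a = (q1 \<cdot> gmult X) \<cdot> b"
      using gmult_gcomp(1)[OF X, of a] gmult_gcomp(1)[OF X, of b] ab q2 q q1 X by simp
  qed (use X q q1 q2 in auto)
  define m where "m u v = k \<cdot> pbpair C p1 p2 u v" for u v
  have mA: "arr (m u v)" "dom (m u v) = dom u" "cod (m u v) = y1"
    if "arr u" "arr v" "dom v = dom u" "cod u = y1" "cod v = y1" "d \<cdot> u = c \<cdot> v" for u v
    using pbpair[OF pb that(1-3) _ _ that(6)] that d c k D unfolding m_def by auto
  have mnat: "m u v \<cdot> e = m (u \<cdot> e) (v \<cdot> e)"
    if "arr u" "arr v" "dom v = dom u" "cod u = y1" "cod v = y1" "d \<cdot> u = c \<cdot> v"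
      "arr e" "cod e = dom u" for u v e
    using pbpair[OF pb that(1-3) _ _ that(6)] pbpair_comp[OF pb that(1-3) _ _ that(6-8)] that d c k D
    unfolding m_def by auto
  have K: "m (q1 \<cdot> a) (q1 \<cdot> b) = q1 \<cdot> gcomp C X a b"
    if h: "arr a" "arr b" "dom b = dom a" "cod a = G1 X" "cod b = G1 X" "gdom X \<cdot> a = gcod X \<cdot> b" for a b
  proof -
    note G = gpair[OF X h]
    have cc: "d \<cdot> (q1 \<cdot> a) = c \<cdot> (q1 \<cdot> b)" using E h by simp
    note P = pbpair[OF pb _ _ _ _ _ cc]
    have "pbpair C p1 p2 (q1 \<cdot> a) (q1 \<cdot> b) = q2 \<cdot> gpair C X a b"
      by (rule pullback_eqI[OF pb]) (use P G h q q1 d c q2 q2e D in auto)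
    then have "m (q1 \<cdot> a) (q1 \<cdot> b) = k \<cdot> (q2 \<cdot> gpair C X a b)" unfolding m_def by simp
    also have "\<dots> = q1 \<cdot> gcomp C X a b"
      using comp_ext[OF k(4), of "gpair C X a b"] G k q2 q q1 X unfolding gcomp_def by simp
    finally show ?thesis .
  qed
  have lift1: "\<exists>e a. e \<in> covers \<and> arr e \<and> cod e = dom u \<and> arr a \<and> dom a = dom e \<and> cod a = G1 X \<and>
     q1 \<cdot> a = u \<cdot> e" if "arr u" "cod u = y1" for u
    using cover_lift[OF q1(1) that(1)] that q q1 by metis
  have lift3: "\<exists>e a b f. e \<in> covers \<and> arr e \<and> cod e = dom u \<and> arr a \<and> dom a = dom e \<and> cod a = G1 X \<and>
     arr b \<and> dom b = dom e \<and> cod b = G1 X \<and> arr f \<and> dom f = dom e \<and> cod f = G1 X \<and>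
     gdom X \<cdot> a = gcod X \<cdot> b \<and> gdom X \<cdot> b = gcod X \<cdot> f \<and> q1 \<cdot> a = u \<cdot> e \<and> q1 \<cdot> b = v \<cdot> e \<and> q1 \<cdot> f = w \<cdot> e"
    if h: "arr u" "arr v" "arr w" "dom v = dom u" "dom w = dom u"
       "cod u = y1" "cod v = y1" "cod w = y1" "d \<cdot> u = c \<cdot> v" "d \<cdot> v = c \<cdot> w" for u v w
  proof -
    obtain e1 f where f: "e1 \<in> covers" "arr e1" "cod e1 = dom w" "arr f" "dom f = dom e1" "cod f = G1 X"
      "q1 \<cdot> f = w \<cdot> e1" using lift1[OF h(3,8)] by blast
    have "d \<cdot> (v \<cdot> e1) = c \<cdot> (w \<cdot> e1)" by (rule comp_ext2[OF h(10)]) (use h f d c in auto)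
    then have "d \<cdot> (v \<cdot> e1) = q0 \<cdot> (gcod X \<cdot> f)" using f(7) E(2)[of f] f by simp
    then obtain e2 b where b: "e2 \<in> covers" "arr e2" "cod e2 = dom e1" "arr b" "dom b = dom e2" "cod b = G1 X"
      "gdom X \<cdot> b = (gcod X \<cdot> f) \<cdot> e2" "q1 \<cdot> b = (v \<cdot> e1) \<cdot> e2"
      using lift2[of "v \<cdot> e1" "dom e1" "gcod X \<cdot> f"] h f X by auto
    have "d \<cdot> (u \<cdot> (e1 \<cdot> e2)) = c \<cdot> (v \<cdot> (e1 \<cdot> e2))" by (rule comp_ext2[OF h(9)]) (use h f b d c in auto)
    then have "d \<cdot> (u \<cdot> (e1 \<cdot> e2)) = q0 \<cdot> (gcod X \<cdot> b)" using b(8) E(2)[of b] h f b by simp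
    then obtain e3 a where a: "e3 \<in> covers" "arr e3" "cod e3 = dom e2" "arr a" "dom a = dom e3" "cod a = G1 X"
      "gdom X \<cdot> a = (gcod X \<cdot> b) \<cdot> e3" "q1 \<cdot> a = (u \<cdot> (e1 \<cdot> e2)) \<cdot> e3"
      using lift2[of "u \<cdot> (e1 \<cdot> e2)" "dom e2" "gcod X \<cdot> b"] h f b X by auto
    have r: "e1 \<cdot> (e2 \<cdot> e3) \<in> covers" using regular_epi_comp f b a by simp
    have "gdom X \<cdot> (b \<cdot> e3) = gcod X \<cdot> ((f \<cdot> e2) \<cdot> e3)"
      using comp_ext[OF b(7), of e3] a b f X by simp
    moreover have "q1 \<cdot> (b \<cdot> e3) = v \<cdot> (e1 \<cdot> (e2 \<cdot> e3))"
      using comp_ext[OF b(8), of e3] a b f h q q1 X by simp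
    moreover have "q1 \<cdot> ((f \<cdot> e2) \<cdot> e3) = w \<cdot> (e1 \<cdot> (e2 \<cdot> e3))"
      using comp_ext[OF f(7), of "e2 \<cdot> e3"] a b f h q q1 X by simp
    ultimately show ?thesis
      by (intro exI[of _ "e1 \<cdot> (e2 \<cdot> e3)"] exI[of _ a] exI[of _ "b \<cdot> e3"] exI[of _ "(f \<cdot> e2) \<cdot> e3"])
        (use r a b f h q q1 X in simp)
  qed
  obtain Y where Y: "internal_groupoid C Y" "G0 Y = y0" "G1 Y = y1" "gdom Y = d" "gcod Y = c" "gunit Y = s"
    and Ym: "\<And>u v. \<lbrakk>arr u; arr v; dom v = dom u; cod u = y1; cod v = y1;
       d \<cdot> u = c \<cdot> v\<rbrakk> \<Longrightarrow> gcomp C Y u v = m u v"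
  proof (rule groupoid_from_operation[where m = m and i = i, OF q(5,6) d(1-3) c(1-3) s(1-3) pb ds])
    have M: "d \<cdot> m u v = d \<cdot> v \<and> c \<cdot> m u v = c \<cdot> u"
      if uv: "arr u" "arr v" "dom v = dom u" "cod u = y1" "cod v = y1" "d \<cdot> u = c \<cdot> v" for u v
    proof -
      have "d \<cdot> v = c \<cdot> (s \<cdot> (d \<cdot> v))" using comp_ext[OF ds(2), of "d \<cdot> v"] uv d c s q by simp
      then obtain e a b f where l: "e \<in> covers" "arr e" "cod e = dom u" "arr a" "dom a = dom e" "cod a = G1 X"
       "arr b" "dom b = dom e" "cod b = G1 X" "gdom X \<cdot> a = gcod X \<cdot> b" "q1 \<cdot> a = u \<cdot> e" "q1 \<cdot> b = v \<cdot> e"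
        using lift3[of u v "s \<cdot> (d \<cdot> v)"] uv d s by auto
      have m1: "m u v \<cdot> e = q1 \<cdot> gcomp C X a b" using mnat[OF uv] K[of a b] l by simp
      note A = mA[OF uv]
      have "(d \<cdot> m u v) \<cdot> e = (d \<cdot> v) \<cdot> e"
        using m1 A uv l d E(1)[of "gcomp C X a b"] E(1)[of b] X by simp
      moreover have "(c \<cdot> m u v) \<cdot> e = (c \<cdot> u) \<cdot> e"
        using m1 A uv l c E(2)[of "gcomp C X a b"] E(2)[of a] X by simp
      ultimately show ?thesis
        using regular_epi_epi[OF l(1), of "d \<cdot> m u v" "d \<cdot> v"] regular_epi_epi[OF l(1), of "c \<cdot> m u v" "c \<cdot> u"]
          A uv l d c by simp
    qed
    {
      fix u v assume uv: "arr u" "arr v" "dom v = dom u" "cod u = y1" "cod v = y1" "d \<cdot> u = c \<cdot> v"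
      show "arr (m u v) \<and> dom (m u v) = dom u \<and> cod (m u v) = y1 \<and> d \<cdot> m u v = d \<cdot> v \<and> c \<cdot> m u v = c \<cdot> u"
        using mA[OF uv] M[OF uv] by simp
      fix e assume e: "arr e" "cod e = dom u"
      show "m u v \<cdot> e = m (u \<cdot> e) (v \<cdot> e)" by (rule mnat[OF uv e])
    next
      fix u assume u: "arr u" "cod u = y1"
      obtain e a where l: "e \<in> covers" "arr e" "cod e = dom u" "arr a" "dom a = dom e" "cod a = G1 X"
        "q1 \<cdot> a = u \<cdot> e" using lift1[OF u] by blast
      have dse: "d \<cdot> (s \<cdot> z) = z" "c \<cdot> (s \<cdot> z) = z" if "arr z" "cod z = y0" for z
        using comp_ext[OF ds(1), of z] comp_ext[OF ds(2), of z] that d c s by auto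
      have sd: "s \<cdot> (d \<cdot> (u \<cdot> e)) = q1 \<cdot> (gunit X \<cdot> (gdom X \<cdot> a))" "s \<cdot> (c \<cdot> (u \<cdot> e)) = q1 \<cdot> (gunit X \<cdot> (gcod X \<cdot> a))"
        using E[of a] E0[of "gdom X \<cdot> a"] E0[of "gcod X \<cdot> a"] l X by simp_all
      have A: "d \<cdot> u = c \<cdot> (s \<cdot> (d \<cdot> u))" "d \<cdot> (s \<cdot> (c \<cdot> u)) = c \<cdot> u" using dse u d c by auto
      have "m u (s \<cdot> (d \<cdot> u)) \<cdot> e = m (q1 \<cdot> a) (q1 \<cdot> (gunit X \<cdot> (gdom X \<cdot> a)))"
        using mnat[OF u(1) _ _ u(2) _ A(1), of e] sd u l d s by simp
      also have "\<dots> = u \<cdot> e" using K[of a "gunit X \<cdot> (gdom X \<cdot> a)"] l X by simp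
      finally have 1: "m u (s \<cdot> (d \<cdot> u)) \<cdot> e = u \<cdot> e" .
      show "m u (s \<cdot> (d \<cdot> u)) = u"
        by (rule regular_epi_epi[OF l(1) _ _ _ _ 1]) (use mA[OF u(1) _ _ u(2) _ A(1)] u l d s in auto)
      have "m (s \<cdot> (c \<cdot> u)) u \<cdot> e = m (q1 \<cdot> (gunit X \<cdot> (gcod X \<cdot> a))) (q1 \<cdot> a)"
        using mnat[OF _ u(1) _ _ u(2) A(2), of e] sd u l c s by simp
      also have "\<dots> = u \<cdot> e" using K[of "gunit X \<cdot> (gcod X \<cdot> a)" a] l X by simp
      finally have 2: "m (s \<cdot> (c \<cdot> u)) u \<cdot> e = u \<cdot> e" .
      show "m (s \<cdot> (c \<cdot> u)) u = u"
        by (rule regular_epi_epi[OF l(1) _ _ _ _ 2]) (use mA[OF _ u(1) _ _ u(2) A(2)] u l c s in auto)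
    next
      fix u v w assume h: "arr u" "arr v" "arr w" "dom v = dom u" "dom w = dom u"
        "cod u = y1" "cod v = y1" "cod w = y1" "d \<cdot> u = c \<cdot> v" "d \<cdot> v = c \<cdot> w"
      obtain e a b f where l: "e \<in> covers" "arr e" "cod e = dom u" "arr a" "dom a = dom e" "cod a = G1 X"
       "arr b" "dom b = dom e" "cod b = G1 X" "arr f" "dom f = dom e" "cod f = G1 X"
       "gdom X \<cdot> a = gcod X \<cdot> b" "gdom X \<cdot> b = gcod X \<cdot> f" "q1 \<cdot> a = u \<cdot> e" "q1 \<cdot> b = v \<cdot> e" "q1 \<cdot> f = w \<cdot> e"
        using lift3[OF h] by blast
      have uv: "arr u" "arr v" "dom v = dom u" "cod u = y1" "cod v = y1" "d \<cdot> u = c \<cdot> v"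
        and vw: "arr v" "arr w" "dom w = dom v" "cod v = y1" "cod w = y1" "d \<cdot> v = c \<cdot> w"
        using h by auto
      note 1 = mA[OF uv] M[OF uv] and 2 = mA[OF vw] M[OF vw]
      have c1: "d \<cdot> m u v = c \<cdot> w" and c2: "d \<cdot> u = c \<cdot> m v w" using 1 2 h by auto
      have e1: "m u v \<cdot> e = q1 \<cdot> gcomp C X a b" using mnat[OF uv] K[of a b] l by simp
      have e2: "m v w \<cdot> e = q1 \<cdot> gcomp C X b f" using mnat[OF vw] K[of b f] l h by simp
      have "m (m u v) w \<cdot> e = m (m u v \<cdot> e) (w \<cdot> e)" by (rule mnat) (use 1 2 h l c1 in auto)
      also have "\<dots> = q1 \<cdot> gcomp C X a (gcomp C X b f)"
        using K[of "gcomp C X a b" f] e1 l X by simp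
      also have "\<dots> = m (u \<cdot> e) (m v w \<cdot> e)"
        using K[of a "gcomp C X b f"] e2 l X by simp
      also have "\<dots> = m u (m v w) \<cdot> e" by (rule mnat[symmetric]) (use 1 2 h l c2 in auto)
      finally have e: "m (m u v) w \<cdot> e = m u (m v w) \<cdot> e" .
      show "m (m u v) w = m u (m v w)"
        by (rule regular_epi_epi[OF l(1) _ _ _ _ e])
          (use mA[of "m u v" w] mA[of u "m v w"] 1 2 h l c1 c2 in auto)
    next
      have ie: "i \<cdot> q1 = q1 \<cdot> ginv C X" by (rule i)
      have 1: "m (Idn C y1) i \<cdot> q1 = (s \<cdot> c) \<cdot> q1"
      proof -
        have "m (Idn C y1) i \<cdot> q1 = m (q1 \<cdot> Idn C (G1 X)) (q1 \<cdot> ginv C X)"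
          using mnat[of "Idn C y1" i q1] i di q d q1 by simp
        also have "\<dots> = q1 \<cdot> gcomp C X (Idn C (G1 X)) (ginv C X)"
          by (rule K) (use X ginv_prop[OF X] in auto)
        also have "\<dots> = (s \<cdot> c) \<cdot> q1" using ginv_prop(4)[OF X] E0[of "gcod X"] c s q q1 X by simp
        finally show ?thesis .
      qed
      show "m (Idn C y1) i = s \<cdot> c"
        by (rule regular_epi_epi[OF q1(1) _ _ _ _ 1]) (use mA[of "Idn C y1" i] i di q d c s in auto)
      have 2: "m i (Idn C y1) \<cdot> q1 = (s \<cdot> d) \<cdot> q1"
      proof -
        have "m i (Idn C y1) \<cdot> q1 = m (q1 \<cdot> ginv C X) (q1 \<cdot> Idn C (G1 X))"
          using mnat[of i "Idn C y1" q1] i di q c q1 by simp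
        also have "\<dots> = q1 \<cdot> gcomp C X (ginv C X) (Idn C (G1 X))"
          by (rule K) (use X ginv_prop[OF X] in auto)
        also have "\<dots> = (s \<cdot> d) \<cdot> q1" using ginv_prop(5)[OF X] E0[of "gdom X"] d s q q1 X by simp
        finally show ?thesis .
      qed
      show "m i (Idn C y1) = s \<cdot> d"
        by (rule regular_epi_epi[OF q1(1) _ _ _ _ 2]) (use mA[of i "Idn C y1"] i di q d c s in auto)
    }
  qed (use i di in auto)
  have "internal_functor C \<lparr>Src = X, Tgt = Y, f0 = q0, f1 = q1\<rparr>"
    by (rule internal_functorI) (use X Y q q0 q1 d c K E in \<open>auto simp: Ym\<close>)
  then show ?thesis by (rule that)
qed

lemma functor_descent:
  assumes Q: "internal_functor C Q" "Src Q = X" "Tgt Q = Y" and r: "f0 Q \<in> covers" "f1 Q \<in> covers"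
    and H: "internal_functor C H" "Src H = X" "Tgt H = Z"
    and k0: "arr k0" "dom k0 = G0 Y" "cod k0 = G0 Z" "k0 \<cdot> f0 Q = f0 H"
    and k1: "arr k1" "dom k1 = G1 Y" "cod k1 = G1 Z" "k1 \<cdot> f1 Q = f1 H"
  shows "internal_functor C \<lparr>Src = Y, Tgt = Z, f0 = k0, f1 = k1\<rparr>"
proof -
  have g: "internal_groupoid C X" "internal_groupoid C Y" "internal_groupoid C Z" using Q H by auto
  have k0e: "k0 \<cdot> (f0 Q \<cdot> z) = f0 H \<cdot> z" if "arr z" "cod z = G0 X" for z
    using comp_ext[OF k0(4), of z] k0 Q that by auto
  have k1e: "k1 \<cdot> (f1 Q \<cdot> z) = f1 H \<cdot> z" if "arr z" "cod z = G1 X" for z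
    using comp_ext[OF k1(4), of z] k1 Q that by auto
  note qd = functor_gdom_arr[OF Q(1,3,2)] and hd = functor_gdom_arr[OF H(1,3,2)]
  have d: "gdom Z \<cdot> k1 = k0 \<cdot> gdom Y"
    by (rule regular_epi_epi[OF r(2)]) (use Q H g k0 k1 k0e k1e qd hd in auto)
  have c: "gcod Z \<cdot> k1 = k0 \<cdot> gcod Y"
    by (rule regular_epi_epi[OF r(2)]) (use Q H g k0 k1 k0e k1e qd hd in auto)
  show ?thesis
  proof (rule internal_functorI[OF g(2,3) k0(1-3) k1(1-3) d c])
    fix u v assume uv: "arr u" "arr v" "dom v = dom u" "cod u = G1 Y" "cod v = G1 Y"
      "gdom Y \<cdot> u = gcod Y \<cdot> v"
    obtain e1 b where b: "e1 \<in> covers" "arr e1" "cod e1 = dom v" "arr b" "dom b = dom e1"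
      "cod b = G1 X" "f1 Q \<cdot> b = v \<cdot> e1" using cover_lift[OF r(2) uv(2)] uv Q by auto
    have "gdom Y \<cdot> (u \<cdot> e1) = gcod Y \<cdot> (v \<cdot> e1)" by (rule comp_ext2[OF uv(6)]) (use uv b g in auto)
    also have "\<dots> = gcod Y \<cdot> (f1 Q \<cdot> b)" using b by simp
    also have "\<dots> = f0 Q \<cdot> (gcod X \<cdot> b)" using functor_gdom(2)[OF Q(1,3) b(4)] b Q by simp
    finally have "gdom Y \<cdot> (u \<cdot> e1) = f0 Q \<cdot> (gcod X \<cdot> b)" .
    from regular_functor_lift[OF Q(1) r(2) Q(2,3) _ _ _ _ _ _ this, of "dom e1"]
    obtain e2 a where a: "e2 \<in> covers" "arr e2" "cod e2 = dom e1" "arr a" "dom a = dom e2"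
      "cod a = G1 X" "gdom X \<cdot> a = (gcod X \<cdot> b) \<cdot> e2" "f1 Q \<cdot> a = (u \<cdot> e1) \<cdot> e2"
      using uv b g by auto
    define e where "e = e1 \<cdot> e2"
    have e: "e \<in> covers" "arr e" "cod e = dom u" "dom e = dom e2"
      unfolding e_def using regular_epi_comp a b uv by auto
    define b' where "b' = b \<cdot> e2"
    have b': "arr b'" "dom b' = dom e2" "cod b' = G1 X" "f1 Q \<cdot> b' = v \<cdot> e" "f1 Q \<cdot> a = u \<cdot> e"
      "gdom X \<cdot> a = gcod X \<cdot> b'"
      unfolding b'_def e_def using a b uv g Q comp_ext[OF b(7), of e2] by auto
    have cp: "gdom Z \<cdot> (k1 \<cdot> u) = gcod Z \<cdot> (k1 \<cdot> v)"
      using comp_ext2[OF d, of u] comp_ext2[OF c, of v] uv k0 k1 g by auto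
    have "(k1 \<cdot> gcomp C Y u v) \<cdot> e = k1 \<cdot> (gcomp C Y (f1 Q \<cdot> a) (f1 Q \<cdot> b'))"
      using uv g k1 e b' by simp
    also have "\<dots> = k1 \<cdot> (f1 Q \<cdot> gcomp C X a b')" using b' a Q by simp
    also have "\<dots> = f1 H \<cdot> gcomp C X a b'" using k1e b' a g by simp
    also have "\<dots> = gcomp C Z (f1 H \<cdot> a) (f1 H \<cdot> b')" using H b' a by simp
    also have "\<dots> = gcomp C Z (k1 \<cdot> (u \<cdot> e)) (k1 \<cdot> (v \<cdot> e))" using k1e[of a] k1e[of b'] b' a by simp
    also have "\<dots> = gcomp C Z (k1 \<cdot> u) (k1 \<cdot> v) \<cdot> e" using k1 e cp uv g by simp
    finally have e': "(k1 \<cdot> gcomp C Y u v) \<cdot> e = gcomp C Z (k1 \<cdot> u) (k1 \<cdot> v) \<cdot> e" .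
    show "k1 \<cdot> gcomp C Y u v = gcomp C Z (k1 \<cdot> u) (k1 \<cdot> v)"
      by (rule regular_epi_epi[OF e(1) _ _ _ _ e']) (use uv k1 e cp g in auto)
  qed
qed

text \<open>The kernel pair is computed levelwise, and a functor out of the domain descends because each of its
components does.\<close>

lemma levelwise_regular_epi:
  assumes Q: "internal_functor C Q" and r: "f0 Q \<in> covers" "f1 Q \<in> covers"
  shows "Q \<in> regular_epis (Gpd C)"
proof -
  interpret G: category "Gpd C" by (rule Gpd_category)
  obtain P R where P: "internal_functor C P" "internal_functor C R" "Src P = Src R" "Tgt P = Src Q"
    "Tgt R = Src Q" and pb0: "is_pullback C (f0 Q) (f0 Q) (f0 P) (f0 R)"
    and pb1: "is_pullback C (f1 Q) (f1 Q) (f1 P) (f1 R)" using Gpd_pullback_exists[OF Q Q refl] by blast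
  have pb: "is_pullback (Gpd C) Q Q P R" by (rule levelwise_pullback[OF Q Q P(1,2) refl P(3-5) pb0 pb1])
  have c0: "is_coequalizer C (f0 P) (f0 R) (f0 Q)" by (rule regular_epi_coequalizer_of_kernel_pair[OF r(1) pb0])
  have c1: "is_coequalizer C (f1 P) (f1 R) (f1 Q)" by (rule regular_epi_coequalizer_of_kernel_pair[OF r(2) pb1])
  have "is_coequalizer (Gpd C) P R Q" unfolding is_coequalizer_def
  proof (intro conjI allI ballI impI)
    show "Q \<bullet> P = Q \<bullet> R" using is_pullback_D(9)[OF pb] .
    fix Z H assume "H \<in> Hom (Gpd C) (Cod (Gpd C) P) Z" and e: "H \<bullet> P = H \<bullet> R"
    then have H: "internal_functor C H" "Src H = Src Q" "Tgt H = Z" using P by auto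
    have e: "f0 H \<cdot> f0 P = f0 H \<cdot> f0 R" "f1 H \<cdot> f1 P = f1 H \<cdot> f1 R"
      using arg_cong[OF e, of f0] arg_cong[OF e, of f1] by auto
    obtain k0 where k0: "arr k0" "dom k0 = G0 (Tgt Q)" "cod k0 = G0 Z" "k0 \<cdot> f0 Q = f0 H"
      using coequalizer_lift[OF c0, of "f0 H"] e H Q P by auto
    obtain k1 where k1: "arr k1" "dom k1 = G1 (Tgt Q)" "cod k1 = G1 Z" "k1 \<cdot> f1 Q = f1 H"
      using coequalizer_lift[OF c1, of "f1 H"] e H Q P by auto
    have K: "internal_functor C \<lparr>Src = Tgt Q, Tgt = Z, f0 = k0, f1 = k1\<rparr>" (is "internal_functor C ?K")
      by (rule functor_descent[OF Q refl refl r H k0 k1])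
    show "\<exists>!K. K \<in> Hom (Gpd C) (Cod (Gpd C) Q) Z \<and> K \<bullet> Q = H"
    proof (rule ex1I[of _ ?K])
      show "?K \<in> Hom (Gpd C) (Cod (Gpd C) Q) Z \<and> ?K \<bullet> Q = H"
        using K k0 k1 H by (auto intro!: functor_eqI)
      fix K' assume "K' \<in> Hom (Gpd C) (Cod (Gpd C) Q) Z \<and> K' \<bullet> Q = H"
      then have K': "internal_functor C K'" "Src K' = Tgt Q" "Tgt K' = Z" "K' \<bullet> Q = H" by auto
      have ke: "f0 K' \<cdot> f0 Q = f0 H" "f1 K' \<cdot> f1 Q = f1 H"
        using arg_cong[OF K'(4), of f0] arg_cong[OF K'(4), of f1] by auto
      have "f0 K' = k0" by (rule regular_epi_epi[OF r(1)]) (use K' k0 ke Q in auto)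
      moreover have "f1 K' = k1" by (rule regular_epi_epi[OF r(2)]) (use K' k1 ke Q in auto)
      ultimately show "K' = ?K" using K' by (auto intro!: functor_eqI)
    qed
  qed (use P Q in auto)
  then show ?thesis by (rule G.regular_epiI)
qed

text \<open>Factor the components of \<open>F\<close> through their images. The images form a quotient groupoid \<open>Y\<close>, and \<open>F\<close>
being a coequalizer forces the monomorphism \<open>Y \<rightarrow> B\<close> to split, so that it is a regular epimorphism
at both levels.\<close>

lemma regular_epi_levelwise:
  assumes "F \<in> regular_epis (Gpd C)"
  shows "internal_functor C F" "f0 F \<in> covers" "f1 F \<in> covers"
proof -
  interpret G: category "Gpd C" by (rule Gpd_category)
  obtain U V where co: "is_coequalizer (Gpd C) U V F" using assms unfolding regular_epis_def by blast
  then have UV: "internal_functor C U" "internal_functor C V" "Src U = Src V" "Tgt U = Tgt V"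
    "internal_functor C F" "Src F = Tgt U" and eq: "F \<bullet> U = F \<bullet> V"
    unfolding is_coequalizer_def by auto
  note eqG = eq
  define X B where "X = Src F" and "B = Tgt F"
  have X: "internal_groupoid C X" "internal_groupoid C B" using UV unfolding X_def B_def by auto
  have s: "Src F = X" "Tgt F = B" "Tgt U = X" "Tgt V = X" using UV X_def B_def by auto
  have eq: "f0 F \<cdot> f0 U = f0 F \<cdot> f0 V" "f1 F \<cdot> f1 U = f1 F \<cdot> f1 V"
    using arg_cong[OF eq, of f0] arg_cong[OF eq, of f1] by auto
  show F: "internal_functor C F" by (rule UV)
  obtain q0 m0 where m0: "q0 \<in> covers" "dom q0 = dom (f0 F)" "arr m0" "dom m0 = cod q0"
    "cod m0 = cod (f0 F)" "m0 \<cdot> q0 = f0 F" "monic C m0" using image_exists[of "f0 F"] F by auto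
  obtain q1 m1 where m1: "q1 \<in> covers" "dom q1 = dom (f1 F)" "arr m1" "dom m1 = cod q1"
    "cod m1 = cod (f1 F)" "m1 \<cdot> q1 = f1 F" "monic C m1" using image_exists[of "f1 F"] F by auto
  have qa: "arr q0" "arr q1" "dom q0 = G0 X" "dom q1 = G1 X" using m0 m1 F s by auto
  have i0: "q0 \<cdot> x = q0 \<cdot> y \<longleftrightarrow> f0 F \<cdot> x = f0 F \<cdot> y"
    if "arr x" "arr y" "dom x = dom y" "cod x = G0 X" "cod y = G0 X" for x y
  proof -
    have "m0 \<cdot> (q0 \<cdot> x) = f0 F \<cdot> x" "m0 \<cdot> (q0 \<cdot> y) = f0 F \<cdot> y"
      by (rule comp_ext[OF m0(6)]; use m0 qa that in auto)+
    then show ?thesis using monicD[OF m0(7), of "q0 \<cdot> x" "q0 \<cdot> y"] m0 qa that by auto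
  qed
  have i1: "q1 \<cdot> x = q1 \<cdot> y \<longleftrightarrow> f1 F \<cdot> x = f1 F \<cdot> y"
    if "arr x" "arr y" "dom x = dom y" "cod x = G1 X" "cod y = G1 X" for x y
  proof -
    have "m1 \<cdot> (q1 \<cdot> x) = f1 F \<cdot> x" "m1 \<cdot> (q1 \<cdot> y) = f1 F \<cdot> y"
      by (rule comp_ext[OF m1(6)]; use m1 qa that in auto)+
    then show ?thesis using monicD[OF m1(7), of "q1 \<cdot> x" "q1 \<cdot> y"] m1 qa that by auto
  qed
  obtain Y where Q: "internal_functor C \<lparr>Src = X, Tgt = Y, f0 = q0, f1 = q1\<rparr>" (is "internal_functor C ?Q")
  proof (rule quotient_groupoid[OF X(1) m0(1) qa(3) m1(1) qa(4)])
    fix u v assume uv: "arr u" "arr v" "dom u = dom v" "cod u = G1 X" "cod v = G1 X" "q1 \<cdot> u = q1 \<cdot> v"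
    then have e: "f1 F \<cdot> u = f1 F \<cdot> v" using i1 by simp
    have "gdom B \<cdot> (f1 F \<cdot> u) = gdom B \<cdot> (f1 F \<cdot> v)" using e by simp
    then show "q0 \<cdot> (gdom X \<cdot> u) = q0 \<cdot> (gdom X \<cdot> v)" using i0 uv X F s by simp
    have "ginv C B \<cdot> (f1 F \<cdot> u) = ginv C B \<cdot> (f1 F \<cdot> v)" using e by simp
    then show "q1 \<cdot> (ginv C X \<cdot> u) = q1 \<cdot> (ginv C X \<cdot> v)" using i1 uv X F s by simp
  next
    fix x y assume xy: "arr x" "arr y" "dom x = dom y" "cod x = G0 X" "cod y = G0 X" "q0 \<cdot> x = q0 \<cdot> y"
    then have e: "f0 F \<cdot> x = f0 F \<cdot> y" using i0 by simp
    then show "q1 \<cdot> (gunit X \<cdot> x) = q1 \<cdot> (gunit X \<cdot> y)" using i1 xy X F s by simp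
  next
    fix u v u' v' assume h: "arr u" "arr v" "arr u'" "arr v'" "dom v = dom u"
       "dom u' = dom u" "dom v' = dom u" "cod u = G1 X" "cod v = G1 X"
       "cod u' = G1 X" "cod v' = G1 X" "gdom X \<cdot> u = gcod X \<cdot> v" "gdom X \<cdot> u' = gcod X \<cdot> v'"
       "q1 \<cdot> u = q1 \<cdot> u'" "q1 \<cdot> v = q1 \<cdot> v'"
    then have "f1 F \<cdot> u = f1 F \<cdot> u'" "f1 F \<cdot> v = f1 F \<cdot> v'" using i1 by auto
    then show "q1 \<cdot> gcomp C X u v = q1 \<cdot> gcomp C X u' v'" using i1 h X F s by simp
  qed
  have gY: "internal_groupoid C Y" "G0 Y = cod q0" "G1 Y = cod q1"
    using functor_gpd(2)[OF Q] functor_arr[OF Q] by auto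
  have M: "internal_functor C \<lparr>Src = Y, Tgt = B, f0 = m0, f1 = m1\<rparr>" (is "internal_functor C ?M")
    by (rule functor_descent[OF Q _ _ _ _ F]) (use m0 m1 gY F s in auto)
  have "f0 F \<cdot> f0 U = m0 \<cdot> (q0 \<cdot> f0 U)" "f0 F \<cdot> f0 V = m0 \<cdot> (q0 \<cdot> f0 V)"
    by (rule comp_ext[OF m0(6), symmetric]; use m0 qa UV s in auto)+
  then have e0: "m0 \<cdot> (q0 \<cdot> f0 U) = m0 \<cdot> (q0 \<cdot> f0 V)" using eq by metis
  have e0: "q0 \<cdot> f0 U = q0 \<cdot> f0 V"
    by (rule monicD[OF m0(7) _ _ _ _ _ e0]) (use m0 qa UV s in auto)
  have "f1 F \<cdot> f1 U = m1 \<cdot> (q1 \<cdot> f1 U)" "f1 F \<cdot> f1 V = m1 \<cdot> (q1 \<cdot> f1 V)"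
    by (rule comp_ext[OF m1(6), symmetric]; use m1 qa UV s in auto)+
  then have e1: "m1 \<cdot> (q1 \<cdot> f1 U) = m1 \<cdot> (q1 \<cdot> f1 V)" using eq by metis
  have e1: "q1 \<cdot> f1 U = q1 \<cdot> f1 V"
    by (rule monicD[OF m1(7) _ _ _ _ _ e1]) (use m1 qa UV s in auto)
  have "?Q \<bullet> U = ?Q \<bullet> V" by (rule functor_eqI) (use e0 e1 UV in auto)
  then obtain S where S: "internal_functor C S" "Src S = B" "Tgt S = Y" "S \<bullet> F = ?Q"
    using coequalizer_lift[OF co, of ?Q] Q s by auto
  have MS: "?M \<bullet> S = Idn (Gpd C) B"
  proof -
    have "\<exists>!K. K \<in> Hom (Gpd C) (Cod (Gpd C) F) B \<and> K \<bullet> F = F"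
    proof -
      have "\<forall>H \<in> Hom (Gpd C) (Cod (Gpd C) U) B. H \<bullet> U = H \<bullet> V \<longrightarrow>
         (\<exists>!K. K \<in> Hom (Gpd C) (Cod (Gpd C) F) B \<and> K \<bullet> F = H)"
        using co unfolding is_coequalizer_def by blast
      moreover have "F \<in> Hom (Gpd C) (Cod (Gpd C) U) B" using F s by simp
      ultimately show ?thesis using eqG by blast
    qed
    moreover have "Idn (Gpd C) B \<in> Hom (Gpd C) (Cod (Gpd C) F) B \<and> Idn (Gpd C) B \<bullet> F = F"
      using G.Idn_Hom[of B] X F s by (auto intro!: functor_eqI)
    moreover have "(?M \<bullet> S) \<bullet> F = ?M \<bullet> ?Q"
      using G.comp_assoc[of F S ?M] F S M s by simp
    moreover have "?M \<bullet> ?Q = F" by (rule functor_eqI) (use m0 m1 s in auto)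
    moreover have "?M \<bullet> S \<in> Hom (Gpd C) (Cod (Gpd C) F) B"
      using G.comp_arr[of S ?M] S M s by simp
    ultimately show ?thesis by metis
  qed
  have "m0 \<cdot> f0 S = Idn C (G0 B)" "m1 \<cdot> f1 S = Idn C (G1 B)"
    using arg_cong[OF MS, of f0] arg_cong[OF MS, of f1] by auto
  then have "m0 \<in> covers" "m1 \<in> covers"
    using split_regular_epi[of m0 "f0 S"] split_regular_epi[of m1 "f1 S"] S m0 m1 gY F s by auto
  then show "f0 F \<in> covers" "f1 F \<in> covers"
    using regular_epi_comp[OF m0(1), of m0] regular_epi_comp[OF m1(1), of m1] m0 m1 by auto
qed

lemma Gpd_regular_epi_iff:
  "F \<in> regular_epis (Gpd C) \<longleftrightarrow> internal_functor C F \<and> f0 F \<in> covers \<and> f1 F \<in> covers"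
  using levelwise_regular_epi regular_epi_levelwise by blast

lemma Gpd_regular_epi_comp:
  assumes F: "F \<in> regular_epis (Gpd C)" and G: "G \<in> regular_epis (Gpd C)" and s: "Src G = Tgt F"
  shows "G \<bullet> F \<in> regular_epis (Gpd C)"
proof -
  interpret G: category "Gpd C" by (rule Gpd_category)
  show ?thesis unfolding Gpd_regular_epi_iff
    using regular_epi_levelwise[OF F] regular_epi_levelwise[OF G] s G.comp_arr(1)[of F G]
      regular_epi_comp[of "f0 F" "f0 G"] regular_epi_comp[of "f1 F" "f1 G"] by simp
qed

lemma Gpd_regular_epi_cancel:
  assumes GF: "G \<bullet> F \<in> regular_epis (Gpd C)" and fs: "internal_functor C F" "internal_functor C G" "Src G = Tgt F"
  shows "G \<in> regular_epis (Gpd C)"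
  unfolding Gpd_regular_epi_iff using regular_epi_levelwise(2,3)[OF GF] fs
    regular_epi_cancel[of "f0 G" "f0 F"] regular_epi_cancel[of "f1 G" "f1 F"] by simp

end

section \<open>Full and essentially surjective functors\<close>

text \<open>Fullness and essential surjectivity in the internal language of \<open>C\<close>: the existential quantifiers are
read locally, that is, after passing to a cover. The functors with both properties turn out to be
the final ones.\<close>

definition locally_full :: "('o, 'a) cat \<Rightarrow> ('o, 'a) ifunctor \<Rightarrow> bool" where
  "locally_full C E \<longleftrightarrow> (\<forall>t. \<forall>x \<in> Hom C t (G0 (Src E)). \<forall>y \<in> Hom C t (G0 (Src E)). \<forall>b \<in> Hom C t (G1 (Tgt E)).
     gdom (Tgt E) \<cdot>\<^bsub>C\<^esub> b = f0 E \<cdot>\<^bsub>C\<^esub> x \<longrightarrow> gcod (Tgt E) \<cdot>\<^bsub>C\<^esub> b = f0 E \<cdot>\<^bsub>C\<^esub> y \<longrightarrow>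
     (\<exists>e \<in> regular_epis C. Cod C e = t \<and> (\<exists>u \<in> Hom C (Dom C e) (G1 (Src E)).
        gdom (Src E) \<cdot>\<^bsub>C\<^esub> u = x \<cdot>\<^bsub>C\<^esub> e \<and> gcod (Src E) \<cdot>\<^bsub>C\<^esub> u = y \<cdot>\<^bsub>C\<^esub> e \<and> f1 E \<cdot>\<^bsub>C\<^esub> u = b \<cdot>\<^bsub>C\<^esub> e)))"

definition locally_ess_surj :: "('o, 'a) cat \<Rightarrow> ('o, 'a) ifunctor \<Rightarrow> bool" where
  "locally_ess_surj C E \<longleftrightarrow> (\<forall>t. \<forall>y \<in> Hom C t (G0 (Tgt E)).
     (\<exists>e \<in> regular_epis C. Cod C e = t \<and> (\<exists>x \<in> Hom C (Dom C e) (G0 (Src E)). \<exists>b \<in> Hom C (Dom C e) (G1 (Tgt E)).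
        gdom (Tgt E) \<cdot>\<^bsub>C\<^esub> b = y \<cdot>\<^bsub>C\<^esub> e \<and> gcod (Tgt E) \<cdot>\<^bsub>C\<^esub> b = f0 E \<cdot>\<^bsub>C\<^esub> x)))"

definition full_ess_surj :: "('o, 'a) cat \<Rightarrow> ('o, 'a) ifunctor set" where
  "full_ess_surj C = {E. internal_functor C E \<and> locally_full C E \<and> locally_ess_surj C E}"

lemma locally_fullE:
  assumes "locally_full C E" "Src E = A" "Tgt E = B" "x \<in> Hom C t (G0 A)" "y \<in> Hom C t (G0 A)" "b \<in> Hom C t (G1 B)"
    "gdom B \<cdot>\<^bsub>C\<^esub> b = f0 E \<cdot>\<^bsub>C\<^esub> x" "gcod B \<cdot>\<^bsub>C\<^esub> b = f0 E \<cdot>\<^bsub>C\<^esub> y"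
  obtains e u where "e \<in> regular_epis C" "e \<in> Arr C" "Cod C e = t" "u \<in> Arr C" "Dom C u = Dom C e" "Cod C u = G1 A"
    "gdom A \<cdot>\<^bsub>C\<^esub> u = x \<cdot>\<^bsub>C\<^esub> e" "gcod A \<cdot>\<^bsub>C\<^esub> u = y \<cdot>\<^bsub>C\<^esub> e" "f1 E \<cdot>\<^bsub>C\<^esub> u = b \<cdot>\<^bsub>C\<^esub> e"
proof -
  have "\<exists>e \<in> regular_epis C. Cod C e = t \<and> (\<exists>u \<in> Hom C (Dom C e) (G1 A).
        gdom A \<cdot>\<^bsub>C\<^esub> u = x \<cdot>\<^bsub>C\<^esub> e \<and> gcod A \<cdot>\<^bsub>C\<^esub> u = y \<cdot>\<^bsub>C\<^esub> e \<and> f1 E \<cdot>\<^bsub>C\<^esub> u = b \<cdot>\<^bsub>C\<^esub> e)"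
    using assms unfolding locally_full_def by blast
  then show ?thesis using that by auto
qed

lemma locally_ess_surjE:
  assumes "locally_ess_surj C E" "Src E = A" "Tgt E = B" "y \<in> Hom C t (G0 B)"
  obtains e x b where "e \<in> regular_epis C" "e \<in> Arr C" "Cod C e = t" "x \<in> Arr C" "Dom C x = Dom C e" "Cod C x = G0 A"
    "b \<in> Arr C" "Dom C b = Dom C e" "Cod C b = G1 B" "gdom B \<cdot>\<^bsub>C\<^esub> b = y \<cdot>\<^bsub>C\<^esub> e" "gcod B \<cdot>\<^bsub>C\<^esub> b = f0 E \<cdot>\<^bsub>C\<^esub> x"
proof -
  have "\<exists>e \<in> regular_epis C. Cod C e = t \<and> (\<exists>x \<in> Hom C (Dom C e) (G0 A). \<exists>b \<in> Hom C (Dom C e) (G1 B).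
        gdom B \<cdot>\<^bsub>C\<^esub> b = y \<cdot>\<^bsub>C\<^esub> e \<and> gcod B \<cdot>\<^bsub>C\<^esub> b = f0 E \<cdot>\<^bsub>C\<^esub> x)"
    using assms unfolding locally_ess_surj_def by blast
  then show ?thesis using that by auto
qed

context category
begin

lemma discrete_fibration_functor: "M \<in> discrete_fibrations C \<Longrightarrow> internal_functor C M"
  unfolding discrete_fibrations_def by simp

text \<open>For groupoids the pullback condition on codomains says that an arrow lifts uniquely along a given
lift of its codomain.\<close>

lemma discrete_fibration_lift:
  assumes M: "M \<in> discrete_fibrations C" "Src M = X" "Tgt M = Y"
    and b: "arr b" "dom b = t" "cod b = G1 Y" and x: "arr x" "dom x = t" "cod x = G0 X"
    and e: "gcod Y \<cdot> b = f0 M \<cdot> x"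
  obtains u where "arr u" "dom u = t" "cod u = G1 X" "f1 M \<cdot> u = b" "gcod X \<cdot> u = x"
proof -
  have F: "internal_functor C M" and pb: "is_pullback C (gcod Y) (f0 M) (f1 M) (gcod X)"
    using M unfolding discrete_fibrations_def by auto
  have "\<exists>w. arr w \<and> dom w = dom b \<and> cod w = dom (f1 M) \<and> f1 M \<cdot> w = b \<and> gcod X \<cdot> w = x"
    by (rule pullback_lift[OF pb b(1) x(1)]) (use b x e F M functor_gpd[OF F] in auto)
  then show ?thesis using that b F M by auto
qed

lemma discrete_fibration_unique:
  assumes M: "M \<in> discrete_fibrations C" "Src M = X"
    and u: "arr u" "arr v" "dom u = dom v" "cod u = G1 X" "cod v = G1 X"
    and e: "f1 M \<cdot> u = f1 M \<cdot> v" "gcod X \<cdot> u = gcod X \<cdot> v"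
  shows "u = v"
proof -
  have F: "internal_functor C M" and pb: "is_pullback C (gcod (Tgt M)) (f0 M) (f1 M) (gcod X)"
    using M unfolding discrete_fibrations_def by auto
  show ?thesis by (rule pullback_eqI[OF pb _ _ _ _ _ e]) (use u F M in auto)
qed

lemma discrete_fibrationI:
  assumes F: "internal_functor C M" and s: "Src M = X" "Tgt M = Y"
    and ex: "\<And>t b x. \<lbrakk>arr b; dom b = t; cod b = G1 Y; arr x; dom x = t; cod x = G0 X;
       gcod Y \<cdot> b = f0 M \<cdot> x\<rbrakk>
       \<Longrightarrow> \<exists>u. arr u \<and> dom u = t \<and> cod u = G1 X \<and> f1 M \<cdot> u = b \<and> gcod X \<cdot> u = x"
    and un: "\<And>u v. \<lbrakk>arr u; arr v; dom u = dom v; cod u = G1 X; cod v = G1 X;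
       f1 M \<cdot> u = f1 M \<cdot> v; gcod X \<cdot> u = gcod X \<cdot> v\<rbrakk> \<Longrightarrow> u = v"
  shows "M \<in> discrete_fibrations C"
proof -
  have g: "internal_groupoid C X" "internal_groupoid C Y" using F s by auto
  have "is_pullback C (gcod Y) (f0 M) (f1 M) (gcod X)"
  proof (rule is_pullbackI)
    show "gcod Y \<cdot> f1 M = f0 M \<cdot> gcod X" by (rule functor_gdom_arr(2)[OF F s(2,1)])
    show "jointly_monic C (f1 M) (gcod X)"
      unfolding jointly_monic_def using un F s by simp
    fix u v assume h: "arr u" "arr v" "dom u = dom v" "cod u = dom (gcod Y)" "cod v = dom (f0 M)"
      "gcod Y \<cdot> u = f0 M \<cdot> v"
    have "\<exists>w. arr w \<and> dom w = dom v \<and> cod w = G1 X \<and> f1 M \<cdot> w = u \<and> gcod X \<cdot> w = v"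
      by (rule ex) (use h F s g in auto)
    then show "\<exists>w. arr w \<and> dom w = dom v \<and> cod w = dom (gcod X) \<and> f1 M \<cdot> w = u \<and> gcod X \<cdot> w = v"
      using g by simp
  qed (use F s g in auto)
  then show ?thesis unfolding discrete_fibrations_def using F s by simp
qed

lemma discrete_fibration_comp:
  assumes M: "M \<in> discrete_fibrations C" and N: "N \<in> discrete_fibrations C" and s: "Src N = Tgt M"
  shows "N \<bullet> M \<in> discrete_fibrations C"
proof -
  interpret G: category "Gpd C" by (rule Gpd_category)
  note F = discrete_fibration_functor[OF M] discrete_fibration_functor[OF N]
  have NM: "internal_functor C (N \<bullet> M)" using G.comp_arr[of M N] F s by simp
  have g: "internal_groupoid C (Src M)" "internal_groupoid C (Tgt M)" "internal_groupoid C (Tgt N)" using F by auto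
  show ?thesis
  proof (rule discrete_fibrationI[OF NM refl refl])
    fix t b x assume h: "arr b" "dom b = t" "cod b = G1 (Tgt (N \<bullet> M))" "arr x" "dom x = t"
      "cod x = G0 (Src (N \<bullet> M))" "gcod (Tgt (N \<bullet> M)) \<cdot> b = f0 (N \<bullet> M) \<cdot> x"
    obtain v where v: "arr v" "dom v = t" "cod v = G1 (Tgt M)" "f1 N \<cdot> v = b" "gcod (Tgt M) \<cdot> v = f0 M \<cdot> x"
      by (rule discrete_fibration_lift[OF N s refl, of b t "f0 M \<cdot> x"]) (use h F s in auto)
    obtain u where u: "arr u" "dom u = t" "cod u = G1 (Src M)" "f1 M \<cdot> u = v" "gcod (Src M) \<cdot> u = x"
      by (rule discrete_fibration_lift[OF M refl refl, of v t x]) (use h v F s in auto)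
    show "\<exists>u. arr u \<and> dom u = t \<and> cod u = G1 (Src (N \<bullet> M)) \<and> f1 (N \<bullet> M) \<cdot> u = b \<and>
        gcod (Src (N \<bullet> M)) \<cdot> u = x"
      by (intro exI[of _ u]) (use u v F s in simp)
  next
    fix u v assume h: "arr u" "arr v" "dom u = dom v" "cod u = G1 (Src (N \<bullet> M))"
      "cod v = G1 (Src (N \<bullet> M))" "f1 (N \<bullet> M) \<cdot> u = f1 (N \<bullet> M) \<cdot> v"
      "gcod (Src (N \<bullet> M)) \<cdot> u = gcod (Src (N \<bullet> M)) \<cdot> v"
    have c: "gcod (Src M) \<cdot> u = gcod (Src M) \<cdot> v" using h by simp
    have e: "gcod (Tgt M) \<cdot> (f1 M \<cdot> u) = gcod (Tgt M) \<cdot> (f1 M \<cdot> v)" using h F c by simp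
    have "f1 M \<cdot> u = f1 M \<cdot> v" by (rule discrete_fibration_unique[OF N s _ _ _ _ _ _ e]) (use h F s in auto)
    then show "u = v" by (rule discrete_fibration_unique[OF M refl, rotated 5]) (use h in auto)
  qed
qed

end

context exact_maltsev
begin

text \<open>To define the diagonal at an object \<open>y\<close> of \<open>B\<close>, choose locally an arrow \<open>b\<close> from \<open>y\<close> to some \<open>E x\<close>, lift
\<open>G b\<close> along \<open>M\<close> with codomain \<open>F x\<close>, and take the domain of the lift. Two choices differ by an
arrow of \<open>B\<close> between objects in the image of \<open>E\<close>, which by fullness comes locally from \<open>A\<close>; so the
value does not depend on the choice and descends along the object \<open>Q\<close> of all choices.\<close>

lemma full_ess_surj_orthogonal:
  assumes E: "E \<in> full_ess_surj C" and M: "M \<in> discrete_fibrations C"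
  shows "orthogonal (Gpd C) E M"
  unfolding orthogonal_def
proof (intro ballI impI)
  fix F G assume "F \<in> Hom (Gpd C) (Dom (Gpd C) E) (Dom (Gpd C) M)" "G \<in> Hom (Gpd C) (Cod (Gpd C) E) (Cod (Gpd C) M)"
    and sq: "G \<bullet> E = M \<bullet> F"
  define A B X Y where "A = Src E" and "B = Tgt E" and "X = Src M" and "Y = Tgt M"
  have fE: "internal_functor C E" "locally_full C E" "locally_ess_surj C E" using E unfolding full_ess_surj_def by auto
  have fM: "internal_functor C M" by (rule discrete_fibration_functor[OF M])
  have fF: "internal_functor C F" "internal_functor C G"
    using \<open>F \<in> _\<close> \<open>G \<in> _\<close> by auto
  have s: "Src E = A" "Tgt E = B" "Src M = X" "Tgt M = Y" "Src F = A" "Tgt F = X" "Src G = B" "Tgt G = Y"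
    using \<open>F \<in> _\<close> \<open>G \<in> _\<close> unfolding A_def B_def X_def Y_def by auto
  note f = fE(1) fM fF s
  have g: "internal_groupoid C A" "internal_groupoid C B" "internal_groupoid C X" "internal_groupoid C Y"
    using functor_gpd[OF fE(1)] functor_gpd[OF fM] s by auto
  have sq01: "f0 G \<cdot> f0 E = f0 M \<cdot> f0 F" "f1 G \<cdot> f1 E = f1 M \<cdot> f1 F"
    using arg_cong[OF sq, of f0] arg_cong[OF sq, of f1] by auto
  have sq0: "f0 G \<cdot> (f0 E \<cdot> z) = f0 M \<cdot> (f0 F \<cdot> z)" if "arr z" "cod z = G0 A" for z
    by (rule comp_ext2[OF sq01(1)]) (use that f in auto)
  have sq1: "f1 G \<cdot> (f1 E \<cdot> z) = f1 M \<cdot> (f1 F \<cdot> z)" if "arr z" "cod z = G1 A" for z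
    by (rule comp_ext2[OF sq01(2)]) (use that f in auto)
  obtain qa qb where pb: "is_pullback C (f0 E) (gcod B) qa qb" using pullback_exists[of "f0 E" "gcod B"] f g by auto
  note D = is_pullback_D[OF pb]
  define Q where "Q = dom qa"
  have q: "arr qa" "dom qa = Q" "cod qa = G0 A" "arr qb" "dom qb = Q" "cod qb = G1 B"
    "gcod B \<cdot> qb = f0 E \<cdot> qa" using D f g unfolding Q_def by auto
  have qe: "gcod B \<cdot> (qb \<cdot> z) = f0 E \<cdot> (qa \<cdot> z)" if "arr z" "cod z = Q" for z
    by (rule comp_ext2[OF q(7)]) (use that q f g in auto)
  define h where "h = gdom B \<cdot> qb"
  have h: "arr h" "dom h = Q" "cod h = G0 B" using q g unfolding h_def by auto
  have Qlift: "\<exists>w. arr w \<and> dom w = t \<and> cod w = Q \<and> qa \<cdot> w = x \<and> qb \<cdot> w = b"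
    if "arr x" "dom x = t" "cod x = G0 A" "arr b" "dom b = t" "cod b = G1 B" "gcod B \<cdot> b = f0 E \<cdot> x" for x b t
    using pullback_lift[OF pb that(1,4)] that f g unfolding Q_def by auto
  have hr: "h \<in> covers"
  proof -
    obtain e x b where l: "e \<in> covers" "arr e" "cod e = G0 B" "arr x" "dom x = dom e" "cod x = G0 A"
      "arr b" "dom b = dom e" "cod b = G1 B" "gdom B \<cdot> b = Idn C (G0 B) \<cdot> e" "gcod B \<cdot> b = f0 E \<cdot> x"
      using locally_ess_surjE[OF fE(3) s(1,2), of "Idn C (G0 B)" "G0 B"] g by auto
    obtain w where w: "arr w" "dom w = dom e" "cod w = Q" "qa \<cdot> w = x" "qb \<cdot> w = b"
      using Qlift[OF l(4-9,11)] by blast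
    show ?thesis by (rule regular_epi_local[OF h(1) l(1) w(1)]) (use w h l q g in \<open>auto simp: h_def\<close>)
  qed
  obtain xi where xi: "arr xi" "dom xi = Q" "cod xi = G1 X" "f1 M \<cdot> xi = f1 G \<cdot> qb" "gcod X \<cdot> xi = f0 F \<cdot> qa"
    by (rule discrete_fibration_lift[OF M s(3,4), of "f1 G \<cdot> qb" Q "f0 F \<cdot> qa"]) (use f q sq0 g in auto)
  have xie: "f1 M \<cdot> (xi \<cdot> z) = f1 G \<cdot> (qb \<cdot> z)" "gcod X \<cdot> (xi \<cdot> z) = f0 F \<cdot> (qa \<cdot> z)" if "arr z" "cod z = Q" for z
    by (rule comp_ext2[OF xi(4)], use that xi f q in auto)[1]
       (rule comp_ext2[OF xi(5)], use that xi f q g in auto)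
  obtain d0 where d0: "arr d0" "dom d0 = G0 B" "cod d0 = G0 X" "d0 \<cdot> h = gdom X \<cdot> xi"
  proof (rule glue[OF hr, of "gdom X \<cdot> xi"])
    fix a b assume ab: "arr a" "arr b" "dom a = dom b" "cod a = dom h" "cod b = dom h" "h \<cdot> a = h \<cdot> b"
    define u1 u2 where "u1 = qb \<cdot> a" and "u2 = qb \<cdot> b"
    have u: "arr u1" "arr u2" "dom u1 = dom b" "dom u2 = dom b" "cod u1 = G1 B" "cod u2 = G1 B"
      "gdom B \<cdot> u1 = gdom B \<cdot> u2" using ab h q g unfolding u1_def u2_def h_def by auto
    have uc: "gcod B \<cdot> u1 = f0 E \<cdot> (qa \<cdot> a)" "gcod B \<cdot> u2 = f0 E \<cdot> (qa \<cdot> b)"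
      using qe ab h unfolding u1_def u2_def by auto
    define w where "w = gcomp C B u2 (ginv C B \<cdot> u1)"
    have w: "arr w" "dom w = dom b" "cod w = G1 B" "gdom B \<cdot> w = f0 E \<cdot> (qa \<cdot> a)" "gcod B \<cdot> w = f0 E \<cdot> (qa \<cdot> b)"
      using u uc g unfolding w_def by auto
    have hom: "qa \<cdot> a \<in> Hom C (dom b) (G0 A)" "qa \<cdot> b \<in> Hom C (dom b) (G0 A)" "w \<in> Hom C (dom b) (G1 B)"
      using ab q h w by auto
    obtain e v where v: "e \<in> covers" "arr e" "cod e = dom b" "arr v" "dom v = dom e" "cod v = G1 A"
      "gdom A \<cdot> v = (qa \<cdot> a) \<cdot> e" "gcod A \<cdot> v = (qa \<cdot> b) \<cdot> e" "f1 E \<cdot> v = w \<cdot> e"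
      using locally_fullE[OF fE(2) s(1,2) hom w(4,5)] by blast
    have wu: "gcomp C B (w \<cdot> e) (u1 \<cdot> e) = u2 \<cdot> e"
    proof -
      have "gdom B \<cdot> (u1 \<cdot> e) = gdom B \<cdot> (u2 \<cdot> e)" by (rule comp_ext2[OF u(7)]) (use u v g in auto)
      then show ?thesis using u v g unfolding w_def by simp
    qed
    have cd: "gdom X \<cdot> (f1 F \<cdot> v) = gcod X \<cdot> (xi \<cdot> (a \<cdot> e))" using f v xie[of "a \<cdot> e"] ab h q by simp
    have "gcomp C X (f1 F \<cdot> v) (xi \<cdot> (a \<cdot> e)) = xi \<cdot> (b \<cdot> e)"
    proof (rule discrete_fibration_unique[OF M s(3)])
      have "f1 M \<cdot> gcomp C X (f1 F \<cdot> v) (xi \<cdot> (a \<cdot> e)) = gcomp C Y (f1 M \<cdot> (f1 F \<cdot> v)) (f1 M \<cdot> (xi \<cdot> (a \<cdot> e)))"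
        using functor_gcomp[OF fM s(3), of "f1 F \<cdot> v" "xi \<cdot> (a \<cdot> e)"] f v cd ab h xi by simp
      also have "\<dots> = gcomp C Y (f1 G \<cdot> (w \<cdot> e)) (f1 G \<cdot> (u1 \<cdot> e))"
        using sq1[of v] xie(1)[of "a \<cdot> e"] v ab h q unfolding u1_def by simp
      also have "\<dots> = f1 G \<cdot> gcomp C B (w \<cdot> e) (u1 \<cdot> e)"
      proof -
        have "gdom B \<cdot> w = gcod B \<cdot> u1" using w uc by simp
        then have "gdom B \<cdot> (w \<cdot> e) = gcod B \<cdot> (u1 \<cdot> e)" by (rule comp_ext2) (use w u v g in auto)
        then show ?thesis using functor_gcomp[OF fF(2) s(7), of "w \<cdot> e" "u1 \<cdot> e"] w(1-3) u(1-6) v(1-3) s by simp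
      qed
      also have "\<dots> = f1 M \<cdot> (xi \<cdot> (b \<cdot> e))" using wu xie(1)[of "b \<cdot> e"] v ab h q unfolding u2_def by simp
      finally show "f1 M \<cdot> gcomp C X (f1 F \<cdot> v) (xi \<cdot> (a \<cdot> e)) = f1 M \<cdot> (xi \<cdot> (b \<cdot> e))" .
      show "gcod X \<cdot> gcomp C X (f1 F \<cdot> v) (xi \<cdot> (a \<cdot> e)) = gcod X \<cdot> (xi \<cdot> (b \<cdot> e))"
        using cd f v xie(2)[of "b \<cdot> e"] ab h q xi g by simp
    qed (use cd f v ab h q xi g in auto)
    then have "gdom X \<cdot> gcomp C X (f1 F \<cdot> v) (xi \<cdot> (a \<cdot> e)) = gdom X \<cdot> (xi \<cdot> (b \<cdot> e))" by simp
    then have "((gdom X \<cdot> xi) \<cdot> a) \<cdot> e = ((gdom X \<cdot> xi) \<cdot> b) \<cdot> e"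
      using cd f v ab h q xi g by simp
    then show "(gdom X \<cdot> xi) \<cdot> a = (gdom X \<cdot> xi) \<cdot> b"
      by (rule regular_epi_epi[OF v(1), rotated 4]) (use v ab h xi g in auto)
  qed (use xi g h in auto)
  have K: "\<exists>z. arr z \<and> dom z = t \<and> cod z = G1 X \<and> gdom X \<cdot> z = d0 \<cdot> (gdom B \<cdot> b) \<and> gcod X \<cdot> z = f0 F \<cdot> x \<and> f1 M \<cdot> z = f1 G \<cdot> b"
    if xb: "arr x" "dom x = t" "cod x = G0 A" "arr b" "dom b = t" "cod b = G1 B" "gcod B \<cdot> b = f0 E \<cdot> x" for x b t
  proof -
    obtain w where w: "arr w" "dom w = t" "cod w = Q" "qa \<cdot> w = x" "qb \<cdot> w = b"
      using Qlift[OF xb] by blast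
    have "d0 \<cdot> (h \<cdot> w) = gdom X \<cdot> (xi \<cdot> w)" by (rule comp_ext2[OF d0(4)]) (use d0 h w xi g in auto)
    then have "gdom X \<cdot> (xi \<cdot> w) = d0 \<cdot> (gdom B \<cdot> b)" using w q g unfolding h_def by simp
    then show ?thesis by (intro exI[of _ "xi \<cdot> w"]) (use w xi xie in simp)
  qed
  have Md0: "f0 M \<cdot> d0 = f0 G"
  proof (rule regular_epi_epi[OF hr])
    have "f0 M \<cdot> (gdom X \<cdot> xi) = gdom Y \<cdot> (f1 M \<cdot> xi)" using f xi(1-3) by simp
    also have "\<dots> = f0 G \<cdot> h" using f xi q unfolding h_def by simp
    finally show "(f0 M \<cdot> d0) \<cdot> h = f0 G \<cdot> h" using f d0 h by simp
  qed (use f d0 h in auto)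
  have Md0e: "f0 M \<cdot> (d0 \<cdot> z) = f0 G \<cdot> z" if "arr z" "cod z = G0 B" for z
    by (rule comp_ext[OF Md0]) (use that f d0 in auto)
  obtain d1 where d1: "arr d1" "dom d1 = G1 B" "cod d1 = G1 X" "f1 M \<cdot> d1 = f1 G" "gcod X \<cdot> d1 = d0 \<cdot> gcod B"
  proof (rule discrete_fibration_lift[OF M s(3,4), of "f1 G" "G1 B" "d0 \<cdot> gcod B"])
    show "gcod Y \<cdot> f1 G = f0 M \<cdot> (d0 \<cdot> gcod B)" using functor_gdom_arr(2)[OF fF(2) s(8,7)] Md0e g by simp
  qed (use f d0 g in auto)
  have d1e: "f1 M \<cdot> (d1 \<cdot> z) = f1 G \<cdot> z" "gcod X \<cdot> (d1 \<cdot> z) = d0 \<cdot> (gcod B \<cdot> z)" if "arr z" "cod z = G1 B" for z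
    by (rule comp_ext[OF d1(4)], use that d1 f in auto)[1]
       (rule comp_ext2[OF d1(5)], use that d1 d0 f g in auto)
  have d1dom: "gdom X \<cdot> d1 = d0 \<cdot> gdom B"
  proof -
    obtain e x b where l: "e \<in> covers" "arr e" "cod e = G1 B" "arr x" "dom x = dom e" "cod x = G0 A"
      "arr b" "dom b = dom e" "cod b = G1 B" "gdom B \<cdot> b = gcod B \<cdot> e" "gcod B \<cdot> b = f0 E \<cdot> x"
      using locally_ess_surjE[OF fE(3) s(1,2), of "gcod B" "G1 B"] g by auto
    obtain z where z: "arr z" "dom z = dom e" "cod z = G1 X" "gdom X \<cdot> z = d0 \<cdot> (gdom B \<cdot> b)"
      "gcod X \<cdot> z = f0 F \<cdot> x" "f1 M \<cdot> z = f1 G \<cdot> b" using K[OF l(4-9,11)] by blast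
    have be: "arr (gcomp C B b e)" "dom (gcomp C B b e) = dom e" "cod (gcomp C B b e) = G1 B"
      "gcod B \<cdot> gcomp C B b e = f0 E \<cdot> x" "gdom B \<cdot> gcomp C B b e = gdom B \<cdot> e" using l g by auto
    obtain z' where z': "arr z'" "dom z' = dom e" "cod z' = G1 X" "gdom X \<cdot> z' = d0 \<cdot> (gdom B \<cdot> e)"
      "gcod X \<cdot> z' = f0 F \<cdot> x" "f1 M \<cdot> z' = f1 G \<cdot> gcomp C B b e" using K[OF l(4-6) be(1-4)] be(5) by auto
    have cz: "gdom X \<cdot> z = gcod X \<cdot> (d1 \<cdot> e)" using z d1e(2)[of e] l by simp
    have "gcomp C X z (d1 \<cdot> e) = z'"
    proof (rule discrete_fibration_unique[OF M s(3)])
      show "f1 M \<cdot> gcomp C X z (d1 \<cdot> e) = f1 M \<cdot> z'"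
        using functor_gcomp[OF fM s(3), of z "d1 \<cdot> e"] functor_gcomp[OF fF(2) s(7), of b e] z z' cz l d1 d1e(1)[of e] s by simp
      show "gcod X \<cdot> gcomp C X z (d1 \<cdot> e) = gcod X \<cdot> z'" using z z' cz l d1 g by simp
    qed (use z z' cz l d1 g in auto)
    then have "gdom X \<cdot> gcomp C X z (d1 \<cdot> e) = gdom X \<cdot> z'" by simp
    then have "gdom X \<cdot> (d1 \<cdot> e) = d0 \<cdot> (gdom B \<cdot> e)" using z z' cz l d1 g by simp
    then have "(gdom X \<cdot> d1) \<cdot> e = (d0 \<cdot> gdom B) \<cdot> e" using l d1 d0 g by simp
    then show ?thesis by (rule regular_epi_epi[OF l(1), rotated 4]) (use l d1 d0 g in auto)
  qed
  define N where "N = \<lparr>Src = B, Tgt = X, f0 = d0, f1 = d1\<rparr>"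
  have N: "internal_functor C N" unfolding N_def
  proof (rule internal_functorI[OF g(2,3) d0(1-3) d1(1-3) d1dom d1(5)])
    fix u v assume uv: "arr u" "arr v" "dom v = dom u" "cod u = G1 B" "cod v = G1 B" "gdom B \<cdot> u = gcod B \<cdot> v"
    have "gdom X \<cdot> (d1 \<cdot> u) = d0 \<cdot> (gdom B \<cdot> u)" by (rule comp_ext2[OF d1dom]) (use uv d1 d0 g in auto)
    then have cc: "gdom X \<cdot> (d1 \<cdot> u) = gcod X \<cdot> (d1 \<cdot> v)" using d1e(2)[of v] uv by simp
    have gu: "arr (gcomp C B u v)" "cod (gcomp C B u v) = G1 B" "dom (gcomp C B u v) = dom u" using uv g by auto
    show "d1 \<cdot> gcomp C B u v = gcomp C X (d1 \<cdot> u) (d1 \<cdot> v)"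
    proof (rule discrete_fibration_unique[OF M s(3)])
      show "f1 M \<cdot> (d1 \<cdot> gcomp C B u v) = f1 M \<cdot> gcomp C X (d1 \<cdot> u) (d1 \<cdot> v)"
        using functor_gcomp[OF fM s(3), of "d1 \<cdot> u" "d1 \<cdot> v"] functor_gcomp[OF fF(2) s(7) uv] d1e(1) uv gu cc d1 s by simp
      show "gcod X \<cdot> (d1 \<cdot> gcomp C B u v) = gcod X \<cdot> gcomp C X (d1 \<cdot> u) (d1 \<cdot> v)"
        using d1e(2) uv gu cc d1 g by simp
    qed (use uv gu cc d1 g in auto)
  qed
  show "\<exists>!\<delta>. \<delta> \<in> Hom (Gpd C) (Cod (Gpd C) E) (Dom (Gpd C) M) \<and> \<delta> \<bullet> E = F \<and> M \<bullet> \<delta> = G"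
  proof (rule ex1I[of _ N])
    have 1: "d0 \<cdot> f0 E = f0 F"
    proof -
      have be: "arr (gunit B \<cdot> f0 E)" "dom (gunit B \<cdot> f0 E) = G0 A" "cod (gunit B \<cdot> f0 E) = G1 B"
        "gcod B \<cdot> (gunit B \<cdot> f0 E) = f0 E \<cdot> Idn C (G0 A)" using f g by auto
      obtain z where z: "arr z" "dom z = G0 A" "cod z = G1 X" "gdom X \<cdot> z = d0 \<cdot> (gdom B \<cdot> (gunit B \<cdot> f0 E))"
        "gcod X \<cdot> z = f0 F \<cdot> Idn C (G0 A)" "f1 M \<cdot> z = f1 G \<cdot> (gunit B \<cdot> f0 E)"
        using K[OF _ _ _ be] idn_arr[of "G0 A"] g by auto
      have "z = gunit X \<cdot> f0 F"
        by (rule discrete_fibration_unique[OF M s(3)]) (use z f g sq01 in auto)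
      then show ?thesis using z f g by simp
    qed
    have 2: "d1 \<cdot> f1 E = f1 F"
    proof (rule discrete_fibration_unique[OF M s(3)])
      show "f1 M \<cdot> (d1 \<cdot> f1 E) = f1 M \<cdot> f1 F" using d1e(1)[of "f1 E"] f sq01 by simp
      have "gcod X \<cdot> (d1 \<cdot> f1 E) = d0 \<cdot> (gcod B \<cdot> f1 E)" using d1e(2)[of "f1 E"] f by simp
      also have "\<dots> = d0 \<cdot> (f0 E \<cdot> gcod A)" using functor_gdom_arr(2)[OF f(1) s(2,1)] by simp
      also have "\<dots> = f0 F \<cdot> gcod A" by (rule comp_ext[OF 1]) (use d0 f g in auto)
      also have "\<dots> = gcod X \<cdot> f1 F" using functor_gdom_arr(2)[OF fF(1) s(6,5)] by simp
      finally show "gcod X \<cdot> (d1 \<cdot> f1 E) = gcod X \<cdot> f1 F" .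
    qed (use f d1 in auto)
    show "N \<in> Hom (Gpd C) (Cod (Gpd C) E) (Dom (Gpd C) M) \<and> N \<bullet> E = F \<and> M \<bullet> N = G"
      using N 1 2 Md0 d1 s by (auto intro!: functor_eqI simp: N_def)
  next
    fix N' assume "N' \<in> Hom (Gpd C) (Cod (Gpd C) E) (Dom (Gpd C) M) \<and> N' \<bullet> E = F \<and> M \<bullet> N' = G"
    then have N': "internal_functor C N'" "Src N' = B" "Tgt N' = X" and e1: "N' \<bullet> E = F" and e2: "M \<bullet> N' = G"
      using s by auto
    have e: "f0 N' \<cdot> f0 E = f0 F" "f1 M \<cdot> f1 N' = f1 G"
      using arg_cong[OF e1, of f0] arg_cong[OF e2, of f1] by auto
    have "f1 N' \<cdot> qb = xi"
    proof (rule discrete_fibration_unique[OF M s(3)])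
      show "f1 M \<cdot> (f1 N' \<cdot> qb) = f1 M \<cdot> xi" using comp_ext[OF e(2), of qb] xi f N' q by simp
      show "gcod X \<cdot> (f1 N' \<cdot> qb) = gcod X \<cdot> xi" using comp_ext[OF e(1), of qa] xi f N' q by simp
    qed (use N' q xi in auto)
    then have "gdom X \<cdot> (f1 N' \<cdot> qb) = gdom X \<cdot> xi" by simp
    then have "f0 N' \<cdot> h = gdom X \<cdot> xi" using N' q unfolding h_def by simp
    then have "f0 N' \<cdot> h = d0 \<cdot> h" using d0 by simp
    then have a: "f0 N' = d0" by (rule regular_epi_epi[OF hr, rotated 4]) (use N' d0 h in auto)
    have b: "f1 N' = d1"
    proof (rule discrete_fibration_unique[OF M s(3)])
      show "gcod X \<cdot> f1 N' = gcod X \<cdot> d1" using functor_gdom_arr(2)[OF N'(1,3,2)] a d1 by simp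
    qed (use N' d1 e in auto)
    show "N' = N" by (rule functor_eqI) (use N' a b in \<open>auto simp: N_def\<close>)
  qed
qed

end

section \<open>The comprehensive factorization\<close>

context exact_maltsev
begin

text \<open>The category of elements of an internal presheaf on \<open>B\<close>: \<open>i0\<close> is the family of its values, and \<open>d\<close>
is the action of an arrow of \<open>B\<close> on an element over its codomain. Projecting it to \<open>B\<close> is a discrete
fibration, and every discrete fibration is of this form.\<close>

lemma action_groupoid:
  assumes B: "internal_groupoid C B" and i0: "arr i0" "dom i0 = I0" "cod i0 = G0 B"
    and pb: "is_pullback C (gcod B) i0 m1 c" and d: "arr d" "dom d = dom m1" "cod d = I0"
    and d_over: "i0 \<cdot> d = gdom B \<cdot> m1"
    and d_unit: "\<And>w. \<lbrakk>arr w; cod w = dom m1;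
       m1 \<cdot> w = gunit B \<cdot> (i0 \<cdot> (c \<cdot> w))\<rbrakk>
       \<Longrightarrow> d \<cdot> w = c \<cdot> w"
    and d_mult: "\<And>u v w. \<lbrakk>arr u; arr v; arr w; dom v = dom u; dom w = dom u;
       cod u = dom m1; cod v = dom m1; cod w = dom m1; d \<cdot> u = c \<cdot> v;
       m1 \<cdot> w = gcomp C B (m1 \<cdot> u) (m1 \<cdot> v); c \<cdot> w = c \<cdot> u\<rbrakk>
       \<Longrightarrow> d \<cdot> w = d \<cdot> v"
  obtains I where "internal_groupoid C I" "G0 I = I0" "G1 I = dom m1" "gdom I = d" "gcod I = c"
    "internal_functor C \<lparr>Src = I, Tgt = B, f0 = i0, f1 = m1\<rparr>"
    "\<lparr>Src = I, Tgt = B, f0 = i0, f1 = m1\<rparr> \<in> discrete_fibrations C"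
proof -
  define I1 where "I1 = dom m1"
  note D = is_pullback_D[OF pb]
  have m: "arr m1" "dom m1 = I1" "cod m1 = G1 B" "arr c" "dom c = I1" "cod c = I0"
    "I1 \<in> Obj C" "I0 \<in> Obj C" using D B i0 unfolding I1_def by auto
  note d = d[unfolded m(2)] and d_unit = d_unit[unfolded m(2)] and d_mult = d_mult[unfolded m(2)]
  have de: "i0 \<cdot> (d \<cdot> z) = gdom B \<cdot> (m1 \<cdot> z)" "gcod B \<cdot> (m1 \<cdot> z) = i0 \<cdot> (c \<cdot> z)" if "arr z" "cod z = I1" for z
    by (rule comp_ext2[OF d_over], use that d m i0 B in auto)[1]
       (rule comp_ext2[OF D(9)], use that d m i0 B in auto)
  have lift: "\<exists>w. arr w \<and> dom w = t \<and> cod w = I1 \<and> m1 \<cdot> w = b \<and> c \<cdot> w = x"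
    if "arr b" "dom b = t" "cod b = G1 B" "arr x" "dom x = t" "cod x = I0" "gcod B \<cdot> b = i0 \<cdot> x" for b x t
    using pullback_lift[OF pb that(1,4)] that i0 m B by auto
  have eqI: "a = b" if "m1 \<cdot> a = m1 \<cdot> b" "c \<cdot> a = c \<cdot> b" "arr a" "arr b" "dom a = dom b" "cod a = I1" "cod b = I1" for a b
    by (rule pullback_eqI[OF pb _ _ _ _ _ that(1,2)]) (use that m in auto)
  obtain s where s: "arr s" "dom s = I0" "cod s = I1" "m1 \<cdot> s = gunit B \<cdot> i0" "c \<cdot> s = Idn C I0"
    using lift[of "gunit B \<cdot> i0" I0 "Idn C I0"] m i0 B by auto
  obtain i where i: "arr i" "dom i = I1" "cod i = I1" "m1 \<cdot> i = ginv C B \<cdot> m1" "c \<cdot> i = d"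
    using lift[of "ginv C B \<cdot> m1" I1 d] m i0 B d d_over by auto
  have se: "m1 \<cdot> (s \<cdot> z) = gunit B \<cdot> (i0 \<cdot> z)" "c \<cdot> (s \<cdot> z) = z" if "arr z" "cod z = I0" for z
    using comp_ext[OF s(4), of z] comp_ext[OF s(5), of z] that s m i0 B by auto
  have ds: "d \<cdot> s = Idn C I0" using d_unit[of s] se[of "Idn C I0"] s m i0 by simp
  define mu where "mu u v = pbpair C m1 c (gcomp C B (m1 \<cdot> u) (m1 \<cdot> v)) (c \<cdot> u)" for u v
  have cmp: "gdom B \<cdot> (m1 \<cdot> u) = gcod B \<cdot> (m1 \<cdot> v)"
    if uv: "arr u" "arr v" "dom v = dom u" "cod u = I1" "cod v = I1" "d \<cdot> u = c \<cdot> v" for u v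
    using de(1)[of u] de(2)[of v] uv by simp
  have mu: "arr (mu u v)" "dom (mu u v) = dom u" "cod (mu u v) = I1"
    "m1 \<cdot> mu u v = gcomp C B (m1 \<cdot> u) (m1 \<cdot> v)" "c \<cdot> mu u v = c \<cdot> u" "d \<cdot> mu u v = d \<cdot> v"
    if uv: "arr u" "arr v" "dom v = dom u" "cod u = I1" "cod v = I1" "d \<cdot> u = c \<cdot> v" for u v
  proof -
    note cm = cmp[OF uv]
    have "gcod B \<cdot> gcomp C B (m1 \<cdot> u) (m1 \<cdot> v) = i0 \<cdot> (c \<cdot> u)" using uv m B cm de(2)[of u] by simp
    note P = pbpair[OF pb _ _ _ _ _ this]
    show M: "arr (mu u v)" "dom (mu u v) = dom u" "cod (mu u v) = I1"
      "m1 \<cdot> mu u v = gcomp C B (m1 \<cdot> u) (m1 \<cdot> v)" "c \<cdot> mu u v = c \<cdot> u"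
      unfolding mu_def using P uv cm m B i0 by auto
    show "d \<cdot> mu u v = d \<cdot> v" by (rule d_mult[of u]) (use M uv in auto)
  qed
  obtain r1 r2 where pbr: "is_pullback C d c r1 r2" using pullback_exists[of d c] d m by auto
  have di: "d \<cdot> i = c"
  proof -
    have h: "arr (Idn C I1)" "arr i" "dom i = dom (Idn C I1)" "cod (Idn C I1) = I1" "cod i = I1" "d \<cdot> Idn C I1 = c \<cdot> i"
      using i m d by auto
    note M = mu[OF h]
    have "mu (Idn C I1) i = s \<cdot> c"
      by (rule eqI) (use M i m d s B se[of c] de(2)[of "Idn C I1"] in auto)
    then have "d \<cdot> i = d \<cdot> (s \<cdot> c)" using M by simp
    then show ?thesis using comp_ext[OF ds, of c] d s m by simp
  qed
  obtain I where I: "internal_groupoid C I" "G0 I = I0" "G1 I = I1" "gdom I = d" "gcod I = c" "gunit I = s"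
    and Im: "\<And>u v. \<lbrakk>arr u; arr v; dom v = dom u; cod u = I1; cod v = I1;
       d \<cdot> u = c \<cdot> v\<rbrakk> \<Longrightarrow> gcomp C I u v = mu u v"
  proof (rule groupoid_from_operation[where m = mu and i = i, OF m(8,7) d(1-3) m(4-6) s(1-3) pbr ds s(5)])
    fix u v assume uv: "arr u" "arr v" "dom v = dom u" "cod u = I1" "cod v = I1" "d \<cdot> u = c \<cdot> v"
    show "arr (mu u v) \<and> dom (mu u v) = dom u \<and> cod (mu u v) = I1 \<and> d \<cdot> mu u v = d \<cdot> v \<and> c \<cdot> mu u v = c \<cdot> u"
      using mu[OF uv] by simp
    fix e assume e: "arr e" "cod e = dom u"
    have c2: "d \<cdot> (u \<cdot> e) = c \<cdot> (v \<cdot> e)" by (rule comp_ext2[OF uv(6)]) (use uv e d m in auto)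
    have ue: "arr (u \<cdot> e)" "arr (v \<cdot> e)" "dom (v \<cdot> e) = dom (u \<cdot> e)" "cod (u \<cdot> e) = I1" "cod (v \<cdot> e) = I1"
      using uv e by auto
    note M = mu[OF uv] and M' = mu[OF ue c2] and cm = cmp[OF uv]
    show "mu u v \<cdot> e = mu (u \<cdot> e) (v \<cdot> e)"
      by (rule eqI) (use M M' uv e m B cm comp_ext[OF M(4), of e] comp_ext[OF M(5), of e] in auto)
  next
    fix u assume u: "arr u" "cod u = I1"
    have dse: "d \<cdot> (s \<cdot> z) = z" if "arr z" "cod z = I0" for z
      using comp_ext[OF ds, of z] that d s by auto
    have h: "d \<cdot> u = c \<cdot> (s \<cdot> (d \<cdot> u))" "d \<cdot> (s \<cdot> (c \<cdot> u)) = c \<cdot> u" using u d m dse se by auto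
    note M = mu[OF u(1) _ _ u(2) _ h(1)] mu[OF _ u(1) _ _ u(2) h(2)]
    have 1: "m1 \<cdot> (s \<cdot> (d \<cdot> u)) = gunit B \<cdot> (gdom B \<cdot> (m1 \<cdot> u))" "m1 \<cdot> (s \<cdot> (c \<cdot> u)) = gunit B \<cdot> (gcod B \<cdot> (m1 \<cdot> u))"
      using se(1)[of "d \<cdot> u"] se(1)[of "c \<cdot> u"] de[of u] u d m by auto
    show "mu u (s \<cdot> (d \<cdot> u)) = u" by (rule eqI) (use M u d m s B 1 in auto)
    show "mu (s \<cdot> (c \<cdot> u)) u = u" by (rule eqI) (use M u d m s B 1 se(2)[of "c \<cdot> u"] in auto)
  next
    fix u v w assume h: "arr u" "arr v" "arr w" "dom v = dom u" "dom w = dom u"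
      "cod u = I1" "cod v = I1" "cod w = I1" "d \<cdot> u = c \<cdot> v" "d \<cdot> v = c \<cdot> w"
    have 1: "gdom B \<cdot> (m1 \<cdot> u) = gcod B \<cdot> (m1 \<cdot> v)" "gdom B \<cdot> (m1 \<cdot> v) = gcod B \<cdot> (m1 \<cdot> w)"
      using cmp[of u v] cmp[of v w] h by auto
    show "mu (mu u v) w = mu u (mu v w)"
      by (rule eqI) (use h m B 1 in \<open>auto simp: mu\<close>)
  next
    have h: "arr (Idn C I1)" "arr i" "dom i = dom (Idn C I1)" "cod (Idn C I1) = I1" "cod i = I1" "d \<cdot> Idn C I1 = c \<cdot> i"
      and h': "dom (Idn C I1) = dom i" "d \<cdot> i = c \<cdot> Idn C I1"
      using i m d di by auto
    note M = mu[OF h] and M' = mu[OF h(2,1) h'(1) h(5,4) h'(2)]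
    show "mu (Idn C I1) i = s \<cdot> c"
      by (rule eqI) (use M i m d s B se[of c] de(2)[of "Idn C I1"] in auto)
    show "mu i (Idn C I1) = s \<cdot> d"
      by (rule eqI) (use M' i m d s B se[of d] d_over in auto)
  qed (use i di in auto)
  have F: "internal_functor C \<lparr>Src = I, Tgt = B, f0 = i0, f1 = m1\<rparr>"
    by (rule internal_functorI) (use I B i0 m d d_over D in \<open>auto simp: Im mu\<close>)
  have "\<lparr>Src = I, Tgt = B, f0 = i0, f1 = m1\<rparr> \<in> discrete_fibrations C"
    unfolding discrete_fibrations_def using F pb I by simp
  then show ?thesis using that[OF I(1,2) _ I(4,5) F] I I1_def by simp
qed

text \<open>The presheaf to be used has at \<open>y\<close> the connected components of the comma groupoid of arrows
\<open>y \<rightarrow> E x\<close>, on which \<open>B\<close> acts by precomposition. The object \<open>Q\<close> collects all pairs of an object \<open>x\<close> of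
\<open>A\<close> and an arrow \<open>b\<close> of \<open>B\<close> into \<open>E x\<close>, and \<open>k\<close> is its quotient by the translations along arrows of \<open>A\<close>;
the quotient is effective, so that equality of classes is witnessed locally by an arrow of \<open>A\<close>,
which gives fullness of the first factor. If \<open>E\<close> is a regular epimorphism on arrows then each \<open>b\<close> is
locally \<open>E u\<close>, so that the class of \<open>b\<close> is the class of an identity and \<open>P\<close> is surjective on
objects.\<close>

lemma comprehensive_factorization:
  assumes E: "internal_functor C E"
  obtains P M where "P \<in> full_ess_surj C" "M \<in> discrete_fibrations C" "Tgt P = Src M" "E = M \<bullet> P"
    "f1 E \<in> covers \<Longrightarrow> f0 P \<in> covers"
proof -
  define A B where "A = Src E" and "B = Tgt E"
  have s: "Src E = A" "Tgt E = B" by (auto simp: A_def B_def)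
  have g: "internal_groupoid C A" "internal_groupoid C B" using E s by auto
  obtain qa qb where pb: "is_pullback C (f0 E) (gcod B) qa qb" using pullback_exists[of "f0 E" "gcod B"] E s g by auto
  note D = is_pullback_D[OF pb]
  define Q where "Q = dom qa"
  have q: "arr qa" "dom qa = Q" "cod qa = G0 A" "arr qb" "dom qb = Q" "cod qb = G1 B" "Q \<in> Obj C"
    using D E s g unfolding Q_def by auto
  have qe: "gcod B \<cdot> (qb \<cdot> z) = f0 E \<cdot> (qa \<cdot> z)" if "arr z" "cod z = Q" for z
    by (rule comp_ext2[OF D(9)[symmetric]]) (use that q E s g in auto)
  \<comment> \<open>the element of Q given by an object x of A and an arrow b into its image\<close>
  define pr where "pr x b = pbpair C qa qb x b" for x b
  have pr: "arr (pr x b)" "dom (pr x b) = t" "cod (pr x b) = Q" "qa \<cdot> pr x b = x" "qb \<cdot> pr x b = b"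
    if "x \<in> Hom C t (G0 A)" "b \<in> Hom C t (G1 B)" "gcod B \<cdot> b = f0 E \<cdot> x" for x b t
    using pbpair[OF pb, of x b] that E s g q unfolding pr_def Q_def by auto
  have prc: "pr x b \<cdot> e = pr (x \<cdot> e) (b \<cdot> e)"
    if "x \<in> Hom C t (G0 A)" "b \<in> Hom C t (G1 B)" "gcod B \<cdot> b = f0 E \<cdot> x" "arr e" "cod e = t" for x b t e
    unfolding pr_def by (rule pbpair_comp[OF pb]) (use that E s g in auto)
  have eqQ: "a = b" if "qa \<cdot> a = qa \<cdot> b" "qb \<cdot> a = qb \<cdot> b" "arr a" "arr b" "dom a = dom b" "cod a = Q" "cod b = Q" for a b
    by (rule pullback_eqI[OF pb _ _ _ _ _ that(1,2)]) (use that q in auto)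
  have pr_all: "p = pr (qa \<cdot> p) (qb \<cdot> p)" if p: "arr p" "cod p = Q" for p
  proof -
    have h: "qa \<cdot> p \<in> Hom C (dom p) (G0 A)" "qb \<cdot> p \<in> Hom C (dom p) (G1 B)" using p q by auto
    note P = pr[OF h qe[OF p]]
    show ?thesis by (rule eqQ) (use P p in simp_all)
  qed
  \<comment> \<open>the relation identifying (x, b) with its translate along an arrow of A\<close>
  obtain ra rb where pbr: "is_pullback C (f0 E \<cdot> gdom A) (gcod B) ra rb"
    using pullback_exists[of "f0 E \<cdot> gdom A" "gcod B"] E s g by auto
  note DR = is_pullback_D[OF pbr]
  define R where "R = dom ra"
  have r: "arr ra" "dom ra = R" "cod ra = G1 A" "arr rb" "dom rb = R" "cod rb = G1 B"
    using DR E s g unfolding R_def by auto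
  have re: "gcod B \<cdot> rb = f0 E \<cdot> (gdom A \<cdot> ra)" using DR(9) E s g r by simp
  have rc: "gdom B \<cdot> (f1 E \<cdot> ra) = gcod B \<cdot> rb" using re E s r by simp
  define r1 r2 where "r1 = pr (gdom A \<cdot> ra) rb" and "r2 = pr (gcod A \<cdot> ra) (gcomp C B (f1 E \<cdot> ra) rb)"
  have r1: "arr r1" "dom r1 = R" "cod r1 = Q" "qa \<cdot> r1 = gdom A \<cdot> ra" "qb \<cdot> r1 = rb"
    using pr[of "gdom A \<cdot> ra" R rb] r re g unfolding r1_def by auto
  have r2: "arr r2" "dom r2 = R" "cod r2 = Q" "qa \<cdot> r2 = gcod A \<cdot> ra" "qb \<cdot> r2 = gcomp C B (f1 E \<cdot> ra) rb"
    using pr[of "gcod A \<cdot> ra" R "gcomp C B (f1 E \<cdot> ra) rb"] r rc g E s unfolding r2_def by auto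
  have r1e: "qa \<cdot> (r1 \<cdot> z) = gdom A \<cdot> (ra \<cdot> z)" "qb \<cdot> (r1 \<cdot> z) = rb \<cdot> z" if "arr z" "cod z = R" for z
    using comp_ext[OF r1(4), of z] comp_ext[OF r1(5), of z] that r r1 q g by auto
  have r2e: "qa \<cdot> (r2 \<cdot> z) = gcod A \<cdot> (ra \<cdot> z)" "qb \<cdot> (r2 \<cdot> z) = gcomp C B (f1 E \<cdot> (ra \<cdot> z)) (rb \<cdot> z)" if "arr z" "cod z = R" for z
    using comp_ext[OF r2(4), of z] comp_ext[OF r2(5), of z] that r r2 q g rc E s by auto
  have Rlift: "\<exists>w. arr w \<and> dom w = t \<and> cod w = R \<and> ra \<cdot> w = u \<and> rb \<cdot> w = b"
    if "u \<in> Hom C t (G1 A)" "b \<in> Hom C t (G1 B)" "gcod B \<cdot> b = f0 E \<cdot> (gdom A \<cdot> u)" for u b t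
    using pullback_lift[OF pbr, of u b] that E s g unfolding R_def by auto
  have relI: "related C r1 r2 p p'"
    if p: "p \<in> Hom C t Q" "p' \<in> Hom C t Q" and e: "e \<in> covers" "cod e = t" and u: "u \<in> Hom C (dom e) (G1 A)"
      "gdom A \<cdot> u = qa \<cdot> (p \<cdot> e)" "gcod A \<cdot> u = qa \<cdot> (p' \<cdot> e)" "gcomp C B (f1 E \<cdot> u) (qb \<cdot> (p \<cdot> e)) = qb \<cdot> (p' \<cdot> e)" for p p' t e u
  proof -
    have ea: "arr e" using e by simp
    obtain w where w: "arr w" "dom w = dom e" "cod w = R" "ra \<cdot> w = u" "rb \<cdot> w = qb \<cdot> (p \<cdot> e)"
      using Rlift[of u "dom e" "qb \<cdot> (p \<cdot> e)"] qe[of "p \<cdot> e"] p u q ea e by auto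
    have 1: "r1 \<cdot> w = p \<cdot> e" by (rule eqQ) (use r1e w u r1 ea p e in auto)
    have 2: "r2 \<cdot> w = p' \<cdot> e" by (rule eqQ) (use r2e w u r2 ea p e in auto)
    show ?thesis by (rule relatedI[OF e(1) _ w(1,2) _ 1 2]) (use p e w r1 in auto)
  qed
  have relE: "\<exists>e u. e \<in> covers \<and> arr e \<and> cod e = t \<and> arr u \<and> dom u = dom e \<and> cod u = G1 A \<and>
      gdom A \<cdot> u = qa \<cdot> (p \<cdot> e) \<and> gcod A \<cdot> u = qa \<cdot> (p' \<cdot> e) \<and> gcomp C B (f1 E \<cdot> u) (qb \<cdot> (p \<cdot> e)) = qb \<cdot> (p' \<cdot> e)"
    if p: "p \<in> Hom C t Q" "p' \<in> Hom C t Q" and rel: "related C r1 r2 p p'" for p p' t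
  proof -
    obtain e w where w: "e \<in> covers" "arr e" "cod e = dom p" "arr w" "dom w = dom e"
     "cod w = dom r1" "r1 \<cdot> w = p \<cdot> e" "r2 \<cdot> w = p' \<cdot> e" using rel by (rule relatedE)
    have "gdom A \<cdot> (ra \<cdot> w) = qa \<cdot> (p \<cdot> e)" "rb \<cdot> w = qb \<cdot> (p \<cdot> e)" using r1e[of w] w r1 by auto
    moreover have "gcod A \<cdot> (ra \<cdot> w) = qa \<cdot> (p' \<cdot> e)" "gcomp C B (f1 E \<cdot> (ra \<cdot> w)) (rb \<cdot> w) = qb \<cdot> (p' \<cdot> e)"
      using r2e[of w] w r1 by auto
    ultimately show ?thesis by (intro exI[of _ e] exI[of _ "ra \<cdot> w"]) (use w r r1 p in auto)
  qed
  obtain k where k: "is_coequalizer C r1 r2 k" and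
    krel: "\<And>x y. \<lbrakk>arr x; arr y; dom x = dom y; cod x = Q; cod y = Q\<rbrakk>
       \<Longrightarrow> k \<cdot> x = k \<cdot> y \<longleftrightarrow> related C r1 r2 x y"
  proof (rule effective_quotient[OF r1(1) r2(1) _ r1(3) r2(3)])
    fix p assume p: "arr p" "cod p = Q"
    show "related C r1 r2 p p"
    proof (rule relI[of p "dom p" p "Idn C (dom p)" "gunit A \<cdot> (qa \<cdot> p)"])
      show "gcomp C B (f1 E \<cdot> (gunit A \<cdot> (qa \<cdot> p))) (qb \<cdot> (p \<cdot> Idn C (dom p))) = qb \<cdot> (p \<cdot> Idn C (dom p))"
        using qe[OF p] p q g E s by simp
    qed (use p q g idn_regular_epi in auto)
  qed (use r1 r2 in auto)
  have kr: "k \<in> covers" using k by (rule regular_epiI)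
  have ka: "arr k" "dom k = Q" using k r1 unfolding is_coequalizer_def by auto
  define I0 where "I0 = cod k"
  have I0: "cod k = I0" "I0 \<in> Obj C" using ka I0_def by auto
  have ktrans: "k \<cdot> pr x b = k \<cdot> pr x' b'"
    if x: "x \<in> Hom C t (G0 A)" "b \<in> Hom C t (G1 B)" "gcod B \<cdot> b = f0 E \<cdot> x"
      "x' \<in> Hom C t (G0 A)" "b' \<in> Hom C t (G1 B)" "gcod B \<cdot> b' = f0 E \<cdot> x'"
      and u: "u \<in> Hom C t (G1 A)" "gdom A \<cdot> u = x" "gcod A \<cdot> u = x'" "gcomp C B (f1 E \<cdot> u) b = b'" for x b x' b' u t
  proof -
    note P = pr[OF x(1-3)] pr[OF x(4-6)]
    have "related C r1 r2 (pr x b) (pr x' b')"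
      by (rule relI[of _ t _ "Idn C t" u]) (use P u x idn_regular_epi Dom_Obj[of x] in auto)
    then show ?thesis using krel[of "pr x b" "pr x' b'"] P by simp
  qed
  have kE: "\<exists>e u. e \<in> covers \<and> arr e \<and> cod e = t \<and> arr u \<and> dom u = dom e \<and> cod u = G1 A \<and>
      gdom A \<cdot> u = x \<cdot> e \<and> gcod A \<cdot> u = x' \<cdot> e \<and> gcomp C B (f1 E \<cdot> u) (b \<cdot> e) = b' \<cdot> e"
    if x: "x \<in> Hom C t (G0 A)" "b \<in> Hom C t (G1 B)" "gcod B \<cdot> b = f0 E \<cdot> x"
      "x' \<in> Hom C t (G0 A)" "b' \<in> Hom C t (G1 B)" "gcod B \<cdot> b' = f0 E \<cdot> x'" and eq: "k \<cdot> pr x b = k \<cdot> pr x' b'" for x b x' b' t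
  proof -
    note P = pr[OF x(1-3)] pr[OF x(4-6)]
    have "related C r1 r2 (pr x b) (pr x' b')" using krel[of "pr x b" "pr x' b'"] P eq by simp
    then obtain e u where u: "e \<in> covers" "arr e" "cod e = t" "arr u" "dom u = dom e" "cod u = G1 A"
      "gdom A \<cdot> u = qa \<cdot> (pr x b \<cdot> e)" "gcod A \<cdot> u = qa \<cdot> (pr x' b' \<cdot> e)"
      "gcomp C B (f1 E \<cdot> u) (qb \<cdot> (pr x b \<cdot> e)) = qb \<cdot> (pr x' b' \<cdot> e)"
      using relE[of "pr x b" t "pr x' b'"] P by auto
    have "qa \<cdot> (pr x b \<cdot> e) = x \<cdot> e" "qb \<cdot> (pr x b \<cdot> e) = b \<cdot> e" "qa \<cdot> (pr x' b' \<cdot> e) = x' \<cdot> e" "qb \<cdot> (pr x' b' \<cdot> e) = b' \<cdot> e"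
      by ((rule comp_ext[OF P(4)] comp_ext[OF P(5)] comp_ext[OF P(9)] comp_ext[OF P(10)]); use P u q in simp)+
    then show ?thesis using u by auto
  qed
  have klift: "\<exists>e x b. e \<in> covers \<and> arr e \<and> cod e = dom i \<and> arr x \<and> dom x = dom e \<and> cod x = G0 A \<and>
     arr b \<and> dom b = dom e \<and> cod b = G1 B \<and> gcod B \<cdot> b = f0 E \<cdot> x \<and> k \<cdot> pr x b = i \<cdot> e"
    if i: "arr i" "cod i = I0" for i
  proof -
    obtain e p where p: "e \<in> covers" "arr e" "cod e = dom i" "arr p" "dom p = dom e"
      "cod p = Q" "k \<cdot> p = i \<cdot> e" using cover_lift[OF kr i(1)] i I0 ka by auto
    show ?thesis
      by (intro exI[of _ e] exI[of _ "qa \<cdot> p"] exI[of _ "qb \<cdot> p"])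
         (use p q qe[of p] pr_all[of p] in auto)
  qed
  define h where "h = gdom B \<cdot> qb"
  have h: "arr h" "dom h = Q" "cod h = G0 B" using q g unfolding h_def by auto
  have "h \<cdot> r1 = h \<cdot> r2" using r1 r2 q g r rc E s unfolding h_def by simp
  then obtain i0 where i0: "arr i0" "dom i0 = I0" "cod i0 = G0 B" "i0 \<cdot> k = h"
    using coequalizer_lift[OF k, of h] h r1 I0 by auto
  have i0e: "i0 \<cdot> (k \<cdot> z) = gdom B \<cdot> (qb \<cdot> z)" if "arr z" "cod z = Q" for z
    using comp_ext[OF i0(4), of z] that i0 ka I0 q g unfolding h_def by simp
  obtain m1 c where pbI: "is_pullback C (gcod B) i0 m1 c" using pullback_exists[of "gcod B" i0] g i0 by auto
  note DM = is_pullback_D[OF pbI]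
  define I1 where "I1 = dom m1"
  have m: "arr m1" "dom m1 = I1" "cod m1 = G1 B" "arr c" "dom c = I1" "cod c = I0" "I1 \<in> Obj C"
    using DM g i0 unfolding I1_def by auto
  have me: "gcod B \<cdot> (m1 \<cdot> z) = i0 \<cdot> (c \<cdot> z)" if "arr z" "cod z = I1" for z
    by (rule comp_ext2[OF DM(9)]) (use that m i0 g in auto)
  have I1lift: "\<exists>w. arr w \<and> dom w = t \<and> cod w = I1 \<and> m1 \<cdot> w = b \<and> c \<cdot> w = x"
    if "b \<in> Hom C t (G1 B)" "x \<in> Hom C t I0" "gcod B \<cdot> b = i0 \<cdot> x" for b x t
    using pullback_lift[OF pbI, of b x] that i0 m g by auto
  have eqI: "a = b" if "m1 \<cdot> a = m1 \<cdot> b" "c \<cdot> a = c \<cdot> b" "arr a" "arr b" "dom a = dom b" "cod a = I1" "cod b = I1" for a b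
    by (rule pullback_eqI[OF pbI _ _ _ _ _ that(1,2)]) (use that m in auto)
  \<comment> \<open>the action of B on the classes, by precomposition\<close>
  obtain n1 n2 where pbn: "is_pullback C (gcod B) h n1 n2" using pullback_exists[of "gcod B" h] g h by auto
  note DN = is_pullback_D[OF pbn]
  define N where "N = dom n1"
  have n12: "arr n1" "dom n1 = N" "cod n1 = G1 B" "arr n2" "dom n2 = N" "cod n2 = Q"
    using DN g h unfolding N_def by auto
  have ne: "gcod B \<cdot> (n1 \<cdot> z) = gdom B \<cdot> (qb \<cdot> (n2 \<cdot> z))" if "arr z" "cod z = N" for z
    using comp_ext2[OF DN(9), of z] that n12 g q unfolding h_def by simp
  have Nlift: "\<exists>w. arr w \<and> dom w = t \<and> cod w = N \<and> n1 \<cdot> w = b \<and> n2 \<cdot> w = p"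
    if "b \<in> Hom C t (G1 B)" "p \<in> Hom C t Q" "gcod B \<cdot> b = gdom B \<cdot> (qb \<cdot> p)" for b p t
  proof -
    have "gcod B \<cdot> b = h \<cdot> p" using that q g unfolding h_def by simp
    then show ?thesis using pullback_lift[OF pbn, of b p] that h n12 g by auto
  qed
  have nq: "gcod B \<cdot> n1 = gdom B \<cdot> (qb \<cdot> n2)" using DN(9) n12 q g unfolding h_def by simp
  obtain n where n: "arr n" "dom n = N" "cod n = I1" "m1 \<cdot> n = n1" "c \<cdot> n = k \<cdot> n2"
    using I1lift[of n1 N "k \<cdot> n2"] n12 nq ka I0 i0e[of n2] by auto
  have nee: "m1 \<cdot> (n \<cdot> z) = n1 \<cdot> z" "c \<cdot> (n \<cdot> z) = k \<cdot> (n2 \<cdot> z)" if "arr z" "cod z = N" for z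
    using comp_ext[OF n(4), of z] comp_ext[OF n(5), of z] that n n12 m ka by auto
  have nr: "n \<in> covers"
  proof -
    obtain e p where p: "e \<in> covers" "arr e" "cod e = I1" "arr p" "dom p = dom e"
      "cod p = Q" "k \<cdot> p = c \<cdot> e" using cover_lift[OF kr m(4)] m I0 ka by auto
    have "gcod B \<cdot> (m1 \<cdot> e) = gdom B \<cdot> (qb \<cdot> p)" using me[of e] i0e[of p] p by simp
    then obtain w where w: "arr w" "dom w = dom e" "cod w = N" "n1 \<cdot> w = m1 \<cdot> e" "n2 \<cdot> w = p"
      using Nlift[of "m1 \<cdot> e" "dom e" p] p m by auto
    have "n \<cdot> w = e" by (rule eqI) (use nee w p n m in auto)
    then show ?thesis using regular_epi_local[OF n(1) p(1) w(1)] w n by simp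
  qed
  define a where "a = pr (qa \<cdot> n2) (gcomp C B (qb \<cdot> n2) n1)"
  have a: "arr a" "dom a = N" "cod a = Q" "qa \<cdot> a = qa \<cdot> n2" "qb \<cdot> a = gcomp C B (qb \<cdot> n2) n1"
    using pr[of "qa \<cdot> n2" N "gcomp C B (qb \<cdot> n2) n1"] n12 q g nq qe[of n2] unfolding a_def by auto
  have ae: "a \<cdot> z = pr (qa \<cdot> (n2 \<cdot> z)) (gcomp C B (qb \<cdot> (n2 \<cdot> z)) (n1 \<cdot> z))" if "arr z" "cod z = N" for z
    using prc[of "qa \<cdot> n2" N "gcomp C B (qb \<cdot> n2) n1" z] that n12 q g nq qe[of n2] unfolding a_def by simp
  obtain d where d: "arr d" "dom d = I1" "cod d = I0" "d \<cdot> n = k \<cdot> a"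
  proof (rule glue[OF nr, of "k \<cdot> a"])
    fix w v assume wv: "arr w" "arr v" "dom w = dom v" "cod w = dom n" "cod v = dom n" "n \<cdot> w = n \<cdot> v"
    define t x b x' b' y where "t = dom v" and "x = qa \<cdot> (n2 \<cdot> w)" and "b = qb \<cdot> (n2 \<cdot> w)"
      and "x' = qa \<cdot> (n2 \<cdot> v)" and "b' = qb \<cdot> (n2 \<cdot> v)" and "y = n1 \<cdot> v"
    have w: "arr w" "arr v" "dom w = t" "dom v = t" "cod w = N" "cod v = N" using wv n t_def by auto
    have y': "n1 \<cdot> w = y" and kk: "k \<cdot> (n2 \<cdot> w) = k \<cdot> (n2 \<cdot> v)"
      using nee[of w] nee[of v] w wv(6) unfolding y_def by auto
    have x: "x \<in> Hom C t (G0 A)" "b \<in> Hom C t (G1 B)" "gcod B \<cdot> b = f0 E \<cdot> x"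
      "x' \<in> Hom C t (G0 A)" "b' \<in> Hom C t (G1 B)" "gcod B \<cdot> b' = f0 E \<cdot> x'" "y \<in> Hom C t (G1 B)"
      "gdom B \<cdot> b = gcod B \<cdot> y" "gdom B \<cdot> b' = gcod B \<cdot> y"
      unfolding x_def b_def x'_def b'_def using w q n12 qe ne[of w] ne[of v] y' by (auto simp: y_def)
    have "n2 \<cdot> w = pr x b" "n2 \<cdot> v = pr x' b'"
      using pr_all[of "n2 \<cdot> w"] pr_all[of "n2 \<cdot> v"] w n12 unfolding x_def b_def x'_def b'_def by auto
    then have "k \<cdot> pr x b = k \<cdot> pr x' b'" using kk by simp
    then obtain e u where u: "e \<in> covers" "arr e" "cod e = t" "arr u" "dom u = dom e" "cod u = G1 A"
      "gdom A \<cdot> u = x \<cdot> e" "gcod A \<cdot> u = x' \<cdot> e" "gcomp C B (f1 E \<cdot> u) (b \<cdot> e) = b' \<cdot> e"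
      using kE[OF x(1-6)] by blast
    have cy: "gdom B \<cdot> (b \<cdot> e) = gcod B \<cdot> (y \<cdot> e)" by (rule comp_ext2[OF x(8)]) (use x u g in auto)
    have cb: "gcod B \<cdot> (b \<cdot> e) = f0 E \<cdot> (x \<cdot> e)" by (rule comp_ext2[OF x(3)]) (use x u g E s in auto)
    have z: "gcomp C B b y \<in> Hom C t (G1 B)" "gcod B \<cdot> gcomp C B b y = f0 E \<cdot> x"
       "gcomp C B b' y \<in> Hom C t (G1 B)" "gcod B \<cdot> gcomp C B b' y = f0 E \<cdot> x'" using x g by auto
    have z': "x \<cdot> e \<in> Hom C (dom e) (G0 A)" "gcomp C B b y \<cdot> e \<in> Hom C (dom e) (G1 B)" "gcod B \<cdot> (gcomp C B b y \<cdot> e) = f0 E \<cdot> (x \<cdot> e)"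
       "x' \<cdot> e \<in> Hom C (dom e) (G0 A)" "gcomp C B b' y \<cdot> e \<in> Hom C (dom e) (G1 B)" "gcod B \<cdot> (gcomp C B b' y \<cdot> e) = f0 E \<cdot> (x' \<cdot> e)"
      using z x u comp_ext2[OF z(2), of e] comp_ext2[OF z(4), of e] g E s by (simp_all del: gcomp_comp)
    have "gcomp C B (f1 E \<cdot> u) (gcomp C B b y \<cdot> e) = gcomp C B (f1 E \<cdot> u) (gcomp C B (b \<cdot> e) (y \<cdot> e))"
      using x u g by simp
    also have "\<dots> = gcomp C B (gcomp C B (f1 E \<cdot> u) (b \<cdot> e)) (y \<cdot> e)"
      by (rule gcomp_assoc[OF g(2), symmetric]) (use x u(1-7) g E s cy cb in auto)
    also have "\<dots> = gcomp C B b' y \<cdot> e" using x u g by simp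
    finally have uu: "gcomp C B (f1 E \<cdot> u) (gcomp C B b y \<cdot> e) = gcomp C B b' y \<cdot> e" .
    have "k \<cdot> pr (x \<cdot> e) (gcomp C B b y \<cdot> e) = k \<cdot> pr (x' \<cdot> e) (gcomp C B b' y \<cdot> e)"
      by (rule ktrans[OF z' _ u(7,8) uu]) (use u in simp)
    then have "k \<cdot> (pr x (gcomp C B b y) \<cdot> e) = k \<cdot> (pr x' (gcomp C B b' y) \<cdot> e)"
      using prc[OF x(1) z(1,2)] prc[OF x(4) z(3,4)] u by simp
    then have "(k \<cdot> (a \<cdot> w)) \<cdot> e = (k \<cdot> (a \<cdot> v)) \<cdot> e"
      using ae[of w] ae[of v] w y' ka pr[OF x(1) z(1,2)] pr[OF x(4) z(3,4)] u
      unfolding x_def b_def x'_def b'_def y_def by simp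
    then have "k \<cdot> (a \<cdot> w) = k \<cdot> (a \<cdot> v)" by (rule regular_epi_epi[OF u(1), rotated 4]) (use u w ka a in auto)
    then show "(k \<cdot> a) \<cdot> w = (k \<cdot> a) \<cdot> v" using w ka a by simp
  qed (use a ka I0 n in auto)
  have act: "d \<cdot> w = k \<cdot> pr x (gcomp C B b y)"
    if x: "x \<in> Hom C t (G0 A)" "b \<in> Hom C t (G1 B)" "gcod B \<cdot> b = f0 E \<cdot> x" "w \<in> Hom C t I1" "m1 \<cdot> w = y" "gdom B \<cdot> b = gcod B \<cdot> y" "c \<cdot> w = k \<cdot> pr x b" for x b y w t
  proof -
    note P = pr[OF x(1-3)]
    have y: "y \<in> Hom C t (G1 B)" using x m by auto
    obtain z where z: "arr z" "dom z = t" "cod z = N" "n1 \<cdot> z = y" "n2 \<cdot> z = pr x b"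
      using Nlift[of y t "pr x b"] P x y by auto
    have "n \<cdot> z = w" by (rule eqI) (use nee z x n in auto)
    moreover have "d \<cdot> (n \<cdot> z) = k \<cdot> (a \<cdot> z)" by (rule comp_ext2[OF d(4)]) (use d n ka a z in auto)
    ultimately show ?thesis using ae[of z] z P by simp
  qed
  have d_over: "i0 \<cdot> d = gdom B \<cdot> m1"
    by (rule regular_epi_epi[OF nr]) (use i0 d n m g i0e[of a] a nq n12 q in auto)
  obtain I where I: "internal_groupoid C I" "G0 I = I0" "G1 I = dom m1" "gdom I = d" "gcod I = c"
    and M: "internal_functor C \<lparr>Src = I, Tgt = B, f0 = i0, f1 = m1\<rparr>" (is "internal_functor C ?M")
    and MD: "\<lparr>Src = I, Tgt = B, f0 = i0, f1 = m1\<rparr> \<in> discrete_fibrations C"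
  proof (rule action_groupoid[OF g(2) i0(1-3) pbI _ _ _ d_over])
    fix w assume w: "arr w" "cod w = dom m1" "m1 \<cdot> w = gunit B \<cdot> (i0 \<cdot> (c \<cdot> w))"
    have cw: "arr (c \<cdot> w)" "cod (c \<cdot> w) = I0" "dom (c \<cdot> w) = dom w" using w m by auto
    obtain e x b where l: "e \<in> covers" "arr e" "cod e = dom (c \<cdot> w)" "arr x" "dom x = dom e" "cod x = G0 A"
     "arr b" "dom b = dom e" "cod b = G1 B" "gcod B \<cdot> b = f0 E \<cdot> x" "k \<cdot> pr x b = (c \<cdot> w) \<cdot> e"
      using klift[OF cw(1,2)] by blast
    have P: "arr (pr x b)" "cod (pr x b) = Q" "qb \<cdot> pr x b = b" using pr[of x "dom e" b] l by auto
    have "i0 \<cdot> (c \<cdot> (w \<cdot> e)) = gdom B \<cdot> b" using i0e[of "pr x b"] P l w m by simp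
    then have mw: "m1 \<cdot> (w \<cdot> e) = gunit B \<cdot> (gdom B \<cdot> b)" using comp_ext[OF w(3), of e] w l m i0 g by simp
    have "d \<cdot> (w \<cdot> e) = k \<cdot> pr x (gcomp C B b (gunit B \<cdot> (gdom B \<cdot> b)))"
      by (rule act[OF _ _ l(10) _ mw]) (use l w m g in auto)
    then have "(d \<cdot> w) \<cdot> e = (c \<cdot> w) \<cdot> e" using l w m d g by simp
    then show "d \<cdot> w = c \<cdot> w" by (rule regular_epi_epi[OF l(1), rotated 4]) (use l w m d in auto)
  next
    fix u v w assume w: "arr u" "arr v" "arr w" "dom v = dom u" "dom w = dom u"
       "cod u = dom m1" "cod v = dom m1" "cod w = dom m1" "d \<cdot> u = c \<cdot> v"
       "m1 \<cdot> w = gcomp C B (m1 \<cdot> u) (m1 \<cdot> v)" "c \<cdot> w = c \<cdot> u"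
    have cw: "arr (c \<cdot> u)" "cod (c \<cdot> u) = I0" "dom (c \<cdot> u) = dom u" using w m by auto
    obtain e x b where l: "e \<in> covers" "arr e" "cod e = dom (c \<cdot> u)" "arr x" "dom x = dom e" "cod x = G0 A"
     "arr b" "dom b = dom e" "cod b = G1 B" "gcod B \<cdot> b = f0 E \<cdot> x" "k \<cdot> pr x b = (c \<cdot> u) \<cdot> e"
      using klift[OF cw(1,2)] by blast
    have P: "arr (pr x b)" "cod (pr x b) = Q" "qb \<cdot> pr x b = b" using pr[of x "dom e" b] l by auto
    define y1 y2 where "y1 = m1 \<cdot> (u \<cdot> e)" and "y2 = m1 \<cdot> (v \<cdot> e)"
    have y: "arr y1" "arr y2" "dom y1 = dom e" "dom y2 = dom e" "cod y1 = G1 B" "cod y2 = G1 B"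
      using w l m unfolding y1_def y2_def by auto
    have by1: "gdom B \<cdot> b = gcod B \<cdot> y1" using i0e[of "pr x b"] P l w m me[of "u \<cdot> e"] unfolding y1_def by simp
    have "i0 \<cdot> (d \<cdot> (u \<cdot> e)) = gdom B \<cdot> y1" unfolding y1_def by (rule comp_ext2[OF d_over]) (use w l m i0 d g in auto)
    moreover have du: "d \<cdot> (u \<cdot> e) = c \<cdot> (v \<cdot> e)" by (rule comp_ext2[OF w(9)]) (use w l m d in auto)
    ultimately have y12: "gdom B \<cdot> y1 = gcod B \<cdot> y2" using me[of "v \<cdot> e"] w l m unfolding y2_def by simp
    have m12: "gdom B \<cdot> (m1 \<cdot> u) = gcod B \<cdot> (m1 \<cdot> v)"
      using comp_ext2[OF d_over, of u] me[of v] w m i0 d g by auto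
    have wy: "m1 \<cdot> (w \<cdot> e) = gcomp C B y1 y2"
      using comp_ext[OF w(10), of e] w l m m12 g unfolding y1_def y2_def by simp
    have "c \<cdot> (w \<cdot> e) = c \<cdot> (u \<cdot> e)" by (rule comp_ext2[OF w(11)]) (use w(1-8) l m in auto)
    then have cwe: "c \<cdot> (w \<cdot> e) = k \<cdot> pr x b" using w(1-8) l m by simp
    have 1: "d \<cdot> (u \<cdot> e) = k \<cdot> pr x (gcomp C B b y1)"
      by (rule act[OF _ _ l(10) _ y1_def[symmetric] by1]) (use l w m in auto)
    have 2: "d \<cdot> (v \<cdot> e) = k \<cdot> pr x (gcomp C B (gcomp C B b y1) y2)"
      by (rule act[of _ "dom e" _ _ y2, OF _ _ _ _ y2_def[symmetric]]) (use 1 du l w m y by1 y12 g in auto)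
    have 3: "d \<cdot> (w \<cdot> e) = k \<cdot> pr x (gcomp C B b (gcomp C B y1 y2))"
      by (rule act[OF _ _ l(10) _ wy _ cwe]) (use l w m y by1 y12 g in auto)
    have "(d \<cdot> w) \<cdot> e = (d \<cdot> v) \<cdot> e" using 2 3 l w m d g y by1 y12 by simp
    then show "d \<cdot> w = d \<cdot> v" by (rule regular_epi_epi[OF l(1), rotated 4]) (use l w m d in auto)
  qed (use d m in auto)
  have MM: "Src ?M = I" "Tgt ?M = B" by auto
  \<comment> \<open>the first factor sends x to the class of (x, identity)\<close>
  define j where "j z = pr z (gunit B \<cdot> (f0 E \<cdot> z))" for z
  have jp: "z \<in> Hom C (dom z) (G0 A)" "gunit B \<cdot> (f0 E \<cdot> z) \<in> Hom C (dom z) (G1 B)" "gcod B \<cdot> (gunit B \<cdot> (f0 E \<cdot> z)) = f0 E \<cdot> z"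
    "arr (j z)" "dom (j z) = dom z" "cod (j z) = Q" "qa \<cdot> j z = z" "qb \<cdot> j z = gunit B \<cdot> (f0 E \<cdot> z)"
    if "arr z" "cod z = G0 A" for z
    using that E s g pr[of z "dom z" "gunit B \<cdot> (f0 E \<cdot> z)"] unfolding j_def by auto
  define e0 where "e0 = k \<cdot> j (Idn C (G0 A))"
  have IA: "arr (Idn C (G0 A))" "cod (Idn C (G0 A)) = G0 A" using g by auto
  have e0: "arr e0" "dom e0 = G0 A" "cod e0 = I0" using jp[OF IA] ka I0 g unfolding e0_def by auto
  have e0e: "e0 \<cdot> z = k \<cdot> j z" if "arr z" "cod z = G0 A" for z
    using prc[OF jp(1-3)[OF IA], of z] that jp[OF IA] g ka E s unfolding e0_def j_def by simp
  have i0j: "i0 \<cdot> (e0 \<cdot> z) = f0 E \<cdot> z" if "arr z" "cod z = G0 A" for z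
    using e0e[OF that] i0e[of "j z"] jp[OF that] that E s g by simp
  obtain e1 where e1: "arr e1" "dom e1 = G1 A" "cod e1 = I1" "m1 \<cdot> e1 = f1 E" "c \<cdot> e1 = e0 \<cdot> gcod A"
    using I1lift[of "f1 E" "G1 A" "e0 \<cdot> gcod A"] E s g e0 i0j[of "gcod A"] functor_gdom_arr(2)[OF E s(2,1)] by auto
  have e1d: "d \<cdot> e1 = e0 \<cdot> gdom A"
  proof -
    note J = jp[of "gcod A"] jp[of "gdom A"]
    have fE: "gdom B \<cdot> f1 E = f0 E \<cdot> gdom A" "gcod B \<cdot> f1 E = f0 E \<cdot> gcod A" using functor_gdom_arr(1,2)[OF E s(2,1)] by auto
    have "d \<cdot> e1 = k \<cdot> pr (gcod A) (gcomp C B (gunit B \<cdot> (f0 E \<cdot> gcod A)) (f1 E))"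
      by (rule act[of _ "G1 A"]) (use J E s g e1 e0e[of "gcod A"] fE in \<open>auto simp: j_def\<close>)
    also have "\<dots> = k \<cdot> pr (gcod A) (f1 E)" using E s g fE by simp
    also have "\<dots> = k \<cdot> j (gdom A)" unfolding j_def
      by (rule ktrans[symmetric, where u = "Idn C (G1 A)" and t = "G1 A"]) (use J E s g fE in auto)
    finally show ?thesis using e0e[of "gdom A"] g by simp
  qed
  define P where "P = \<lparr>Src = A, Tgt = I, f0 = e0, f1 = e1\<rparr>"
  have P: "internal_functor C P" unfolding P_def
  proof (rule internal_functorI[OF g(1) I(1)])
    fix u v assume uv: "arr u" "arr v" "dom v = dom u" "cod u = G1 A" "cod v = G1 A" "gdom A \<cdot> u = gcod A \<cdot> v"
    have e1e: "m1 \<cdot> (e1 \<cdot> z) = f1 E \<cdot> z" "c \<cdot> (e1 \<cdot> z) = e0 \<cdot> (gcod A \<cdot> z)" if "arr z" "cod z = G1 A" for z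
      using comp_ext[OF e1(4), of z] comp_ext[OF e1(5), of z] that e1 m e0 g by auto
    have cc: "d \<cdot> (e1 \<cdot> u) = c \<cdot> (e1 \<cdot> v)"
    proof -
      have "d \<cdot> (e1 \<cdot> u) = e0 \<cdot> (gdom A \<cdot> u)" by (rule comp_ext2[OF e1d]) (use uv d e1 e0 g in auto)
      then show ?thesis using e1e(2)[of v] uv by simp
    qed
    have gi: "arr (gcomp C I (e1 \<cdot> u) (e1 \<cdot> v))" "dom (gcomp C I (e1 \<cdot> u) (e1 \<cdot> v)) = dom u"
      "cod (gcomp C I (e1 \<cdot> u) (e1 \<cdot> v)) = I1" "c \<cdot> gcomp C I (e1 \<cdot> u) (e1 \<cdot> v) = c \<cdot> (e1 \<cdot> u)"
      using gcomp_arr[OF I(1), of "e1 \<cdot> u" "e1 \<cdot> v"] I uv e1 cc m by auto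
    have gm: "m1 \<cdot> gcomp C I (e1 \<cdot> u) (e1 \<cdot> v) = gcomp C B (m1 \<cdot> (e1 \<cdot> u)) (m1 \<cdot> (e1 \<cdot> v))"
      using functor_gcomp[OF M MM(1), of "e1 \<cdot> u" "e1 \<cdot> v"] I uv e1 cc m by auto
    show "e1 \<cdot> gcomp C A u v = gcomp C I (e1 \<cdot> u) (e1 \<cdot> v)"
      by (rule eqI) (use gi gm uv e1 g e1e E s in auto)
  qed (use I m e0 e1 e1d in auto)
  have EMP: "E = ?M \<bullet> P"
    by (rule functor_eqI) (use s e1 i0j[of "Idn C (G0 A)"] e0 g E i0 in \<open>auto simp: P_def\<close>)
  have "locally_full C P" unfolding locally_full_def
  proof (intro allI ballI impI)
    fix t x y w assume xy: "x \<in> Hom C t (G0 (Src P))" "y \<in> Hom C t (G0 (Src P))" "w \<in> Hom C t (G1 (Tgt P))"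
      "gdom (Tgt P) \<cdot> w = f0 P \<cdot> x" "gcod (Tgt P) \<cdot> w = f0 P \<cdot> y"
    then have h: "arr x" "dom x = t" "cod x = G0 A" "arr y" "dom y = t" "cod y = G0 A"
      "arr w" "dom w = t" "cod w = I1" "d \<cdot> w = e0 \<cdot> x" "c \<cdot> w = e0 \<cdot> y" using I m by (auto simp: P_def)
    define b where "b = m1 \<cdot> w"
    have b: "arr b" "dom b = t" "cod b = G1 B" "gcod B \<cdot> b = f0 E \<cdot> y"
      using h m me[of w] i0j[of y] unfolding b_def by auto
    have "i0 \<cdot> (d \<cdot> w) = gdom B \<cdot> b" unfolding b_def by (rule comp_ext2[OF d_over]) (use h m i0 d g in auto)
    then have bd: "gdom B \<cdot> b = f0 E \<cdot> x" using h i0j[of x] by simp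
    note J = jp[OF h(1,3)] jp[OF h(4,6)]
    have "d \<cdot> w = k \<cdot> pr y (gcomp C B (gunit B \<cdot> (f0 E \<cdot> y)) b)"
      by (rule act[of _ t]) (use J h b g E s e0e[of y] in \<open>auto simp: b_def[symmetric] j_def\<close>)
    then have "k \<cdot> pr x (gunit B \<cdot> (f0 E \<cdot> x)) = k \<cdot> pr y b" using h b g E s e0e[of x] unfolding j_def by simp
    then obtain e u where u: "e \<in> covers" "arr e" "cod e = t" "arr u" "dom u = dom e" "cod u = G1 A"
      "gdom A \<cdot> u = x \<cdot> e" "gcod A \<cdot> u = y \<cdot> e" "gcomp C B (f1 E \<cdot> u) ((gunit B \<cdot> (f0 E \<cdot> x)) \<cdot> e) = b \<cdot> e"
      using kE[of x t "gunit B \<cdot> (f0 E \<cdot> x)" y b] J h b by auto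
    have fu: "f1 E \<cdot> u = b \<cdot> e" using u(9) u h g E s by simp
    have "e1 \<cdot> u = w \<cdot> e"
    proof (rule eqI)
      show "m1 \<cdot> (e1 \<cdot> u) = m1 \<cdot> (w \<cdot> e)" using comp_ext[OF e1(4), of u] fu u h m e1 unfolding b_def by simp
      have "c \<cdot> (e1 \<cdot> u) = e0 \<cdot> (gcod A \<cdot> u)" by (rule comp_ext2[OF e1(5)]) (use u e1 m e0 g in auto)
      also have "\<dots> = c \<cdot> (w \<cdot> e)" using comp_ext2[OF h(11), of e] u h m e0 by simp
      finally show "c \<cdot> (e1 \<cdot> u) = c \<cdot> (w \<cdot> e)" .
    qed (use u h e1 in auto)
    then show "\<exists>e \<in> covers. cod e = t \<and> (\<exists>u \<in> Hom C (dom e) (G1 (Src P)).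
        gdom (Src P) \<cdot> u = x \<cdot> e \<and> gcod (Src P) \<cdot> u = y \<cdot> e \<and> f1 P \<cdot> u = w \<cdot> e)"
      by (intro bexI[of _ e] conjI bexI[of _ u]) (use u in \<open>auto simp: P_def\<close>)
  qed
  moreover have "locally_ess_surj C P" unfolding locally_ess_surj_def
  proof (intro allI ballI)
    fix t i assume "i \<in> Hom C t (G0 (Tgt P))"
    then have i: "arr i" "dom i = t" "cod i = I0" using I by (auto simp: P_def)
    obtain e x b where l: "e \<in> covers" "arr e" "cod e = dom i" "arr x" "dom x = dom e" "cod x = G0 A"
     "arr b" "dom b = dom e" "cod b = G1 B" "gcod B \<cdot> b = f0 E \<cdot> x" "k \<cdot> pr x b = i \<cdot> e"
      using klift[OF i(1,3)] by blast
    note J = jp[OF l(4,6)]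
    obtain w where w: "arr w" "dom w = dom e" "cod w = I1" "m1 \<cdot> w = b" "c \<cdot> w = e0 \<cdot> x"
      using I1lift[of b "dom e" "e0 \<cdot> x"] l e0 i0j[of x] by auto
    have "d \<cdot> w = k \<cdot> pr x (gcomp C B (gunit B \<cdot> (f0 E \<cdot> x)) b)"
      by (rule act[of _ "dom e"]) (use J l w g E s e0e[of x] in \<open>auto simp: j_def\<close>)
    then have "d \<cdot> w = i \<cdot> e" using l g E s by simp
    then show "\<exists>e \<in> covers. cod e = t \<and> (\<exists>x \<in> Hom C (dom e) (G0 (Src P)). \<exists>b \<in> Hom C (dom e) (G1 (Tgt P)).
        gdom (Tgt P) \<cdot> b = i \<cdot> e \<and> gcod (Tgt P) \<cdot> b = f0 P \<cdot> x)"
      by (intro bexI[of _ e] conjI bexI[of _ x] bexI[of _ w]) (use w l i I m in \<open>auto simp: P_def\<close>)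
  qed
  ultimately have "P \<in> full_ess_surj C" using P unfolding full_ess_surj_def by simp
  moreover have "f0 P \<in> covers" if r: "f1 E \<in> covers"
  proof -
    obtain e x b where l: "e \<in> covers" "arr e" "cod e = I0" "arr x" "dom x = dom e" "cod x = G0 A"
     "arr b" "dom b = dom e" "cod b = G1 B" "gcod B \<cdot> b = f0 E \<cdot> x" "k \<cdot> pr x b = Idn C I0 \<cdot> e"
      using klift[of "Idn C I0"] I0 by auto
    obtain e' u where u: "e' \<in> covers" "arr e'" "cod e' = dom e" "arr u" "dom u = dom e'"
      "cod u = G1 A" "gdom A \<cdot> u = x \<cdot> e'" "f1 E \<cdot> u = (ginv C B \<cdot> b) \<cdot> e'"
      by (rule regular_functor_lift[OF E r s, of "ginv C B \<cdot> b" "dom e" x]) (use l g in auto)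
    have fu: "f1 E \<cdot> u = ginv C B \<cdot> (b \<cdot> e')" using u l g by simp
    have bc: "gcod B \<cdot> (b \<cdot> e') = f0 E \<cdot> (x \<cdot> e')" by (rule comp_ext2[OF l(10)]) (use l u g E s in auto)
    have "gcod B \<cdot> (f1 E \<cdot> u) = f0 E \<cdot> (gcod A \<cdot> u)"
      using functor_gdom(2)[OF E s(2), of u] u(4-6) s by simp
    then have bd: "f0 E \<cdot> (gcod A \<cdot> u) = gdom B \<cdot> (b \<cdot> e')" using fu l u g by simp
    have "k \<cdot> pr (x \<cdot> e') (b \<cdot> e') = k \<cdot> j (gcod A \<cdot> u)" unfolding j_def
      by (rule ktrans[where u = u and t = "dom e'"]) (use u l g E s fu bc bd in auto)
    then have "e0 \<cdot> (gcod A \<cdot> u) = e \<cdot> e'"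
      using e0e[of "gcod A \<cdot> u"] prc[of x "dom e" b e'] l u g ka I0 pr[of x "dom e" b] comp_ext[of k "pr x b" e e'] by simp
    then have "e0 \<in> covers"
      using regular_epi_local[OF e0(1) regular_epi_comp[OF u(1) l(1)], of "gcod A \<cdot> u"] u l g e0 by simp
    then show ?thesis by (simp add: P_def)
  qed
  ultimately show ?thesis using that[OF _ MD _ EMP] MM by (simp add: P_def)
qed

end

section \<open>Monadic functors\<close>

lemma functorD:
  assumes "is_functor A B F"
  shows "x \<in> Obj A \<Longrightarrow> FObj F x \<in> Obj B"
    "f \<in> Arr A \<Longrightarrow> FArr F f \<in> Arr B" "f \<in> Arr A \<Longrightarrow> Dom B (FArr F f) = FObj F (Dom A f)"
    "f \<in> Arr A \<Longrightarrow> Cod B (FArr F f) = FObj F (Cod A f)"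
    "x \<in> Obj A \<Longrightarrow> FArr F (Idn A x) = Idn B (FObj F x)"
    "\<lbrakk>f \<in> Arr A; g \<in> Arr A; Dom A g = Cod A f\<rbrakk>
       \<Longrightarrow> FArr F (g \<cdot>\<^bsub>A\<^esub> f) = FArr F g \<cdot>\<^bsub>B\<^esub> FArr F f"
  using assms unfolding is_functor_def by auto

lemma comp_functor_sel [simp]:
  "FObj (comp_functor G F) x = FObj G (FObj F x)" "FArr (comp_functor G F) f = FArr G (FArr F f)"
  by (simp_all add: comp_functor_def)

lemma comp_functor_functor:
  assumes "is_functor A B F" "is_functor B D G" shows "is_functor A D (comp_functor G F)"
  using assms unfolding is_functor_def by simp

lemma EM_category_sel [simp]:
  "Obj (EM_category X T \<eta> \<mu>) = EM_algebras X T \<eta> \<mu>"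
  "Dom (EM_category X T \<eta> \<mu>) (s, f, t) = s" "Cod (EM_category X T \<eta> \<mu>) (s, f, t) = t"
  "(s', g, t') \<cdot>\<^bsub>EM_category X T \<eta> \<mu>\<^esub> (s, f, t) = (s, g \<cdot>\<^bsub>X\<^esub> f, t')"
  "Idn (EM_category X T \<eta> \<mu>) (x, h) = ((x, h), Idn X x, (x, h))"
  by (simp_all add: EM_category_def)

lemma EM_arr_iff:
  "(s, f, t) \<in> Arr (EM_category X T \<eta> \<mu>) \<longleftrightarrow> s \<in> EM_algebras X T \<eta> \<mu> \<and> t \<in> EM_algebras X T \<eta> \<mu> \<and>
     f \<in> Hom X (fst s) (fst t) \<and> f \<cdot>\<^bsub>X\<^esub> snd s = snd t \<cdot>\<^bsub>X\<^esub> FArr T f"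
  by (cases s; cases t) (simp add: EM_category_def)

lemma EM_algebra_iff:
  "(x, h) \<in> EM_algebras X T \<eta> \<mu> \<longleftrightarrow> x \<in> Obj X \<and> h \<in> Hom X (FObj T x) x \<and>
     h \<cdot>\<^bsub>X\<^esub> \<eta> x = Idn X x \<and> h \<cdot>\<^bsub>X\<^esub> \<mu> x = h \<cdot>\<^bsub>X\<^esub> FArr T h"
  by (simp add: EM_algebras_def)

lemma EM_category:
  assumes X: "category X" and T: "is_functor X X T"
  shows "category (EM_category X T \<eta> \<mu>)" (is "category ?M")
proof -
  interpret X: category X by fact
  note T = functorD[OF T]
  have arrE: "\<exists>x h f y k. \<phi> = ((x, h), f, (y, k)) \<and> (x, h) \<in> EM_algebras X T \<eta> \<mu> \<and> (y, k) \<in> EM_algebras X T \<eta> \<mu> \<and>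
     f \<in> Arr X \<and> Dom X f = x \<and> Cod X f = y \<and> f \<cdot>\<^bsub>X\<^esub> h = k \<cdot>\<^bsub>X\<^esub> FArr T f" if "\<phi> \<in> Arr ?M" for \<phi>
    using that by (auto simp: EM_category_def)
  show ?thesis
  proof
    fix f assume f: "f \<in> Arr ?M"
    show "Dom ?M f \<in> Obj ?M" "Cod ?M f \<in> Obj ?M" using arrE[OF f] by auto
  next
    fix a assume a: "a \<in> Obj ?M"
    obtain x h where xh: "a = (x, h)" by (cases a)
    with a have h: "x \<in> Obj X" "h \<in> Arr X" "Dom X h = FObj T x" "Cod X h = x" by (auto simp: EM_algebra_iff)
    show "Idn ?M a \<in> Hom ?M a a"
      using a h T(5)[OF h(1)] unfolding xh by (simp add: EM_arr_iff)
  next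
    fix f g a b c assume fg: "f \<in> Hom ?M a b" "g \<in> Hom ?M b c"
    have A: "f \<in> Arr ?M" "g \<in> Arr ?M" using fg by auto
    obtain x h f' y k where f: "f = ((x, h), f', (y, k))" "(x, h) \<in> EM_algebras X T \<eta> \<mu>" "(y, k) \<in> EM_algebras X T \<eta> \<mu>"
      "f' \<in> Arr X" "Dom X f' = x" "Cod X f' = y" "f' \<cdot>\<^bsub>X\<^esub> h = k \<cdot>\<^bsub>X\<^esub> FArr T f'"
      using arrE[OF A(1)] by blast
    obtain x' h' g' z l where g: "g = ((x', h'), g', (z, l))" "(x', h') \<in> EM_algebras X T \<eta> \<mu>" "(z, l) \<in> EM_algebras X T \<eta> \<mu>"
      "g' \<in> Arr X" "Dom X g' = x'" "Cod X g' = z" "g' \<cdot>\<^bsub>X\<^esub> h' = l \<cdot>\<^bsub>X\<^esub> FArr T g'"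
      using arrE[OF A(2)] by blast
    have ab: "x' = y" "h' = k" "a = (x, h)" "c = (z, l)" using f g fg by auto
    have h: "h \<in> Arr X" "Dom X h = FObj T x" "Cod X h = x" "k \<in> Arr X" "Dom X k = FObj T y" "Cod X k = y"
      "l \<in> Arr X" "Dom X l = FObj T z" "Cod X l = z" using f(2,3) g(3) by (auto simp: EM_algebra_iff)
    have "(g' \<cdot>\<^bsub>X\<^esub> f') \<cdot>\<^bsub>X\<^esub> h = g' \<cdot>\<^bsub>X\<^esub> (k \<cdot>\<^bsub>X\<^esub> FArr T f')" using f g ab h by simp
    also have "\<dots> = (l \<cdot>\<^bsub>X\<^esub> FArr T g') \<cdot>\<^bsub>X\<^esub> FArr T f'"
      by (rule X.comp_ext) (use f g ab h T(2-4) in auto)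
    also have "\<dots> = l \<cdot>\<^bsub>X\<^esub> FArr T (g' \<cdot>\<^bsub>X\<^esub> f')" using f g ab h T(2-4,6) by simp
    finally show "g \<cdot>\<^bsub>?M\<^esub> f \<in> Hom ?M a c" using f g ab by (simp add: EM_arr_iff)
  next
    fix f a b assume "f \<in> Hom ?M a b"
    then show "f \<cdot>\<^bsub>?M\<^esub> Idn ?M a = f" "Idn ?M b \<cdot>\<^bsub>?M\<^esub> f = f" using arrE[of f] by auto
  next
    fix f g h a b c d assume fgh: "f \<in> Hom ?M a b" "g \<in> Hom ?M b c" "h \<in> Hom ?M c d"
    then obtain x1 f' x2 x2' g' x3 x3' h' x4 where
      "f = (x1, f', x2)" "g = (x2', g', x3)" "h = (x3', h', x4)" "f' \<in> Arr X" "g' \<in> Arr X" "h' \<in> Arr X"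
      "Dom X g' = fst x2'" "Cod X f' = fst x2" "Dom X h' = fst x3'" "Cod X g' = fst x3"
      using arrE[of f] arrE[of g] arrE[of h] by fastforce
    then show "(h \<cdot>\<^bsub>?M\<^esub> g) \<cdot>\<^bsub>?M\<^esub> f = h \<cdot>\<^bsub>?M\<^esub> (g \<cdot>\<^bsub>?M\<^esub> f)" using fgh by simp
  qed
qed

lemma nat_transD:
  assumes "is_nat_trans A B F G \<tau>"
  shows "x \<in> Obj A \<Longrightarrow> \<tau> x \<in> Arr B" "x \<in> Obj A \<Longrightarrow> Dom B (\<tau> x) = FObj F x" "x \<in> Obj A \<Longrightarrow> Cod B (\<tau> x) = FObj G x"
    "f \<in> Arr A \<Longrightarrow> \<tau> (Cod A f) \<cdot>\<^bsub>B\<^esub> FArr F f = FArr G f \<cdot>\<^bsub>B\<^esub> \<tau> (Dom A f)"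
  using assms unfolding is_nat_trans_def by auto

lemma comparison_functor_functor:
  assumes A: "category A" and X: "category X" and adj: "is_adjunction X A L U \<eta> \<epsilon>"
  shows "is_functor A (EM_category X (comp_functor U L) \<eta> (\<lambda>x. FArr U (\<epsilon> (FObj L x)))) (comparison_functor A U \<epsilon>)"
    (is "is_functor A ?M ?K")
proof -
  interpret A: category A by fact
  interpret X: category X by fact
  have L: "is_functor X A L" and U: "is_functor A X U"
    and eta: "is_nat_trans X X id_functor (comp_functor U L) \<eta>" and eps: "is_nat_trans A A (comp_functor L U) id_functor \<epsilon>"
    and tri: "\<And>a. a \<in> Obj A \<Longrightarrow> FArr U (\<epsilon> a) \<cdot>\<^bsub>X\<^esub> \<eta> (FObj U a) = Idn X (FObj U a)"
    using adj unfolding is_adjunction_def by auto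
  note L = functorD[OF L] and U = functorD[OF U] and eta = nat_transD[OF eta] and eps = nat_transD[OF eps]
  have alg: "(FObj U a, FArr U (\<epsilon> a)) \<in> EM_algebras X (comp_functor U L) \<eta> (\<lambda>x. FArr U (\<epsilon> (FObj L x)))"
    if a: "a \<in> Obj A" for a
    unfolding EM_algebra_iff
  proof (intro conjI)
    note e = eps(1-3)[OF a]
    have LU: "FObj L (FObj U a) \<in> Obj A" using a L U by simp
    note e' = eps(1-3)[OF LU]
    have "\<epsilon> a \<cdot>\<^bsub>A\<^esub> FArr L (FArr U (\<epsilon> a)) = \<epsilon> a \<cdot>\<^bsub>A\<^esub> \<epsilon> (FObj L (FObj U a))"
      using eps(4)[OF e(1)] e a by (simp add: id_functor_def)
    then have "FArr U (\<epsilon> a \<cdot>\<^bsub>A\<^esub> FArr L (FArr U (\<epsilon> a))) = FArr U (\<epsilon> a \<cdot>\<^bsub>A\<^esub> \<epsilon> (FObj L (FObj U a)))" by simp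
    then show "FArr U (\<epsilon> a) \<cdot>\<^bsub>X\<^esub> FArr U (\<epsilon> (FObj L (FObj U a))) = FArr U (\<epsilon> a) \<cdot>\<^bsub>X\<^esub> FArr (comp_functor U L) (FArr U (\<epsilon> a))"
      using U(6) e e' L U(1-4) a by (simp add: id_functor_def)
  qed (use a U eps(1-3)[OF a] tri in \<open>auto simp: id_functor_def\<close>)
  show ?thesis unfolding is_functor_def
  proof (intro conjI ballI impI)
    fix a assume a: "a \<in> Obj A"
    show "FObj ?K a \<in> Obj ?M" using alg[OF a] by (simp add: comparison_functor_def)
    show "FArr ?K (Idn A a) = Idn ?M (FObj ?K a)" using a U by (simp add: comparison_functor_def)
  next
    fix f assume f: "f \<in> Arr A"
    note e = eps(1-3)[OF A.Dom_Obj[OF f]] eps(1-3)[OF A.Cod_Obj[OF f]]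
    have "\<epsilon> (Cod A f) \<cdot>\<^bsub>A\<^esub> FArr L (FArr U f) = f \<cdot>\<^bsub>A\<^esub> \<epsilon> (Dom A f)" using eps(4)[OF f] by (simp add: id_functor_def)
    then have "FArr U (\<epsilon> (Cod A f) \<cdot>\<^bsub>A\<^esub> FArr L (FArr U f)) = FArr U (f \<cdot>\<^bsub>A\<^esub> \<epsilon> (Dom A f))" by simp
    then have "FArr U f \<cdot>\<^bsub>X\<^esub> FArr U (\<epsilon> (Dom A f)) = FArr U (\<epsilon> (Cod A f)) \<cdot>\<^bsub>X\<^esub> FArr U (FArr L (FArr U f))"
      using U(6) e L(2-4) U(2-4) f by (simp add: id_functor_def)
    then show "FArr ?K f \<in> Hom ?M (FObj ?K (Dom A f)) (FObj ?K (Cod A f))"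
      using alg[of "Dom A f"] alg[of "Cod A f"] f U(2-4) by (simp add: comparison_functor_def EM_arr_iff)
    fix g assume "g \<in> Arr A" "Dom A g = Cod A f"
    then show "FArr ?K (g \<cdot>\<^bsub>A\<^esub> f) = FArr ?K g \<cdot>\<^bsub>?M\<^esub> FArr ?K f" using f U(6) by (simp add: comparison_functor_def)
  qed
qed

text \<open>The inverse functor chooses an object and an isomorphism for each object of \<open>B\<close>.\<close>

lemma fully_faithful_ess_surj_equivalence:
  assumes A: "category A" and B: "category B" and F: "is_functor A B F"
    and ff: "\<And>x y \<phi>. \<lbrakk>x \<in> Obj A; y \<in> Obj A; \<phi> \<in> Hom B (FObj F x) (FObj F y)\<rbrakk>
       \<Longrightarrow> \<exists>!f. f \<in> Hom A x y \<and> FArr F f = \<phi>"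
    and es: "\<And>b. b \<in> Obj B \<Longrightarrow> \<exists>a \<in> Obj A. \<exists>i \<in> Hom B (FObj F a) b. is_iso B i"
  shows "is_equivalence_functor A B F"
proof -
  interpret A: category A by fact
  interpret B: category B by fact
  note Ff = functorD[OF F]
  obtain go where go: "\<And>b. b \<in> Obj B \<Longrightarrow> go b \<in> Obj A \<and> (\<exists>i \<in> Hom B (FObj F (go b)) b. is_iso B i)"
    using es by metis
  obtain \<beta> where \<beta>: "\<And>b. b \<in> Obj B \<Longrightarrow> \<beta> b \<in> Hom B (FObj F (go b)) b \<and> is_iso B (\<beta> b)"
    using go by metis
  have "\<forall>b. \<exists>j. b \<in> Obj B \<longrightarrow> j \<in> Hom B b (FObj F (go b)) \<and> j \<cdot>\<^bsub>B\<^esub> \<beta> b = Idn B (FObj F (go b)) \<and> \<beta> b \<cdot>\<^bsub>B\<^esub> j = Idn B b"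
    using \<beta> unfolding is_iso_def by (metis Hom_iff)
  then obtain \<gamma> where \<gamma>: "\<And>b. b \<in> Obj B \<Longrightarrow> \<gamma> b \<in> Hom B b (FObj F (go b)) \<and>
     \<gamma> b \<cdot>\<^bsub>B\<^esub> \<beta> b = Idn B (FObj F (go b)) \<and> \<beta> b \<cdot>\<^bsub>B\<^esub> \<gamma> b = Idn B b" by metis
  define lft where "lft x y \<phi> = (THE f. f \<in> Hom A x y \<and> FArr F f = \<phi>)" for x y \<phi>
  have lft: "lft x y \<phi> \<in> Arr A" "Dom A (lft x y \<phi>) = x" "Cod A (lft x y \<phi>) = y" "FArr F (lft x y \<phi>) = \<phi>"
    if "x \<in> Obj A" "y \<in> Obj A" "\<phi> \<in> Hom B (FObj F x) (FObj F y)" for x y \<phi>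
    using theI'[OF ff[OF that]] unfolding lft_def by auto
  have inj: "f = g" if "f \<in> Arr A" "g \<in> Arr A" "Dom A f = Dom A g" "Cod A f = Cod A g" "FArr F f = FArr F g" for f g
  proof -
    have "\<exists>!h. h \<in> Hom A (Dom A f) (Cod A f) \<and> FArr F h = FArr F f"
      by (rule ff) (use that Ff in auto)
    then show ?thesis using that by auto
  qed
  define G where "G = \<lparr>FObj = go, FArr = (\<lambda>\<phi>. lft (go (Dom B \<phi>)) (go (Cod B \<phi>)) (\<gamma> (Cod B \<phi>) \<cdot>\<^bsub>B\<^esub> (\<phi> \<cdot>\<^bsub>B\<^esub> \<beta> (Dom B \<phi>))))\<rparr>"
  have Gs [simp]: "FObj G = go" by (simp add: G_def)
  have bg: "\<beta> b \<in> Arr B" "Dom B (\<beta> b) = FObj F (go b)" "Cod B (\<beta> b) = b" "\<gamma> b \<in> Arr B" "Dom B (\<gamma> b) = b" "Cod B (\<gamma> b) = FObj F (go b)"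
    "\<gamma> b \<cdot>\<^bsub>B\<^esub> \<beta> b = Idn B (FObj F (go b))" "\<beta> b \<cdot>\<^bsub>B\<^esub> \<gamma> b = Idn B b" "go b \<in> Obj A" if "b \<in> Obj B" for b
    using \<beta>[OF that] \<gamma>[OF that] go[OF that] by auto
  have Garr: "FArr G \<phi> \<in> Arr A" "Dom A (FArr G \<phi>) = go (Dom B \<phi>)" "Cod A (FArr G \<phi>) = go (Cod B \<phi>)"
    "FArr F (FArr G \<phi>) = \<gamma> (Cod B \<phi>) \<cdot>\<^bsub>B\<^esub> (\<phi> \<cdot>\<^bsub>B\<^esub> \<beta> (Dom B \<phi>))" if p: "\<phi> \<in> Arr B" for \<phi>
  proof -
    have "\<gamma> (Cod B \<phi>) \<cdot>\<^bsub>B\<^esub> (\<phi> \<cdot>\<^bsub>B\<^esub> \<beta> (Dom B \<phi>)) \<in> Hom B (FObj F (go (Dom B \<phi>))) (FObj F (go (Cod B \<phi>)))"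
      using p bg[OF B.Dom_Obj[OF p]] bg[OF B.Cod_Obj[OF p]] by simp
    from lft[OF _ _ this] show "FArr G \<phi> \<in> Arr A" "Dom A (FArr G \<phi>) = go (Dom B \<phi>)" "Cod A (FArr G \<phi>) = go (Cod B \<phi>)"
    "FArr F (FArr G \<phi>) = \<gamma> (Cod B \<phi>) \<cdot>\<^bsub>B\<^esub> (\<phi> \<cdot>\<^bsub>B\<^esub> \<beta> (Dom B \<phi>))"
      using bg[OF B.Dom_Obj[OF p]] bg[OF B.Cod_Obj[OF p]] by (auto simp: G_def)
  qed
  have G: "is_functor B A G" unfolding is_functor_def
  proof (intro conjI ballI impI)
    fix b assume b: "b \<in> Obj B"
    show "FObj G b \<in> Obj A" using bg b by simp
    have i: "Idn B b \<in> Arr B" "Dom B (Idn B b) = b" "Cod B (Idn B b) = b" using b by auto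
    note Gi = Garr[OF i(1), unfolded i(2,3)]
    show "FArr G (Idn B b) = Idn A (FObj G b)"
      by (rule inj) (use Gi bg[OF b] Ff(5)[of "go b"] b in auto)
  next
    fix \<phi> assume p: "\<phi> \<in> Arr B"
    show "FArr G \<phi> \<in> Hom A (FObj G (Dom B \<phi>)) (FObj G (Cod B \<phi>))" using Garr[OF p] by simp
    fix \<psi> assume q: "\<psi> \<in> Arr B" "Dom B \<psi> = Cod B \<phi>"
    define a b c where "a = Dom B \<phi>" and "b = Cod B \<phi>" and "c = Cod B \<psi>"
    have obj: "a \<in> Obj B" "b \<in> Obj B" "c \<in> Obj B" using p q by (auto simp: a_def b_def c_def)
    have t: "Dom B \<phi> = a" "Cod B \<phi> = b" "Dom B \<psi> = b" "Cod B \<psi> = c" using q by (auto simp: a_def b_def c_def)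
    have qp: "\<psi> \<cdot>\<^bsub>B\<^esub> \<phi> \<in> Arr B" "Dom B (\<psi> \<cdot>\<^bsub>B\<^esub> \<phi>) = a" "Cod B (\<psi> \<cdot>\<^bsub>B\<^esub> \<phi>) = c" using p q(1) t by auto
    note G1 = Garr[OF p, unfolded t] and G2 = Garr[OF q(1), unfolded t] and G3 = Garr[OF qp(1), unfolded qp(2,3)]
    note ba = bg[OF obj(1)] and bb = bg[OF obj(2)] and bc = bg[OF obj(3)]
    show "FArr G (\<psi> \<cdot>\<^bsub>B\<^esub> \<phi>) = FArr G \<psi> \<cdot>\<^bsub>A\<^esub> FArr G \<phi>"
    proof (rule inj)
      have "\<beta> b \<cdot>\<^bsub>B\<^esub> (\<gamma> b \<cdot>\<^bsub>B\<^esub> (\<phi> \<cdot>\<^bsub>B\<^esub> \<beta> a)) = \<phi> \<cdot>\<^bsub>B\<^esub> \<beta> a"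
        using B.comp_ext[OF bb(8), of "\<phi> \<cdot>\<^bsub>B\<^esub> \<beta> a"] p t ba bb by simp
      then show "FArr F (FArr G (\<psi> \<cdot>\<^bsub>B\<^esub> \<phi>)) = FArr F (FArr G \<psi> \<cdot>\<^bsub>A\<^esub> FArr G \<phi>)"
        using G1 G2 G3 Ff(6)[of "FArr G \<phi>" "FArr G \<psi>"] p q(1) t ba bb bc by simp
    qed (use G1 G2 G3 in auto)
  qed
  define \<alpha> where "\<alpha> x = lft x (go (FObj F x)) (\<gamma> (FObj F x))" for x
  define \<alpha>' where "\<alpha>' x = lft (go (FObj F x)) x (\<beta> (FObj F x))" for x
  have al: "\<alpha> x \<in> Arr A" "Dom A (\<alpha> x) = x" "Cod A (\<alpha> x) = go (FObj F x)" "FArr F (\<alpha> x) = \<gamma> (FObj F x)"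
     "\<alpha>' x \<in> Arr A" "Dom A (\<alpha>' x) = go (FObj F x)" "Cod A (\<alpha>' x) = x" "FArr F (\<alpha>' x) = \<beta> (FObj F x)" if x: "x \<in> Obj A" for x
    using lft[of x "go (FObj F x)" "\<gamma> (FObj F x)"] lft[of "go (FObj F x)" x "\<beta> (FObj F x)"] x bg[OF Ff(1)[OF x]]
    unfolding \<alpha>_def \<alpha>'_def by auto
  have "is_nat_iso A A id_functor (comp_functor G F) \<alpha>"
    unfolding is_nat_iso_def is_nat_trans_def
  proof (intro conjI ballI)
    fix x assume x: "x \<in> Obj A"
    show "\<alpha> x \<in> Hom A (FObj id_functor x) (FObj (comp_functor G F) x)" using al[OF x] by (simp add: id_functor_def)
    note a = al[OF x] and b = bg[OF Ff(1)[OF x]]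
    show "is_iso A (\<alpha> x)"
    proof (rule A.is_isoI[OF a(1,5)])
      show "\<alpha>' x \<cdot>\<^bsub>A\<^esub> \<alpha> x = Idn A (Dom A (\<alpha> x))"
        by (rule inj) (use a b x Ff(5)[OF x] Ff(6)[of "\<alpha> x" "\<alpha>' x"] in auto)
      show "\<alpha> x \<cdot>\<^bsub>A\<^esub> \<alpha>' x = Idn A (Cod A (\<alpha> x))"
        by (rule inj) (use a b x Ff(5)[OF b(9)] Ff(6)[of "\<alpha>' x" "\<alpha> x"] in auto)
    qed (use a in auto)
  next
    fix f assume f: "f \<in> Arr A"
    note a = al[OF A.Dom_Obj[OF f]] and a' = al[OF A.Cod_Obj[OF f]]
    note b = bg[OF Ff(1)[OF A.Dom_Obj[OF f]]] and b' = bg[OF Ff(1)[OF A.Cod_Obj[OF f]]]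
    have Ffa: "FArr F f \<in> Arr B" "Dom B (FArr F f) = FObj F (Dom A f)" "Cod B (FArr F f) = FObj F (Cod A f)" using Ff f by auto
    note Gf = Garr[OF Ffa(1), unfolded Ffa(2,3)]
    have "\<alpha> (Cod A f) \<cdot>\<^bsub>A\<^esub> f = FArr G (FArr F f) \<cdot>\<^bsub>A\<^esub> \<alpha> (Dom A f)"
    proof (rule inj)
      show "FArr F (\<alpha> (Cod A f) \<cdot>\<^bsub>A\<^esub> f) = FArr F (FArr G (FArr F f) \<cdot>\<^bsub>A\<^esub> \<alpha> (Dom A f))"
        using Ff(6)[of f "\<alpha> (Cod A f)"] Ff(6)[of "\<alpha> (Dom A f)" "FArr G (FArr F f)"] a a' b b' f Gf Ffa by simp
    qed (use a a' f Gf in auto)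
    then show "\<alpha> (Cod A f) \<cdot>\<^bsub>A\<^esub> FArr id_functor f = FArr (comp_functor G F) f \<cdot>\<^bsub>A\<^esub> \<alpha> (Dom A f)"
      by (simp add: id_functor_def)
  qed
  moreover have "is_nat_iso B B (comp_functor F G) id_functor \<beta>"
    unfolding is_nat_iso_def is_nat_trans_def
  proof (intro conjI ballI)
    fix b assume b: "b \<in> Obj B"
    show "\<beta> b \<in> Hom B (FObj (comp_functor F G) b) (FObj id_functor b)" "is_iso B (\<beta> b)"
      using \<beta>[OF b] by (auto simp: id_functor_def)
  next
    fix \<phi> assume p: "\<phi> \<in> Arr B"
    note b = bg[OF B.Dom_Obj[OF p]] and b' = bg[OF B.Cod_Obj[OF p]] and Gf = Garr[OF p]
    have "\<beta> (Cod B \<phi>) \<cdot>\<^bsub>B\<^esub> (\<gamma> (Cod B \<phi>) \<cdot>\<^bsub>B\<^esub> (\<phi> \<cdot>\<^bsub>B\<^esub> \<beta> (Dom B \<phi>))) = \<phi> \<cdot>\<^bsub>B\<^esub> \<beta> (Dom B \<phi>)"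
      using B.comp_ext[OF b'(8), of "\<phi> \<cdot>\<^bsub>B\<^esub> \<beta> (Dom B \<phi>)"] p b b' by simp
    then show "\<beta> (Cod B \<phi>) \<cdot>\<^bsub>B\<^esub> FArr (comp_functor F G) \<phi> = FArr id_functor \<phi> \<cdot>\<^bsub>B\<^esub> \<beta> (Dom B \<phi>)"
      using Gf by (simp add: id_functor_def)
  qed
  ultimately show ?thesis unfolding is_equivalence_functor_def using F G by blast
qed

text \<open>The forgetful functor of algebras reflects isomorphisms, since the inverse of an algebra morphism is
again one, and an equivalence reflects them too.\<close>

lemma monadic_conservative:
  assumes A: "category A" and X: "category X" and mon: "is_monadic A X U"
    and f: "f \<in> Arr A" and iso: "is_iso X (FArr U f)"
  shows "is_iso A f"
proof -
  interpret A: category A by fact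
  interpret X: category X by fact
  obtain L \<eta> \<epsilon> where adj: "is_adjunction X A L U \<eta> \<epsilon>" and
    eq: "is_equivalence_functor A (EM_category X (comp_functor U L) \<eta> (\<lambda>x. FArr U (\<epsilon> (FObj L x)))) (comparison_functor A U \<epsilon>)"
    using mon unfolding is_monadic_def by blast
  define T M K where "T = comp_functor U L" and "M = EM_category X T \<eta> (\<lambda>x. FArr U (\<epsilon> (FObj L x)))"
    and "K = comparison_functor A U \<epsilon>"
  have T: "is_functor X X T" unfolding T_def
    using adj comp_functor_functor unfolding is_adjunction_def by blast
  interpret M: category M unfolding M_def by (rule EM_category[OF X T])
  have K: "is_functor A M K" unfolding K_def M_def T_def by (rule comparison_functor_functor[OF A X adj])
  obtain G \<alpha> where G: "is_functor M A G" and al: "is_nat_iso A A id_functor (comp_functor G K) \<alpha>"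
    using eq unfolding is_equivalence_functor_def M_def T_def K_def by blast
  note Kf = functorD[OF K] and Gf = functorD[OF G] and Tf = functorD[OF T]
  obtain g where g: "FArr U f \<in> Arr X" "g \<in> Arr X" "Dom X g = Cod X (FArr U f)" "Cod X g = Dom X (FArr U f)"
    "g \<cdot>\<^bsub>X\<^esub> FArr U f = Idn X (Dom X (FArr U f))" "FArr U f \<cdot>\<^bsub>X\<^esub> g = Idn X (Cod X (FArr U f))" using iso by (rule X.is_isoE)
  obtain x h u y k where Kfeq: "FArr K f = ((x, h), u, (y, k))" and u: "u = FArr U f"
    by (simp add: K_def comparison_functor_def)
  have KA: "((x, h), u, (y, k)) \<in> Arr M" using Kf(2)[OF f] Kfeq by simp
  have ua: "u \<in> Arr X" "Dom X u = x" "Cod X u = y" "u \<cdot>\<^bsub>X\<^esub> h = k \<cdot>\<^bsub>X\<^esub> FArr T u"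
    and alg: "(x, h) \<in> Obj M" "(y, k) \<in> Obj M"
    using KA by (auto simp: M_def EM_arr_iff)
  have hk: "h \<in> Arr X" "Dom X h = FObj T x" "Cod X h = x" "k \<in> Arr X" "Dom X k = FObj T y" "Cod X k = y"
    using alg by (auto simp: M_def EM_algebra_iff)
  have ga: "g \<in> Arr X" "Dom X g = y" "Cod X g = x" "g \<cdot>\<^bsub>X\<^esub> u = Idn X x" "u \<cdot>\<^bsub>X\<^esub> g = Idn X y" using g ua u by auto
  have ob: "x \<in> Obj X" "y \<in> Obj X" using ua X.Dom_Obj X.Cod_Obj by auto
  have Tu: "FArr T u \<in> Arr X" "Dom X (FArr T u) = FObj T x" "Cod X (FArr T u) = FObj T y"
     "FArr T g \<in> Arr X" "Dom X (FArr T g) = FObj T y" "Cod X (FArr T g) = FObj T x"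
    "FArr T u \<cdot>\<^bsub>X\<^esub> FArr T g = Idn X (FObj T y)"
    using Tf(2-4) Tf(6)[of g u] Tf(5) ua ga ob by auto
  have "g \<cdot>\<^bsub>X\<^esub> k = g \<cdot>\<^bsub>X\<^esub> (k \<cdot>\<^bsub>X\<^esub> (FArr T u \<cdot>\<^bsub>X\<^esub> FArr T g))" using Tu hk by simp
  also have "\<dots> = g \<cdot>\<^bsub>X\<^esub> ((u \<cdot>\<^bsub>X\<^esub> h) \<cdot>\<^bsub>X\<^esub> FArr T g)"
    using X.comp_ext[OF ua(4)[symmetric], of "FArr T g"] Tu hk ua(1-3) by simp
  also have "(u \<cdot>\<^bsub>X\<^esub> h) \<cdot>\<^bsub>X\<^esub> FArr T g = u \<cdot>\<^bsub>X\<^esub> (h \<cdot>\<^bsub>X\<^esub> FArr T g)"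
    by (rule X.comp_assoc) (use Tu hk ua in auto)
  also have "g \<cdot>\<^bsub>X\<^esub> (u \<cdot>\<^bsub>X\<^esub> (h \<cdot>\<^bsub>X\<^esub> FArr T g)) = h \<cdot>\<^bsub>X\<^esub> FArr T g"
    using X.comp_ext[OF ga(4), of "h \<cdot>\<^bsub>X\<^esub> FArr T g"] Tu hk ua(1-3) ga by simp
  finally have "g \<cdot>\<^bsub>X\<^esub> k = h \<cdot>\<^bsub>X\<^esub> FArr T g" .
  then have gM: "((y, k), g, (x, h)) \<in> Arr M" using alg ga by (simp add: M_def EM_arr_iff)
  have "is_iso M (FArr K f)" unfolding Kfeq
    by (rule M.is_isoI[OF KA gM]) (use ga in \<open>auto simp: M_def\<close>)
  then obtain j where j: "FArr K f \<in> Arr M" "j \<in> Arr M" "Dom M j = Cod M (FArr K f)" "Cod M j = Dom M (FArr K f)"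
    "j \<cdot>\<^bsub>M\<^esub> FArr K f = Idn M (Dom M (FArr K f))" "FArr K f \<cdot>\<^bsub>M\<^esub> j = Idn M (Cod M (FArr K f))" by (rule M.is_isoE)
  have t: "Dom M (FArr K f) = FObj K (Dom A f)" "Cod M (FArr K f) = FObj K (Cod A f)" using Kf f by auto
  have Gi: "FArr G j \<cdot>\<^bsub>A\<^esub> FArr G (FArr K f) = Idn A (FObj G (FObj K (Dom A f)))"
    "FArr G (FArr K f) \<cdot>\<^bsub>A\<^esub> FArr G j = Idn A (FObj G (FObj K (Cod A f)))"
    using Gf(6)[OF j(1,2,3)] Gf(6)[OF j(2,1)] j Gf(5) Kf(1) f t by auto
  have Ga: "FArr G j \<in> Arr A" "Dom A (FArr G j) = FObj G (FObj K (Cod A f))" "Cod A (FArr G j) = FObj G (FObj K (Dom A f))"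
    "FArr G (FArr K f) \<in> Arr A" "Dom A (FArr G (FArr K f)) = FObj G (FObj K (Dom A f))"
    "Cod A (FArr G (FArr K f)) = FObj G (FObj K (Cod A f))"
    using Gf(2-4) j t by auto
  have ai: "is_iso A (\<alpha> x)" "\<alpha> x \<in> Arr A" "Dom A (\<alpha> x) = x" "Cod A (\<alpha> x) = FObj G (FObj K x)" if "x \<in> Obj A" for x
    using al that unfolding is_nat_iso_def is_nat_trans_def by (auto simp: id_functor_def)
  have nat: "\<alpha> (Cod A f) \<cdot>\<^bsub>A\<^esub> f = FArr G (FArr K f) \<cdot>\<^bsub>A\<^esub> \<alpha> (Dom A f)"
    using al f unfolding is_nat_iso_def is_nat_trans_def by (auto simp: id_functor_def)
  define a b where "a = \<alpha> (Dom A f)" and "b = \<alpha> (Cod A f)"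
  note a = ai[OF A.Dom_Obj[OF f], folded a_def] and b = ai[OF A.Cod_Obj[OF f], folded b_def]
  obtain a' where a': "a' \<in> Arr A" "Dom A a' = Cod A a" "Cod A a' = Dom A a" "a' \<cdot>\<^bsub>A\<^esub> a = Idn A (Dom A a)" "a \<cdot>\<^bsub>A\<^esub> a' = Idn A (Cod A a)"
    using a(1) by (rule A.is_isoE)
  obtain b' where b': "b' \<in> Arr A" "Dom A b' = Cod A b" "Cod A b' = Dom A b" "b' \<cdot>\<^bsub>A\<^esub> b = Idn A (Dom A b)" "b \<cdot>\<^bsub>A\<^esub> b' = Idn A (Cod A b)"
    using b(1) by (rule A.is_isoE)
  have nat': "b \<cdot>\<^bsub>A\<^esub> f = FArr G (FArr K f) \<cdot>\<^bsub>A\<^esub> a" using nat unfolding a_def b_def .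
  define r where "r = a' \<cdot>\<^bsub>A\<^esub> (FArr G j \<cdot>\<^bsub>A\<^esub> b)"
  have r: "r \<in> Arr A" "Dom A r = Cod A f" "Cod A r = Dom A f" using a a' b b' Ga unfolding r_def by auto
  show ?thesis
  proof (rule A.is_isoI[OF f r])
    have "r \<cdot>\<^bsub>A\<^esub> f = a' \<cdot>\<^bsub>A\<^esub> (FArr G j \<cdot>\<^bsub>A\<^esub> (b \<cdot>\<^bsub>A\<^esub> f))" using f a a' b b' Ga unfolding r_def by simp
    also have "\<dots> = a' \<cdot>\<^bsub>A\<^esub> (FArr G j \<cdot>\<^bsub>A\<^esub> (FArr G (FArr K f) \<cdot>\<^bsub>A\<^esub> a))" by (simp only: nat')
    also have "\<dots> = Idn A (Dom A f)" using A.comp_ext[OF Gi(1), of a] f a a' b b' Ga by simp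
    finally show "r \<cdot>\<^bsub>A\<^esub> f = Idn A (Dom A f)" .
    have "f \<cdot>\<^bsub>A\<^esub> r = b' \<cdot>\<^bsub>A\<^esub> (b \<cdot>\<^bsub>A\<^esub> (f \<cdot>\<^bsub>A\<^esub> r))" using A.comp_ext[OF b'(4), of "f \<cdot>\<^bsub>A\<^esub> r"] b b' f r by simp
    also have "\<dots> = b' \<cdot>\<^bsub>A\<^esub> (FArr G (FArr K f) \<cdot>\<^bsub>A\<^esub> (a \<cdot>\<^bsub>A\<^esub> r))"
      using A.comp_ext2[OF nat', of r] b b' f r Ga a by simp
    also have "a \<cdot>\<^bsub>A\<^esub> r = FArr G j \<cdot>\<^bsub>A\<^esub> b" using A.comp_ext[OF a'(5), of "FArr G j \<cdot>\<^bsub>A\<^esub> b"] b b' Ga a a' unfolding r_def by simp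
    also have "FArr G (FArr K f) \<cdot>\<^bsub>A\<^esub> (FArr G j \<cdot>\<^bsub>A\<^esub> b) = b" using A.comp_ext[OF Gi(2), of b] Ga b by simp
    finally show "f \<cdot>\<^bsub>A\<^esub> r = Idn A (Cod A f)" using b' b by simp
  qed
qed

section \<open>Monadicity of pulling back along an effective descent morphism\<close>

lemma slice_sel [simp]:
  "f \<in> Obj (slice_in C F b) \<longleftrightarrow> f \<in> Arr C \<and> f \<in> F \<and> Cod C f = b"
  "Dom (slice_in C F b) (f, h, g) = f" "Cod (slice_in C F b) (f, h, g) = g"
  "Idn (slice_in C F b) f = (f, Idn C (Dom C f), f)"
  "(f', h', g') \<cdot>\<^bsub>slice_in C F b\<^esub> (f, h, g) = (f, h' \<cdot>\<^bsub>C\<^esub> h, g')"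
  "(f, h, g) \<in> Arr (slice_in C F b) \<longleftrightarrow> f \<in> Arr C \<and> f \<in> F \<and> Cod C f = b \<and> g \<in> Arr C \<and> g \<in> F \<and> Cod C g = b \<and>
     h \<in> Arr C \<and> Dom C h = Dom C f \<and> Cod C h = Dom C g \<and> g \<cdot>\<^bsub>C\<^esub> h = f"
  by (auto simp: slice_in_def)

lemma slice_arrE:
  assumes "\<phi> \<in> Arr (slice_in C F b)"
  obtains f h g where "\<phi> = (f, h, g)" "f \<in> Arr C" "f \<in> F" "Cod C f = b" "g \<in> Arr C" "g \<in> F" "Cod C g = b"
     "h \<in> Arr C" "Dom C h = Dom C f" "Cod C h = Dom C g" "g \<cdot>\<^bsub>C\<^esub> h = f"
  using assms by (cases \<phi>) auto

lemma (in category) slice_category: "category (slice_in C F b)"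
proof
  fix \<phi> assume "\<phi> \<in> Arr (slice_in C F b)"
  then show "Dom (slice_in C F b) \<phi> \<in> Obj (slice_in C F b)" "Cod (slice_in C F b) \<phi> \<in> Obj (slice_in C F b)"
    by (cases \<phi>; auto)+
next
  fix f assume "f \<in> Obj (slice_in C F b)"
  then show "Idn (slice_in C F b) f \<in> Hom (slice_in C F b) f f" by simp
next
  fix \<phi> \<psi> a x y assume A: "\<phi> \<in> Hom (slice_in C F b) a x" "\<psi> \<in> Hom (slice_in C F b) x y"
  have "\<phi> \<in> Arr (slice_in C F b)" "\<psi> \<in> Arr (slice_in C F b)" using A by auto
  then obtain f h g g' h' k where f: "\<phi> = (f, h, g)" "f \<in> Arr C" "f \<in> F" "Cod C f = b" "g \<in> Arr C" "g \<in> F" "Cod C g = b"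
     "h \<in> Arr C" "Dom C h = Dom C f" "Cod C h = Dom C g" "g \<cdot> h = f"
    and k: "\<psi> = (g', h', k)" "k \<in> Arr C" "k \<in> F" "Cod C k = b"
     "h' \<in> Arr C" "Dom C h' = Dom C g'" "Cod C h' = Dom C k" "k \<cdot> h' = g'"
    by (elim slice_arrE) blast
  have "g' = g" using A f(1) k(1) by simp
  note k = k[unfolded this]
  have "k \<cdot> (h' \<cdot> h) = f" using comp_ext[OF k(8), of h] f k by simp
  then show "\<psi> \<cdot>\<^bsub>slice_in C F b\<^esub> \<phi> \<in> Hom (slice_in C F b) a y" using A f k by simp
next
  fix \<phi> a x assume "\<phi> \<in> Hom (slice_in C F b) a x"
  then show "\<phi> \<cdot>\<^bsub>slice_in C F b\<^esub> Idn (slice_in C F b) a = \<phi>" "Idn (slice_in C F b) x \<cdot>\<^bsub>slice_in C F b\<^esub> \<phi> = \<phi>"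
    by (cases \<phi>; auto)+
next
  fix \<phi> \<psi> \<chi> a x y z assume "\<phi> \<in> Hom (slice_in C F b) a x" "\<psi> \<in> Hom (slice_in C F b) x y" "\<chi> \<in> Hom (slice_in C F b) y z"
  then show "(\<chi> \<cdot>\<^bsub>slice_in C F b\<^esub> \<psi>) \<cdot>\<^bsub>slice_in C F b\<^esub> \<phi> = \<chi> \<cdot>\<^bsub>slice_in C F b\<^esub> (\<psi> \<cdot>\<^bsub>slice_in C F b\<^esub> \<phi>)"
    by (cases \<phi>; cases \<psi>; cases \<chi>) auto
qed

text \<open>Pullbacks along a fixed \<open>p\<close> are the chosen ones of the pullback functor: for \<open>f\<close> over the codomain of
\<open>p\<close>, the projections are \<open>pb1 p f\<close>, to the domain of \<open>f\<close>, and \<open>pb2 p f\<close>, to the domain of \<open>p\<close>.\<close>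

locale category_with_pullbacks = category C for C (structure) +
  assumes pullback_ex: "\<And>f g. \<lbrakk>arr f; arr g; cod f = cod g\<rbrakk>
       \<Longrightarrow> \<exists>s t. is_pullback C f g s t"
    and stable: "\<And>f g s t. is_pullback C f g s t \<Longrightarrow> f \<in> covers \<Longrightarrow> t \<in> covers"
begin

definition pb1 :: "'b \<Rightarrow> 'b \<Rightarrow> 'b" where "pb1 p f = fst (some_pullback C f p)"
definition pb2 :: "'b \<Rightarrow> 'b \<Rightarrow> 'b" where "pb2 p f = snd (some_pullback C f p)"

lemma pb12:
  assumes "arr f" "arr p" "cod f = cod p"
  shows "is_pullback C f p (pb1 p f) (pb2 p f)"
proof -
  have "\<exists>z. case z of (s, t) \<Rightarrow> is_pullback C f p s t" using pullback_ex[OF assms] by auto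
  from someI_ex[OF this] have "case some_pullback C f p of (s, t) \<Rightarrow> is_pullback C f p s t"
    unfolding some_pullback_def .
  then show ?thesis unfolding pb1_def pb2_def by (simp add: case_prod_unfold)
qed

lemma pb12D:
  assumes "arr f" "arr p" "cod f = cod p"
  shows "arr (pb1 p f)" "arr (pb2 p f)" "dom (pb1 p f) = dom (pb2 p f)" "cod (pb1 p f) = dom f"
    "cod (pb2 p f) = dom p" "f \<cdot> pb1 p f = p \<cdot> pb2 p f"
  using is_pullback_D[OF pb12[OF assms]] by auto

definition pb_map :: "'b \<Rightarrow> 'b \<Rightarrow> 'b \<Rightarrow> 'b \<Rightarrow> 'b" where
  "pb_map p f h g = (THE k. k \<in> Hom C (dom (pb2 p f)) (dom (pb2 p g)) \<and>
     pb1 p g \<cdot> k = h \<cdot> pb1 p f \<and> pb2 p g \<cdot> k = pb2 p f)"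

lemma pb_map:
  assumes p: "arr p" and f: "arr f" "cod f = cod p" and g: "arr g" "cod g = cod p"
    and h: "arr h" "dom h = dom f" "cod h = dom g" "g \<cdot> h = f"
  shows "arr (pb_map p f h g)" "dom (pb_map p f h g) = dom (pb2 p f)" "cod (pb_map p f h g) = dom (pb2 p g)"
    "pb1 p g \<cdot> pb_map p f h g = h \<cdot> pb1 p f" "pb2 p g \<cdot> pb_map p f h g = pb2 p f"
proof -
  note pf = pb12[OF f(1) p f(2)] and pg = pb12[OF g(1) p g(2)]
  note Df = pb12D[OF f(1) p f(2)] and Dg = pb12D[OF g(1) p g(2)]
  have "g \<cdot> (h \<cdot> pb1 p f) = f \<cdot> pb1 p f" by (rule comp_ext[OF h(4)]) (use g h f Df in auto)
  then have "g \<cdot> (h \<cdot> pb1 p f) = p \<cdot> pb2 p f" using Df(6) by simp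
  then have "\<exists>!k. k \<in> Hom C (dom (h \<cdot> pb1 p f)) (dom (pb1 p g)) \<and> pb1 p g \<cdot> k = h \<cdot> pb1 p f \<and> pb2 p g \<cdot> k = pb2 p f"
    by (intro is_pullback_unique[OF pg]) (use Df Dg h in simp_all)
  then have "\<exists>!k. k \<in> Hom C (dom (pb2 p f)) (dom (pb2 p g)) \<and> pb1 p g \<cdot> k = h \<cdot> pb1 p f \<and> pb2 p g \<cdot> k = pb2 p f"
    using Df Dg h by simp
  from theI'[OF this] show "arr (pb_map p f h g)" "dom (pb_map p f h g) = dom (pb2 p f)" "cod (pb_map p f h g) = dom (pb2 p g)"
    "pb1 p g \<cdot> pb_map p f h g = h \<cdot> pb1 p f" "pb2 p g \<cdot> pb_map p f h g = pb2 p f"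
    unfolding pb_map_def by auto
qed

lemma pb_eqI:
  assumes p: "arr p" and f: "arr f" "cod f = cod p"
    and "pb1 p f \<cdot> a = pb1 p f \<cdot> b" "pb2 p f \<cdot> a = pb2 p f \<cdot> b" "arr a" "arr b" "dom a = dom b"
    "cod a = dom (pb2 p f)" "cod b = dom (pb2 p f)"
  shows "a = b"
  by (rule pullback_eqI[OF pb12[OF f(1) p f(2)] assms(6-8) _ _ assms(4,5)])
    (use pb12D[OF f(1) p f(2)] assms in simp_all)

lemma pullback_functor_sel:
  "FObj (pullback_functor C p) f = pb2 p f" "FArr (pullback_functor C p) (f, h, g) = (pb2 p f, pb_map p f h g, pb2 p g)"
  by (simp_all add: pullback_functor_def pb1_def pb2_def pb_map_def)

lemma pullback_functor_functor:
  assumes p: "arr p"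
  shows "is_functor (slice_in C (covers) (cod p)) (slice_in C (covers) (dom p)) (pullback_functor C p)"
    (is "is_functor ?A ?X ?U")
  unfolding is_functor_def
proof (intro conjI ballI impI)
  fix f assume "f \<in> Obj ?A"
  then have f: "arr f" "f \<in> covers" "cod f = cod p" by auto
  note pf = pb12[OF f(1) p f(3)]
  note D = pb12D[OF f(1) p f(3)]
  show "FObj ?U f \<in> Obj ?X" using stable[OF pf f(2)] D by (simp add: pullback_functor_sel)
  have i: "arr (Idn C (dom f))" "dom (Idn C (dom f)) = dom f" "cod (Idn C (dom f)) = dom f"
    "f \<cdot> Idn C (dom f) = f" using f by auto
  note M = pb_map[OF p f(1,3,1,3) i]
  have "pb_map p f (Idn C (dom f)) f = Idn C (dom (pb2 p f))"
    by (rule pb_eqI[OF p f(1,3)]) (use M D in auto)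
  then show "FArr ?U (Idn ?A f) = Idn ?X (FObj ?U f)" by (simp add: pullback_functor_sel)
next
  fix \<phi> assume phi: "\<phi> \<in> Arr ?A"
  then obtain f h g where f: "\<phi> = (f, h, g)" "arr f" "f \<in> covers" "cod f = cod p" "arr g"
    "g \<in> covers" "cod g = cod p" "arr h" "dom h = dom f" "cod h = dom g" "g \<cdot> h = f" by (rule slice_arrE)
  note pf = pb12[OF f(2) p f(4)] and pg = pb12[OF f(5) p f(7)]
  note D = pb12D[OF f(2) p f(4)] pb12D[OF f(5) p f(7)]
  note M = pb_map[OF p f(2,4,5,7-11)]
  show "FArr ?U \<phi> \<in> Hom ?X (FObj ?U (Dom ?A \<phi>)) (FObj ?U (Cod ?A \<phi>))"
    using stable[OF pf f(3)] stable[OF pg f(6)] D M f by (simp add: pullback_functor_sel)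
  fix \<psi> assume psi: "\<psi> \<in> Arr ?A" "Dom ?A \<psi> = Cod ?A \<phi>"
  from psi(1) obtain g' h' k where k: "\<psi> = (g', h', k)" "arr g'" "g' \<in> covers" "cod g' = cod p" "arr k"
    "k \<in> covers" "cod k = cod p" "arr h'" "dom h' = dom g'" "cod h' = dom k" "k \<cdot> h' = g'" by (rule slice_arrE)
  have gg: "g' = g" using psi k f by simp
  note k = k[unfolded gg]
  note M' = pb_map[OF p k(2,4,5,7-11)]
  have hh: "arr (h' \<cdot> h)" "dom (h' \<cdot> h) = dom f" "cod (h' \<cdot> h) = dom k" "k \<cdot> (h' \<cdot> h) = f"
    using comp_ext[OF k(11), of h] f k by auto
  note M'' = pb_map[OF p f(2,4) k(5,7) hh]
  note Dk = pb12D[OF k(5) p k(7)]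
  have "pb_map p f (h' \<cdot> h) k = pb_map p g h' k \<cdot> pb_map p f h g"
  proof (rule pb_eqI[OF p k(5,7)])
    show "pb1 p k \<cdot> pb_map p f (h' \<cdot> h) k = pb1 p k \<cdot> (pb_map p g h' k \<cdot> pb_map p f h g)"
      using comp_ext[OF M'(4), of "pb_map p f h g"] M M' M'' D Dk f k by simp
    show "pb2 p k \<cdot> pb_map p f (h' \<cdot> h) k = pb2 p k \<cdot> (pb_map p g h' k \<cdot> pb_map p f h g)"
      using comp_ext[OF M'(5), of "pb_map p f h g"] M M' M'' D Dk f k by simp
  qed (use M M' M'' D Dk in auto)
  then show "FArr ?U (\<psi> \<cdot>\<^bsub>?A\<^esub> \<phi>) = FArr ?U \<psi> \<cdot>\<^bsub>?X\<^esub> FArr ?U \<phi>"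
    using f k by (simp add: pullback_functor_sel)
qed

end

text \<open>The last condition is effectiveness of descent along \<open>p : E \<rightarrow> B\<close>. For \<open>x : X \<rightarrow> E\<close> a generalized
element of \<open>X \<times>\<^sub>B E\<close>, with projections \<open>s\<close> and \<open>t\<close>, is a pair \<open>(z, e)\<close> where \<open>x z\<close> and \<open>e\<close> have the
same image in \<open>B\<close>, and \<open>h\<close> transports \<open>z\<close> to the fibre over \<open>e\<close>, with \<open>h (z, x z) = z\<close> as unit law. The
condition asks for an object \<open>f\<close> over \<open>B\<close> whose pullback is \<open>x\<close> and whose projection \<open>q\<close> does not see
the transport. In a Mal'tsev setting the unit law is the whole of the requirement on \<open>h\<close>, since it
makes the relation \<open>s\<close>, \<open>h\<close> reflexive.\<close>

locale effective_descent = category_with_pullbacks C for C (structure) +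
  fixes p
  assumes p: "p \<in> covers"
    and compose: "\<And>f g. \<lbrakk>f \<in> covers; g \<in> covers; dom g = cod f\<rbrakk>
       \<Longrightarrow> g \<cdot> f \<in> covers"
    and cancel: "\<And>f g. \<lbrakk>g \<cdot> f \<in> covers; arr f; arr g; dom g = cod f\<rbrakk>
       \<Longrightarrow> g \<in> covers"
    and descent: "\<And>x s t h. \<lbrakk>x \<in> covers; cod x = dom p; is_pullback C (p \<cdot> x) p s t;
       h \<in> Hom C (dom s) (dom x); x \<cdot> h = t;
       \<And>w. \<lbrakk>w \<in> Hom C (dom x) (dom s); s \<cdot> w = Idn C (dom x); t \<cdot> w = x\<rbrakk> \<Longrightarrow> h \<cdot> w = Idn C (dom x)\<rbrakk>
       \<Longrightarrow> \<exists>q f. q \<in> covers \<and> is_pullback C f p q x \<and> q \<cdot> h = q \<cdot> s"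
begin

text \<open>The left adjoint \<open>L\<close> composes with \<open>p\<close>; the component at \<open>x : X \<rightarrow> E\<close> of the unit is the graph of \<open>x\<close>,
as an arrow \<open>X \<rightarrow> X \<times>\<^sub>B E\<close>, and the counit is a pullback projection.\<close>

abbreviation "SliceB \<equiv> slice_in C (regular_epis C) (cod p)"
abbreviation "SliceE \<equiv> slice_in C (regular_epis C) (dom p)"
abbreviation "Pull \<equiv> pullback_functor C p"
definition L :: "('b, 'b \<times> 'b \<times> 'b, 'b, 'b \<times> 'b \<times> 'b) cfunctor" where
  "L = \<lparr>FObj = (\<lambda>x. p \<cdot> x), FArr = (\<lambda>(x, k, y). (p \<cdot> x, k, p \<cdot> y))\<rparr>"
definition "graph x = pbpair C (pb1 p (p \<cdot> x)) (pb2 p (p \<cdot> x)) (Idn C (dom x)) x"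
definition "\<eta> x = (x, graph x, pb2 p (p \<cdot> x))"
definition "\<epsilon> f = (p \<cdot> pb2 p f, pb1 p f, f)"

lemma pa: "arr p" using p by simp

lemma L_sel: "FObj L x = p \<cdot> x" "FArr L (x, k, y) = (p \<cdot> x, k, p \<cdot> y)"
  by (simp_all add: L_def)

lemma pbD:
  assumes "arr f" "cod f = cod p"
  shows "arr (pb1 p f)" "arr (pb2 p f)" "dom (pb1 p f) = dom (pb2 p f)" "cod (pb1 p f) = dom f"
    "cod (pb2 p f) = dom p" "f \<cdot> pb1 p f = p \<cdot> pb2 p f" "pb1 p f \<in> covers"
proof -
  note pf = pb12[OF assms(1) pa assms(2)]
  show "arr (pb1 p f)" "arr (pb2 p f)" "dom (pb1 p f) = dom (pb2 p f)" "cod (pb1 p f) = dom f"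
    "cod (pb2 p f) = dom p" "f \<cdot> pb1 p f = p \<cdot> pb2 p f" using pb12D[OF assms(1) pa assms(2)] by auto
  show "pb1 p f \<in> covers" by (rule stable[OF pullback_sym[OF pf] p])
qed

lemma pb2_regular:
  assumes "f \<in> covers" "cod f = cod p" shows "pb2 p f \<in> covers"
  by (rule stable[OF pb12[OF _ pa assms(2)] assms(1)]) (use assms in simp)

lemma preg: "x \<in> covers \<Longrightarrow> cod x = dom p \<Longrightarrow> p \<cdot> x \<in> covers"
  using compose[of x p] p by simp

lemma px:
  assumes "arr x" "cod x = dom p"
  shows "arr (p \<cdot> x)" "cod (p \<cdot> x) = cod p" "dom (p \<cdot> x) = dom x"
  using assms pa by auto

lemma graph:
  assumes x: "arr x" "cod x = dom p"
  shows "arr (graph x)" "dom (graph x) = dom x" "cod (graph x) = dom (pb2 p (p \<cdot> x))"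
    "pb1 p (p \<cdot> x) \<cdot> graph x = Idn C (dom x)" "pb2 p (p \<cdot> x) \<cdot> graph x = x"
  using pbpair[OF pb12[OF px(1)[OF x] pa px(2)[OF x]], of "Idn C (dom x)" x] x pa pbD[OF px(1,2)[OF x]] px[OF x]
  unfolding graph_def by auto

lemma L_functor: "is_functor SliceE SliceB L"
  unfolding is_functor_def
proof (intro conjI ballI impI)
  fix x assume x: "x \<in> Obj SliceE"
  then show "FObj L x \<in> Obj SliceB" using preg[of x] p pa by (simp add: L_sel)
  show "FArr L (Idn SliceE x) = Idn SliceB (FObj L x)" using x pa by (simp add: L_sel)
next
  fix \<phi> assume "\<phi> \<in> Arr SliceE"
  then obtain f h g where f: "\<phi> = (f, h, g)" "arr f" "f \<in> covers" "cod f = dom p" "arr g"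
    "g \<in> covers" "cod g = dom p" "arr h" "dom h = dom f" "cod h = dom g" "g \<cdot> h = f" by (rule slice_arrE)
  show "FArr L \<phi> \<in> Hom SliceB (FObj L (Dom SliceE \<phi>)) (FObj L (Cod SliceE \<phi>))"
    using f preg[of f] preg[of g] p pa by (simp add: L_sel)
  fix \<psi> assume "\<psi> \<in> Arr SliceE" "Dom SliceE \<psi> = Cod SliceE \<phi>"
  then show "FArr L (\<psi> \<cdot>\<^bsub>SliceE\<^esub> \<phi>) = FArr L \<psi> \<cdot>\<^bsub>SliceB\<^esub> FArr L \<phi>" using f by (cases \<psi>) (simp add: L_sel)
qed

lemma U_functor: "is_functor SliceB SliceE Pull" by (rule pullback_functor_functor[OF pa])

lemma adjunction: "is_adjunction SliceE SliceB L Pull \<eta> \<epsilon>"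
  unfolding is_adjunction_def
proof (intro conjI ballI)
  show "is_functor SliceE SliceB L" by (rule L_functor)
  show "is_functor SliceB SliceE Pull" by (rule U_functor)
  show "is_nat_trans SliceE SliceE id_functor (comp_functor Pull L) \<eta>"
    unfolding is_nat_trans_def
  proof (intro conjI ballI)
    fix x assume "x \<in> Obj SliceE"
    then have x: "arr x" "cod x = dom p" "x \<in> covers" by auto
    show "\<eta> x \<in> Hom SliceE (FObj id_functor x) (FObj (comp_functor Pull L) x)"
      using x graph[OF x(1,2)] pbD[OF px(1,2)[OF x(1,2)]] pb2_regular[of "p \<cdot> x"] preg[of x] p pa
      by (simp add: \<eta>_def id_functor_def L_sel pullback_functor_sel)
  next
    fix \<phi> assume "\<phi> \<in> Arr SliceE"
    then obtain f h g where f: "\<phi> = (f, h, g)" "arr f" "f \<in> covers" "cod f = dom p" "arr g"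
      "g \<in> covers" "cod g = dom p" "arr h" "dom h = dom f" "cod h = dom g" "g \<cdot> h = f" by (rule slice_arrE)
    have h: "arr h" "dom h = dom (p \<cdot> f)" "cod h = dom (p \<cdot> g)" "(p \<cdot> g) \<cdot> h = p \<cdot> f" using f pa by auto
    note pf = px[OF f(2,4)] and pg = px[OF f(5,7)]
    note M = pb_map[OF pa pf(1,2) pg(1,2) h]
    note uf = graph[OF f(2,4)] and ug = graph[OF f(5,7)] and Df = pbD[OF pf(1,2)] and Dg = pbD[OF pg(1,2)]
    have "graph g \<cdot> h = pb_map p (p \<cdot> f) h (p \<cdot> g) \<cdot> graph f"
    proof (rule pb_eqI[OF pa pg(1,2)])
      show "pb1 p (p \<cdot> g) \<cdot> (graph g \<cdot> h) = pb1 p (p \<cdot> g) \<cdot> (pb_map p (p \<cdot> f) h (p \<cdot> g) \<cdot> graph f)"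
        using comp_ext[OF ug(4), of h] comp_ext[OF M(4), of "graph f"] M uf ug Df Dg f pf pg pa by simp
      show "pb2 p (p \<cdot> g) \<cdot> (graph g \<cdot> h) = pb2 p (p \<cdot> g) \<cdot> (pb_map p (p \<cdot> f) h (p \<cdot> g) \<cdot> graph f)"
        using comp_ext[OF ug(5), of h] comp_ext[OF M(5), of "graph f"] M uf ug Df Dg f pf pg pa by simp
    qed (use M uf ug f in auto)
    then show "\<eta> (Cod SliceE \<phi>) \<cdot>\<^bsub>SliceE\<^esub> FArr id_functor \<phi> = FArr (comp_functor Pull L) \<phi> \<cdot>\<^bsub>SliceE\<^esub> \<eta> (Dom SliceE \<phi>)"
      using f by (simp add: \<eta>_def id_functor_def L_sel pullback_functor_sel)
  qed
  show "is_nat_trans SliceB SliceB (comp_functor L Pull) id_functor \<epsilon>"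
    unfolding is_nat_trans_def
  proof (intro conjI ballI)
    fix f assume "f \<in> Obj SliceB"
    then have f: "arr f" "cod f = cod p" "f \<in> covers" by auto
    show "\<epsilon> f \<in> Hom SliceB (FObj (comp_functor L Pull) f) (FObj id_functor f)"
      using f pbD[OF f(1,2)] pb2_regular[OF f(3,2)] preg[of "pb2 p f"] p pa
      by (simp add: \<epsilon>_def id_functor_def L_sel pullback_functor_sel)
  next
    fix \<phi> assume "\<phi> \<in> Arr SliceB"
    then obtain f h g where f: "\<phi> = (f, h, g)" "arr f" "f \<in> covers" "cod f = cod p" "arr g"
      "g \<in> covers" "cod g = cod p" "arr h" "dom h = dom f" "cod h = dom g" "g \<cdot> h = f" by (rule slice_arrE)
    note M = pb_map[OF pa f(2,4,5,7-11)]
    show "\<epsilon> (Cod SliceB \<phi>) \<cdot>\<^bsub>SliceB\<^esub> FArr (comp_functor L Pull) \<phi> = FArr id_functor \<phi> \<cdot>\<^bsub>SliceB\<^esub> \<epsilon> (Dom SliceB \<phi>)"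
      using f M by (simp add: \<epsilon>_def id_functor_def L_sel pullback_functor_sel)
  qed
  fix x assume "x \<in> Obj SliceE"
  then have x: "arr x" "cod x = dom p" "x \<in> covers" by auto
  show "\<epsilon> (FObj L x) \<cdot>\<^bsub>SliceB\<^esub> FArr L (\<eta> x) = Idn SliceB (FObj L x)"
    using x graph[OF x(1,2)] pa by (simp add: \<epsilon>_def \<eta>_def L_sel)
next
  fix f assume "f \<in> Obj SliceB"
  then have f: "arr f" "cod f = cod p" "f \<in> covers" by auto
  note D = pbD[OF f(1,2)]
  note pt = px[OF D(2,5)]
  note D' = pbD[OF pt(1,2)] and u = graph[OF D(2,5)]
  have h: "arr (pb1 p f)" "dom (pb1 p f) = dom (p \<cdot> pb2 p f)" "cod (pb1 p f) = dom f" "f \<cdot> pb1 p f = p \<cdot> pb2 p f" using D pt by auto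
  note M = pb_map[OF pa pt(1,2) f(1,2) h]
  have "pb_map p (p \<cdot> pb2 p f) (pb1 p f) f \<cdot> graph (pb2 p f) = Idn C (dom (pb2 p f))"
  proof (rule pb_eqI[OF pa f(1,2)])
    show "pb1 p f \<cdot> (pb_map p (p \<cdot> pb2 p f) (pb1 p f) f \<cdot> graph (pb2 p f)) = pb1 p f \<cdot> Idn C (dom (pb2 p f))"
      using comp_ext[OF M(4), of "graph (pb2 p f)"] M u D D' pt by simp
    show "pb2 p f \<cdot> (pb_map p (p \<cdot> pb2 p f) (pb1 p f) f \<cdot> graph (pb2 p f)) = pb2 p f \<cdot> Idn C (dom (pb2 p f))"
      using comp_ext[OF M(5), of "graph (pb2 p f)"] M u D D' pt by simp
  qed (use M u D in auto)
  then show "FArr Pull (\<epsilon> f) \<cdot>\<^bsub>SliceE\<^esub> \<eta> (FObj Pull f) = Idn SliceE (FObj Pull f)"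
    by (simp add: \<epsilon>_def \<eta>_def pullback_functor_sel)
qed

abbreviation "Alg \<equiv> EM_category SliceE (comp_functor Pull L) \<eta> (\<lambda>x. FArr Pull (\<epsilon> (FObj L x)))"
abbreviation "Cmp \<equiv> comparison_functor SliceB Pull \<epsilon>"

text \<open>The underlying arrow of the structure map of the algebra that the comparison functor assigns to \<open>f\<close>.\<close>
definition "\<theta> f = pb_map p (p \<cdot> pb2 p f) (pb1 p f) f"

lemma \<theta>:
  assumes f: "arr f" "cod f = cod p"
  shows "arr (\<theta> f)" "dom (\<theta> f) = dom (pb2 p (p \<cdot> pb2 p f))" "cod (\<theta> f) = dom (pb2 p f)"
    "pb1 p f \<cdot> \<theta> f = pb1 p f \<cdot> pb1 p (p \<cdot> pb2 p f)" "pb2 p f \<cdot> \<theta> f = pb2 p (p \<cdot> pb2 p f)"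
  using pb_map[OF pa px(1,2)[OF pbD(2,5)[OF f]] f pbD(1)[OF f]] pbD[OF f] pa unfolding \<theta>_def by auto

lemma K_sel: "FObj Cmp f = (pb2 p f, (pb2 p (p \<cdot> pb2 p f), \<theta> f, pb2 p f))"
  "FArr Cmp (f, h, g) = ((pb2 p f, (pb2 p (p \<cdot> pb2 p f), \<theta> f, pb2 p f)), (pb2 p f, pb_map p f h g, pb2 p g),
     (pb2 p g, (pb2 p (p \<cdot> pb2 p g), \<theta> g, pb2 p g)))"
  by (simp_all add: comparison_functor_def \<epsilon>_def pullback_functor_sel \<theta>_def)

text \<open>The arrow underlying a morphism of algebras, followed by the projection to the domain of \<open>g\<close>, is
invariant under the transport of fibres and hence descends along the regular epimorphism
\<open>pb1 p f\<close>.\<close>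

lemma K_fully_faithful:
  assumes f: "f \<in> Obj SliceB" and g: "g \<in> Obj SliceB" and phi: "\<phi> \<in> Hom Alg (FObj Cmp f) (FObj Cmp g)"
  shows "\<exists>!\<psi>. \<psi> \<in> Hom SliceB f g \<and> FArr Cmp \<psi> = \<phi>"
proof -
  have f: "arr f" "cod f = cod p" "f \<in> covers" using f by auto
  have g: "arr g" "cod g = cod p" "g \<in> covers" using g by auto
  note Df = pbD[OF f(1,2)] and Dg = pbD[OF g(1,2)]
  note ptf = px[OF Df(2,5)] and ptg = px[OF Dg(2,5)]
  note Dtf = pbD[OF ptf(1,2)] and Dtg = pbD[OF ptg(1,2)]
  note tf = \<theta>[OF f(1,2)] and tg = \<theta>[OF g(1,2)]
  obtain s \<kappa> t where phi1: "\<phi> = (s, \<kappa>, t)" by (cases \<phi>)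
  have st: "s = FObj Cmp f" "t = FObj Cmp g" and pA: "(s, \<kappa>, t) \<in> Arr Alg" using phi phi1 by auto
  have kap: "\<kappa> \<in> Hom SliceE (pb2 p f) (pb2 p g)"
    and eq: "\<kappa> \<cdot>\<^bsub>SliceE\<^esub> snd s = snd t \<cdot>\<^bsub>SliceE\<^esub> FArr Pull (FArr L \<kappa>)" using pA st by (auto simp: EM_arr_iff K_sel)
  obtain k where k: "\<kappa> = (pb2 p f, k, pb2 p g)" "arr k" "dom k = dom (pb2 p f)" "cod k = dom (pb2 p g)"
    "pb2 p g \<cdot> k = pb2 p f" using kap by (cases \<kappa>) auto
  have hk: "arr k" "dom k = dom (p \<cdot> pb2 p f)" "cod k = dom (p \<cdot> pb2 p g)" "(p \<cdot> pb2 p g) \<cdot> k = p \<cdot> pb2 p f"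
    using k Df Dg ptf ptg pa by auto
  note Mk = pb_map[OF pa ptf(1,2) ptg(1,2) hk]
  define l where "l = pb_map p (p \<cdot> pb2 p f) k (p \<cdot> pb2 p g)"
  note Mk = Mk[folded l_def]
  have kt: "k \<cdot> \<theta> f = \<theta> g \<cdot> l" using eq st k by (simp add: K_sel L_sel pullback_functor_sel l_def)
  \<comment> \<open>the first component of k is constant on the fibres of the projection to the domain of f\<close>
  obtain a b where pb: "is_pullback C (pb1 p f) (pb1 p f) a b" using pullback_ex[of "pb1 p f" "pb1 p f"] Df by auto
  note D = is_pullback_D[OF pb]
  have ca: "cod a = dom (pb2 p f)" "cod b = dom (pb2 p f)" "dom b = dom a" using D Df by auto
  have "(p \<cdot> pb2 p f) \<cdot> b = f \<cdot> (pb1 p f \<cdot> b)"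
    by (rule trans[OF comp_assoc comp_ext2[OF Df(6), symmetric]]) (use D(4,5) Df(1-5) f pa ca in auto)
  also have "\<dots> = f \<cdot> (pb1 p f \<cdot> a)" using D(9) by simp
  also have "\<dots> = p \<cdot> (pb2 p f \<cdot> a)" by (rule comp_ext2[OF Df(6)]) (use D Df f pa ca in auto)
  finally have "(p \<cdot> pb2 p f) \<cdot> b = p \<cdot> (pb2 p f \<cdot> a)" .
  then have "\<exists>z. arr z \<and> dom z = dom b \<and> cod z = dom (pb1 p (p \<cdot> pb2 p f)) \<and>
      pb1 p (p \<cdot> pb2 p f) \<cdot> z = b \<and> pb2 p (p \<cdot> pb2 p f) \<cdot> z = pb2 p f \<cdot> a"
    by (intro pullback_lift[OF pb12[OF ptf(1) pa ptf(2)]]) (use D Df ptf ca in auto)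
  then obtain z where z: "arr z" "dom z = dom b" "cod z = dom (pb2 p (p \<cdot> pb2 p f))"
    "pb1 p (p \<cdot> pb2 p f) \<cdot> z = b" "pb2 p (p \<cdot> pb2 p f) \<cdot> z = pb2 p f \<cdot> a" using Dtf by auto
  have tz: "\<theta> f \<cdot> z = a"
  proof (rule pb_eqI[OF pa f(1,2)])
    have "pb1 p f \<cdot> (\<theta> f \<cdot> z) = pb1 p f \<cdot> (pb1 p (p \<cdot> pb2 p f) \<cdot> z)"
      by (rule comp_ext2[OF tf(4)]) (use tf z Df Dtf ptf in auto)
    then show "pb1 p f \<cdot> (\<theta> f \<cdot> z) = pb1 p f \<cdot> a" using z D(9) by simp
    show "pb2 p f \<cdot> (\<theta> f \<cdot> z) = pb2 p f \<cdot> a" using comp_ext[OF tf(5), of z] tf z Df by simp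
  qed (use tf z D Df ca in auto)
  have kk: "(pb1 p g \<cdot> k) \<cdot> a = (pb1 p g \<cdot> k) \<cdot> b"
  proof -
    have "(pb1 p g \<cdot> k) \<cdot> a = pb1 p g \<cdot> ((k \<cdot> \<theta> f) \<cdot> z)" using tz k tf z Dg D(4,5) ca by simp
    also have "\<dots> = pb1 p g \<cdot> (\<theta> g \<cdot> (l \<cdot> z))" unfolding kt using tg Mk z Dtf Dtg by simp
    also have "\<dots> = pb1 p g \<cdot> (pb1 p (p \<cdot> pb2 p g) \<cdot> (l \<cdot> z))"
      using comp_ext2[OF tg(4), of "l \<cdot> z"] tg Mk z Dg Dtg ptg by simp
    also have "\<dots> = pb1 p g \<cdot> (k \<cdot> (pb1 p (p \<cdot> pb2 p f) \<cdot> z))"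
      using comp_ext2[OF Mk(4), of z] Mk z Dtf Dtg ptf ptg k Df Dg by simp
    also have "\<dots> = (pb1 p g \<cdot> k) \<cdot> b" using z k Dg ca D by simp
    finally show ?thesis .
  qed
  have co: "is_coequalizer C a b (pb1 p f)" by (rule regular_epi_coequalizer_of_kernel_pair[OF Df(7) pb])
  obtain h where h: "arr h" "dom h = dom f" "cod h = dom g" "h \<cdot> pb1 p f = pb1 p g \<cdot> k"
    using coequalizer_lift[OF co _ _ kk] k Df Dg D by auto
  have gh: "g \<cdot> h = f"
  proof (rule regular_epi_epi[OF Df(7)])
    have "g \<cdot> (pb1 p g \<cdot> k) = (p \<cdot> pb2 p g) \<cdot> k" by (rule comp_ext[OF Dg(6)]) (use g Dg k in auto)
    then show "(g \<cdot> h) \<cdot> pb1 p f = f \<cdot> pb1 p f" using h g Df(1-5) hk(4) Df(6) by simp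
  qed (use h g f Df in auto)
  have mk: "pb_map p f h' g = k" if "arr h'" "dom h' = dom f" "cod h' = dom g" "g \<cdot> h' = f" "h' \<cdot> pb1 p f = pb1 p g \<cdot> k" for h'
    by (rule pb_eqI[OF pa g(1,2)]) (use pb_map[OF pa f(1,2) g(1,2) that(1-4)] that k in auto)
  show ?thesis
  proof (rule ex1I[of _ "(f, h, g)"])
    show "(f, h, g) \<in> Hom SliceB f g \<and> FArr Cmp (f, h, g) = \<phi>"
      using f g h gh mk[OF h(1-3) gh h(4)] phi1 st k by (simp add: K_sel)
  next
    fix \<psi> assume psi: "\<psi> \<in> Hom SliceB f g \<and> FArr Cmp \<psi> = \<phi>"
    then obtain h' where h': "\<psi> = (f, h', g)" "arr h'" "dom h' = dom f" "cod h' = dom g" "g \<cdot> h' = f"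
      by (cases \<psi>) auto
    have "pb_map p f h' g = k" using psi h' phi1 k by (simp add: K_sel)
    then have "h' \<cdot> pb1 p f = h \<cdot> pb1 p f" using pb_map(4)[OF pa f(1,2) g(1,2) h'(2-5)] h by simp
    then have "h' = h" by (rule regular_epi_epi[OF Df(7), rotated 4]) (use h h' Df in auto)
    then show "\<psi> = (f, h, g)" using h' by simp
  qed
qed

text \<open>The structure map of an algebra on \<open>x\<close> is a transport \<open>h\<close> as in the descent condition, and the
comparison of \<open>x\<close> with the pullback of the descended object is an isomorphism of algebras because \<open>q\<close>
coequalizes \<open>s\<close> and \<open>h\<close>.\<close>

lemma K_ess_surj:
  assumes b: "b \<in> Obj Alg" shows "\<exists>f \<in> Obj SliceB. \<exists>i \<in> Hom Alg (FObj Cmp f) b. is_iso Alg i"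
proof -
  interpret XX: category SliceE by (rule slice_category)
  interpret MM: category Alg
    by (rule EM_category[OF slice_category comp_functor_functor[OF L_functor U_functor]])
  obtain x hh where bx: "b = (x, hh)" by (cases b)
  have x: "arr x" "cod x = dom p" "x \<in> covers" and hh: "hh \<in> Hom SliceE (FObj Pull (FObj L x)) x"
    and un: "hh \<cdot>\<^bsub>SliceE\<^esub> \<eta> x = Idn SliceE x"
    using b by (auto simp: bx EM_algebra_iff)
  note ppx = px[OF x(1,2)]
  note D = pbD[OF ppx(1,2)]
  define s t where "s = pb1 p (p \<cdot> x)" and "t = pb2 p (p \<cdot> x)"
  note D = D[folded s_def t_def]
  obtain h where h: "hh = (t, h, x)" "arr h" "dom h = dom t" "cod h = dom x" "x \<cdot> h = t"
    using hh by (cases hh) (auto simp: L_sel pullback_functor_sel t_def)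
  have pbs: "is_pullback C (p \<cdot> x) p s t" unfolding s_def t_def by (rule pb12[OF ppx(1) pa ppx(2)])
  have un': "h \<cdot> graph x = Idn C (dom x)" using un h by (simp add: \<eta>_def)
  note graphx = graph[OF x(1,2), folded s_def t_def]
  obtain q f where q: "q \<in> covers" "is_pullback C f p q x" "q \<cdot> h = q \<cdot> s"
  proof -
    have "\<exists>q f. q \<in> covers \<and> is_pullback C f p q x \<and> q \<cdot> h = q \<cdot> s"
    proof (rule descent[OF x(3,2) pbs])
      fix w assume w: "w \<in> Hom C (dom x) (dom s)" "s \<cdot> w = Idn C (dom x)" "t \<cdot> w = x"
      have "w = graph x" by (rule pullback_eqI[OF pbs]) (use w graphx D in auto)
      then show "h \<cdot> w = Idn C (dom x)" using un' by simp
    qed (use h D in auto)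
    then show ?thesis using that by blast
  qed
  note Dq = is_pullback_D[OF q(2)]
  have f: "arr f" "cod f = cod p" "f \<in> covers"
    using Dq cancel[of f q] preg[OF x(3,2)] x by auto
  note pf = pb12[OF f(1) pa f(2)] and Df = pbD[OF f(1,2)]
  note ptf = px[OF Df(2,5)]
  note Dtf = pbD[OF ptf(1,2)]
  obtain j where j: "is_iso C j" "arr j" "dom j = dom (pb1 p f)" "cod j = dom q" "q \<cdot> j = pb1 p f" "x \<cdot> j = pb2 p f"
    using pullback_compare[OF q(2) pf] by blast
  obtain j' where j': "arr j'" "dom j' = cod j" "cod j' = dom j" "j' \<cdot> j = Idn C (dom j)" "j \<cdot> j' = Idn C (cod j)"
    using j(1) by (rule is_isoE)
  have hj: "arr j" "dom j = dom (p \<cdot> pb2 p f)" "cod j = dom (p \<cdot> x)" "(p \<cdot> x) \<cdot> j = p \<cdot> pb2 p f"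
    using j Df ptf ppx Dq x pa by auto
  note Mj = pb_map[OF pa ptf(1,2) ppx(1,2) hj, folded s_def t_def]
  define l where "l = pb_map p (p \<cdot> pb2 p f) j (p \<cdot> x)"
  note Mj = Mj[folded l_def]
  note tf = \<theta>[OF f(1,2)]
  have alg: "j \<cdot> \<theta> f = h \<cdot> l"
  proof (rule pullback_eqI[OF q(2)])
    have "q \<cdot> (j \<cdot> \<theta> f) = pb1 p f \<cdot> \<theta> f" by (rule comp_ext[OF j(5)]) (use j tf Dq Df in auto)
    also have "\<dots> = pb1 p f \<cdot> pb1 p (p \<cdot> pb2 p f)" by (rule tf)
    also have "\<dots> = q \<cdot> (j \<cdot> pb1 p (p \<cdot> pb2 p f))" by (rule comp_ext[OF j(5), symmetric]) (use j tf Dq Df Dtf ptf in auto)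
    also have "\<dots> = q \<cdot> (s \<cdot> l)" using Mj by simp
    also have "\<dots> = q \<cdot> (h \<cdot> l)" by (rule comp_ext2[OF q(3)[symmetric]]) (use Mj D h Dq ppx in auto)
    finally show "q \<cdot> (j \<cdot> \<theta> f) = q \<cdot> (h \<cdot> l)" .
    have "x \<cdot> (j \<cdot> \<theta> f) = pb2 p f \<cdot> \<theta> f" by (rule comp_ext[OF j(6)]) (use j tf Dq Df in auto)
    also have "\<dots> = x \<cdot> (h \<cdot> l)" using comp_ext[OF h(5), of l] tf Mj h x by simp
    finally show "x \<cdot> (j \<cdot> \<theta> f) = x \<cdot> (h \<cdot> l)" .
  qed (use j tf Dq Df Mj h in auto)
  have KfA: "FObj Cmp f \<in> Obj Alg"
    using functorD(1)[OF comparison_functor_functor[OF slice_category slice_category adjunction], of f] f by simp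
  have jX: "(pb2 p f, j, x) \<in> Arr SliceE" "(x, j', pb2 p f) \<in> Arr SliceE"
  proof -
    have "pb2 p f \<cdot> j' = x" using comp_ext[OF j(6), of j'] j j' Dq x by simp
    then show "(pb2 p f, j, x) \<in> Arr SliceE" "(x, j', pb2 p f) \<in> Arr SliceE"
      using j j' Df Dq x pb2_regular[OF f(3,2)] by auto
  qed
  have "is_iso SliceE (pb2 p f, j, x)"
    by (rule XX.is_isoI[OF jX]) (use j j' Df Dq in auto)
  define i where "i = (FObj Cmp f, (pb2 p f, j, x), (x, hh))"
  have iA: "i \<in> Arr Alg" unfolding i_def EM_arr_iff
    using KfA b bx jX alg h by (simp add: K_sel L_sel pullback_functor_sel l_def t_def)
  define i' where "i' = ((x, hh), (x, j', pb2 p f), FObj Cmp f)"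
  have "i' \<in> Arr Alg" unfolding i'_def EM_arr_iff
  proof (intro conjI)
    have hj': "arr j'" "dom j' = dom (p \<cdot> x)" "cod j' = dom (p \<cdot> pb2 p f)" "(p \<cdot> pb2 p f) \<cdot> j' = p \<cdot> x"
      using jX j' ptf ppx Df pa by auto
    note Mj' = pb_map[OF pa ppx(1,2) ptf(1,2) hj', folded s_def t_def]
    define l' where "l' = pb_map p (p \<cdot> x) j' (p \<cdot> pb2 p f)"
    note Mj' = Mj'[folded l'_def]
    have ll: "l \<cdot> l' = Idn C (dom t)"
    proof (rule pullback_eqI[OF pbs])
      show "s \<cdot> (l \<cdot> l') = s \<cdot> Idn C (dom t)"
        using comp_ext[OF Mj(4), of l'] comp_ext[OF j'(5), of s] Mj Mj' j j' D Df(1-5) Dtf ptf Dq ppx by simp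
      show "t \<cdot> (l \<cdot> l') = t \<cdot> Idn C (dom t)"
        using comp_ext[OF Mj(5), of l'] Mj Mj' D by simp
    qed (use Mj Mj' D in auto)
    have "j' \<cdot> h = j' \<cdot> ((h \<cdot> l) \<cdot> l')" using ll h Mj Mj' by simp
    also have "\<dots> = j' \<cdot> (j \<cdot> (\<theta> f \<cdot> l'))" unfolding alg[symmetric] using j tf Mj' Df by simp
    also have "\<dots> = \<theta> f \<cdot> l'" using comp_ext[OF j'(4), of "\<theta> f \<cdot> l'"] j j' tf Mj' Df by simp
    finally have "j' \<cdot> h = \<theta> f \<cdot> l'" .
    then show "(x, j', pb2 p f) \<cdot>\<^bsub>SliceE\<^esub> snd (x, hh) = snd (FObj Cmp f) \<cdot>\<^bsub>SliceE\<^esub> FArr (comp_functor Pull L) (x, j', pb2 p f)"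
      using h by (simp add: K_sel L_sel pullback_functor_sel l'_def t_def)
  qed (use KfA b bx jX in \<open>auto simp: K_sel\<close>)
  then have "is_iso Alg i"
    by (intro MM.is_isoI[OF iA]) (use j j' Df(1-5) Dq(6) in \<open>auto simp: i_def i'_def K_sel\<close>)
  then show ?thesis
    by (intro bexI[of _ f] bexI[of _ i]) (use f iA bx in \<open>auto simp: i_def\<close>)
qed

theorem regular_epi_monadic_extension: "monadic_extension C (covers) p"
proof -
  have "is_equivalence_functor SliceB Alg Cmp"
    by (rule fully_faithful_ess_surj_equivalence[OF slice_category _ _ K_fully_faithful K_ess_surj])
      (use EM_category[OF slice_category comp_functor_functor[OF L_functor U_functor]]
        comparison_functor_functor[OF slice_category slice_category adjunction] in auto)
  then show ?thesis unfolding monadic_extension_def is_monadic_def using adjunction pa by blast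
qed

end

section \<open>Connected components and stably connected functors\<close>

context regular_cat
begin

lemma glue_pair:
  assumes jm: "jointly_monic C p q" "arr p" "arr q" "dom q = dom p"
    and e: "e \<in> covers" "cod e = t" and u: "arr u" "dom u = t" "cod u = cod p"
    and v: "arr v" "dom v = t" "cod v = cod q"
    and w: "arr w" "dom w = dom e" "cod w = dom p" "p \<cdot> w = u \<cdot> e" "q \<cdot> w = v \<cdot> e"
  shows "\<exists>w. arr w \<and> dom w = t \<and> cod w = dom p \<and> p \<cdot> w = u \<and> q \<cdot> w = v"
proof -
  have ea: "arr e" using e by simp
  obtain k where k: "arr k" "dom k = cod e" "cod k = cod w" "k \<cdot> e = w"
  proof (rule glue[OF e(1), of w])
    fix a b assume ab: "arr a" "arr b" "dom a = dom b" "cod a = dom e" "cod b = dom e" "e \<cdot> a = e \<cdot> b"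
    have 1: "p \<cdot> (w \<cdot> a) = p \<cdot> (w \<cdot> b)"
      using comp_ext[OF w(4), of a] comp_ext[OF w(4), of b] ab jm w u ea e by simp
    have 2: "q \<cdot> (w \<cdot> a) = q \<cdot> (w \<cdot> b)"
      using comp_ext[OF w(5), of a] comp_ext[OF w(5), of b] ab jm w v ea e by simp
    show "w \<cdot> a = w \<cdot> b" by (rule jointly_monicD[OF jm(1) _ _ _ _ _ 1 2]) (use ab w in auto)
  qed (use w in auto)
  have "p \<cdot> k = u" by (rule regular_epi_epi[OF e(1)]) (use k jm w u ea e in auto)
  moreover have "q \<cdot> k = v" by (rule regular_epi_epi[OF e(1)]) (use k jm w v ea e in auto)
  ultimately show ?thesis using k e w by auto
qed

lemma gpr_eqI:
  assumes B: "internal_groupoid C B" and "gpr1 B \<cdot> a = gpr1 B \<cdot> b" "gpr2 B \<cdot> a = gpr2 B \<cdot> b"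
    "arr a" "arr b" "dom a = dom b" "cod a = G2 B" "cod b = G2 B"
  shows "a = b"
  by (rule pullback_eqI[OF gpd_pullback[OF B] assms(4-6) _ _ assms(2,3)]) (use B assms in auto)

text \<open>The decalage of \<open>B\<close>, that is, the sum of the slice groupoids \<open>B/y\<close>: its objects are the arrows of \<open>B\<close>,
and a composable pair \<open>(u, v)\<close> is an arrow from \<open>u v\<close> to \<open>u\<close> lying over \<open>v\<close>. It covers \<open>B\<close> by a discrete
fibration \<open>W\<close>, and it is an equivalence relation, with two arrows of \<open>B\<close> connected precisely when they
have the same codomain. So it is the universal object on which to test the classes \<open>E'\<close> and
\<open>M*\<close>.\<close>

lemma decalage:
  assumes B: "internal_groupoid C B"
  obtains W where "W \<in> discrete_fibrations C" "Tgt W = B" "f0 W \<in> covers" "f1 W \<in> covers"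
    "G0 (Src W) = G1 B" "f0 W = gdom B"
    "\<And>w. arr w \<Longrightarrow> cod w = G1 (Src W) \<Longrightarrow> gdom B \<cdot> (gcod (Src W) \<cdot> w) = gcod B \<cdot> (f1 W \<cdot> w) \<and>
       gcomp C B (gcod (Src W) \<cdot> w) (f1 W \<cdot> w) = gdom (Src W) \<cdot> w"
    "\<And>t b b'. \<lbrakk>b \<in> Hom C t (G1 B); b' \<in> Hom C t (G1 B);
       gcod B \<cdot> b = gcod B \<cdot> b'\<rbrakk>
       \<Longrightarrow> \<exists>w \<in> Hom C t (G1 (Src W)). gdom (Src W) \<cdot> w = b \<and> gcod (Src W) \<cdot> w = b'"
proof -
  note pb = gpd_pullback[OF B]
  note eqI = gpr_eqI[OF B]
  note gm = gmult_gcomp[OF B]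
  have g0: "gdom B \<cdot> gunit B = Idn C (G0 B)" "gcod B \<cdot> gunit B = Idn C (G0 B)" using gpd_eqs B by auto
  define s where "s = gpair C B (Idn C (G1 B)) (gunit B \<cdot> gdom B)"
  have s: "arr s" "dom s = G1 B" "cod s = G2 B" "gpr1 B \<cdot> s = Idn C (G1 B)" "gpr2 B \<cdot> s = gunit B \<cdot> gdom B"
    using gpair[OF B, of "Idn C (G1 B)" "gunit B \<cdot> gdom B"] B unfolding s_def by auto
  have se: "gpr1 B \<cdot> (s \<cdot> z) = z" "gpr2 B \<cdot> (s \<cdot> z) = gunit B \<cdot> (gdom B \<cdot> z)" if "arr z" "cod z = G1 B" for z
    using comp_ext[OF s(4), of z] comp_ext[OF s(5), of z] that s B by auto
  have ds: "gmult B \<cdot> s = Idn C (G1 B)" using gm(1)[OF s(1,3)] s B by simp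
  have gmpr: "gmult B = gcomp C B (gpr1 B) (gpr2 B)" "gdom B \<cdot> gpr1 B = gcod B \<cdot> gpr2 B"
    using gm[of "Idn C (G2 B)"] B by auto
  define i where "i = gpair C B (gmult B) (ginv C B \<cdot> gpr2 B)"
  have i: "arr i" "dom i = G2 B" "cod i = G2 B" "gpr1 B \<cdot> i = gmult B" "gpr2 B \<cdot> i = ginv C B \<cdot> gpr2 B"
    using gpair[OF B, of "gmult B" "ginv C B \<cdot> gpr2 B"] B gpd_eqs(3)[OF B] unfolding i_def by auto
  have di: "gmult B \<cdot> i = gpr1 B"
  proof -
    have "gmult B \<cdot> i = gcomp C B (gcomp C B (gpr1 B) (gpr2 B)) (ginv C B \<cdot> gpr2 B)" using gm(1)[OF i(1,3)] i gmpr by simp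
    also have "\<dots> = gcomp C B (gpr1 B) (gcomp C B (gpr2 B) (ginv C B \<cdot> gpr2 B))"
      by (rule gcomp_assoc[OF B]) (use B gmpr(2) in auto)
    also have "\<dots> = gpr1 B" using B gmpr(2) by simp
    finally show ?thesis .
  qed
  define m where "m u v = gpair C B (gpr1 B \<cdot> u) (gcomp C B (gpr2 B \<cdot> u) (gpr2 B \<cdot> v))" for u v
  have m: "arr (m u v)" "dom (m u v) = dom u" "cod (m u v) = G2 B" "gpr1 B \<cdot> m u v = gpr1 B \<cdot> u"
    "gpr2 B \<cdot> m u v = gcomp C B (gpr2 B \<cdot> u) (gpr2 B \<cdot> v)" "gmult B \<cdot> m u v = gmult B \<cdot> v"
    "gdom B \<cdot> (gpr2 B \<cdot> u) = gcod B \<cdot> (gpr2 B \<cdot> v)"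
    if h: "arr u" "arr v" "dom v = dom u" "cod u = G2 B" "cod v = G2 B" "gmult B \<cdot> u = gpr1 B \<cdot> v" for u v
  proof -
    have "gdom B \<cdot> (gmult B \<cdot> u) = gdom B \<cdot> (gpr2 B \<cdot> u)" using gm[OF h(1,4)] h B by simp
    then show c: "gdom B \<cdot> (gpr2 B \<cdot> u) = gcod B \<cdot> (gpr2 B \<cdot> v)" using h gm(2)[OF h(2,5)] by simp
    have "gdom B \<cdot> (gpr1 B \<cdot> u) = gcod B \<cdot> gcomp C B (gpr2 B \<cdot> u) (gpr2 B \<cdot> v)" using gm(2)[OF h(1,4)] h B c by simp
    note G = gpair[OF B _ _ _ _ _ this]
    show M: "arr (m u v)" "dom (m u v) = dom u" "cod (m u v) = G2 B" "gpr1 B \<cdot> m u v = gpr1 B \<cdot> u"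
      "gpr2 B \<cdot> m u v = gcomp C B (gpr2 B \<cdot> u) (gpr2 B \<cdot> v)" using G h B c unfolding m_def by auto
    have "gmult B \<cdot> m u v = gcomp C B (gcomp C B (gpr1 B \<cdot> u) (gpr2 B \<cdot> u)) (gpr2 B \<cdot> v)"
      using gm(1)[OF M(1,3)] M h B c gm(2)[OF h(1,4)] by simp
    also have "\<dots> = gmult B \<cdot> v" using gm(1)[OF h(1,4)] gm(1)[OF h(2,5)] h by simp
    finally show "gmult B \<cdot> m u v = gmult B \<cdot> v" .
  qed
  obtain r1 r2 where pbr: "is_pullback C (gmult B) (gpr1 B) r1 r2" using pullback_exists[of "gmult B" "gpr1 B"] B by auto
  obtain D where D: "internal_groupoid C D" "G0 D = G1 B" "G1 D = G2 B" "gdom D = gmult B" "gcod D = gpr1 B" "gunit D = s"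
    and Dm: "\<And>u v. \<lbrakk>arr u; arr v; dom v = dom u; cod u = G2 B; cod v = G2 B;
       gmult B \<cdot> u = gpr1 B \<cdot> v\<rbrakk> \<Longrightarrow> gcomp C D u v = m u v"
  proof (rule groupoid_from_operation[where m = m and i = i, OF gpd_arr(2,3)[OF B] gpd_arr(19-21)[OF B] gpd_arr(13-15)[OF B] s(1-3) pbr ds s(4)])
    fix u v assume uv: "arr u" "arr v" "dom v = dom u" "cod u = G2 B" "cod v = G2 B" "gmult B \<cdot> u = gpr1 B \<cdot> v"
    show "arr (m u v) \<and> dom (m u v) = dom u \<and> cod (m u v) = G2 B \<and> gmult B \<cdot> m u v = gmult B \<cdot> v \<and> gpr1 B \<cdot> m u v = gpr1 B \<cdot> u"
      using m[OF uv] by simp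
    fix e assume e: "arr e" "cod e = dom u"
    have c2: "gmult B \<cdot> (u \<cdot> e) = gpr1 B \<cdot> (v \<cdot> e)" by (rule comp_ext2[OF uv(6)]) (use uv e B in auto)
    have ue: "arr (u \<cdot> e)" "arr (v \<cdot> e)" "dom (v \<cdot> e) = dom (u \<cdot> e)" "cod (u \<cdot> e) = G2 B" "cod (v \<cdot> e) = G2 B"
      using uv e by auto
    note M = m[OF uv] and M' = m[OF ue c2]
    show "m u v \<cdot> e = m (u \<cdot> e) (v \<cdot> e)"
    proof (rule eqI)
      have "gpr1 B \<cdot> (m u v \<cdot> e) = gpr1 B \<cdot> (u \<cdot> e)" by (rule comp_ext2[OF M(4)]) (use M uv e B in auto)
      then show "gpr1 B \<cdot> (m u v \<cdot> e) = gpr1 B \<cdot> m (u \<cdot> e) (v \<cdot> e)" using M' by simp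
      have "gpr2 B \<cdot> (m u v \<cdot> e) = gcomp C B (gpr2 B \<cdot> u) (gpr2 B \<cdot> v) \<cdot> e" by (rule comp_ext[OF M(5)]) (use M uv e B in auto)
      then show "gpr2 B \<cdot> (m u v \<cdot> e) = gpr2 B \<cdot> m (u \<cdot> e) (v \<cdot> e)" using M' M uv e B by simp
    qed (use M M' uv e in auto)
  next
    fix u assume u: "arr u" "cod u = G2 B"
    have dse: "gmult B \<cdot> (s \<cdot> z) = z" if "arr z" "cod z = G1 B" for z
      using comp_ext[OF ds, of z] that s B by auto
    have h: "gmult B \<cdot> u = gpr1 B \<cdot> (s \<cdot> (gmult B \<cdot> u))" "gmult B \<cdot> (s \<cdot> (gpr1 B \<cdot> u)) = gpr1 B \<cdot> u" using u B dse se by auto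
    have sa: "arr (s \<cdot> (gmult B \<cdot> u))" "dom (s \<cdot> (gmult B \<cdot> u)) = dom u" "cod (s \<cdot> (gmult B \<cdot> u)) = G2 B"
      "arr (s \<cdot> (gpr1 B \<cdot> u))" "dom u = dom (s \<cdot> (gpr1 B \<cdot> u))" "cod (s \<cdot> (gpr1 B \<cdot> u)) = G2 B" using u s B by auto
    note M = m(1-5)[OF u(1) sa(1,2) u(2) sa(3) h(1)] and M' = m(1-5)[OF sa(4) u(1) sa(5,6) u(2) h(2)]
    have su: "gpr2 B \<cdot> (s \<cdot> (gmult B \<cdot> u)) = gunit B \<cdot> (gdom B \<cdot> (gmult B \<cdot> u))"
      "gpr1 B \<cdot> (s \<cdot> (gpr1 B \<cdot> u)) = gpr1 B \<cdot> u" "gpr2 B \<cdot> (s \<cdot> (gpr1 B \<cdot> u)) = gunit B \<cdot> (gdom B \<cdot> (gpr1 B \<cdot> u))"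
      by (rule se; use u s B in simp)+
    have gd: "gdom B \<cdot> (gmult B \<cdot> u) = gdom B \<cdot> (gpr2 B \<cdot> u)" using gm[OF u] u B by simp
    show "m u (s \<cdot> (gmult B \<cdot> u)) = u"
      by (rule eqI) (use M u B gd su in simp_all)
    show "m (s \<cdot> (gpr1 B \<cdot> u)) u = u"
      by (rule eqI) (use M' u s B gm(2)[OF u] su in simp_all)
  next
    fix u v w assume h: "arr u" "arr v" "arr w" "dom v = dom u" "dom w = dom u"
      "cod u = G2 B" "cod v = G2 B" "cod w = G2 B" "gmult B \<cdot> u = gpr1 B \<cdot> v" "gmult B \<cdot> v = gpr1 B \<cdot> w"
    have uv: "arr u" "arr v" "dom v = dom u" "cod u = G2 B" "cod v = G2 B" "gmult B \<cdot> u = gpr1 B \<cdot> v"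
      and vw: "arr v" "arr w" "dom w = dom v" "cod v = G2 B" "cod w = G2 B" "gmult B \<cdot> v = gpr1 B \<cdot> w" using h by auto
    note M = m[OF uv] m[OF vw]
    have 1: "arr (m u v)" "arr w" "dom w = dom (m u v)" "cod (m u v) = G2 B" "cod w = G2 B" "gmult B \<cdot> m u v = gpr1 B \<cdot> w"
      and 2: "arr u" "arr (m v w)" "dom (m v w) = dom u" "cod u = G2 B" "cod (m v w) = G2 B" "gmult B \<cdot> u = gpr1 B \<cdot> m v w"
      using M h by auto
    show "m (m u v) w = m u (m v w)"
      by (rule eqI) (use M m[OF 1] m[OF 2] h B in auto)
  next
    have h: "arr (Idn C (G2 B))" "arr i" "dom i = dom (Idn C (G2 B))" "cod (Idn C (G2 B)) = G2 B" "cod i = G2 B"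
      "gmult B \<cdot> Idn C (G2 B) = gpr1 B \<cdot> i" and h': "dom (Idn C (G2 B)) = dom i" "gmult B \<cdot> i = gpr1 B \<cdot> Idn C (G2 B)"
      using i B di by auto
    note M = m[OF h] and M' = m[OF h(2,1) h'(1) h(5,4) h'(2)]
    show "m (Idn C (G2 B)) i = s \<cdot> gpr1 B"
      by (rule eqI) (use M i s B se[of "gpr1 B"] gmpr in auto)
    have gd: "gdom B \<cdot> gmult B = gdom B \<cdot> gpr2 B" by (rule gpd_eqs(3)[OF B])
    show "m i (Idn C (G2 B)) = s \<cdot> gmult B"
      by (rule eqI) (use M' i s B se[of "gmult B"] gd in auto)
  qed (use i di in auto)
  define W where "W = \<lparr>Src = D, Tgt = B, f0 = gdom B, f1 = gpr2 B\<rparr>"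
  have W: "internal_functor C W" unfolding W_def
  proof (rule internal_functorI[OF D(1) B])
    show "gdom B \<cdot> gpr2 B = gdom B \<cdot> gdom D" using gpd_eqs(3)[OF B] D by simp
    show "gcod B \<cdot> gpr2 B = gdom B \<cdot> gcod D" using gmpr D by simp
    fix u v assume "arr u" "arr v" "dom v = dom u" "cod u = G1 D" "cod v = G1 D" "gdom D \<cdot> u = gcod D \<cdot> v"
    then have uv: "arr u" "arr v" "dom v = dom u" "cod u = G2 B" "cod v = G2 B" "gmult B \<cdot> u = gpr1 B \<cdot> v" using D by auto
    show "gpr2 B \<cdot> gcomp C D u v = gcomp C B (gpr2 B \<cdot> u) (gpr2 B \<cdot> v)" using m[OF uv] Dm[OF uv] by simp
  qed (use B D in auto)
  have s2: "\<exists>w. arr w \<and> cod w = G2 B \<and> gpr2 B \<cdot> w = Idn C (G1 B)"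
    using gpair[OF B, of "gunit B \<cdot> gcod B" "Idn C (G1 B)"] B by (intro exI) auto
  show ?thesis
  proof (rule that[of W])
    show "W \<in> discrete_fibrations C" unfolding discrete_fibrations_def
      using W pullback_sym[OF pb] D by (simp add: W_def)
    show "f0 W \<in> covers" using split_regular_epi[of "gdom B" "gunit B"] B g0 by (simp add: W_def)
    show "f1 W \<in> covers" using s2 split_regular_epi[of "gpr2 B"] B by (auto simp: W_def)
  next
    fix w assume "arr w" "cod w = G1 (Src W)"
    then have w: "arr w" "cod w = G2 B" using D by (auto simp: W_def)
    show "gdom B \<cdot> (gcod (Src W) \<cdot> w) = gcod B \<cdot> (f1 W \<cdot> w) \<and> gcomp C B (gcod (Src W) \<cdot> w) (f1 W \<cdot> w) = gdom (Src W) \<cdot> w"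
      using gm[OF w] D by (simp add: W_def)
  next
    fix t b b' assume b: "b \<in> Hom C t (G1 B)" "b' \<in> Hom C t (G1 B)" "gcod B \<cdot> b = gcod B \<cdot> b'"
    define c where "c = gcomp C B (ginv C B \<cdot> b') b"
    have c: "arr c" "dom c = t" "cod c = G1 B" "gcod B \<cdot> c = gdom B \<cdot> b'" "gcomp C B b' c = b"
      using b B unfolding c_def by auto
    note G = gpair[OF B, of b' c]
    have G: "arr (gpair C B b' c)" "dom (gpair C B b' c) = t" "cod (gpair C B b' c) = G2 B"
      "gpr1 B \<cdot> gpair C B b' c = b'" "gpr2 B \<cdot> gpair C B b' c = c" using G b c by auto
    show "\<exists>w \<in> Hom C t (G1 (Src W)). gdom (Src W) \<cdot> w = b \<and> gcod (Src W) \<cdot> w = b'"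
      by (intro bexI[of _ "gpair C B b' c"]) (use G gm(1)[OF G(1,3)] c D in \<open>auto simp: W_def\<close>)
  qed (use D in \<open>auto simp: W_def\<close>)
qed

end

context exact_maltsev
begin

text \<open>The span of domain and codomain is reflexive, so its coequalizer is effective.\<close>

lemma components:
  assumes X: "internal_groupoid C X"
  shows "is_coequalizer C (gdom X) (gcod X) (components C X)"
    and "x \<in> Hom C t (G0 X) \<Longrightarrow> y \<in> Hom C t (G0 X) \<Longrightarrow>
      components C X \<cdot> x = components C X \<cdot> y \<longleftrightarrow> related C (gdom X) (gcod X) x y"
proof -
  obtain q where q: "is_coequalizer C (gdom X) (gcod X) q" and
    qi: "\<And>x y. \<lbrakk>arr x; arr y; dom x = dom y; cod x = G0 X; cod y = G0 X\<rbrakk>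
       \<Longrightarrow> q \<cdot> x = q \<cdot> y \<longleftrightarrow> related C (gdom X) (gcod X) x y"
  proof (rule effective_quotient[of "gdom X" "gcod X" "G0 X"])
    fix x assume x: "arr x" "cod x = G0 X"
    show "related C (gdom X) (gcod X) x x"
      by (rule related_global[of "gunit X \<cdot> x"]) (use x X in auto)
  qed (use X in auto)
  show co: "is_coequalizer C (gdom X) (gcod X) (components C X)"
    unfolding components_def using q by (rule someI)
  have qa: "arr q" "dom q = G0 X" "q \<cdot> gdom X = q \<cdot> gcod X"
    and ca: "arr (components C X)" "dom (components C X) = G0 X" "components C X \<cdot> gdom X = components C X \<cdot> gcod X"
    using q co X unfolding is_coequalizer_def by auto
  obtain k where k: "arr k" "dom k = cod q" "k \<cdot> q = components C X"
    using coequalizer_lift[OF q ca(1)] ca X by auto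
  obtain l where l: "arr l" "dom l = cod (components C X)" "l \<cdot> components C X = q"
    using coequalizer_lift[OF co qa(1)] qa X by auto
  assume h: "x \<in> Hom C t (G0 X)" "y \<in> Hom C t (G0 X)"
  have "k \<cdot> (q \<cdot> z) = components C X \<cdot> z" "l \<cdot> (components C X \<cdot> z) = q \<cdot> z" if "z \<in> Hom C t (G0 X)" for z
    using comp_ext[OF k(3), of z] comp_ext[OF l(3), of z] that k l qa ca by auto
  then have "components C X \<cdot> x = components C X \<cdot> y \<longleftrightarrow> q \<cdot> x = q \<cdot> y" using h by metis
  then show "components C X \<cdot> x = components C X \<cdot> y \<longleftrightarrow> related C (gdom X) (gcod X) x y" using qi[of x y] h by simp
qed

lemma components_arr [simp]:
  assumes X: "internal_groupoid C X"
  shows "arr (components C X)" "dom (components C X) = G0 X" "cod (components C X) = FObj (pi0 C) X"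
    "components C X \<in> covers"
  using components(1)[OF X] X regular_epiI[OF components(1)[OF X]] unfolding is_coequalizer_def
  by (auto simp: pi0_def)

lemma components_gdom_gcod:
  assumes X: "internal_groupoid C X" and u: "arr u" "cod u = G1 X"
  shows "components C X \<cdot> (gdom X \<cdot> u) = components C X \<cdot> (gcod X \<cdot> u)"
proof -
  have "components C X \<cdot> gdom X = components C X \<cdot> gcod X"
    using components(1)[OF X] unfolding is_coequalizer_def by auto
  from this show ?thesis by (rule comp_ext2) (use X u in auto)
qed

lemma components_connected:
  assumes X: "internal_groupoid C X" and x: "x \<in> Hom C t (G0 X)" and y: "y \<in> Hom C t (G0 X)"
    and eq: "components C X \<cdot> x = components C X \<cdot> y"
  obtains e u where "e \<in> covers" "arr e" "cod e = t" "arr u" "dom u = dom e" "cod u = G1 X"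
    "gdom X \<cdot> u = x \<cdot> e" "gcod X \<cdot> u = y \<cdot> e"
proof -
  have "related C (gdom X) (gcod X) x y" using components(2)[OF X x y] eq by simp
  then show ?thesis by (rule relatedE) (use that X x in auto)
qed

lemma pi0_arr:
  assumes F: "internal_functor C F" "Src F = X" "Tgt F = Y"
  shows "arr (FArr (pi0 C) F)" "dom (FArr (pi0 C) F) = FObj (pi0 C) X" "cod (FArr (pi0 C) F) = FObj (pi0 C) Y"
    "FArr (pi0 C) F \<cdot> components C X = components C Y \<cdot> f0 F"
proof -
  have g: "internal_groupoid C X" "internal_groupoid C Y" using F by auto
  note cX = components_arr[OF g(1)] and cY = components_arr[OF g(2)]
  have "(components C Y \<cdot> f0 F) \<cdot> gdom X = components C Y \<cdot> (gdom Y \<cdot> f1 F)"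
    using functor_gdom_arr(1)[OF F(1,3,2)] F g cY by simp
  also have "\<dots> = components C Y \<cdot> (gcod Y \<cdot> f1 F)" by (rule components_gdom_gcod[OF g(2)]) (use F in auto)
  also have "\<dots> = (components C Y \<cdot> f0 F) \<cdot> gcod X"
    using functor_gdom_arr(2)[OF F(1,3,2)] F g cY by simp
  finally have "\<exists>k. arr k \<and> dom k = cod (components C X) \<and> cod k = cod (components C Y \<cdot> f0 F) \<and>
      k \<cdot> components C X = components C Y \<cdot> f0 F"
    by (intro coequalizer_lift[OF components(1)[OF g(1)]]) (use F g cY in simp_all)
  then obtain k where k: "arr k" "dom k = FObj (pi0 C) X" "cod k = FObj (pi0 C) Y"
    "k \<cdot> components C X = components C Y \<cdot> f0 F" using F g cX cY by auto
  have "FArr (pi0 C) F = k" unfolding pi0_def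
  proof (simp add: F(2,3), rule the_equality)
    show "arr k \<and> dom k = cod (components C X) \<and> cod k = cod (components C Y) \<and>
      k \<cdot> components C X = components C Y \<cdot> f0 F" using k cX cY by simp
    fix k' assume k': "arr k' \<and> dom k' = cod (components C X) \<and> cod k' = cod (components C Y) \<and>
      k' \<cdot> components C X = components C Y \<cdot> f0 F"
    show "k' = k" by (rule regular_epi_epi[OF cX(4)]) (use k k' cX in auto)
  qed
  then show "arr (FArr (pi0 C) F)" "dom (FArr (pi0 C) F) = FObj (pi0 C) X" "cod (FArr (pi0 C) F) = FObj (pi0 C) Y"
    "FArr (pi0 C) F \<cdot> components C X = components C Y \<cdot> f0 F" using k by auto
qed

text \<open>An arrow is invertible when it is a regular epimorphism and a monomorphism; both are tested here on
representatives, since every element of \<open>pi0\<close> is locally represented by an object.\<close>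

lemma pi0_iso_iff:
  assumes F: "internal_functor C F" "Src F = X" "Tgt F = Y"
  shows "is_iso C (FArr (pi0 C) F) \<longleftrightarrow>
    (\<forall>t. \<forall>y \<in> Hom C t (G0 Y). \<exists>e \<in> covers. cod e = t \<and> (\<exists>x \<in> Hom C (dom e) (G0 X).
       components C Y \<cdot> (y \<cdot> e) = components C Y \<cdot> (f0 F \<cdot> x))) \<and>
    (\<forall>t. \<forall>x \<in> Hom C t (G0 X). \<forall>x' \<in> Hom C t (G0 X).
       components C Y \<cdot> (f0 F \<cdot> x) = components C Y \<cdot> (f0 F \<cdot> x') \<longrightarrow> components C X \<cdot> x = components C X \<cdot> x')"
    (is "_ \<longleftrightarrow> ?S \<and> ?I")
proof
  have g: "internal_groupoid C X" "internal_groupoid C Y" using F by auto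
  note cX = components_arr[OF g(1)] and cY = components_arr[OF g(2)]
  define k where "k = FArr (pi0 C) F"
  note k = pi0_arr[OF F, folded k_def]
  have ke: "k \<cdot> (components C X \<cdot> x) = components C Y \<cdot> (f0 F \<cdot> x)" if "arr x" "cod x = G0 X" for x
    by (rule comp_ext2[OF k(4)]) (use that k F g in auto)
  {
    assume "is_iso C (FArr (pi0 C) F)"
    then obtain j where j: "arr j" "dom j = FObj (pi0 C) Y" "cod j = FObj (pi0 C) X"
      "j \<cdot> k = Idn C (FObj (pi0 C) X)" "k \<cdot> j = Idn C (FObj (pi0 C) Y)"
      using is_isoE[of "FArr (pi0 C) F"] k unfolding k_def by metis
    show "?S \<and> ?I"
    proof (intro conjI allI ballI impI)
      fix t y assume y: "y \<in> Hom C t (G0 Y)"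
      obtain e x where x: "e \<in> covers" "arr e" "cod e = dom (j \<cdot> (components C Y \<cdot> y))" "arr x" "dom x = dom e"
        "cod x = dom (components C X)" "components C X \<cdot> x = (j \<cdot> (components C Y \<cdot> y)) \<cdot> e"
        using cover_lift[OF cX(4), of "j \<cdot> (components C Y \<cdot> y)"] j y cY cX by auto
      have "components C Y \<cdot> (f0 F \<cdot> x) = k \<cdot> (components C X \<cdot> x)" using ke[of x] x cX by simp
      also have "\<dots> = k \<cdot> (j \<cdot> (components C Y \<cdot> (y \<cdot> e)))" using x j y cY by simp
      also have "\<dots> = components C Y \<cdot> (y \<cdot> e)" using comp_ext[OF j(5), of "components C Y \<cdot> (y \<cdot> e)"] x j y cY k by simp
      finally have "components C Y \<cdot> (y \<cdot> e) = components C Y \<cdot> (f0 F \<cdot> x)" by simp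
      then show "\<exists>e \<in> covers. cod e = t \<and> (\<exists>x \<in> Hom C (dom e) (G0 X).
         components C Y \<cdot> (y \<cdot> e) = components C Y \<cdot> (f0 F \<cdot> x))"
        by (intro bexI[of _ e] conjI bexI[of _ x]) (use x y j cX cY in auto)
    next
      fix t x x' assume x: "x \<in> Hom C t (G0 X)" "x' \<in> Hom C t (G0 X)"
        "components C Y \<cdot> (f0 F \<cdot> x) = components C Y \<cdot> (f0 F \<cdot> x')"
      then have "k \<cdot> (components C X \<cdot> x) = k \<cdot> (components C X \<cdot> x')" using ke by simp
      then have "j \<cdot> (k \<cdot> (components C X \<cdot> x)) = j \<cdot> (k \<cdot> (components C X \<cdot> x'))" by simp
      then show "components C X \<cdot> x = components C X \<cdot> x'"
        using comp_ext[OF j(4), of "components C X \<cdot> x"] comp_ext[OF j(4), of "components C X \<cdot> x'"] x j k cX by simp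
    qed
  next
    assume SI: "?S \<and> ?I"
    have yI: "Idn C (G0 Y) \<in> Hom C (G0 Y) (G0 Y)" using g by simp
    obtain e x where x: "e \<in> covers" "cod e = G0 Y" "x \<in> Hom C (dom e) (G0 X)"
       "components C Y \<cdot> (Idn C (G0 Y) \<cdot> e) = components C Y \<cdot> (f0 F \<cdot> x)" using SI yI by blast
    have ea: "arr e" using x by simp
    have "k \<cdot> (components C X \<cdot> x) = components C Y \<cdot> e" using ke[of x] x ea by simp
    then have kr: "k \<in> covers"
      using regular_epi_local[OF k(1) regular_epi_comp[OF x(1) cY(4)], of "components C X \<cdot> x"] x k cX cY by simp
    obtain j where j: "arr j" "dom j = cod k" "cod j = cod (Idn C (FObj (pi0 C) X))" "j \<cdot> k = Idn C (FObj (pi0 C) X)"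
    proof (rule glue[OF kr, of "Idn C (FObj (pi0 C) X)"])
      fix a b assume ab: "arr a" "arr b" "dom a = dom b" "cod a = dom k" "cod b = dom k" "k \<cdot> a = k \<cdot> b"
      obtain e1 x where x: "e1 \<in> covers" "arr e1" "cod e1 = dom a" "arr x" "dom x = dom e1"
        "cod x = G0 X" "components C X \<cdot> x = a \<cdot> e1" using cover_lift[OF cX(4) ab(1)] ab k cX by metis
      obtain e2 y where y: "e2 \<in> covers" "arr e2" "cod e2 = dom (b \<cdot> e1)" "arr y" "dom y = dom e2"
        "cod y = G0 X" "components C X \<cdot> y = (b \<cdot> e1) \<cdot> e2" using cover_lift[OF cX(4), of "b \<cdot> e1"] ab x k cX by auto
      have xe: "components C X \<cdot> (x \<cdot> e2) = a \<cdot> (e1 \<cdot> e2)" using comp_ext[OF x(7), of e2] x y ab k cX by simp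
      have kk: "k \<cdot> (a \<cdot> (e1 \<cdot> e2)) = k \<cdot> (b \<cdot> (e1 \<cdot> e2))" by (rule comp_ext2[OF ab(6)]) (use ab x y k in auto)
      have "components C Y \<cdot> (f0 F \<cdot> (x \<cdot> e2)) = k \<cdot> (a \<cdot> (e1 \<cdot> e2))" using ke[of "x \<cdot> e2"] xe x y ab by simp
      also have "\<dots> = components C Y \<cdot> (f0 F \<cdot> y)" using ke[of y] kk x y ab k by simp
      finally have "components C Y \<cdot> (f0 F \<cdot> (x \<cdot> e2)) = components C Y \<cdot> (f0 F \<cdot> y)" .
      moreover have "x \<cdot> e2 \<in> Hom C (dom e2) (G0 X)" "y \<in> Hom C (dom e2) (G0 X)" using x y ab by auto
      ultimately have "components C X \<cdot> (x \<cdot> e2) = components C X \<cdot> y" using SI by blast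
      then have "(a \<cdot> e1) \<cdot> e2 = (b \<cdot> e1) \<cdot> e2" using xe x y ab by simp
      then have "a \<cdot> e1 = b \<cdot> e1" by (rule regular_epi_epi[OF y(1), rotated 4]) (use ab x y in auto)
      then have "a = b" by (rule regular_epi_epi[OF x(1), rotated 4]) (use ab x y in auto)
      then show "Idn C (FObj (pi0 C) X) \<cdot> a = Idn C (FObj (pi0 C) X) \<cdot> b" by simp
    qed (use k Dom_Obj[OF k(1)] in auto)
    have kX: "FObj (pi0 C) X \<in> Obj C" "FObj (pi0 C) Y \<in> Obj C" using k Dom_Obj[OF k(1)] Cod_Obj[OF k(1)] by auto
    have kjk: "(k \<cdot> j) \<cdot> k = Idn C (FObj (pi0 C) Y) \<cdot> k" using j k kX by simp
    have kj: "k \<cdot> j = Idn C (FObj (pi0 C) Y)" by (rule regular_epi_epi[OF kr _ _ _ _ kjk]) (use j k kX in auto)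
    show "is_iso C (FArr (pi0 C) F)" unfolding k_def[symmetric]
      by (rule is_isoI[OF k(1) j(1)]) (use j k kX kj in auto)
  }
qed

text \<open>Pull \<open>E\<close> back along the decalage \<open>W\<close>. An object of the pullback is an object \<open>x\<close> of \<open>A\<close> with an arrow
of \<open>B\<close> out of \<open>E x\<close>, and the components of the decalage are the objects of \<open>B\<close>. Surjectivity on
components therefore says that every object of \<open>B\<close> receives an arrow from some \<open>E x\<close>, and injectivity,
applied to \<open>b : E x \<rightarrow> E y\<close> and the identity of \<open>E y\<close>, produces an arrow \<open>x \<rightarrow> y\<close> over \<open>b\<close>.\<close>

lemma class_E'_subset_full_ess_surj:
  assumes E: "E \<in> class_E' (Gpd C) C (regular_epis (Gpd C)) (pi0 C)"
  shows "E \<in> full_ess_surj C"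
proof -
  have fE: "internal_functor C E" using E unfolding class_E'_def by simp
  define A B where "A = Src E" and "B = Tgt E"
  have g: "internal_groupoid C A" "internal_groupoid C B" using fE unfolding A_def B_def by auto
  have sE: "Src E = A" "Tgt E = B" by (auto simp: A_def B_def)
  obtain W where W: "W \<in> discrete_fibrations C" "Tgt W = B" "f0 W \<in> covers" "f1 W \<in> covers"
    "G0 (Src W) = G1 B" "f0 W = gdom B"
    and tri: "\<And>w. arr w \<Longrightarrow> cod w = G1 (Src W) \<Longrightarrow> gdom B \<cdot> (gcod (Src W) \<cdot> w) = gcod B \<cdot> (f1 W \<cdot> w) \<and>
       gcomp C B (gcod (Src W) \<cdot> w) (f1 W \<cdot> w) = gdom (Src W) \<cdot> w"
    and conn: "\<And>t b b'. \<lbrakk>b \<in> Hom C t (G1 B); b' \<in> Hom C t (G1 B);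
       gcod B \<cdot> b = gcod B \<cdot> b'\<rbrakk>
       \<Longrightarrow> \<exists>w \<in> Hom C t (G1 (Src W)). gdom (Src W) \<cdot> w = b \<and> gcod (Src W) \<cdot> w = b'" using decalage[OF g(2)] by blast
  define D where "D = Src W"
  have fW: "internal_functor C W" by (rule discrete_fibration_functor[OF W(1)])
  note tri = tri[folded D_def] and conn = conn[folded D_def]
  have gD: "internal_groupoid C D" "Src W = D" "G0 D = G1 B" using fW W D_def by auto
  have Wr: "W \<in> regular_epis (Gpd C)" using fW W levelwise_regular_epi by blast
  obtain P Q where P: "internal_functor C P" "internal_functor C Q" "Src P = Src Q" "Tgt P = Src E" "Tgt Q = Src W"
    and pb0: "is_pullback C (f0 E) (f0 W) (f0 P) (f0 Q)" and pb1: "is_pullback C (f1 E) (f1 W) (f1 P) (f1 Q)"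
    using Gpd_pullback_exists[OF fE fW] W sE by metis
  have "is_pullback (Gpd C) E W P Q" by (rule levelwise_pullback[OF fE fW P(1,2) _ P(3-5) pb0 pb1]) (use W sE in simp)
  then have "is_iso C (FArr (pi0 C) Q)" using E Wr unfolding class_E'_def class_E_def by blast
  define S where "S = Src Q"
  have s: "Src P = S" "Src Q = S" "Tgt P = A" "Tgt Q = D" "internal_groupoid C S" using P gD sE S_def by auto
  note iso = \<open>is_iso C (FArr (pi0 C) Q)\<close>[unfolded pi0_iso_iff[OF P(2) s(2,4)]]
  have sq: "f0 E \<cdot> (f0 P \<cdot> z) = gdom B \<cdot> (f0 Q \<cdot> z)" if "arr z" "cod z = G0 S" for z
    using comp_ext2[OF is_pullback_D(9)[OF pb0], of z] that P fE fW s W sE gD g by simp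
  have sq1: "f1 E \<cdot> (f1 P \<cdot> z) = f1 W \<cdot> (f1 Q \<cdot> z)" if "arr z" "cod z = G1 S" for z
    by (rule comp_ext2[OF is_pullback_D(9)[OF pb1]]) (use that P fE fW s W sE gD in auto)
  have "locally_ess_surj C E" unfolding locally_ess_surj_def
  proof (intro allI ballI)
    fix t b assume "b \<in> Hom C t (G0 (Tgt E))"
    then have b: "arr b" "dom b = t" "cod b = G0 B" using sE by auto
    have y: "gunit B \<cdot> b \<in> Hom C t (G0 D)" using b g gD by simp
    obtain e z where z: "e \<in> covers" "cod e = t" "z \<in> Hom C (dom e) (G0 S)"
      "components C D \<cdot> ((gunit B \<cdot> b) \<cdot> e) = components C D \<cdot> (f0 Q \<cdot> z)" using iso y by blast
    have ea: "arr e" using z by simp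
    have h: "(gunit B \<cdot> b) \<cdot> e \<in> Hom C (dom e) (G0 D)" "f0 Q \<cdot> z \<in> Hom C (dom e) (G0 D)" using z b ea g gD P s by auto
    obtain e2 w where w: "e2 \<in> covers" "arr e2" "cod e2 = dom e" "arr w" "dom w = dom e2" "cod w = G1 D"
      "gdom D \<cdot> w = ((gunit B \<cdot> b) \<cdot> e) \<cdot> e2" "gcod D \<cdot> w = (f0 Q \<cdot> z) \<cdot> e2"
      using components_connected[OF gD(1) h z(4)] by blast
    define \<beta> where "\<beta> = f0 Q \<cdot> (z \<cdot> e2)"
    have be: "arr \<beta>" "dom \<beta> = dom e2" "cod \<beta> = G1 B" "gcod D \<cdot> w = \<beta>" using w z P s gD unfolding \<beta>_def by auto
    have t: "gdom B \<cdot> \<beta> = gcod B \<cdot> (f1 W \<cdot> w)" "gcomp C B \<beta> (f1 W \<cdot> w) = gunit B \<cdot> (b \<cdot> (e \<cdot> e2))"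
      using tri[OF w(4,6)] be w b z ea g by auto
    have W1: "arr (f1 W \<cdot> w)" "dom (f1 W \<cdot> w) = dom e2" "cod (f1 W \<cdot> w) = G1 B" using w fW gD W by auto
    have "gcod B \<cdot> gcomp C B \<beta> (f1 W \<cdot> w) = gcod B \<cdot> \<beta>"
      by (rule gcomp_arr(5)[OF g(2)]) (use be t(1) W1 in simp_all)
    then have cb: "gcod B \<cdot> \<beta> = b \<cdot> (e \<cdot> e2)" using t b z w ea g by simp
    have db: "gdom B \<cdot> \<beta> = f0 E \<cdot> (f0 P \<cdot> (z \<cdot> e2))" using sq[of "z \<cdot> e2"] z w unfolding \<beta>_def by simp
    show "\<exists>e \<in> covers. cod e = t \<and> (\<exists>x \<in> Hom C (dom e) (G0 (Src E)). \<exists>c \<in> Hom C (dom e) (G1 (Tgt E)).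
        gdom (Tgt E) \<cdot> c = b \<cdot> e \<and> gcod (Tgt E) \<cdot> c = f0 E \<cdot> x)"
      by (intro bexI[of _ "e \<cdot> e2"] conjI bexI[of _ "f0 P \<cdot> (z \<cdot> e2)"] bexI[of _ "ginv C B \<cdot> \<beta>"])
        (use be cb db sE z w ea P s g regular_epi_comp[OF w(1) z(1)] in auto)
  qed
  moreover have "locally_full C E" unfolding locally_full_def
  proof (intro allI ballI impI)
    fix t x y b assume "x \<in> Hom C t (G0 (Src E))" "y \<in> Hom C t (G0 (Src E))" "b \<in> Hom C t (G1 (Tgt E))"
      "gdom (Tgt E) \<cdot> b = f0 E \<cdot> x" "gcod (Tgt E) \<cdot> b = f0 E \<cdot> y"
    then have h: "arr x" "dom x = t" "cod x = G0 A" "arr y" "dom y = t" "cod y = G0 A"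
      "arr b" "dom b = t" "cod b = G1 B" "gdom B \<cdot> b = f0 E \<cdot> x" "gcod B \<cdot> b = f0 E \<cdot> y" using sE by auto
    have "\<exists>z. arr z \<and> dom z = dom x \<and> cod z = dom (f0 P) \<and> f0 P \<cdot> z = x \<and> f0 Q \<cdot> z = b"
      by (rule pullback_lift[OF pb0]) (use h fE fW W gD sE in auto)
    then obtain z1 where z1: "arr z1" "dom z1 = t" "cod z1 = G0 S" "f0 P \<cdot> z1 = x" "f0 Q \<cdot> z1 = b" using h P s by auto
    have "\<exists>z. arr z \<and> dom z = dom y \<and> cod z = dom (f0 P) \<and> f0 P \<cdot> z = y \<and> f0 Q \<cdot> z = gunit B \<cdot> (gcod B \<cdot> b)"
      by (rule pullback_lift[OF pb0]) (use h fE fW W gD sE g in auto)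
    then obtain z2 where z2: "arr z2" "dom z2 = t" "cod z2 = G0 S" "f0 P \<cdot> z2 = y" "f0 Q \<cdot> z2 = gunit B \<cdot> (gcod B \<cdot> b)"
      using h P s by auto
    have bb: "b \<in> Hom C t (G1 B)" "gunit B \<cdot> (gcod B \<cdot> b) \<in> Hom C t (G1 B)" "gcod B \<cdot> b = gcod B \<cdot> (gunit B \<cdot> (gcod B \<cdot> b))"
      using h g fE sE by auto
    obtain w where w: "arr w" "dom w = t" "cod w = G1 D" "gdom D \<cdot> w = b" "gcod D \<cdot> w = gunit B \<cdot> (gcod B \<cdot> b)"
      using conn[OF bb] by auto
    have "components C D \<cdot> (f0 Q \<cdot> z1) = components C D \<cdot> (f0 Q \<cdot> z2)"
      using components_gdom_gcod[OF gD(1) w(1,3)] w z1 z2 by simp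
    moreover have zH: "z1 \<in> Hom C t (G0 S)" "z2 \<in> Hom C t (G0 S)" using z1 z2 by auto
    ultimately have "components C S \<cdot> z1 = components C S \<cdot> z2" using iso by blast
    then obtain e u where u: "e \<in> covers" "arr e" "cod e = t" "arr u" "dom u = dom e" "cod u = G1 S"
      "gdom S \<cdot> u = z1 \<cdot> e" "gcod S \<cdot> u = z2 \<cdot> e" using components_connected[OF s(5) zH] by blast
    define \<omega> where "\<omega> = f1 Q \<cdot> u"
    have om: "arr (\<omega>)" "Dom C \<omega> = dom e" "Cod C \<omega> = G1 D" "gdom D \<cdot> \<omega> = b \<cdot> e" "gcod D \<cdot> \<omega> = gunit B \<cdot> (gcod B \<cdot> (b \<cdot> e))"
    proof -
      have "f0 Q \<cdot> (z2 \<cdot> e) = (gunit B \<cdot> (gcod B \<cdot> b)) \<cdot> e" by (rule comp_ext[OF z2(5)]) (use z2(1-3) u(1-3) P s in auto)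
      also have "\<dots> = gunit B \<cdot> (gcod B \<cdot> (b \<cdot> e))" using h(7-9) u(1-3) g by simp
      finally have q2: "f0 Q \<cdot> (z2 \<cdot> e) = gunit B \<cdot> (gcod B \<cdot> (b \<cdot> e))" .
      have q1: "f0 Q \<cdot> (z1 \<cdot> e) = b \<cdot> e" by (rule comp_ext[OF z1(5)]) (use z1(1-3) u(1-3) P s in auto)
      show "arr (\<omega>)" "Dom C \<omega> = dom e" "Cod C \<omega> = G1 D" "gdom D \<cdot> \<omega> = b \<cdot> e" "gcod D \<cdot> \<omega> = gunit B \<cdot> (gcod B \<cdot> (b \<cdot> e))"
        unfolding \<omega>_def using u P s q1 q2 by simp_all
    qed
    have t: "gdom B \<cdot> (gcod D \<cdot> \<omega>) = gcod B \<cdot> (f1 W \<cdot> \<omega>)" "gcomp C B (gcod D \<cdot> \<omega>) (f1 W \<cdot> \<omega>) = b \<cdot> e"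
      using tri[OF om(1,3)] om by auto
    have W1: "arr (f1 W \<cdot> \<omega>)" "dom (f1 W \<cdot> \<omega>) = dom e" "cod (f1 W \<cdot> \<omega>) = G1 B" using om fW gD W by auto
    have ce: "gcod B \<cdot> (f1 W \<cdot> \<omega>) = gcod B \<cdot> (b \<cdot> e)"
    proof -
      have "gdom B \<cdot> (gunit B \<cdot> (gcod B \<cdot> (b \<cdot> e))) = gcod B \<cdot> (b \<cdot> e)"
        by (rule gdom_gunit(1)[OF g(2)]) (use h(7-9) u(1-3) g in auto)
      then show ?thesis using t(1) unfolding om(5) by simp
    qed
    have "gcomp C B (gunit B \<cdot> (gcod B \<cdot> (b \<cdot> e))) (f1 W \<cdot> \<omega>) = f1 W \<cdot> \<omega>"
      by (rule gcomp_unit_left[OF g(2) W1(1,3) ce])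
    then have We: "f1 W \<cdot> \<omega> = b \<cdot> e" using t(2) unfolding om(5) by simp
    have v: "gdom A \<cdot> (f1 P \<cdot> u) = x \<cdot> e" "gcod A \<cdot> (f1 P \<cdot> u) = y \<cdot> e"
    proof -
      have "f0 P \<cdot> (z1 \<cdot> e) = x \<cdot> e" by (rule comp_ext[OF z1(4)]) (use z1(1-3) u(1-3) P s in auto)
      moreover have "f0 P \<cdot> (z2 \<cdot> e) = y \<cdot> e" by (rule comp_ext[OF z2(4)]) (use z2(1-3) u(1-3) P s in auto)
      ultimately show "gdom A \<cdot> (f1 P \<cdot> u) = x \<cdot> e" "gcod A \<cdot> (f1 P \<cdot> u) = y \<cdot> e" using u P s by simp_all
    qed
    have "f1 E \<cdot> (f1 P \<cdot> u) = b \<cdot> e" using sq1[OF u(4,6)] We unfolding \<omega>_def by simp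
    then show "\<exists>e \<in> covers. cod e = t \<and> (\<exists>u \<in> Hom C (dom e) (G1 (Src E)).
        gdom (Src E) \<cdot> u = x \<cdot> e \<and> gcod (Src E) \<cdot> u = y \<cdot> e \<and> f1 E \<cdot> u = b \<cdot> e)"
      by (intro bexI[of _ e] conjI bexI[of _ "f1 P \<cdot> u"]) (use u v sE P s in auto)
  qed
  ultimately show ?thesis using fE unfolding full_ess_surj_def by simp
qed

text \<open>Fullness passes to every pullback and gives injectivity on components. Essential surjectivity does
not pass to every pullback; but along a regular epimorphism \<open>F\<close> the arrow from \<open>F y\<close> to the image of
\<open>E\<close> lifts to an arrow out of \<open>y\<close>, and this gives surjectivity on components.\<close>

lemma full_ess_surj_subset_class_E':
  assumes E: "E \<in> full_ess_surj C"
  shows "E \<in> class_E' (Gpd C) C (regular_epis (Gpd C)) (pi0 C)"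
  unfolding class_E'_def
proof (intro CollectI conjI ballI allI impI)
  have fE: "internal_functor C E" "locally_full C E" "locally_ess_surj C E" using E unfolding full_ess_surj_def by auto
  show "E \<in> Arr (Gpd C)" using fE by simp
  fix F P Q assume Fr: "F \<in> regular_epis (Gpd C)" and pb: "is_pullback (Gpd C) E F P Q"
  have fF: "internal_functor C F" "f0 F \<in> covers" "f1 F \<in> covers" using regular_epi_levelwise[OF Fr] by auto
  define A B X S where "A = Src E" and "B = Tgt E" and "X = Src F" and "S = Src Q"
  have P: "internal_functor C P" "internal_functor C Q"
    and s: "Src E = A" "Tgt E = B" "Src F = X" "Tgt F = B" "Src P = S" "Tgt P = A" "Src Q = S" "Tgt Q = X"
    using is_pullback_D[OF pb] unfolding A_def B_def X_def S_def by auto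
  have g: "internal_groupoid C A" "internal_groupoid C B" "internal_groupoid C X" "internal_groupoid C S"
    using functor_gpd[OF fE(1)] functor_gpd[OF P(2)] s by auto
  note pb0 = Gpd_pullback_levelwise(1)[OF pb] and pb1 = Gpd_pullback_levelwise(2)[OF pb]
  have sq0: "f0 E \<cdot> (f0 P \<cdot> z) = f0 F \<cdot> (f0 Q \<cdot> z)" if "arr z" "cod z = G0 S" for z
    by (rule comp_ext2[OF is_pullback_D(9)[OF pb0]]) (use that P fE fF s in auto)
  have "is_iso C (FArr (pi0 C) Q)" unfolding pi0_iso_iff[OF P(2) s(7,8)]
  proof (intro conjI allI ballI impI)
    fix t y assume "y \<in> Hom C t (G0 X)"
    then have y: "arr y" "dom y = t" "cod y = G0 X" by auto
    have "f0 F \<cdot> y \<in> Hom C t (G0 B)" using y fF s by simp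
    then obtain e x b where l: "e \<in> covers" "arr e" "cod e = t" "arr x" "dom x = dom e" "cod x = G0 A"
     "arr b" "dom b = dom e" "cod b = G1 B" "gdom B \<cdot> b = (f0 F \<cdot> y) \<cdot> e" "gcod B \<cdot> b = f0 E \<cdot> x"
      using locally_ess_surjE[OF fE(3) s(1,2)] by blast
    obtain e2 u where u: "e2 \<in> covers" "arr e2" "cod e2 = dom e" "arr u" "dom u = dom e2"
      "cod u = G1 X" "gdom X \<cdot> u = (y \<cdot> e) \<cdot> e2" "f1 F \<cdot> u = b \<cdot> e2"
      by (rule regular_functor_lift[OF fF(1,3) s(3,4), of b "dom e" "y \<cdot> e"]) (use l y fF s in auto)
    have "f0 F \<cdot> (gcod X \<cdot> u) = gcod B \<cdot> (f1 F \<cdot> u)" using functor_gdom(2)[OF fF(1) s(4), of u] u s by simp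
    also have "\<dots> = f0 E \<cdot> (x \<cdot> e2)" using comp_ext2[OF l(11), of e2] u l fE s g by simp
    finally have "f0 E \<cdot> (x \<cdot> e2) = f0 F \<cdot> (gcod X \<cdot> u)" by simp
    then have "\<exists>z. arr z \<and> dom z = dom (x \<cdot> e2) \<and> cod z = dom (f0 P) \<and> f0 P \<cdot> z = x \<cdot> e2 \<and> f0 Q \<cdot> z = gcod X \<cdot> u"
      by (intro pullback_lift[OF pb0]) (use l u fE fF s g in auto)
    then obtain z where z: "arr z" "dom z = dom e2" "cod z = G0 S" "f0 P \<cdot> z = x \<cdot> e2" "f0 Q \<cdot> z = gcod X \<cdot> u"
      using l u P s by auto
    have "components C X \<cdot> (y \<cdot> (e \<cdot> e2)) = components C X \<cdot> (f0 Q \<cdot> z)"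
      using components_gdom_gcod[OF g(3) u(4,6)] u l y z by simp
    then show "\<exists>e \<in> covers. cod e = t \<and> (\<exists>x \<in> Hom C (dom e) (G0 S).
       components C X \<cdot> (y \<cdot> e) = components C X \<cdot> (f0 Q \<cdot> x))"
      by (intro bexI[of _ "e \<cdot> e2"] conjI bexI[of _ z]) (use z l u regular_epi_comp[OF u(1) l(1)] in auto)
  next
    fix t z z' assume "z \<in> Hom C t (G0 S)" "z' \<in> Hom C t (G0 S)" and eq: "components C X \<cdot> (f0 Q \<cdot> z) = components C X \<cdot> (f0 Q \<cdot> z')"
    then have z: "arr z" "dom z = t" "cod z = G0 S" "arr z'" "dom z' = t" "cod z' = G0 S" by auto
    have h: "f0 Q \<cdot> z \<in> Hom C t (G0 X)" "f0 Q \<cdot> z' \<in> Hom C t (G0 X)" using z P s by auto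
    obtain e v where v: "e \<in> covers" "arr e" "cod e = t" "arr v" "dom v = dom e" "cod v = G1 X"
      "gdom X \<cdot> v = (f0 Q \<cdot> z) \<cdot> e" "gcod X \<cdot> v = (f0 Q \<cdot> z') \<cdot> e" using components_connected[OF g(3) h eq] by blast
    have h2: "f0 P \<cdot> (z \<cdot> e) \<in> Hom C (dom e) (G0 A)" "f0 P \<cdot> (z' \<cdot> e) \<in> Hom C (dom e) (G0 A)" "f1 F \<cdot> v \<in> Hom C (dom e) (G1 B)"
      "gdom B \<cdot> (f1 F \<cdot> v) = f0 E \<cdot> (f0 P \<cdot> (z \<cdot> e))" "gcod B \<cdot> (f1 F \<cdot> v) = f0 E \<cdot> (f0 P \<cdot> (z' \<cdot> e))"
      using z v P fF s sq0[of "z \<cdot> e"] sq0[of "z' \<cdot> e"] by auto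
    obtain e2 u where u: "e2 \<in> covers" "arr e2" "cod e2 = dom e" "arr u" "dom u = dom e2" "cod u = G1 A"
      "gdom A \<cdot> u = (f0 P \<cdot> (z \<cdot> e)) \<cdot> e2" "gcod A \<cdot> u = (f0 P \<cdot> (z' \<cdot> e)) \<cdot> e2" "f1 E \<cdot> u = (f1 F \<cdot> v) \<cdot> e2"
      using locally_fullE[OF fE(2) s(1,2) h2] by blast
    have "\<exists>w. arr w \<and> dom w = dom u \<and> cod w = dom (f1 P) \<and> f1 P \<cdot> w = u \<and> f1 Q \<cdot> w = v \<cdot> e2"
      by (rule pullback_lift[OF pb1]) (use u v fE fF s in auto)
    then obtain w where w: "arr w" "dom w = dom e2" "cod w = G1 S" "f1 P \<cdot> w = u" "f1 Q \<cdot> w = v \<cdot> e2" using u P s by auto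
    have Pw: "f0 P \<cdot> (gdom S \<cdot> w) = gdom A \<cdot> u" "f0 P \<cdot> (gcod S \<cdot> w) = gcod A \<cdot> u"
      "f0 Q \<cdot> (gdom S \<cdot> w) = gdom X \<cdot> (v \<cdot> e2)" "f0 Q \<cdot> (gcod S \<cdot> w) = gcod X \<cdot> (v \<cdot> e2)"
      using functor_gdom[OF P(1) s(6), of w] functor_gdom[OF P(2) s(8), of w] w s by auto
    have vd: "gdom X \<cdot> (v \<cdot> e2) = ((f0 Q \<cdot> z) \<cdot> e) \<cdot> e2" "gcod X \<cdot> (v \<cdot> e2) = ((f0 Q \<cdot> z') \<cdot> e) \<cdot> e2"
      by (rule comp_ext[OF v(7)], use v u g in auto)[1] (rule comp_ext[OF v(8)], use v u g in auto)
    have 1: "gdom S \<cdot> w = z \<cdot> (e \<cdot> e2)"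
      by (rule pullback_eqI[OF pb0]) (use Pw vd w u v z g P s in auto)
    have 2: "gcod S \<cdot> w = z' \<cdot> (e \<cdot> e2)"
      by (rule pullback_eqI[OF pb0]) (use Pw vd w u v z g P s in auto)
    have "components C S \<cdot> (z \<cdot> (e \<cdot> e2)) = components C S \<cdot> (z' \<cdot> (e \<cdot> e2))"
      using components_gdom_gcod[OF g(4) w(1,3)] 1 2 by simp
    then have "(components C S \<cdot> z) \<cdot> (e \<cdot> e2) = (components C S \<cdot> z') \<cdot> (e \<cdot> e2)" using z v u g by simp
    moreover have "e \<cdot> e2 \<in> covers" using regular_epi_comp[OF u(1) v(1)] u v by simp
    ultimately show "components C S \<cdot> z = components C S \<cdot> z'"
      using regular_epi_epi[of "e \<cdot> e2" "components C S \<cdot> z" "components C S \<cdot> z'"] z v u g by simp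
  qed
  then show "Q \<in> class_E (Gpd C) C (pi0 C)" using P unfolding class_E_def by simp
qed

text \<open>A map in both orthogonal classes is orthogonal to itself, hence invertible.\<close>

lemma full_discrete_fibration_iso:
  assumes E: "E \<in> full_ess_surj C" "E \<in> discrete_fibrations C"
  shows "is_iso (Gpd C) E"
proof -
  interpret G: category "Gpd C" by (rule Gpd_category)
  have fE: "internal_functor C E" by (rule discrete_fibration_functor[OF E(2)])
  have I: "Idn (Gpd C) (Src E) \<in> Hom (Gpd C) (Dom (Gpd C) E) (Dom (Gpd C) E)"
    "Idn (Gpd C) (Tgt E) \<in> Hom (Gpd C) (Cod (Gpd C) E) (Cod (Gpd C) E)"
    using G.idn_arr[of "Src E"] G.idn_arr[of "Tgt E"] fE by auto
  have sq: "Idn (Gpd C) (Tgt E) \<bullet> E = E \<bullet> Idn (Gpd C) (Src E)"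
    by (rule functor_eqI) (use fE in auto)
  obtain N where N: "N \<in> Hom (Gpd C) (Cod (Gpd C) E) (Dom (Gpd C) E)" "N \<bullet> E = Idn (Gpd C) (Src E)"
    "E \<bullet> N = Idn (Gpd C) (Tgt E)"
    using full_ess_surj_orthogonal[OF E] I sq unfolding orthogonal_def by blast
  show ?thesis by (rule G.is_isoI[of E N]) (use N fE in auto)
qed

lemma iso_comp_full_ess_surj:
  assumes P: "P \<in> full_ess_surj C" and M: "is_iso (Gpd C) M" "Src M = Tgt P"
  shows "M \<bullet> P \<in> full_ess_surj C"
proof -
  interpret G: category "Gpd C" by (rule Gpd_category)
  obtain N where "M \<in> Arr (Gpd C)" "N \<in> Arr (Gpd C)" "Dom (Gpd C) N = Cod (Gpd C) M" "Cod (Gpd C) N = Dom (Gpd C) M"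
    and e1: "N \<bullet> M = Idn (Gpd C) (Dom (Gpd C) M)" and e2: "M \<bullet> N = Idn (Gpd C) (Cod (Gpd C) M)"
    using M(1) by (rule G.is_isoE)
  then have N: "internal_functor C M" "internal_functor C N" "Src N = Tgt M" "Tgt N = Src M" by auto
  define A I B where "A = Src P" and "I = Tgt P" and "B = Tgt M"
  have fP: "internal_functor C P" "locally_full C P" "locally_ess_surj C P" using P unfolding full_ess_surj_def by auto
  have s: "Src P = A" "Tgt P = I" "Src M = I" "Tgt M = B" "Src N = B" "Tgt N = I" using N M A_def I_def B_def by auto
  have g: "internal_groupoid C A" "internal_groupoid C I" "internal_groupoid C B"
    using functor_gpd[OF fP(1)] functor_gpd[OF N(1)] s by auto
  have e: "f0 N \<cdot> f0 M = Idn C (G0 I)" "f0 M \<cdot> f0 N = Idn C (G0 B)" "f1 M \<cdot> f1 N = Idn C (G1 B)"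
    using arg_cong[OF e1, of f0] arg_cong[OF e2, of f0] arg_cong[OF e2, of f1] s by auto
  have n0: "f0 N \<cdot> (f0 M \<cdot> z) = z" if "arr z" "cod z = G0 I" for z using comp_ext[OF e(1), of z] that N s by simp
  have m0: "f0 M \<cdot> (f0 N \<cdot> z) = z" if "arr z" "cod z = G0 B" for z using comp_ext[OF e(2), of z] that N s by simp
  have m1: "f1 M \<cdot> (f1 N \<cdot> z) = z" if "arr z" "cod z = G1 B" for z using comp_ext[OF e(3), of z] that N s by simp
  have fMP: "internal_functor C (M \<bullet> P)" using G.comp_arr[of P M] fP N M by simp
  moreover have "locally_full C (M \<bullet> P)" unfolding locally_full_def
  proof (intro allI ballI impI)
    fix t x y b assume "x \<in> Hom C t (G0 (Src (M \<bullet> P)))" "y \<in> Hom C t (G0 (Src (M \<bullet> P)))"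
      "b \<in> Hom C t (G1 (Tgt (M \<bullet> P)))" "gdom (Tgt (M \<bullet> P)) \<cdot> b = f0 (M \<bullet> P) \<cdot> x"
      "gcod (Tgt (M \<bullet> P)) \<cdot> b = f0 (M \<bullet> P) \<cdot> y"
    then have h: "x \<in> Hom C t (G0 A)" "y \<in> Hom C t (G0 A)" "b \<in> Hom C t (G1 B)" "gdom B \<cdot> b = f0 M \<cdot> (f0 P \<cdot> x)" "gcod B \<cdot> b = f0 M \<cdot> (f0 P \<cdot> y)"
      using s fP N by auto
    have h2: "f1 N \<cdot> b \<in> Hom C t (G1 I)" "gdom I \<cdot> (f1 N \<cdot> b) = f0 P \<cdot> x" "gcod I \<cdot> (f1 N \<cdot> b) = f0 P \<cdot> y"
      using h N s n0[of "f0 P \<cdot> x"] n0[of "f0 P \<cdot> y"] fP by auto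
    obtain e u where u: "e \<in> covers" "arr e" "cod e = t" "arr u" "dom u = dom e" "cod u = G1 A"
      "gdom A \<cdot> u = x \<cdot> e" "gcod A \<cdot> u = y \<cdot> e" "f1 P \<cdot> u = (f1 N \<cdot> b) \<cdot> e"
      using locally_fullE[OF fP(2) s(1,2) h(1,2) h2] by blast
    have "(f1 M \<cdot> f1 P) \<cdot> u = b \<cdot> e" using u m1[of "b \<cdot> e"] h fP N s by simp
    then show "\<exists>e \<in> covers. cod e = t \<and> (\<exists>u \<in> Hom C (dom e) (G1 (Src (M \<bullet> P))).
        gdom (Src (M \<bullet> P)) \<cdot> u = x \<cdot> e \<and> gcod (Src (M \<bullet> P)) \<cdot> u = y \<cdot> e \<and> f1 (M \<bullet> P) \<cdot> u = b \<cdot> e)"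
      by (intro bexI[of _ e] conjI bexI[of _ u]) (use u s in auto)
  qed
  moreover have "locally_ess_surj C (M \<bullet> P)" unfolding locally_ess_surj_def
  proof (intro allI ballI)
    fix t y assume "y \<in> Hom C t (G0 (Tgt (M \<bullet> P)))"
    then have y: "arr y" "dom y = t" "cod y = G0 B" using s by auto
    have "f0 N \<cdot> y \<in> Hom C t (G0 I)" using y N s by simp
    then obtain e x b where l: "e \<in> covers" "arr e" "cod e = t" "arr x" "dom x = dom e" "cod x = G0 A"
     "arr b" "dom b = dom e" "cod b = G1 I" "gdom I \<cdot> b = (f0 N \<cdot> y) \<cdot> e" "gcod I \<cdot> b = f0 P \<cdot> x"
      using locally_ess_surjE[OF fP(3) s(1,2)] by blast
    have "gdom B \<cdot> (f1 M \<cdot> b) = y \<cdot> e" "gcod B \<cdot> (f1 M \<cdot> b) = f0 M \<cdot> (f0 P \<cdot> x)"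
      using functor_gdom[OF N(1) s(4), of b] l s N y m0[of "y \<cdot> e"] by auto
    then show "\<exists>e \<in> covers. cod e = t \<and> (\<exists>x \<in> Hom C (dom e) (G0 (Src (M \<bullet> P))).
        \<exists>b \<in> Hom C (dom e) (G1 (Tgt (M \<bullet> P))).
        gdom (Tgt (M \<bullet> P)) \<cdot> b = y \<cdot> e \<and> gcod (Tgt (M \<bullet> P)) \<cdot> b = f0 (M \<bullet> P) \<cdot> x)"
      by (intro bexI[of _ e] conjI bexI[of _ x] bexI[of _ "f1 M \<cdot> b"]) (use l s N fP in auto)
  qed
  ultimately show ?thesis unfolding full_ess_surj_def by simp
qed

text \<open>If \<open>E = M P\<close> is the comprehensive factorization of a final \<open>E\<close>, then orthogonality of \<open>E\<close> to \<open>M\<close> gives a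
section of \<open>M\<close>, which is an inverse since \<open>P\<close> is orthogonal to \<open>M\<close>.\<close>

lemma final_eq_full_ess_surj: "final_functors C = full_ess_surj C"
proof (intro equalityI subsetI)
  fix E assume "E \<in> full_ess_surj C"
  then show "E \<in> final_functors C"
    using full_ess_surj_orthogonal unfolding final_functors_def by (simp add: full_ess_surj_def)
next
  interpret G: category "Gpd C" by (rule Gpd_category)
  fix E assume E: "E \<in> final_functors C"
  then have fE: "internal_functor C E" unfolding final_functors_def by simp
  obtain P M where PM: "P \<in> full_ess_surj C" "M \<in> discrete_fibrations C" "Tgt P = Src M" "E = M \<bullet> P"
    using comprehensive_factorization[OF fE] by metis
  have fP: "internal_functor C P" and fM: "internal_functor C M"
    using PM discrete_fibration_functor unfolding full_ess_surj_def by auto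
  have s: "Src E = Src P" "Tgt E = Tgt M" using PM by auto
  have I: "internal_functor C (Idn (Gpd C) (Tgt M))" "internal_functor C (Idn (Gpd C) (Src M))"
    using G.idn_arr(1)[of "Tgt M"] G.idn_arr(1)[of "Src M"] fM by auto
  have sq: "Idn (Gpd C) (Tgt M) \<bullet> E = M \<bullet> P"
    using G.idn_comp[of E "Tgt M"] fE s PM(4) by simp
  have oE: "orthogonal (Gpd C) E M" using E PM unfolding final_functors_def by blast
  have "P \<in> Hom (Gpd C) (Dom (Gpd C) E) (Dom (Gpd C) M)" "Idn (Gpd C) (Tgt M) \<in> Hom (Gpd C) (Cod (Gpd C) E) (Cod (Gpd C) M)"
    using fP I s PM(3) by auto
  then obtain N where N: "N \<in> Hom (Gpd C) (Cod (Gpd C) E) (Dom (Gpd C) M)" "N \<bullet> E = P"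
    "M \<bullet> N = Idn (Gpd C) (Tgt M)"
    using oE sq unfolding orthogonal_def by blast
  have fN: "internal_functor C N" "Src N = Tgt M" "Tgt N = Src M" using N s by auto
  have sq2: "M \<bullet> P = M \<bullet> P" ..
  have "P \<in> Hom (Gpd C) (Dom (Gpd C) P) (Dom (Gpd C) M)" "M \<in> Hom (Gpd C) (Cod (Gpd C) P) (Cod (Gpd C) M)"
    using fP fM PM(3) by auto
  then have ex: "\<exists>!\<delta>. \<delta> \<in> Hom (Gpd C) (Cod (Gpd C) P) (Dom (Gpd C) M) \<and> \<delta> \<bullet> P = P \<and> M \<bullet> \<delta> = M"
    using full_ess_surj_orthogonal[OF PM(1,2)] unfolding orthogonal_def by blast
  have 1: "N \<bullet> M \<in> Hom (Gpd C) (Cod (Gpd C) P) (Dom (Gpd C) M)"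
    using G.comp_arr[of M N] fN fM PM(3) by simp
  have 2: "(N \<bullet> M) \<bullet> P = P"
    using G.comp_assoc[of P M N] fN fM fP PM(3) N(2) PM(4) by simp
  have 3: "M \<bullet> (N \<bullet> M) = M"
    using G.comp_assoc[of M N M] G.idn_comp[of M "Tgt M"] fN fM N(3) by simp
  have 4: "Idn (Gpd C) (Src M) \<in> Hom (Gpd C) (Cod (Gpd C) P) (Dom (Gpd C) M)" using I PM(3) by simp
  have 5: "Idn (Gpd C) (Src M) \<bullet> P = P" "M \<bullet> Idn (Gpd C) (Src M) = M"
    using G.idn_comp[of P "Src M"] G.comp_idn[of M "Src M"] fP fM PM(3) by auto
  have "N \<bullet> M = Idn (Gpd C) (Src M)" using ex 1 2 3 4 5 by blast
  then have "is_iso (Gpd C) M"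
    by (intro G.is_isoI[of M N]) (use fM fN N in auto)
  then show "E \<in> full_ess_surj C" using iso_comp_full_ess_surj[OF PM(1)] PM(3,4) by simp
qed

lemma class_E'_eq_final: "class_E' (Gpd C) C (regular_epis (Gpd C)) (pi0 C) = final_functors C"
  unfolding final_eq_full_ess_surj
  using class_E'_subset_full_ess_surj full_ess_surj_subset_class_E' by blast

end

section \<open>Discrete fibrations and trivial coverings\<close>

lemma discrete_groupoid_sel [simp]:
  "G0 (discrete_groupoid C z) = z" "G1 (discrete_groupoid C z) = z" "G2 (discrete_groupoid C z) = z"
  "gdom (discrete_groupoid C z) = Idn C z" "gcod (discrete_groupoid C z) = Idn C z"
  "gunit (discrete_groupoid C z) = Idn C z" "gpr1 (discrete_groupoid C z) = Idn C z"
  "gpr2 (discrete_groupoid C z) = Idn C z" "gmult (discrete_groupoid C z) = Idn C z"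
  by (simp_all add: discrete_groupoid_def)

context category
begin

lemma pullback_paste_cancel:
  assumes outer: "is_pullback C (m \<cdot> e) p s t" and right: "is_pullback C m p s' t'"
    and e: "arr e" "cod e = dom m" and k: "arr k" "dom k = dom s" "cod k = dom s'" "s' \<cdot> k = e \<cdot> s" "t' \<cdot> k = t"
  shows "is_pullback C e s' s k"
proof (rule is_pullbackI)
  note D = is_pullback_D[OF right]
  have me: "arr (m \<cdot> e)" "dom (m \<cdot> e) = dom e" using e D by auto
  have s: "arr s" "cod s = dom e" "arr t" "dom t = dom s" "cod t = dom p" using is_pullback_D[OF outer] me by auto
  show "arr e" "arr s'" "cod e = cod s'" "arr s" "arr k" "dom s = dom k" "cod s = dom e"
    "cod k = dom s'" "e \<cdot> s = s' \<cdot> k" using e D k s by auto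
  have te: "t' \<cdot> (k \<cdot> a) = t \<cdot> a" if "arr a" "cod a = dom k" for a
    by (rule comp_ext[OF k(5)]) (use that k D in auto)
  show "jointly_monic C s k" unfolding jointly_monic_def
  proof (intro allI impI)
    fix a b assume ab: "arr a" "arr b" "dom a = dom b" "cod a = dom s" "cod b = dom s" "s \<cdot> a = s \<cdot> b" "k \<cdot> a = k \<cdot> b"
    show "a = b" by (rule pullback_eqI[OF outer ab(1-6)]) (use te[of a] te[of b] ab k in simp)
  qed
  fix u v assume uv: "arr u" "arr v" "dom u = dom v" "cod u = dom e" "cod v = dom s'" "e \<cdot> u = s' \<cdot> v"
  have "m \<cdot> (s' \<cdot> v) = p \<cdot> (t' \<cdot> v)" by (rule comp_ext2[OF D(9)]) (use uv(2,5) D(1-8) in auto)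
  moreover have "(m \<cdot> e) \<cdot> u = m \<cdot> (s' \<cdot> v)" using uv(1,4,6) e D(1) by simp
  ultimately have "(m \<cdot> e) \<cdot> u = p \<cdot> (t' \<cdot> v)" by simp
  then have "\<exists>w. arr w \<and> dom w = dom u \<and> cod w = dom s \<and> s \<cdot> w = u \<and> t \<cdot> w = t' \<cdot> v"
    by (intro pullback_lift[OF outer]) (use uv me D in auto)
  then obtain w where w: "arr w" "dom w = dom u" "cod w = dom s" "s \<cdot> w = u" "t \<cdot> w = t' \<cdot> v" by blast
  have "k \<cdot> w = v"
  proof (rule pullback_eqI[OF right])
    have "s' \<cdot> (k \<cdot> w) = e \<cdot> (s \<cdot> w)" by (rule comp_ext2[OF k(4)]) (use w k(1-3) s(1,2) e(1) D(4) in auto)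
    then show "s' \<cdot> (k \<cdot> w) = s' \<cdot> v" using w(4) uv(6) by simp
    show "t' \<cdot> (k \<cdot> w) = t' \<cdot> v" using te[of w] w k by simp
  qed (use w k uv in auto)
  then show "\<exists>w. arr w \<and> dom w = dom v \<and> cod w = dom k \<and> s \<cdot> w = u \<and> k \<cdot> w = v"
    using w k uv by auto
qed

lemma iso_orthogonal:
  assumes e: "is_iso C e" and m: "arr m"
  shows "orthogonal C e m" unfolding orthogonal_def
proof (intro ballI impI)
  obtain j where j: "arr e" "arr j" "dom j = cod e" "cod j = dom e" "j \<cdot> e = Idn C (dom e)" "e \<cdot> j = Idn C (cod e)"
    using is_isoE[OF e] by metis
  fix f g assume fg: "f \<in> Hom C (dom e) (dom m)" "g \<in> Hom C (cod e) (cod m)" "g \<cdot> e = m \<cdot> f"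
  show "\<exists>!d. d \<in> Hom C (cod e) (dom m) \<and> d \<cdot> e = f \<and> m \<cdot> d = g"
  proof (rule ex1I[of _ "f \<cdot> j"])
    have "m \<cdot> (f \<cdot> j) = g \<cdot> (e \<cdot> j)" by (rule comp_ext2[OF fg(3)[symmetric]]) (use fg j m in auto)
    then show "f \<cdot> j \<in> Hom C (cod e) (dom m) \<and> (f \<cdot> j) \<cdot> e = f \<and> m \<cdot> (f \<cdot> j) = g" using fg(1,2) j by simp
    fix d assume d: "d \<in> Hom C (cod e) (dom m) \<and> d \<cdot> e = f \<and> m \<cdot> d = g"
    have "(d \<cdot> e) \<cdot> j = d \<cdot> (e \<cdot> j)" by (rule comp_assoc) (use d j(1-4) in auto)
    then show "d = f \<cdot> j" using d j by simp
  qed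
qed

lemma orthogonal_comp:
  assumes o: "orthogonal C e m" "orthogonal C e' m" and a: "arr e" "arr e'" "dom e' = cod e" and m: "arr m"
  shows "orthogonal C (e' \<cdot> e) m" unfolding orthogonal_def
proof (intro ballI impI)
  fix f g assume "f \<in> Hom C (dom (e' \<cdot> e)) (dom m)" "g \<in> Hom C (cod (e' \<cdot> e)) (cod m)" "g \<cdot> (e' \<cdot> e) = m \<cdot> f"
  then have fg: "f \<in> Hom C (dom e) (dom m)" "g \<in> Hom C (cod e') (cod m)" "(g \<cdot> e') \<cdot> e = m \<cdot> f" using a by auto
  obtain d where d: "d \<in> Hom C (cod e) (dom m)" "d \<cdot> e = f" "m \<cdot> d = g \<cdot> e'"
    and du: "\<And>d'. \<lbrakk>d' \<in> Hom C (cod e) (dom m); d' \<cdot> e = f; m \<cdot> d' = g \<cdot> e'\<rbrakk>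
       \<Longrightarrow> d' = d"
  proof -
    have "g \<cdot> e' \<in> Hom C (cod e) (cod m)" using fg a by simp
    then have "\<exists>!d. d \<in> Hom C (cod e) (dom m) \<and> d \<cdot> e = f \<and> m \<cdot> d = g \<cdot> e'"
      using o(1) fg unfolding orthogonal_def by blast
    then show thesis using that by blast
  qed
  have d': "d \<in> Hom C (dom e') (dom m)" "g \<cdot> e' = m \<cdot> d" using d a by auto
  then have "\<exists>!c. c \<in> Hom C (cod e') (dom m) \<and> c \<cdot> e' = d \<and> m \<cdot> c = g"
    using o(2) fg(2) unfolding orthogonal_def by blast
  then obtain c where c: "c \<in> Hom C (cod e') (dom m)" "c \<cdot> e' = d" "m \<cdot> c = g"
    and cu: "\<And>c'. \<lbrakk>c' \<in> Hom C (cod e') (dom m); c' \<cdot> e' = d; m \<cdot> c' = g\<rbrakk>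
       \<Longrightarrow> c' = c" by blast
  show "\<exists>!c. c \<in> Hom C (cod (e' \<cdot> e)) (dom m) \<and> c \<cdot> (e' \<cdot> e) = f \<and> m \<cdot> c = g"
  proof (rule ex1I[of _ c])
    have "c \<cdot> (e' \<cdot> e) = d \<cdot> e" by (rule comp_ext[OF c(2)]) (use c(1) a in auto)
    then show "c \<in> Hom C (cod (e' \<cdot> e)) (dom m) \<and> c \<cdot> (e' \<cdot> e) = f \<and> m \<cdot> c = g" using c(1,3) d(2) a by simp
    fix c' assume "c' \<in> Hom C (cod (e' \<cdot> e)) (dom m) \<and> c' \<cdot> (e' \<cdot> e) = f \<and> m \<cdot> c' = g"
    then have c': "c' \<in> Hom C (cod e') (dom m)" "c' \<cdot> (e' \<cdot> e) = f" "m \<cdot> c' = g" using a by auto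
    have "c' \<cdot> e' = d"
    proof (rule du)
      show "m \<cdot> (c' \<cdot> e') = g \<cdot> e'" by (rule comp_ext[OF c'(3)]) (use c' a m in auto)
    qed (use c' a in auto)
    then show "c' = c" using cu c' by blast
  qed
qed

lemma identity_pullback:
  assumes "arr k" shows "is_pullback C (Idn C (cod k)) k k (Idn C (dom k))"
proof (rule is_pullbackI)
  show "jointly_monic C k (Idn C (dom k))" using assms unfolding jointly_monic_def by simp
  fix u v assume "arr u" "arr v" "dom u = dom v" "cod u = dom (Idn C (cod k))" "cod v = dom k" "Idn C (cod k) \<cdot> u = k \<cdot> v"
  then show "\<exists>w. arr w \<and> dom w = dom v \<and> cod w = dom (Idn C (dom k)) \<and> k \<cdot> w = u \<and> Idn C (dom k) \<cdot> w = v"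
    using assms by (intro exI[of _ v]) simp
qed (use assms in auto)

lemma discrete_groupoid_gcomp:
  assumes z: "z \<in> Obj C" and u: "arr u" "cod u = z"
  shows "gcomp C (discrete_groupoid C z) u u = u"
proof -
  have pb: "is_pullback C (Idn C z) (Idn C z) (Idn C z) (Idn C z)" using identity_pullback[of "Idn C z"] z by simp
  have "gpair C (discrete_groupoid C z) u u = pbpair C (Idn C z) (Idn C z) u u"
    using z by (simp add: gpair_def pbpair_def)
  moreover have "arr (\<dots>)" "cod (pbpair C (Idn C z) (Idn C z) u u) = z" "Idn C z \<cdot> pbpair C (Idn C z) (Idn C z) u u = u"
    using pbpair[OF pb, of u u] u z by auto
  ultimately show ?thesis by (simp add: gcomp_def)
qed

lemma discrete_groupoid_groupoid:
  assumes z: "z \<in> Obj C" shows "internal_groupoid C (discrete_groupoid C z)"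
proof -
  have pb: "is_pullback C (Idn C z) (Idn C z) (Idn C z) (Idn C z)" using identity_pullback[of "Idn C z"] z by simp
  note c = discrete_groupoid_gcomp[OF z]
  have I: "Idn C z \<in> Hom C z z" using z by simp
  have "internal_category C (discrete_groupoid C z)" unfolding internal_category_def
    using z pb c by (auto simp: c)
  then show ?thesis unfolding internal_groupoid_def
    using z c by (auto intro!: bexI[OF _ I])
qed

lemma discrete_functor_arr:
  assumes k: "arr k"
  shows "FArr (discrete_functor C) k \<in> discrete_fibrations C" "Src (FArr (discrete_functor C) k) = discrete_groupoid C (dom k)"
    "Tgt (FArr (discrete_functor C) k) = discrete_groupoid C (cod k)" "f0 (FArr (discrete_functor C) k) = k" "f1 (FArr (discrete_functor C) k) = k"
proof -
  show s: "Src (FArr (discrete_functor C) k) = discrete_groupoid C (dom k)"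
    "Tgt (FArr (discrete_functor C) k) = discrete_groupoid C (cod k)" "f0 (FArr (discrete_functor C) k) = k" "f1 (FArr (discrete_functor C) k) = k"
    by (simp_all add: discrete_functor_def)
  have "internal_functor C \<lparr>Src = discrete_groupoid C (dom k), Tgt = discrete_groupoid C (cod k), f0 = k, f1 = k\<rparr>"
  proof (rule internal_functorI)
    fix u v assume "arr u" "arr v" "dom v = dom u" "cod u = G1 (discrete_groupoid C (dom k))"
      "cod v = G1 (discrete_groupoid C (dom k))" "gdom (discrete_groupoid C (dom k)) \<cdot> u = gcod (discrete_groupoid C (dom k)) \<cdot> v"
    then show "k \<cdot> gcomp C (discrete_groupoid C (dom k)) u v = gcomp C (discrete_groupoid C (cod k)) (k \<cdot> u) (k \<cdot> v)"
      using k by (simp add: discrete_groupoid_gcomp)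
  qed (use k discrete_groupoid_groupoid in auto)
  then show "FArr (discrete_functor C) k \<in> discrete_fibrations C"
    unfolding discrete_fibrations_def using identity_pullback[OF k] by (simp add: discrete_functor_def)
qed

lemma iso_discrete_fibration:
  assumes "is_iso (Gpd C) F" shows "F \<in> discrete_fibrations C"
proof -
  have F: "internal_functor C F" "is_iso C (f0 F)" "is_iso C (f1 F)" using Gpd_iso_levelwise[OF assms] by auto
  define X Y where "X = Src F" and "Y = Tgt F"
  have s: "Src F = X" "Tgt F = Y" by (auto simp: X_def Y_def)
  have g: "internal_groupoid C X" "internal_groupoid C Y" using F s by auto
  obtain j0 where j0: "arr j0" "dom j0 = G0 Y" "cod j0 = G0 X" "j0 \<cdot> f0 F = Idn C (G0 X)"
    using is_isoE[OF F(2)] F s by (metis functor_arr(2,3))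
  obtain j1 where j1: "arr j1" "dom j1 = G1 Y" "cod j1 = G1 X" "j1 \<cdot> f1 F = Idn C (G1 X)" "f1 F \<cdot> j1 = Idn C (G1 Y)"
    using is_isoE[OF F(3)] F s by (metis functor_arr(5,6))
  show ?thesis
  proof (rule discrete_fibrationI[OF F(1) s])
    fix t b x assume h: "arr b" "dom b = t" "cod b = G1 Y" "arr x" "dom x = t" "cod x = G0 X" "gcod Y \<cdot> b = f0 F \<cdot> x"
    have u: "f1 F \<cdot> (j1 \<cdot> b) = b" using comp_ext[OF j1(5), of b] h j1 F s by simp
    have "f0 F \<cdot> (gcod X \<cdot> (j1 \<cdot> b)) = f0 F \<cdot> x"
      using functor_gdom(2)[OF F(1) s(2), of "j1 \<cdot> b"] u h j1 s by simp
    then have "j0 \<cdot> (f0 F \<cdot> (gcod X \<cdot> (j1 \<cdot> b))) = j0 \<cdot> (f0 F \<cdot> x)" by simp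
    then have "gcod X \<cdot> (j1 \<cdot> b) = x"
      using comp_ext[OF j0(4), of x] comp_ext[OF j0(4), of "gcod X \<cdot> (j1 \<cdot> b)"] h j0 j1 F s g by simp
    then show "\<exists>u. arr u \<and> dom u = t \<and> cod u = G1 X \<and> f1 F \<cdot> u = b \<and> gcod X \<cdot> u = x"
      by (intro exI[of _ "j1 \<cdot> b"]) (use u h j1 in simp)
  next
    fix u v assume h: "arr u" "arr v" "dom u = dom v" "cod u = G1 X" "cod v = G1 X" "f1 F \<cdot> u = f1 F \<cdot> v"
    then have e: "j1 \<cdot> (f1 F \<cdot> u) = j1 \<cdot> (f1 F \<cdot> v)" by simp
    have "j1 \<cdot> (f1 F \<cdot> x) = x" if "arr x" "cod x = G1 X" for x
      using comp_ext[OF j1(4), of x] that j1(1-3) F(1) s by simp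
    then show "u = v" using e h(1,2,4,5) by metis
  qed
qed

lemma discrete_fibration_cancel:
  assumes N: "N \<in> discrete_fibrations C" and NK: "N \<bullet> K \<in> discrete_fibrations C"
    and K: "internal_functor C K" "Tgt K = Src N"
  shows "K \<in> discrete_fibrations C"
proof -
  note fN = discrete_fibration_functor[OF N]
  define X Y Z where "X = Src K" and "Y = Tgt K" and "Z = Tgt N"
  have s: "Src K = X" "Tgt K = Y" "Src N = Y" "Tgt N = Z" using K by (auto simp: X_def Y_def Z_def)
  have g: "internal_groupoid C X" "internal_groupoid C Y" "internal_groupoid C Z" using K fN s by auto
  have sNK: "Src (N \<bullet> K) = X" "Tgt (N \<bullet> K) = Z" using s by auto
  show ?thesis
  proof (rule discrete_fibrationI[OF K(1) s(1,2)])
    fix t b x assume h: "arr b" "dom b = t" "cod b = G1 Y" "arr x" "dom x = t" "cod x = G0 X" "gcod Y \<cdot> b = f0 K \<cdot> x"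
    obtain u where u: "arr u" "dom u = t" "cod u = G1 X" "f1 (N \<bullet> K) \<cdot> u = f1 N \<cdot> b" "gcod X \<cdot> u = x"
      by (rule discrete_fibration_lift[OF NK sNK, of "f1 N \<cdot> b" t x]) (use h fN K s in auto)
    have "f1 K \<cdot> u = b"
      by (rule discrete_fibration_unique[OF N s(3)]) (use u h fN K s in auto)
    then show "\<exists>u. arr u \<and> dom u = t \<and> cod u = G1 X \<and> f1 K \<cdot> u = b \<and> gcod X \<cdot> u = x" using u by blast
  next
    fix u v assume h: "arr u" "arr v" "dom u = dom v" "cod u = G1 X" "cod v = G1 X" "f1 K \<cdot> u = f1 K \<cdot> v" "gcod X \<cdot> u = gcod X \<cdot> v"
    show "u = v" by (rule discrete_fibration_unique[OF NK sNK(1) h(1-5) _ h(7)]) (use h K fN s in simp)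
  qed
qed

end

context regular_cat
begin

lemma Gpd_pullback_functors:
  assumes pb: "is_pullback (Gpd C) F G P Q"
  shows "internal_functor C F" "internal_functor C G" "internal_functor C P" "internal_functor C Q"
    "Tgt G = Tgt F" "Tgt P = Src F" "Tgt Q = Src G" "Src P = Src Q"
  using is_pullback_D[OF pb] by auto

lemma discrete_fibration_stable:
  assumes pb: "is_pullback (Gpd C) F G P Q" and F: "F \<in> discrete_fibrations C"
  shows "Q \<in> discrete_fibrations C"
proof -
  note f = Gpd_pullback_functors[OF pb]
  define A B X S where "A = Src F" and "B = Tgt F" and "X = Src G" and "S = Src Q"
  have s: "Src F = A" "Tgt F = B" "Src G = X" "Tgt G = B" "Src P = S" "Tgt P = A" "Src Q = S" "Tgt Q = X"
    using f by (auto simp: A_def B_def X_def S_def)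
  have g: "internal_groupoid C A" "internal_groupoid C B" "internal_groupoid C X" "internal_groupoid C S"
    using functor_gpd[OF f(1)] functor_gpd[OF f(4)] s by auto
  note pb0 = Gpd_pullback_levelwise(1)[OF pb] and pb1 = Gpd_pullback_levelwise(2)[OF pb]
  have sq0: "f0 F \<cdot> (f0 P \<cdot> z) = f0 G \<cdot> (f0 Q \<cdot> z)" if "arr z" "cod z = G0 S" for z
    by (rule comp_ext2[OF is_pullback_D(9)[OF pb0]]) (use that f(1-4) s in auto)
  have sq1: "f1 F \<cdot> (f1 P \<cdot> z) = f1 G \<cdot> (f1 Q \<cdot> z)" if "arr z" "cod z = G1 S" for z
    by (rule comp_ext2[OF is_pullback_D(9)[OF pb1]]) (use that f(1-4) s in auto)
  show ?thesis
  proof (rule discrete_fibrationI[OF f(4) s(7,8)])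
    fix t b x assume h: "arr b" "dom b = t" "cod b = G1 X" "arr x" "dom x = t" "cod x = G0 S" "gcod X \<cdot> b = f0 Q \<cdot> x"
    have "gcod B \<cdot> (f1 G \<cdot> b) = f0 G \<cdot> (gcod X \<cdot> b)" using functor_gdom(2)[OF f(2) s(4), of b] h s by simp
    also have "\<dots> = f0 F \<cdot> (f0 P \<cdot> x)" using sq0[of x] h by simp
    finally have c: "gcod B \<cdot> (f1 G \<cdot> b) = f0 F \<cdot> (f0 P \<cdot> x)" .
    obtain u where u: "arr u" "dom u = t" "cod u = G1 A" "f1 F \<cdot> u = f1 G \<cdot> b" "gcod A \<cdot> u = f0 P \<cdot> x"
      by (rule discrete_fibration_lift[OF F s(1,2) _ _ _ _ _ _ c]) (use h f(1-4) s in auto)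
    have "\<exists>w. arr w \<and> dom w = dom u \<and> cod w = dom (f1 P) \<and> f1 P \<cdot> w = u \<and> f1 Q \<cdot> w = b"
      by (rule pullback_lift[OF pb1]) (use u h f(1-4) s in auto)
    then obtain w where w: "arr w" "dom w = t" "cod w = G1 S" "f1 P \<cdot> w = u" "f1 Q \<cdot> w = b" using u f(1-4) s by auto
    have "gcod S \<cdot> w = x"
    proof (rule pullback_eqI[OF pb0])
      show "f0 P \<cdot> (gcod S \<cdot> w) = f0 P \<cdot> x" using functor_gdom(2)[OF f(3) s(6), of w] w u s by simp
      show "f0 Q \<cdot> (gcod S \<cdot> w) = f0 Q \<cdot> x" using functor_gdom(2)[OF f(4) s(8), of w] w h s by simp
    qed (use w h g f(1-4) s in auto)
    then show "\<exists>u. arr u \<and> dom u = t \<and> cod u = G1 S \<and> f1 Q \<cdot> u = b \<and> gcod S \<cdot> u = x" using w by blast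
  next
    fix u v assume h: "arr u" "arr v" "dom u = dom v" "cod u = G1 S" "cod v = G1 S" "f1 Q \<cdot> u = f1 Q \<cdot> v" "gcod S \<cdot> u = gcod S \<cdot> v"
    have "f1 P \<cdot> u = f1 P \<cdot> v"
    proof (rule discrete_fibration_unique[OF F s(1)])
      show "f1 F \<cdot> (f1 P \<cdot> u) = f1 F \<cdot> (f1 P \<cdot> v)" using sq1[of u] sq1[of v] h by simp
      show "gcod A \<cdot> (f1 P \<cdot> u) = gcod A \<cdot> (f1 P \<cdot> v)"
        using functor_gdom(2)[OF f(3) s(6), of u] functor_gdom(2)[OF f(3) s(6), of v] h s by simp
    qed (use h f(1-4) s in auto)
    then show "u = v" by (intro jointly_monicD[OF pullback_jointly_monic[OF pb1] h(1-3) _ _ _ h(6)]) (use h f(1-4) s in auto)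
  qed
qed

end

context exact_maltsev
begin

text \<open>For a functor surjective on objects fullness and surjectivity are both stable under all pullbacks,
unlike essential surjectivity alone.\<close>

lemma full_regular_stable:
  assumes pb: "is_pullback (Gpd C) F G P Q" and F: "locally_full C F" "f0 F \<in> covers"
  shows "Q \<in> full_ess_surj C"
proof -
  note f = Gpd_pullback_functors[OF pb]
  define A B X S where "A = Src F" and "B = Tgt F" and "X = Src G" and "S = Src Q"
  have s: "Src F = A" "Tgt F = B" "Src G = X" "Tgt G = B" "Src P = S" "Tgt P = A" "Src Q = S" "Tgt Q = X"
    using f by (auto simp: A_def B_def X_def S_def)
  have g: "internal_groupoid C A" "internal_groupoid C B" "internal_groupoid C X" "internal_groupoid C S"
    using functor_gpd[OF f(1)] functor_gpd[OF f(4)] s by auto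
  note pb0 = Gpd_pullback_levelwise(1)[OF pb] and pb1 = Gpd_pullback_levelwise(2)[OF pb]
  have sq0: "f0 F \<cdot> (f0 P \<cdot> z) = f0 G \<cdot> (f0 Q \<cdot> z)" if "arr z" "cod z = G0 S" for z
    by (rule comp_ext2[OF is_pullback_D(9)[OF pb0]]) (use that f(1-4) s in auto)
  have "locally_full C Q" unfolding locally_full_def
  proof (intro allI ballI impI)
    fix t x y b assume "x \<in> Hom C t (G0 (Src Q))" "y \<in> Hom C t (G0 (Src Q))" "b \<in> Hom C t (G1 (Tgt Q))"
      "gdom (Tgt Q) \<cdot> b = f0 Q \<cdot> x" "gcod (Tgt Q) \<cdot> b = f0 Q \<cdot> y"
    then have h: "arr x" "dom x = t" "cod x = G0 S" "arr y" "dom y = t" "cod y = G0 S"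
      "arr b" "dom b = t" "cod b = G1 X" "gdom X \<cdot> b = f0 Q \<cdot> x" "gcod X \<cdot> b = f0 Q \<cdot> y" using s by auto
    have h2: "f0 P \<cdot> x \<in> Hom C t (G0 A)" "f0 P \<cdot> y \<in> Hom C t (G0 A)" "f1 G \<cdot> b \<in> Hom C t (G1 B)"
      "gdom B \<cdot> (f1 G \<cdot> b) = f0 F \<cdot> (f0 P \<cdot> x)" "gcod B \<cdot> (f1 G \<cdot> b) = f0 F \<cdot> (f0 P \<cdot> y)"
      using functor_gdom[OF f(2) s(4), of b] h f(1-4) s sq0[of x] sq0[of y] by auto
    obtain e u where u: "e \<in> covers" "arr e" "cod e = t" "arr u" "dom u = dom e" "cod u = G1 A"
      "gdom A \<cdot> u = (f0 P \<cdot> x) \<cdot> e" "gcod A \<cdot> u = (f0 P \<cdot> y) \<cdot> e" "f1 F \<cdot> u = (f1 G \<cdot> b) \<cdot> e"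
      using locally_fullE[OF F(1) s(1,2) h2] by blast
    have "\<exists>w. arr w \<and> dom w = dom u \<and> cod w = dom (f1 P) \<and> f1 P \<cdot> w = u \<and> f1 Q \<cdot> w = b \<cdot> e"
      by (rule pullback_lift[OF pb1]) (use u h f(1-4) s in auto)
    then obtain w where w: "arr w" "dom w = dom e" "cod w = G1 S" "f1 P \<cdot> w = u" "f1 Q \<cdot> w = b \<cdot> e" using u f(1-4) s by auto
    have be: "gdom X \<cdot> (b \<cdot> e) = (f0 Q \<cdot> x) \<cdot> e" "gcod X \<cdot> (b \<cdot> e) = (f0 Q \<cdot> y) \<cdot> e"
      by (rule comp_ext[OF h(10)], use h u g in auto)[1] (rule comp_ext[OF h(11)], use h u g in auto)
    have 1: "gdom S \<cdot> w = x \<cdot> e"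
    proof (rule pullback_eqI[OF pb0])
      show "f0 P \<cdot> (gdom S \<cdot> w) = f0 P \<cdot> (x \<cdot> e)" using functor_gdom(1)[OF f(3) s(6), of w] w u h f(1-4) s by simp
      show "f0 Q \<cdot> (gdom S \<cdot> w) = f0 Q \<cdot> (x \<cdot> e)" using functor_gdom(1)[OF f(4) s(8), of w] be w u h(1-9) f(1-4) s by simp
    qed (use w u h g f(1-4) s in auto)
    have 2: "gcod S \<cdot> w = y \<cdot> e"
    proof (rule pullback_eqI[OF pb0])
      show "f0 P \<cdot> (gcod S \<cdot> w) = f0 P \<cdot> (y \<cdot> e)" using functor_gdom(2)[OF f(3) s(6), of w] w u h f(1-4) s by simp
      show "f0 Q \<cdot> (gcod S \<cdot> w) = f0 Q \<cdot> (y \<cdot> e)" using functor_gdom(2)[OF f(4) s(8), of w] be w u h(1-9) f(1-4) s by simp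
    qed (use w u h g f(1-4) s in auto)
    show "\<exists>e \<in> covers. cod e = t \<and> (\<exists>u \<in> Hom C (dom e) (G1 (Src Q)).
        gdom (Src Q) \<cdot> u = x \<cdot> e \<and> gcod (Src Q) \<cdot> u = y \<cdot> e \<and> f1 Q \<cdot> u = b \<cdot> e)"
      by (intro bexI[of _ e] conjI bexI[of _ w]) (use u w 1 2 s in auto)
  qed
  moreover have "locally_ess_surj C Q" unfolding locally_ess_surj_def
  proof (intro allI ballI)
    fix t y assume "y \<in> Hom C t (G0 (Tgt Q))"
    then have y: "arr y" "dom y = t" "cod y = G0 X" using s by auto
    obtain e a where a: "e \<in> covers" "arr e" "cod e = dom (f0 G \<cdot> y)" "arr a" "dom a = dom e"
      "cod a = dom (f0 F)" "f0 F \<cdot> a = (f0 G \<cdot> y) \<cdot> e" using cover_lift[OF F(2), of "f0 G \<cdot> y"] y f(1-4) s by auto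
    have "\<exists>w. arr w \<and> dom w = dom a \<and> cod w = dom (f0 P) \<and> f0 P \<cdot> w = a \<and> f0 Q \<cdot> w = y \<cdot> e"
      by (rule pullback_lift[OF pb0]) (use a y f(1-4) s in auto)
    then obtain w where w: "arr w" "dom w = dom e" "cod w = G0 S" "f0 Q \<cdot> w = y \<cdot> e" using a f(1-4) s by auto
    show "\<exists>e \<in> covers. cod e = t \<and> (\<exists>x \<in> Hom C (dom e) (G0 (Src Q)). \<exists>b \<in> Hom C (dom e) (G1 (Tgt Q)).
        gdom (Tgt Q) \<cdot> b = y \<cdot> e \<and> gcod (Tgt Q) \<cdot> b = f0 Q \<cdot> x)"
      by (intro bexI[of _ e] conjI bexI[of _ w] bexI[of _ "gunit X \<cdot> (y \<cdot> e)"]) (use a w y s g f(1-4) in auto)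
  qed
  ultimately show ?thesis using f unfolding full_ess_surj_def by simp
qed

text \<open>Effective descent in \<open>C\<close> itself: by the unit law the relation \<open>s\<close>, \<open>h\<close> on \<open>X\<close> is reflexive, so its
quotient \<open>q\<close> is effective, and elements identified by \<open>q\<close> are transports of each other. An element of
\<open>X\<close> is thus determined by its class and its image under \<open>x\<close>.\<close>

lemma level_descent:
  assumes p: "arr p" and x: "arr x" "cod x = dom p" and pb: "is_pullback C (p \<cdot> x) p s t"
    and h: "arr h" "dom h = dom s" "cod h = dom x" "x \<cdot> h = t"
    and unit: "\<And>z w. \<lbrakk>arr z; cod z = dom x; arr w; dom w = dom z; cod w = dom s;
       s \<cdot> w = z; t \<cdot> w = x \<cdot> z\<rbrakk> \<Longrightarrow> h \<cdot> w = z"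
  obtains q f where "q \<in> covers" "arr q" "dom q = dom x" "is_pullback C f p q x" "q \<cdot> h = q \<cdot> s"
    "\<And>z z'. \<lbrakk>arr z; arr z'; dom z = dom z'; cod z = dom x; cod z' = dom x;
       q \<cdot> z = q \<cdot> z'\<rbrakk>
       \<Longrightarrow> \<exists>w. arr w \<and> dom w = dom z \<and> cod w = dom s \<and> s \<cdot> w = z \<and> h \<cdot> w = z'"
proof -
  define X P where "X = dom x" and "P = dom s"
  note D = is_pullback_D[OF pb]
  have px: "arr (p \<cdot> x)" "dom (p \<cdot> x) = X" using p x by (auto simp: X_def)
  have s: "arr s" "dom s = P" "cod s = X" "arr t" "dom t = P" "cod t = dom p" using D px P_def by auto
  have hh: "arr h" "dom h = P" "cod h = X" "dom x = X" using h s X_def by auto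
  have ht: "x \<cdot> (h \<cdot> w) = t \<cdot> w" if "arr w" "cod w = P" for w
    by (rule comp_ext[OF h(4)]) (use that h s x in auto)
  have lift: "\<exists>w. arr w \<and> dom w = T \<and> cod w = P \<and> s \<cdot> w = z \<and> t \<cdot> w = e"
    if "z \<in> Hom C T X" "e \<in> Hom C T (dom p)" "p \<cdot> (x \<cdot> z) = p \<cdot> e" for z e T
  proof -
    have "(p \<cdot> x) \<cdot> z = p \<cdot> e" using that p x hh by simp
    then show ?thesis using pullback_lift[OF pb, of z e] that s px p by auto
  qed
  have jm: "jointly_monic C s t" by (rule pullback_jointly_monic[OF pb])
  have refl: "related C s h z z" if z: "arr z" "cod z = X" for z
  proof -
    obtain w where w: "arr w" "dom w = dom z" "cod w = P" "s \<cdot> w = z" "t \<cdot> w = x \<cdot> z"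
      using lift[of z "dom z" "x \<cdot> z"] z x hh by auto
    have "h \<cdot> w = z" by (rule unit[of z]) (use w z s hh in auto)
    then show ?thesis using related_global[of w z s h z] w z s by simp
  qed
  obtain q where q: "is_coequalizer C s h q" and
    qi: "\<And>z z'. \<lbrakk>arr z; arr z'; dom z = dom z'; cod z = X; cod z' = X\<rbrakk>
       \<Longrightarrow> q \<cdot> z = q \<cdot> z' \<longleftrightarrow> related C s h z z'"
    by (rule effective_quotient[OF s(1) hh(1) _ s(3) hh(3) refl]) (use s hh in auto)
  have qr: "q \<in> covers" using q by (rule regular_epiI)
  have qa: "arr q" "dom q = X" "q \<cdot> h = q \<cdot> s" using q s unfolding is_coequalizer_def by auto
  have qrel: "\<exists>w. arr w \<and> dom w = dom z \<and> cod w = dom s \<and> s \<cdot> w = z \<and> h \<cdot> w = z'"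
    if z: "arr z" "arr z'" "dom z = dom z'" "cod z = X" "cod z' = X" "q \<cdot> z = q \<cdot> z'" for z z'
  proof -
    have "related C s h z z'" using qi[OF z(1-5)] z(6) by simp
    then obtain e w where w: "e \<in> covers" "arr e" "cod e = dom z" "arr w" "dom w = dom e"
      "cod w = dom s" "s \<cdot> w = z \<cdot> e" "h \<cdot> w = z' \<cdot> e" by (rule relatedE)
    have jm2: "jointly_monic C s h" unfolding jointly_monic_def
    proof (intro allI impI)
      fix a b assume ab: "arr a" "arr b" "dom a = dom b" "cod a = dom s" "cod b = dom s" "s \<cdot> a = s \<cdot> b" "h \<cdot> a = h \<cdot> b"
      show "a = b" by (rule jointly_monicD[OF jm ab(1-6)]) (use ht[of a] ht[of b] ab s in simp)
    qed
    show ?thesis by (rule glue_pair[OF jm2 s(1) hh(1) _ w(1)]) (use w z s hh in auto)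
  qed
  have "(p \<cdot> x) \<cdot> s = (p \<cdot> x) \<cdot> h" using D(9) h p x s hh by simp
  then obtain f where f: "arr f" "dom f = cod q" "cod f = cod p" "f \<cdot> q = p \<cdot> x"
    using coequalizer_lift[OF q px(1)] px s p x by auto
  have fq: "f \<cdot> (q \<cdot> z) = p \<cdot> (x \<cdot> z)" if "arr z" "cod z = X" for z
    by (rule comp_ext2[OF f(4)]) (use that f qa p x hh in auto)
  have qx: "jointly_monic C q x" unfolding jointly_monic_def
  proof (intro allI impI)
    fix a b assume "arr a" "arr b" "dom a = dom b" "cod a = dom q" "cod b = dom q" "q \<cdot> a = q \<cdot> b" "x \<cdot> a = x \<cdot> b"
    then have ab: "arr a" "arr b" "dom a = dom b" "cod a = X" "cod b = X" "q \<cdot> a = q \<cdot> b" "x \<cdot> a = x \<cdot> b" using qa by auto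
    obtain w where w: "arr w" "dom w = dom a" "cod w = dom s" "s \<cdot> w = a" "h \<cdot> w = b" using qrel[OF ab(1-6)] by blast
    have "t \<cdot> w = x \<cdot> a" using ht[of w] w s ab by simp
    then have "h \<cdot> w = a" by (intro unit[of a w]) (use w ab hh in auto)
    then show "a = b" using w by simp
  qed
  have "is_pullback C f p q x"
  proof (rule is_pullbackI)
    fix y e assume ye: "arr y" "arr e" "dom y = dom e" "cod y = dom f" "cod e = dom p" "f \<cdot> y = p \<cdot> e"
    obtain c z where z: "c \<in> covers" "arr c" "cod c = dom y" "arr z" "dom z = dom c"
      "cod z = dom q" "q \<cdot> z = y \<cdot> c" using cover_lift[OF qr ye(1)] ye f by metis
    have "f \<cdot> (y \<cdot> c) = p \<cdot> (e \<cdot> c)" by (rule comp_ext2[OF ye(6)]) (use ye z f p in auto)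
    then have "p \<cdot> (x \<cdot> z) = p \<cdot> (e \<cdot> c)" using fq[of z] z qa by simp
    then obtain w where w: "arr w" "dom w = dom c" "cod w = P" "s \<cdot> w = z" "t \<cdot> w = e \<cdot> c"
      using lift[of z "dom c" "e \<cdot> c"] z ye qa by auto
    have "q \<cdot> (h \<cdot> w) = q \<cdot> (s \<cdot> w)" by (rule comp_ext2[OF qa(3)]) (use w s hh qa in auto)
    then have 1: "q \<cdot> (h \<cdot> w) = y \<cdot> c" using w z by simp
    have 2: "x \<cdot> (h \<cdot> w) = e \<cdot> c" using ht[of w] w by simp
    have "\<exists>k. arr k \<and> dom k = dom e \<and> cod k = dom q \<and> q \<cdot> k = y \<and> x \<cdot> k = e"
      by (rule glue_pair[OF qx qa(1) x(1) _ z(1) _ _ _ _ _ _ _ _ _ _ 1 2]) (use z ye f p x hh qa w in auto)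
    then show "\<exists>k. arr k \<and> dom k = dom e \<and> cod k = dom x \<and> q \<cdot> k = y \<and> x \<cdot> k = e" using qa hh by simp
  qed (use f p x qa hh qx in auto)
  then show ?thesis using that[OF qr qa(1)] qa qrel hh by simp
qed

lemma Gpd_category_with_pullbacks: "category_with_pullbacks (Gpd C)"
proof -
  interpret G: category "Gpd C" by (rule Gpd_category)
  show ?thesis
  proof
    fix F G assume "F \<in> Arr (Gpd C)" "G \<in> Arr (Gpd C)" "Cod (Gpd C) F = Cod (Gpd C) G"
    then have F: "internal_functor C F" "internal_functor C G" "Tgt F = Tgt G" by auto
    obtain P Q where P: "internal_functor C P" "internal_functor C Q" "Src P = Src Q" "Tgt P = Src F"
      "Tgt Q = Src G" and pb: "is_pullback C (f0 F) (f0 G) (f0 P) (f0 Q)" "is_pullback C (f1 F) (f1 G) (f1 P) (f1 Q)"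
      using Gpd_pullback_exists[OF F] by metis
    show "\<exists>s t. is_pullback (Gpd C) F G s t" using levelwise_pullback[OF F(1,2) P(1,2) F(3) P(3-5) pb] by blast
  next
    fix F G P Q assume pb: "is_pullback (Gpd C) F G P Q" and F: "F \<in> regular_epis (Gpd C)"
    show "Q \<in> regular_epis (Gpd C)" unfolding Gpd_regular_epi_iff
      using regular_epi_stable[OF Gpd_pullback_levelwise(1)[OF pb]] regular_epi_stable[OF Gpd_pullback_levelwise(2)[OF pb]]
        regular_epi_levelwise[OF F] Gpd_pullback_functors(4)[OF pb] by simp
  qed
qed

text \<open>Descent is performed on objects and on arrows separately; the equivalence relations \<open>s\<close>, \<open>h\<close> at the
two levels form a congruence of groupoids, because \<open>s\<close> and \<open>h\<close> are functors, and so the quotient is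
again a groupoid.\<close>

lemma Gpd_effective_descent:
  assumes p: "p \<in> regular_epis (Gpd C)"
  shows "effective_descent (Gpd C) p"
proof -
  interpret G: category_with_pullbacks "Gpd C" by (rule Gpd_category_with_pullbacks)
  have fp: "internal_functor C p" "f0 p \<in> covers" "f1 p \<in> covers" using regular_epi_levelwise[OF p] by auto
  show ?thesis
  proof
    show "p \<in> regular_epis (Gpd C)" by (rule p)
    fix F G assume F: "F \<in> regular_epis (Gpd C)" "G \<in> regular_epis (Gpd C)" "Dom (Gpd C) G = Cod (Gpd C) F"
    then show "G \<bullet> F \<in> regular_epis (Gpd C)" using Gpd_regular_epi_comp[of F G] by simp
  next
    fix F G assume FG: "G \<bullet> F \<in> regular_epis (Gpd C)" "F \<in> Arr (Gpd C)" "G \<in> Arr (Gpd C)" "Dom (Gpd C) G = Cod (Gpd C) F"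
    then show "G \<in> regular_epis (Gpd C)" using Gpd_regular_epi_cancel[of G F] by simp
  next
    fix x s t h
    assume x: "x \<in> regular_epis (Gpd C)" "Cod (Gpd C) x = Dom (Gpd C) p"
      and pb: "is_pullback (Gpd C) (p \<bullet> x) p s t"
      and h: "h \<in> Hom (Gpd C) (Dom (Gpd C) s) (Dom (Gpd C) x)" "x \<bullet> h = t"
      and unit: "\<And>w. \<lbrakk>w \<in> Hom (Gpd C) (Dom (Gpd C) x) (Dom (Gpd C) s); s \<bullet> w = Idn (Gpd C) (Dom (Gpd C) x); t \<bullet> w = x\<rbrakk>
         \<Longrightarrow> h \<bullet> w = Idn (Gpd C) (Dom (Gpd C) x)"
    have fx: "internal_functor C x" using regular_epi_levelwise[OF x(1)] by simp
    define X E B P where "X = Src x" and "E = Src p" and "B = Tgt p" and "P = Src s"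
    note fs = Gpd_pullback_functors[OF pb]
    have fh: "internal_functor C h" using h by simp
    have sr: "Src x = X" "Tgt x = E" "Src p = E" "Tgt p = B" "Src s = P" "Tgt s = X" "Src t = P" "Tgt t = E" "Src h = P" "Tgt h = X"
      using x h fs by (auto simp: X_def E_def B_def P_def)
    have g: "internal_groupoid C X" "internal_groupoid C E" "internal_groupoid C B" "internal_groupoid C P"
      using functor_gpd[OF fx] functor_gpd[OF fp(1)] functor_gpd[OF fh] sr by auto
    note f = fp(1) fx fs(3,4) fh
    have pb0: "is_pullback C (f0 p \<cdot> f0 x) (f0 p) (f0 s) (f0 t)" and pb1: "is_pullback C (f1 p \<cdot> f1 x) (f1 p) (f1 s) (f1 t)"
      using Gpd_pullback_levelwise[OF pb] by auto
    have xh: "f0 x \<cdot> f0 h = f0 t" "f1 x \<cdot> f1 h = f1 t" using arg_cong[OF h(2), of f0] arg_cong[OF h(2), of f1] by auto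
    have "\<exists>w. w \<in> Arr (Gpd C) \<and> Dom (Gpd C) w = Dom (Gpd C) (Idn (Gpd C) X) \<and> Cod (Gpd C) w = Dom (Gpd C) s \<and>
        s \<bullet> w = Idn (Gpd C) X \<and> t \<bullet> w = x"
    proof (rule pullback_lift[OF pb])
      show "(p \<bullet> x) \<bullet> Idn (Gpd C) X = p \<bullet> x"
        using G.comp_idn[of "p \<bullet> x" X] fs(1) sr by simp
      show "Idn (Gpd C) X \<in> Arr (Gpd C)" using G.idn_arr(1)[of X] g by simp
    qed (use fx sr in auto)
    then obtain w where w: "internal_functor C w" "Src w = X" "Tgt w = P" "s \<bullet> w = Idn (Gpd C) X" "t \<bullet> w = x"
      using sr by auto
    have hw: "h \<bullet> w = Idn (Gpd C) X" using unit[of w] w sr by simp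
    have w0: "f0 s \<cdot> f0 w = Idn C (G0 X)" "f0 t \<cdot> f0 w = f0 x" "f0 h \<cdot> f0 w = Idn C (G0 X)"
      and w1: "f1 s \<cdot> f1 w = Idn C (G1 X)" "f1 t \<cdot> f1 w = f1 x" "f1 h \<cdot> f1 w = Idn C (G1 X)"
      using arg_cong[OF w(4), of f0] arg_cong[OF w(5), of f0] arg_cong[OF hw, of f0]
        arg_cong[OF w(4), of f1] arg_cong[OF w(5), of f1] arg_cong[OF hw, of f1] by auto
    have unit0: "f0 h \<cdot> v = z" if v: "arr z" "cod z = dom (f0 x)" "arr v" "dom v = dom z" "cod v = dom (f0 s)"
        "f0 s \<cdot> v = z" "f0 t \<cdot> v = f0 x \<cdot> z" for z v
    proof -
      have z: "cod z = G0 X" "cod v = G0 P" using v f sr by auto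
      have 1: "f0 s \<cdot> (f0 w \<cdot> z) = Idn C (G0 X) \<cdot> z" by (rule comp_ext[OF w0(1)]) (use v(1) z w f sr in auto)
      have 2: "f0 t \<cdot> (f0 w \<cdot> z) = f0 x \<cdot> z" by (rule comp_ext[OF w0(2)]) (use v(1) z w f sr in auto)
      have 3: "f0 h \<cdot> (f0 w \<cdot> z) = Idn C (G0 X) \<cdot> z" by (rule comp_ext[OF w0(3)]) (use v(1) z w f sr in auto)
      have "v = f0 w \<cdot> z" by (rule pullback_eqI[OF pb0]) (use v z 1 2 w f sr in auto)
      then show ?thesis using 3 v z by simp
    qed
    have unit1: "f1 h \<cdot> v = z" if v: "arr z" "cod z = dom (f1 x)" "arr v" "dom v = dom z" "cod v = dom (f1 s)"
        "f1 s \<cdot> v = z" "f1 t \<cdot> v = f1 x \<cdot> z" for z v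
    proof -
      have z: "cod z = G1 X" "cod v = G1 P" using v f sr by auto
      have 1: "f1 s \<cdot> (f1 w \<cdot> z) = Idn C (G1 X) \<cdot> z" by (rule comp_ext[OF w1(1)]) (use v(1) z w f sr in auto)
      have 2: "f1 t \<cdot> (f1 w \<cdot> z) = f1 x \<cdot> z" by (rule comp_ext[OF w1(2)]) (use v(1) z w f sr in auto)
      have 3: "f1 h \<cdot> (f1 w \<cdot> z) = Idn C (G1 X) \<cdot> z" by (rule comp_ext[OF w1(3)]) (use v(1) z w f sr in auto)
      have "v = f1 w \<cdot> z" by (rule pullback_eqI[OF pb1]) (use v z 1 2 w f sr in auto)
      then show ?thesis using 3 v z by simp
    qed
    have px0: "arr (f0 x)" "cod (f0 x) = dom (f0 p)" "arr (f0 h)" "dom (f0 h) = dom (f0 s)" "cod (f0 h) = dom (f0 x)"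
      and px1: "arr (f1 x)" "cod (f1 x) = dom (f1 p)" "arr (f1 h)" "dom (f1 h) = dom (f1 s)" "cod (f1 h) = dom (f1 x)"
      using f sr by auto
    obtain q0 k0 where q0: "q0 \<in> covers" "arr q0" "dom q0 = dom (f0 x)" "is_pullback C k0 (f0 p) q0 (f0 x)" "q0 \<cdot> f0 h = q0 \<cdot> f0 s"
      and r0: "\<And>z z'. \<lbrakk>arr z; arr z'; dom z = dom z'; cod z = dom (f0 x);
       cod z' = dom (f0 x); q0 \<cdot> z = q0 \<cdot> z'\<rbrakk>
       \<Longrightarrow> \<exists>w. arr w \<and> dom w = dom z \<and> cod w = dom (f0 s) \<and> f0 s \<cdot> w = z \<and> f0 h \<cdot> w = z'"
      using level_descent[OF functor_arr(1)[OF fp(1)] px0(1,2) pb0 px0(3-5) xh(1) unit0] by blast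
    obtain q1 k1 where q1: "q1 \<in> covers" "arr q1" "dom q1 = dom (f1 x)" "is_pullback C k1 (f1 p) q1 (f1 x)" "q1 \<cdot> f1 h = q1 \<cdot> f1 s"
      and r1: "\<And>z z'. \<lbrakk>arr z; arr z'; dom z = dom z'; cod z = dom (f1 x);
       cod z' = dom (f1 x); q1 \<cdot> z = q1 \<cdot> z'\<rbrakk>
       \<Longrightarrow> \<exists>w. arr w \<and> dom w = dom z \<and> cod w = dom (f1 s) \<and> f1 s \<cdot> w = z \<and> f1 h \<cdot> w = z'"
      using level_descent[OF functor_arr(4)[OF fp(1)] px1(1,2) pb1 px1(3-5) xh(2) unit1] by blast
    have R1: "\<exists>w. arr w \<and> dom w = dom z \<and> cod w = G1 P \<and> f1 s \<cdot> w = z \<and> f1 h \<cdot> w = z'"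
      if "arr z" "arr z'" "dom z = dom z'" "cod z = G1 X" "cod z' = G1 X" "q1 \<cdot> z = q1 \<cdot> z'" for z z'
      using r1[OF that(1-3)] that f sr by simp
    have R0: "\<exists>w. arr w \<and> dom w = dom z \<and> cod w = G0 P \<and> f0 s \<cdot> w = z \<and> f0 h \<cdot> w = z'"
      if "arr z" "arr z'" "dom z = dom z'" "cod z = G0 X" "cod z' = G0 X" "q0 \<cdot> z = q0 \<cdot> z'" for z z'
      using r0[OF that(1-3)] that f sr by simp
    have Q0: "q0 \<cdot> (f0 h \<cdot> v) = q0 \<cdot> (f0 s \<cdot> v)" if "arr v" "cod v = G0 P" for v
      by (rule comp_ext2[OF q0(5)]) (use that q0 f sr in auto)
    have Q1: "q1 \<cdot> (f1 h \<cdot> v) = q1 \<cdot> (f1 s \<cdot> v)" if "arr v" "cod v = G1 P" for v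
      by (rule comp_ext2[OF q1(5)]) (use that q1 f sr in auto)
    have dq: "dom q0 = G0 X" "dom q1 = G1 X" using q0 q1 f sr by auto
    have sh: "a = b" if ab: "arr a" "arr b" "dom a = dom b" "cod a = G0 P" "cod b = G0 P" "f0 s \<cdot> a = f0 s \<cdot> b" "f0 h \<cdot> a = f0 h \<cdot> b" for a b
    proof (rule pullback_eqI[OF pb0])
      have "f0 t \<cdot> z = f0 x \<cdot> (f0 h \<cdot> z)" if "arr z" "cod z = G0 P" for z
        by (rule comp_ext[OF xh(1), symmetric]) (use that f sr in auto)
      then show "f0 t \<cdot> a = f0 t \<cdot> b" using ab by simp
    qed (use ab f sr in auto)
    obtain Y where Q: "internal_functor C \<lparr>Src = X, Tgt = Y, f0 = q0, f1 = q1\<rparr>" (is "internal_functor C ?Q")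
    proof (rule quotient_groupoid[OF g(1) q0(1) dq(1) q1(1) dq(2)])
      fix u v assume uv: "arr u" "arr v" "dom u = dom v" "cod u = G1 X" "cod v = G1 X" "q1 \<cdot> u = q1 \<cdot> v"
      obtain w where w: "arr w" "dom w = dom u" "cod w = G1 P" "f1 s \<cdot> w = u" "f1 h \<cdot> w = v" using R1[OF uv] by blast
      show "q0 \<cdot> (gdom X \<cdot> u) = q0 \<cdot> (gdom X \<cdot> v)"
        using Q0[of "gdom P \<cdot> w"] functor_gdom(1)[OF f(3) sr(6), of w] functor_gdom(1)[OF f(5) sr(10), of w] w g sr by simp
      have i: "f1 s \<cdot> (ginv C P \<cdot> w) = ginv C X \<cdot> u" "f1 h \<cdot> (ginv C P \<cdot> w) = ginv C X \<cdot> v"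
        using functor_ginv[OF f(3) sr(5), of w] functor_ginv[OF f(5) sr(9), of w] w sr by auto
      show "q1 \<cdot> (ginv C X \<cdot> u) = q1 \<cdot> (ginv C X \<cdot> v)" using Q1[of "ginv C P \<cdot> w"] i w g by simp
    next
      fix a b assume ab: "arr a" "arr b" "dom a = dom b" "cod a = G0 X" "cod b = G0 X" "q0 \<cdot> a = q0 \<cdot> b"
      obtain w where w: "arr w" "dom w = dom a" "cod w = G0 P" "f0 s \<cdot> w = a" "f0 h \<cdot> w = b" using R0[OF ab] by blast
      have "f1 s \<cdot> (gunit P \<cdot> w) = gunit X \<cdot> a" "f1 h \<cdot> (gunit P \<cdot> w) = gunit X \<cdot> b"
        using functor_gunit[OF f(3) sr(5), of w] functor_gunit[OF f(5) sr(9), of w] w sr by auto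
      then show "q1 \<cdot> (gunit X \<cdot> a) = q1 \<cdot> (gunit X \<cdot> b)" using Q1[of "gunit P \<cdot> w"] w g by simp
    next
      fix u v u' v' assume uv: "arr u" "arr v" "arr u'" "arr v'" "dom v = dom u"
       "dom u' = dom u" "dom v' = dom u" "cod u = G1 X" "cod v = G1 X"
       "cod u' = G1 X" "cod v' = G1 X" "gdom X \<cdot> u = gcod X \<cdot> v" "gdom X \<cdot> u' = gcod X \<cdot> v'"
       "q1 \<cdot> u = q1 \<cdot> u'" "q1 \<cdot> v = q1 \<cdot> v'"
      obtain w where w: "arr w" "dom w = dom u" "cod w = G1 P" "f1 s \<cdot> w = u" "f1 h \<cdot> w = u'" using R1[of u u'] uv by auto
      obtain l where l: "arr l" "dom l = dom u" "cod l = G1 P" "f1 s \<cdot> l = v" "f1 h \<cdot> l = v'" using R1[of v v'] uv by auto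
      have wl: "gdom P \<cdot> w = gcod P \<cdot> l"
      proof (rule sh)
        show "f0 s \<cdot> (gdom P \<cdot> w) = f0 s \<cdot> (gcod P \<cdot> l)"
          using functor_gdom(1)[OF f(3) sr(6), of w] functor_gdom(2)[OF f(3) sr(6), of l] w l uv sr by simp
        show "f0 h \<cdot> (gdom P \<cdot> w) = f0 h \<cdot> (gcod P \<cdot> l)"
          using functor_gdom(1)[OF f(5) sr(10), of w] functor_gdom(2)[OF f(5) sr(10), of l] w l uv sr by simp
      qed (use w l g in auto)
      have "f1 s \<cdot> gcomp C P w l = gcomp C X u v" "f1 h \<cdot> gcomp C P w l = gcomp C X u' v'"
        using functor_gcomp[OF f(3) sr(5), of w l] functor_gcomp[OF f(5) sr(9), of w l] w l wl sr by auto
      then show "q1 \<cdot> gcomp C X u v = q1 \<cdot> gcomp C X u' v'" using Q1[of "gcomp C P w l"] w l wl g by simp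
    qed
    have gY: "internal_groupoid C Y" "G0 Y = cod q0" "G1 Y = cod q1"
      using functor_gpd(2)[OF Q] functor_arr[OF Q] by auto
    note D0 = is_pullback_D[OF q0(4)] and D1 = is_pullback_D[OF q1(4)]
    have px: "internal_functor C (p \<bullet> x)" "Src (p \<bullet> x) = X" "Tgt (p \<bullet> x) = B" using fs(1) sr by auto
    have K: "internal_functor C \<lparr>Src = Y, Tgt = B, f0 = k0, f1 = k1\<rparr>" (is "internal_functor C ?K")
      by (rule functor_descent[OF Q _ _ _ _ px]) (use q0 q1 D0 D1 gY fp sr in auto)
    have "is_pullback (Gpd C) ?K p ?Q x"
      by (rule levelwise_pullback[OF K fp(1) Q fx]) (use sr q0 q1 in auto)
    moreover have "?Q \<in> regular_epis (Gpd C)" by (rule levelwise_regular_epi[OF Q]) (use q0 q1 in auto)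
    moreover have "?Q \<bullet> h = ?Q \<bullet> s" by (rule functor_eqI) (use q0 q1 sr in auto)
    ultimately show "\<exists>q f. q \<in> regular_epis (Gpd C) \<and> is_pullback (Gpd C) f p q x \<and> q \<bullet> h = q \<bullet> s" by blast
  qed
qed

lemma pi0_unit_functor:
  assumes X: "internal_groupoid C X"
  shows "internal_functor C (pi0_unit C X)" "Src (pi0_unit C X) = X" "Tgt (pi0_unit C X) = discrete_groupoid C (FObj (pi0 C) X)"
    "f0 (pi0_unit C X) = components C X" "f1 (pi0_unit C X) = components C X \<cdot> gdom X"
proof -
  note c = components_arr[OF X]
  have z: "FObj (pi0 C) X \<in> Obj C" using Cod_Obj[OF c(1)] c by simp
  have e: "components C X \<cdot> gdom X = components C X \<cdot> gcod X"
    using components(1)[OF X] unfolding is_coequalizer_def by auto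
  have "internal_functor C \<lparr>Src = X, Tgt = discrete_groupoid C (FObj (pi0 C) X), f0 = components C X, f1 = components C X \<cdot> gdom X\<rparr>"
  proof (rule internal_functorI[OF X discrete_groupoid_groupoid[OF z]])
    fix u v assume uv: "arr u" "arr v" "dom v = dom u" "cod u = G1 X" "cod v = G1 X" "gdom X \<cdot> u = gcod X \<cdot> v"
    have "components C X \<cdot> (gdom X \<cdot> u) = components C X \<cdot> (gdom X \<cdot> v)"
      using components_gdom_gcod[OF X uv(2,5)] uv by simp
    then show "(components C X \<cdot> gdom X) \<cdot> gcomp C X u v =
      gcomp C (discrete_groupoid C (FObj (pi0 C) X)) ((components C X \<cdot> gdom X) \<cdot> u) ((components C X \<cdot> gdom X) \<cdot> v)"
      using discrete_groupoid_gcomp[OF z, of "components C X \<cdot> (gdom X \<cdot> v)"] uv X c by simp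
  qed (use c z X e in auto)
  then show "internal_functor C (pi0_unit C X)" by (simp add: pi0_unit_def)
qed (simp_all add: pi0_unit_def)

text \<open>Functors between discrete groupoids are discrete fibrations, and these are stable under pullback.\<close>

lemma class_M_discrete_fibration:
  assumes m: "m \<in> class_M (Gpd C) F (pi0 C) (discrete_functor C) (pi0_unit C)"
  shows "m \<in> discrete_fibrations C"
proof -
  have fm: "internal_functor C m" and
    pb: "is_pullback (Gpd C) (pi0_unit C (Tgt m)) (FArr (discrete_functor C) (FArr (pi0 C) m)) m (pi0_unit C (Src m))"
    using m unfolding class_M_def by auto
  interpret G: category "Gpd C" by (rule Gpd_category)
  show ?thesis
    by (rule discrete_fibration_stable[OF G.pullback_sym[OF pb] discrete_functor_arr(1)])
      (rule pi0_arr(1)[OF fm refl refl])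
qed

text \<open>The decalage \<open>W\<close> of the codomain is a monadic extension, as a regular epimorphism. It remains to see
that the pullback \<open>Q\<close> of \<open>f\<close> along \<open>W\<close> is a trivial covering. The codomain \<open>D\<close> of \<open>Q\<close> is an equivalence
relation, so that a discrete fibration over it has trivial monodromy: connected objects of the
domain that lie over the same object are equal. Hence an object of the domain is determined by
its component and its image in \<open>D\<close>, and every compatible such pair arises by transport along an
arrow of \<open>D\<close>.\<close>

lemma regular_discrete_fibration_M_star:
  assumes f: "f \<in> regular_epis (Gpd C)" "f \<in> discrete_fibrations C"
  shows "f \<in> class_M_star (Gpd C) (regular_epis (Gpd C)) (pi0 C) (discrete_functor C) (pi0_unit C)"
proof -
  interpret G: category_with_pullbacks "Gpd C" by (rule Gpd_category_with_pullbacks)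
  have ff: "internal_functor C f" by (rule discrete_fibration_functor[OF f(2)])
  define B where "B = Tgt f"
  have gB: "internal_groupoid C B" using ff B_def by simp
  obtain W where W: "W \<in> discrete_fibrations C" "Tgt W = B" "f0 W \<in> covers" "f1 W \<in> covers"
    "G0 (Src W) = G1 B" "f0 W = gdom B"
    and tri: "\<And>w. arr w \<Longrightarrow> cod w = G1 (Src W) \<Longrightarrow> gdom B \<cdot> (gcod (Src W) \<cdot> w) = gcod B \<cdot> (f1 W \<cdot> w) \<and>
       gcomp C B (gcod (Src W) \<cdot> w) (f1 W \<cdot> w) = gdom (Src W) \<cdot> w" by (rule decalage[OF gB], rule that) assumption+
  have fW: "internal_functor C W" by (rule discrete_fibration_functor[OF W(1)])
  have Wr: "W \<in> regular_epis (Gpd C)" using fW W levelwise_regular_epi by blast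
  have mon: "monadic_extension (Gpd C) (regular_epis (Gpd C)) W"
    using effective_descent.regular_epi_monadic_extension[OF Gpd_effective_descent[OF Wr]] .
  define D where "D = Src W"
  note tri = tri[folded D_def]
  have gD: "internal_groupoid C D" "Src W = D" "G0 D = G1 B" using fW W D_def by auto
  \<comment> \<open>the decalage is an equivalence relation: a triangle is determined by its two sides\<close>
  have thin: "f1 W \<cdot> w = gunit B \<cdot> (gdom B \<cdot> (gdom D \<cdot> w)) \<and> w = gunit D \<cdot> (gdom D \<cdot> w)"
    if w: "arr w" "cod w = G1 D" "gdom D \<cdot> w = gcod D \<cdot> w" for w
  proof -
    define b where "b = gcod D \<cdot> w"
    have b: "arr b" "dom b = dom w" "cod b = G1 B" "gdom D \<cdot> w = b" "gcod D \<cdot> w = b" using w gD unfolding b_def by auto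
    have W1: "arr (f1 W \<cdot> w)" "dom (f1 W \<cdot> w) = dom w" "cod (f1 W \<cdot> w) = G1 B" using w fW gD W by auto
    have t: "gdom B \<cdot> b = gcod B \<cdot> (f1 W \<cdot> w)" "gcomp C B b (f1 W \<cdot> w) = b" using tri[OF w(1,2)] b by auto
    have e: "f1 W \<cdot> w = gunit B \<cdot> (gdom B \<cdot> b)"
      by (rule gcomp_left_cancel[OF gB b(1)]) (use W1 b t gB in auto)
    have "w = gunit D \<cdot> b"
      by (rule discrete_fibration_unique[OF W(1) gD(2)]) (use w b e gD fW W in auto)
    then show ?thesis using e b by simp
  qed
  obtain P Q where pb: "is_pullback (Gpd C) f W P Q" using G.pullback_ex[of f W] ff fW W B_def by auto
  note fs = Gpd_pullback_functors[OF pb]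
  have Qd: "Q \<in> discrete_fibrations C" by (rule discrete_fibration_stable[OF pb f(2)])
  have Qr: "Q \<in> regular_epis (Gpd C)" by (rule G.stable[OF pb f(1)])
  define S where "S = Src Q"
  have s: "Src Q = S" "Tgt Q = D" using fs gD S_def by auto
  have gS: "internal_groupoid C S" using functor_gpd(1)[OF fs(4)] s by simp
  define k where "k = FArr (pi0 C) Q"
  note k = pi0_arr[OF fs(4) s, folded k_def]
  note cS = components_arr[OF gS] and cD = components_arr[OF gD(1)]
  have ke: "k \<cdot> (components C S \<cdot> z) = components C D \<cdot> (f0 Q \<cdot> z)" if "arr z" "cod z = G0 S" for z
    by (rule comp_ext2[OF k(4)]) (use that k fs(4) s gS gD in auto)
  note dk = discrete_functor_arr[OF k(1)]
  note uS = pi0_unit_functor[OF gS] and uD = pi0_unit_functor[OF gD(1)]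
  have jm0: "jointly_monic C (f0 Q) (components C S)" unfolding jointly_monic_def
  proof (intro allI impI)
    fix a b assume "arr a" "arr b" "dom a = dom b" "cod a = dom (f0 Q)" "cod b = dom (f0 Q)"
      "f0 Q \<cdot> a = f0 Q \<cdot> b" "components C S \<cdot> a = components C S \<cdot> b"
    then have ab: "arr a" "arr b" "dom a = dom b" "cod a = G0 S" "cod b = G0 S"
      "f0 Q \<cdot> a = f0 Q \<cdot> b" "components C S \<cdot> a = components C S \<cdot> b" using fs(4) s by auto
    have H: "a \<in> Hom C (dom b) (G0 S)" "b \<in> Hom C (dom b) (G0 S)" using ab by auto
    obtain e u where u: "e \<in> covers" "arr e" "cod e = dom b" "arr u" "dom u = dom e" "cod u = G1 S"
      "gdom S \<cdot> u = a \<cdot> e" "gcod S \<cdot> u = b \<cdot> e" using components_connected[OF gS H ab(7)] by blast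
    have Qe: "f0 Q \<cdot> (a \<cdot> e) = f0 Q \<cdot> (b \<cdot> e)" by (rule comp_ext2[OF ab(6)]) (use ab u fs(4) s in auto)
    have Qd': "gdom D \<cdot> (f1 Q \<cdot> u) = f0 Q \<cdot> (b \<cdot> e)" "gcod D \<cdot> (f1 Q \<cdot> u) = f0 Q \<cdot> (b \<cdot> e)"
      using functor_gdom[OF fs(4) s(2), of u] u Qe s by auto
    have "f1 Q \<cdot> u = gunit D \<cdot> (f0 Q \<cdot> (b \<cdot> e))"
      using thin[of "f1 Q \<cdot> u"] Qd' u fs(4) s by simp
    also have "\<dots> = f1 Q \<cdot> (gunit S \<cdot> (b \<cdot> e))" using functor_gunit[OF fs(4) s(1), of "b \<cdot> e"] s ab u by simp
    finally have e: "f1 Q \<cdot> u = f1 Q \<cdot> (gunit S \<cdot> (b \<cdot> e))" .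
    have "u = gunit S \<cdot> (b \<cdot> e)"
      by (rule discrete_fibration_unique[OF Qd s(1) _ _ _ _ _ e]) (use u ab gS in auto)
    then have "gdom S \<cdot> u = gdom S \<cdot> (gunit S \<cdot> (b \<cdot> e))" by simp
    then have e2: "a \<cdot> e = b \<cdot> e" using u ab gS by simp
    show "a = b" by (rule regular_epi_epi[OF u(1) _ _ _ _ e2]) (use ab u in auto)
  qed
  have pb0: "is_pullback C (components C D) k (f0 Q) (components C S)"
  proof (rule is_pullbackI)
    fix y c assume "arr y" "arr c" "dom y = dom c" "cod y = dom (components C D)" "cod c = dom k"
      "components C D \<cdot> y = k \<cdot> c"
    then have yc: "arr y" "arr c" "dom y = dom c" "cod y = G0 D" "cod c = FObj (pi0 C) S"
      "components C D \<cdot> y = k \<cdot> c" using cD k by auto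
    obtain e z where z: "e \<in> covers" "arr e" "cod e = dom c" "arr z" "dom z = dom e"
      "cod z = G0 S" "components C S \<cdot> z = c \<cdot> e" using cover_lift[OF cS(4) yc(2)] yc cS by metis
    have H: "y \<cdot> e \<in> Hom C (dom e) (G0 D)" "f0 Q \<cdot> z \<in> Hom C (dom e) (G0 D)" using yc z fs(4) s by auto
    have "components C D \<cdot> (y \<cdot> e) = k \<cdot> (c \<cdot> e)" by (rule comp_ext2[OF yc(6)]) (use yc z cD k in auto)
    also have "\<dots> = components C D \<cdot> (f0 Q \<cdot> z)" using ke[of z] z by simp
    finally have eq: "components C D \<cdot> (y \<cdot> e) = components C D \<cdot> (f0 Q \<cdot> z)" .
    obtain e2 v where v: "e2 \<in> covers" "arr e2" "cod e2 = dom e" "arr v" "dom v = dom e2" "cod v = G1 D"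
      "gdom D \<cdot> v = (y \<cdot> e) \<cdot> e2" "gcod D \<cdot> v = (f0 Q \<cdot> z) \<cdot> e2" using components_connected[OF gD(1) H eq] by blast
    obtain u where u: "arr u" "dom u = dom e2" "cod u = G1 S" "f1 Q \<cdot> u = v" "gcod S \<cdot> u = z \<cdot> e2"
      by (rule discrete_fibration_lift[OF Qd s, of v "dom e2" "z \<cdot> e2"]) (use v z fs(4) s in auto)
    have 1: "f0 Q \<cdot> (gdom S \<cdot> u) = y \<cdot> (e \<cdot> e2)"
      using functor_gdom(1)[OF fs(4) s(2), of u] u v yc z s by simp
    have "components C S \<cdot> (gdom S \<cdot> u) = components C S \<cdot> (z \<cdot> e2)" using components_gdom_gcod[OF gS u(1,3)] u by simp
    also have "\<dots> = (c \<cdot> e) \<cdot> e2" by (rule comp_ext[OF z(7)]) (use z v cS in auto)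
    finally have 2: "components C S \<cdot> (gdom S \<cdot> u) = c \<cdot> (e \<cdot> e2)" using yc z v by simp
    have r: "e \<cdot> e2 \<in> covers" using regular_epi_comp[OF v(1) z(1)] v by simp
    have "\<exists>w. arr w \<and> dom w = dom c \<and> cod w = dom (f0 Q) \<and> f0 Q \<cdot> w = y \<and> components C S \<cdot> w = c"
      by (rule glue_pair[OF jm0 _ _ _ r _ _ _ _ _ _ _ _ _ _ 1 2]) (use u v z yc fs(4) s cS gS in auto)
    then show "\<exists>w. arr w \<and> dom w = dom c \<and> cod w = dom (components C S) \<and> f0 Q \<cdot> w = y \<and> components C S \<cdot> w = c"
      using fs(4) s cS by simp
  qed (use k cS cD fs(4) s jm0 in auto)
  have pb1: "is_pullback C (components C D \<cdot> gdom D) k (f1 Q) (components C S \<cdot> gdom S)"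
  proof (rule is_pullbackI)
    show "(components C D \<cdot> gdom D) \<cdot> f1 Q = k \<cdot> (components C S \<cdot> gdom S)"
      using ke[of "gdom S"] functor_gdom_arr(1)[OF fs(4) s(2,1)] gS gD cD fs(4) s by simp
    show "jointly_monic C (f1 Q) (components C S \<cdot> gdom S)" unfolding jointly_monic_def
    proof (intro allI impI)
      fix a b assume "arr a" "arr b" "dom a = dom b" "cod a = dom (f1 Q)" "cod b = dom (f1 Q)"
        "f1 Q \<cdot> a = f1 Q \<cdot> b" "(components C S \<cdot> gdom S) \<cdot> a = (components C S \<cdot> gdom S) \<cdot> b"
      then have ab: "arr a" "arr b" "dom a = dom b" "cod a = G1 S" "cod b = G1 S"
        "f1 Q \<cdot> a = f1 Q \<cdot> b" "components C S \<cdot> (gdom S \<cdot> a) = components C S \<cdot> (gdom S \<cdot> b)" using fs(4) s gS cS by auto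
      have 1: "components C S \<cdot> (gcod S \<cdot> a) = components C S \<cdot> (gcod S \<cdot> b)"
        using components_gdom_gcod[OF gS ab(1,4)] components_gdom_gcod[OF gS ab(2,5)] ab(7) by simp
      have 2: "f0 Q \<cdot> (gcod S \<cdot> a) = f0 Q \<cdot> (gcod S \<cdot> b)"
        using functor_gdom(2)[OF fs(4) s(2), of a] functor_gdom(2)[OF fs(4) s(2), of b] ab s by simp
      have 3: "gcod S \<cdot> a = gcod S \<cdot> b" by (rule jointly_monicD[OF jm0 _ _ _ _ _ 2 1]) (use ab gS fs(4) s in auto)
      show "a = b" by (rule discrete_fibration_unique[OF Qd s(1) ab(1-6) 3])
    qed
    fix v c assume "arr v" "arr c" "dom v = dom c" "cod v = dom (components C D \<cdot> gdom D)" "cod c = dom k"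
      "(components C D \<cdot> gdom D) \<cdot> v = k \<cdot> c"
    then have vc: "arr v" "arr c" "dom v = dom c" "cod v = G1 D" "cod c = dom k"
      "components C D \<cdot> (gdom D \<cdot> v) = k \<cdot> c" using cD gD by auto
    have "components C D \<cdot> (gcod D \<cdot> v) = k \<cdot> c" using components_gdom_gcod[OF gD(1) vc(1,4)] vc by simp
    then have "\<exists>w. arr w \<and> dom w = dom (gcod D \<cdot> v) \<and> cod w = dom (f0 Q) \<and> f0 Q \<cdot> w = gcod D \<cdot> v \<and> components C S \<cdot> w = c"
      by (intro pullback_lift[OF pb0]) (use vc gD cD in auto)
    then obtain z where z: "arr z" "dom z = dom c" "cod z = G0 S" "f0 Q \<cdot> z = gcod D \<cdot> v" "components C S \<cdot> z = c"
      using vc gD fs(4) s by auto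
    obtain u where u: "arr u" "dom u = dom c" "cod u = G1 S" "f1 Q \<cdot> u = v" "gcod S \<cdot> u = z"
      by (rule discrete_fibration_lift[OF Qd s, of v "dom c" z]) (use vc z in auto)
    have "components C S \<cdot> (gdom S \<cdot> u) = c" using components_gdom_gcod[OF gS u(1,3)] u z by simp
    then show "\<exists>w. arr w \<and> dom w = dom c \<and> cod w = dom (components C S \<cdot> gdom S) \<and> f1 Q \<cdot> w = v \<and> (components C S \<cdot> gdom S) \<cdot> w = c"
      by (intro exI[of _ u]) (use u gS cS in simp)
  qed (use k cS cD gS gD fs(4) s in auto)
  have "is_pullback (Gpd C) (pi0_unit C D) (FArr (discrete_functor C) k) Q (pi0_unit C S)"
    by (rule levelwise_pullback[OF uD(1) discrete_fibration_functor[OF dk(1)] fs(4) uS(1)])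
      (use pb0 pb1 uS uD dk k s in auto)
  then have "Q \<in> class_M (Gpd C) (regular_epis (Gpd C)) (pi0 C) (discrete_functor C) (pi0_unit C)"
    unfolding class_M_def using fs(4) Qr s k_def by simp
  then show ?thesis unfolding class_M_star_def using ff f(1) mon pb by auto
qed

text \<open>Being a discrete fibration is reflected by pulling back along a monadic extension \<open>p\<close>. Let
\<open>f = M P\<close> be the comprehensive factorization; \<open>P\<close> is surjective on objects, because \<open>f\<close> is a regular
epimorphism on arrows, so that its pullback \<open>k\<close> along the pullback of \<open>p\<close> is final and, by cancellation, a discrete fibration, hence invertible; and a monadic functor reflects
isomorphisms, so that \<open>P\<close> is invertible. The use of the slices \<open>F(B)\<close> is legitimate since \<open>M\<close> is a
regular epimorphism along with \<open>f\<close>.\<close>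

lemma M_star_discrete_fibration:
  assumes f: "f \<in> class_M_star (Gpd C) (regular_epis (Gpd C)) (pi0 C) (discrete_functor C) (pi0_unit C)"
  shows "f \<in> regular_epis (Gpd C)" "f \<in> discrete_fibrations C"
proof -
  interpret G: category_with_pullbacks "Gpd C" by (rule Gpd_category_with_pullbacks)
  show fr: "f \<in> regular_epis (Gpd C)" using f unfolding class_M_star_def by simp
  obtain p s t where p: "monadic_extension (Gpd C) (regular_epis (Gpd C)) p" "is_pullback (Gpd C) f p s t"
    "t \<in> class_M (Gpd C) (regular_epis (Gpd C)) (pi0 C) (discrete_functor C) (pi0_unit C)"
    using f unfolding class_M_star_def by blast
  have pa: "internal_functor C p" and pm: "is_monadic (slice_in (Gpd C) (regular_epis (Gpd C)) (Tgt p))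
      (slice_in (Gpd C) (regular_epis (Gpd C)) (Src p)) (pullback_functor (Gpd C) p)"
    using p(1) unfolding monadic_extension_def by auto
  have td: "t \<in> discrete_fibrations C" by (rule class_M_discrete_fibration[OF p(3)])
  note lf = regular_epi_levelwise[OF fr]
  obtain P M where PM: "P \<in> full_ess_surj C" "M \<in> discrete_fibrations C" "Tgt P = Src M" "f = M \<bullet> P"
    and P0: "f0 P \<in> covers" using comprehensive_factorization[OF lf(1)] lf(3) by metis
  have fP: "internal_functor C P" "locally_full C P" and fM: "internal_functor C M"
    using PM discrete_fibration_functor unfolding full_ess_surj_def by auto
  have tf: "Tgt f = Tgt p" using Gpd_pullback_functors(5)[OF p(2)] by simp
  have st: "Src f = Src P" "Tgt M = Tgt p" using PM tf by auto
  have Mr: "M \<in> regular_epis (Gpd C)" using Gpd_regular_epi_cancel[of M P] fr PM(3,4) fM fP by simp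
  have fA: "f \<in> Arr (Gpd C)" "Cod (Gpd C) f = Cod (Gpd C) p" "p \<in> Arr (Gpd C)" "M \<in> Arr (Gpd C)" "Cod (Gpd C) M = Cod (Gpd C) p"
    using lf pa fM tf st by auto
  have PA: "P \<in> Arr (Gpd C)" "Dom (Gpd C) P = Dom (Gpd C) f" "Cod (Gpd C) P = Dom (Gpd C) M" "M \<bullet> P = f"
    using fP st PM by auto
  note pf = G.pb12[OF fA(1,3,2)] and pM = G.pb12[OF fA(4,3,5)]
  define k where "k = G.pb_map p f P M"
  note k = G.pb_map[OF fA(3,1,2,4,5) PA, folded k_def]
  note Df = G.pb12D[OF fA(1,3,2)] and DM = G.pb12D[OF fA(4,3,5)]
  \<comment> \<open>the comparison of the pullbacks is final and a discrete fibration, hence invertible\<close>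
  have pbk: "is_pullback (Gpd C) P (G.pb1 p M) (G.pb1 p f) k"
    by (rule G.pullback_paste_cancel[OF _ pM]) (use pf PA k Df DM in auto)
  have kf: "k \<in> full_ess_surj C" by (rule full_regular_stable[OF pbk fP(2) P0])
  obtain i where i: "is_iso (Gpd C) i" "i \<in> Arr (Gpd C)" "Cod (Gpd C) i = Dom (Gpd C) s" "t \<bullet> i = G.pb2 p f"
    using G.pullback_compare[OF p(2) pf] by metis
  have pf2: "G.pb2 p f \<in> discrete_fibrations C"
    using discrete_fibration_comp[OF iso_discrete_fibration[OF i(1)] td] i Gpd_pullback_functors(8)[OF p(2)] by simp
  have "k \<in> discrete_fibrations C"
    by (rule discrete_fibration_cancel[OF discrete_fibration_stable[OF pM PM(2)]]) (use k pf2 DM in auto)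
  then have ki: "is_iso (Gpd C) k" by (rule full_discrete_fibration_iso[OF kf])
  then obtain j where j: "k \<in> Arr (Gpd C)" "j \<in> Arr (Gpd C)" "Dom (Gpd C) j = Cod (Gpd C) k" "Cod (Gpd C) j = Dom (Gpd C) k"
    "j \<bullet> k = Idn (Gpd C) (Dom (Gpd C) k)" "k \<bullet> j = Idn (Gpd C) (Cod (Gpd C) k)" by (rule G.is_isoE)
  let ?A = "slice_in (Gpd C) (regular_epis (Gpd C)) (Tgt p)" and ?X = "slice_in (Gpd C) (regular_epis (Gpd C)) (Src p)"
  interpret A: category ?A by (rule G.slice_category)
  interpret X: category ?X by (rule G.slice_category)
  have fPM: "(f, P, M) \<in> Arr ?A" using fA PA fr Mr by simp
  have regs: "G.pb2 p f \<in> regular_epis (Gpd C)" "G.pb2 p M \<in> regular_epis (Gpd C)" using G.stable[OF pf fr] G.stable[OF pM Mr] by auto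
  have kX: "(G.pb2 p f, k, G.pb2 p M) \<in> Arr ?X" using regs k Df DM by simp
  have "G.pb2 p M \<bullet> (k \<bullet> j) = G.pb2 p f \<bullet> j"
    by (rule G.comp_ext[OF k(5) DM(2) k(1) _ j(2)]) (use k(1-3) j(2-4) DM(1-3) in auto)
  moreover have "G.pb2 p M \<bullet> (k \<bullet> j) = G.pb2 p M"
    unfolding j(6) by (rule G.comp_idn) (use k(3) DM in auto)
  ultimately have "G.pb2 p f \<bullet> j = G.pb2 p M" by simp
  then have jX: "(G.pb2 p M, j, G.pb2 p f) \<in> Arr ?X" using regs k j Df DM by simp
  have "is_iso ?X (G.pb2 p f, k, G.pb2 p M)"
    by (rule X.is_isoI[OF kX jX]) (use k j in auto)
  then have "is_iso ?X (FArr (pullback_functor (Gpd C) p) (f, P, M))" by (simp add: G.pullback_functor_sel k_def)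
  then have "is_iso ?A (f, P, M)"
    by (rule monadic_conservative[OF G.slice_category G.slice_category pm fPM])
  then obtain \<psi> where "\<psi> \<in> Arr ?A" "Dom ?A \<psi> = Cod ?A (f, P, M)" "Cod ?A \<psi> = Dom ?A (f, P, M)"
    "\<psi> \<cdot>\<^bsub>?A\<^esub> (f, P, M) = Idn ?A (Dom ?A (f, P, M))" "(f, P, M) \<cdot>\<^bsub>?A\<^esub> \<psi> = Idn ?A (Cod ?A (f, P, M))" by (rule A.is_isoE)
  then obtain N where "N \<in> Arr (Gpd C)" "Dom (Gpd C) N = Dom (Gpd C) M" "Cod (Gpd C) N = Dom (Gpd C) f"
    "N \<bullet> P = Idn (Gpd C) (Dom (Gpd C) f)" "P \<bullet> N = Idn (Gpd C) (Dom (Gpd C) M)"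
    by (cases \<psi>) auto
  then have "is_iso (Gpd C) P" by (intro G.is_isoI[OF PA(1)]) (use PA in auto)
  then show "f \<in> discrete_fibrations C"
    using discrete_fibration_comp[OF iso_discrete_fibration PM(2)] PM(3,4) by simp
qed

lemma M_star_eq: "class_M_star (Gpd C) (regular_epis (Gpd C)) (pi0 C) (discrete_functor C) (pi0_unit C)
   = regular_epis (Gpd C) \<inter> discrete_fibrations C"
  using regular_discrete_fibration_M_star M_star_discrete_fibration by blast

lemma relative_factorization_system:
  "factorization_system_for (Gpd C) (regular_epis (Gpd C)) (final_functors C) (regular_epis (Gpd C) \<inter> discrete_fibrations C)"
proof -
  interpret G: category "Gpd C" by (rule Gpd_category)
  have fin: "i \<bullet> e \<in> final_functors C"
    if "\<forall>m \<in> discrete_fibrations C. orthogonal (Gpd C) e m" "\<forall>m \<in> discrete_fibrations C. orthogonal (Gpd C) i m"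
      "e \<in> Arr (Gpd C)" "i \<in> Arr (Gpd C)" "Dom (Gpd C) i = Cod (Gpd C) e" for i e
  proof -
    have "orthogonal (Gpd C) (i \<bullet> e) m" if m: "m \<in> discrete_fibrations C" for m
      by (rule G.orthogonal_comp) (use that m \<open>\<forall>m \<in> _. orthogonal _ e m\<close> \<open>\<forall>m \<in> _. orthogonal _ i m\<close>
          \<open>e \<in> _\<close> \<open>i \<in> _\<close> \<open>Dom _ i = _\<close> in \<open>auto simp: discrete_fibrations_def\<close>)
    then show ?thesis using that(3-5) G.comp_arr(1)[of e i] unfolding final_functors_def by simp
  qed
  have iso_fin: "\<forall>m \<in> discrete_fibrations C. orthogonal (Gpd C) i m" if "is_iso (Gpd C) i" for i
    using G.iso_orthogonal[OF that] unfolding discrete_fibrations_def by blast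
  have idn_iso: "is_iso (Gpd C) (Idn (Gpd C) X)" if "X \<in> Obj (Gpd C)" for X
    using G.is_isoI[of "Idn (Gpd C) X" "Idn (Gpd C) X"] G.idn_arr[OF that] G.comp_idn[of "Idn (Gpd C) X" X] by simp
  have reg: "G \<bullet> F \<in> regular_epis (Gpd C) \<inter> discrete_fibrations C"
    if "F \<in> regular_epis (Gpd C) \<inter> discrete_fibrations C" "G \<in> regular_epis (Gpd C) \<inter> discrete_fibrations C" "Src G = Tgt F" for F G
  proof -
    show ?thesis using Gpd_regular_epi_comp[of F G] discrete_fibration_comp[of F G] that by simp
  qed
  have iso_reg: "i \<in> regular_epis (Gpd C) \<inter> discrete_fibrations C" if "is_iso (Gpd C) i" for i
    using G.iso_regular_epi[OF that] iso_discrete_fibration[OF that] by simp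
  have fac: "\<exists>e \<in> final_functors C. \<exists>m \<in> regular_epis (Gpd C) \<inter> discrete_fibrations C. Cod (Gpd C) e = Dom (Gpd C) m \<and> f = m \<bullet> e"
    if f: "f \<in> regular_epis (Gpd C)" for f
  proof -
    note lf = regular_epi_levelwise[OF f]
    obtain P M where PM: "P \<in> full_ess_surj C" "M \<in> discrete_fibrations C" "Tgt P = Src M" "f = M \<bullet> P"
      using comprehensive_factorization[OF lf(1)] by metis
    have fP: "internal_functor C P" and fM: "internal_functor C M"
      using PM discrete_fibration_functor unfolding full_ess_surj_def by auto
    have "M \<in> regular_epis (Gpd C)" using Gpd_regular_epi_cancel[of M P] f PM(3,4) fM fP by simp
    then show ?thesis using PM final_eq_full_ess_surj by auto
  qed
  show ?thesis unfolding factorization_system_for_def closed_under_isos_def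
  proof (intro conjI ballI allI impI)
    show "final_functors C \<subseteq> Arr (Gpd C)" by (auto simp: final_functors_def)
    show "regular_epis (Gpd C) \<inter> discrete_fibrations C \<subseteq> Arr (Gpd C)" by (auto simp: discrete_fibrations_def)
    show "Idn (Gpd C) X \<in> final_functors C" if "X \<in> Obj (Gpd C)" for X
      using iso_fin[OF idn_iso[OF that]] G.idn_arr(1)[OF that] unfolding final_functors_def by blast
    show "Idn (Gpd C) X \<in> regular_epis (Gpd C) \<inter> discrete_fibrations C" if "X \<in> Obj (Gpd C)" for X
      by (rule iso_reg[OF idn_iso[OF that]])
    show "i \<bullet> e \<in> final_functors C" if "e \<in> final_functors C" "is_iso (Gpd C) i" "Dom (Gpd C) i = Cod (Gpd C) e" for i e
      by (rule fin) (use that iso_fin in \<open>auto simp: final_functors_def is_iso_def\<close>)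
    show "e \<bullet> i \<in> final_functors C" if "e \<in> final_functors C" "is_iso (Gpd C) i" "Cod (Gpd C) i = Dom (Gpd C) e" for i e
      by (rule fin) (use that iso_fin in \<open>auto simp: final_functors_def is_iso_def\<close>)
    show "i \<bullet> m \<in> regular_epis (Gpd C) \<inter> discrete_fibrations C"
      if "m \<in> regular_epis (Gpd C) \<inter> discrete_fibrations C" "is_iso (Gpd C) i" "Dom (Gpd C) i = Cod (Gpd C) m" for i m
      by (rule reg[OF that(1) iso_reg[OF that(2)]]) (use that in simp)
    show "m \<bullet> i \<in> regular_epis (Gpd C) \<inter> discrete_fibrations C"
      if "m \<in> regular_epis (Gpd C) \<inter> discrete_fibrations C" "is_iso (Gpd C) i" "Cod (Gpd C) i = Dom (Gpd C) m" for i m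
      by (rule reg[OF iso_reg[OF that(2)] that(1)]) (use that in simp)
    show "orthogonal (Gpd C) e m" if "e \<in> final_functors C" "m \<in> regular_epis (Gpd C) \<inter> discrete_fibrations C" for e m
      using that unfolding final_functors_def by blast
  qed (use fac in auto)
qed

end

theorem mainTheorem2:
  fixes C :: "('o, 'a) cat"
  assumes "exact_category C" and "maltsev_category C"
  shows "relative_monotone_light_system (Gpd C) C (regular_epis (Gpd C))
           (pi0 C) (discrete_functor C) (pi0_unit C) \<and>
         class_E' (Gpd C) C (regular_epis (Gpd C)) (pi0 C) = final_functors C \<and>
         class_M_star (Gpd C) (regular_epis (Gpd C)) (pi0 C) (discrete_functor C) (pi0_unit C)
           = regular_epis (Gpd C) \<inter> discrete_fibrations C"
proof -
  interpret exact_maltsev C by unfold_locales (use assms in auto)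
  show ?thesis unfolding relative_monotone_light_system_def
    using relative_factorization_system class_E'_eq_final M_star_eq by simp
qed

end
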